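(* Let $\tau>0$, $\alpha\in\mathbb C$, integers $0\le m<q$, $0\le n\le p$, ${\bf a}\in\mathbb C^p$, ${\bf b}\in\mathbb C^q$ be admissible parameters for the Meijer-Barnes $K$-function. Let $$b_\sharp=\max_{m+1\le j\le q}\mathrm{Re}(b_j)$$ and write $\Lambda_-^\sharp$ for the subset of elements of $\Lambda^-$ having the real part $\lambda_\sharp=b_\sharp-\tau-1$. Denote these elements by $p_1,\dots,p_r$ and write $m_1,\dots,m_r$ for their corresponding multiplicities (as poles of $\mathcal G(s)$). Suppose that the table of contours in the definition of $K$ allows for the contour $\mathcal L_{\theta^-,\theta^+}$ with $\theta^+\ge\pi/2$ and $\theta^-\le-\pi/2$. Then there is $\delta>0$ such that, as $z\to0$, $$K_{p,q}^{m,n}\Big(\begin{matrix}{\bf a}\\{\bf b}\end{matrix}\Big\vert z;\tau,\alpha\Big)=\bigg[\sum_{k=1}^rz^{-p_k}\sum_{i=0}^{m_k-1}A_{k,i}\ln^i(z)\bigg]\big(1+O(|z|^{-\lambda_\sharp+\delta})\big)$$ for some complex constants $A_{k,i}$, where $|\arg(z)|<-\pi\,\mathrm{Re}(\nu)/(2\tau)$ in case (vi) and $\arg(z)=0$ in case (vii).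
   Context: Barnes double gamma function. For $\tau\in\mathbb C\setminus(-\infty,0]$ let $\psi=\Gamma'/\Gamma$, $\gamma_E=-\psi(1)$, $$C(\tau)=\lim_{k\to\infty}\Big[\sum_{j=1}^{k-1}\psi(j\tau)+\tfrac12\psi(k\tau)-\tfrac1\tau\ln\frac{\Gamma(k\tau)}{\sqrt{2\pi}}\Big],\quad D(\tau)=\lim_{k\to\infty}\Big[\sum_{j=1}^{k-1}\psi'(j\tau)+\tfrac12\psi'(k\tau)-\tfrac1\tau\psi(k\tau)\Big],$$ $a(\tau)=\gamma_E\tau+\frac{\tau}{2}\ln(2\pi\tau)+\frac12\ln\tau-\tau C(\tau)$, $b(\tau)=-\frac{\pi^2\tau^2}{6}-\tau\ln\tau-\tau^2D(\tau)$, and $$G(z;\tau)=\frac z\tau e^{a(\tau)\frac z\tau+b(\tau)\frac{z^2}{2\tau^2}}\prod_{k,l\ge0,\,(k,l)\ne(0,0)}\Big(1+\frac z{k\tau+l}\Big)e^{-\frac z{k\tau+l}+\frac{z^2}{2(k\tau+l)^2}} .$$ It is entire in $z$ with zeros at $-k\tau-l$, $k,l\ge0$, and satisfies $G(1;\tau)=1$, $G(z+1;\tau)=\Gamma(z/\tau)G(z;\tau)$, $G(z+\tau;\tau)=(2\pi)^{\frac{\tau-1}2}\tau^{-z+\frac12}\Gamma(z)G(z;\tau)$. Parameters. For $\tau>0$, $\alpha\in\mathbb C$, integers $0\le m\le q$, $0\le n\le p$, ${\bf a}=(a_1,\dots,a_p)\in\mathbb C^p$, ${\bf b}=(b_1,\dots,b_q)\in\mathbb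 C^q$ put $$\mathcal G(s)=\frac{\prod_{j=1}^mG(b_j-s;\tau)\prod_{j=1}^nG(1+\tau-a_j+s;\tau)}{\prod_{j=m+1}^qG(1+\tau-b_j+s;\tau)\prod_{j=n+1}^pG(a_j-s;\tau)},$$ $\Lambda^+=\{a_j+l\tau+k: n+1\le j\le p,\ l,k\ge0\}$, $\Lambda^-=\{b_j-l\tau-k: m+1\le j\le q,\ l,k\ge1\}$ ($l,k$ integers), $N=2(m+n)-p-q$, $\nu=\sum_{j=1}^pa_j-\sum_{j=1}^qb_j$, $\mu=\sum_{j=1}^na_j-\sum_{j=n+1}^pa_j+\sum_{j=1}^mb_j-\sum_{j=m+1}^qb_j$. Contours. Assume $\Lambda^+\cap\Lambda^-=\emptyset$. For $\theta^+\in(0,\pi)$, $\theta^-\in(-\pi,0)$, $\mathcal L_{\theta^-,\theta^+}$ denotes a contour dividing the plane into two domains, one containing $\Lambda^+$ and all large positive numbers and the other containing $\Lambda^-$, oriented so that $\Lambda^-$ is on the left, and which for large $|s|$ coincides with a ray $c_++re^{i\theta^+}$ in the upper half-plane and a ray $c_-+re^{i\theta^-}$ in the lower half-plane. $K$-function. For $z>0$, $$K_{p,q}^{m,n}\Big(\begin{matrix}{\bf a}\\{\bf b}\end{matrix}\Big\vert z;\tau,\alpha\Big)=\frac1{2\pi i}\int_{\mathcal L_{\theta^-,\theta^+}}\mathcal G(s)e^{\frac{\pi\alpha}\tau s^2}z^{-s}\,ds,$$ where the seven cases of parameters are: (i) $N>0$; (ii) $N=0$, $\mathrm{Re}(\alpha)\ge0$,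 $4\alpha\ne\pm(p-q)i$; (iii) $N=0$, $4\alpha=(q-p)i\ne0$, $\mu\ne0$, $\arg\mu\ne\pi/2$; (iv) $N=0$, $4\alpha=(p-q)i\ne0$, $\mu\ne0$, $\arg\mu\ne-\pi/2$; (v) $N=\alpha=p-q=0$, $\mathrm{Re}(\mu)\ne0$; (vi) $N=\alpha=p-q=\mu=0$, $\mathrm{Re}(\nu)<0$; (vii) $N=\alpha=p-q=\mu=\nu=0$ (here $z\in(0,1)\cup(1,\infty)$). Table of contours ($\epsilon>0$ small): (i), (vi): $\theta^+=\pi/2$, $\theta^-=-\pi/2$. (ii): $\theta^+=\pi/2$ and $\theta^-=-\pi/2$ if $\mathrm{Re}(\alpha)>0$; if $\mathrm{Re}(\alpha)=0$: $\theta^+=3\pi/4$ if $4i\alpha+q-p>0$, $\theta^+=\pi/4$ if $4i\alpha+q-p<0$; $\theta^-=-\pi/4$ if $4i\alpha+p-q>0$, $\theta^-=-3\pi/4$ if $4i\alpha+p-q<0$. (iii): $\theta^+=\pi/2$ if $\mathrm{Im}(\mu)<0$, $\theta^+=\epsilon$ if $\arg\mu\in[0,\pi/2)$, $\theta^+=\pi-\epsilon$ if $\arg\mu\in(\pi/2,\pi]$; $\theta^-=-\pi/4$ if $p>q$, $\theta^-=-3\pi/4$ if $p<q$. (iv): $\theta^+=\pi/4$ if $p>q$, $\theta^+=3\pi/4$ if $p<q$; $\theta^-=-\pi/2$ if $\mathrm{Im}(\mu)>0$, $\theta^-=-\epsilon$ if $\arg\mu\in(-\pi/2,0]$, $\theta^-=-\pi+\epsilon$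 if $\arg\mu\in[-\pi,-\pi/2)$. (v): $\theta^+=\pi/2$ if $\mathrm{Im}(\mu)<0$, $\theta^+=\epsilon$ if $\arg\mu\in[0,\pi/2)$, $\theta^+=\pi-\epsilon$ if $\arg\mu\in(\pi/2,\pi]$; $\theta^-=-\pi/2$ if $\mathrm{Im}(\mu)>0$, $\theta^-=-\epsilon$ if $\arg\mu\in(-\pi/2,0]$, $\theta^-=-\pi+\epsilon$ if $\arg\mu\in[-\pi,-\pi/2)$. (vii): $\theta^\pm=\pm\epsilon$ if $z>1$; $\theta^\pm=\pm(\pi-\epsilon)$ if $0<z<1$. (A negative real $\mu$ is assigned argument $\pi$ or $-\pi$, as needed.) Parameters satisfying $\Lambda^+\cap\Lambda^-=\emptyset$ and one of (i)-(vii) are called admissible. Domain. In cases (i)-(v) $K$ continues analytically to the Riemann surface of the logarithm ($-\infty<\arg z<\infty$); in case (vi) to the sector $|\arg z|<-\pi\mathrm{Re}(\nu)/(2\tau)$; in case (vii) the domain is $(0,1)\cup(1,\infty)$.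
   Formalization: The factor (1+O(|z|^{-λ_♯+δ})) is replaced by an added error: K = [sum] + O(|z|^{-λ_♯+δ}), uniform for arg z in compact sets of admitted values; the printed form fails, e.g. for m=0, n=p=q=1, α=0, τ>1 irrational, b=-10, a=b-1/2. *)

theory Defs
  imports "HOL-Complex_Analysis.Complex_Analysis" "HOL-Library.Landau_Symbols"
begin

section \<open>The Barnes double gamma function\<close>

definition barnes_C :: "real \<Rightarrow> real" where
  "barnes_C \<tau> = lim (\<lambda>k. (\<Sum>j=1..<k. Digamma (real j * \<tau>)) + Digamma (real k * \<tau>) / 2
                        - (1 / \<tau>) * ln (Gamma (real k * \<tau>) / sqrt (2 * pi)))"

definition barnes_D :: "real \<Rightarrow> real" where
  "barnes_D \<tau> = lim (\<lambda>k. (\<Sum>j=1..<k. Polygamma 1 (real j * \<tau>)) + Polygamma 1 (real k * \<tau>) / 2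
                        - (1 / \<tau>) * Digamma (real k * \<tau>))"

definition barnes_a :: "real \<Rightarrow> real" where
  "barnes_a \<tau> = euler_mascheroni * \<tau> + \<tau> / 2 * ln (2 * pi * \<tau>) + ln \<tau> / 2 - \<tau> * barnes_C \<tau>"

definition barnes_b :: "real \<Rightarrow> real" where
  "barnes_b \<tau> = - (pi\<^sup>2 * \<tau>\<^sup>2 / 6) - \<tau> * ln \<tau> - \<tau>\<^sup>2 * barnes_D \<tau>"

text \<open>The double product is unordered: the limit of the partial products along the net of finite
  sets of index pairs, as for \<^const>\<open>infsum\<close>.\<close>
definition barnes_G :: "real \<Rightarrow> complex \<Rightarrow> complex" where
  "barnes_G \<tau> z =
     z / of_real \<tau> *
     exp (of_real (barnes_a \<tau>) * (z / of_real \<tau>) +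
          of_real (barnes_b \<tau>) * (z\<^sup>2 / (2 * (of_real \<tau>)\<^sup>2))) *
     Lim (finite_subsets_at_top (UNIV - {(0, 0)}))
       (\<lambda>F. \<Prod>(k, l)\<in>F. let u = z / (of_nat k * of_real \<tau> + of_nat l)
                         in (1 + u) * exp (- u + u\<^sup>2 / 2))"

section \<open>Parameters\<close>

text \<open>Throughout, the vectors \<open>a\<close> and \<open>b\<close> are given by the values \<open>a 1, \<dots>, a p\<close>
  and \<open>b 1, \<dots>, b q\<close>; other values are never used.\<close>

definition MB_integrand ::
  "nat \<Rightarrow> nat \<Rightarrow> nat \<Rightarrow> nat \<Rightarrow> (nat \<Rightarrow> complex) \<Rightarrow> (nat \<Rightarrow> complex) \<Rightarrow> real \<Rightarrow> complex \<Rightarrow> complex" where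
  "MB_integrand m n p q a b \<tau> s =
     ((\<Prod>j=1..m. barnes_G \<tau> (b j - s)) * (\<Prod>j=1..n. barnes_G \<tau> (1 + of_real \<tau> - a j + s))) /
     ((\<Prod>j=m+1..q. barnes_G \<tau> (1 + of_real \<tau> - b j + s)) * (\<Prod>j=n+1..p. barnes_G \<tau> (a j - s)))"

definition MB_Lambda_plus :: "nat \<Rightarrow> nat \<Rightarrow> (nat \<Rightarrow> complex) \<Rightarrow> real \<Rightarrow> complex set" where
  "MB_Lambda_plus n p a \<tau> =
     {a j + of_nat l * of_real \<tau> + of_nat k | j l k. j \<in> {n+1..p}}"

definition MB_Lambda_minus :: "nat \<Rightarrow> nat \<Rightarrow> (nat \<Rightarrow> complex) \<Rightarrow> real \<Rightarrow> complex set" where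
  "MB_Lambda_minus m q b \<tau> =
     {b j - of_nat l * of_real \<tau> - of_nat k | j l k. j \<in> {m+1..q} \<and> l \<ge> 1 \<and> k \<ge> 1}"

definition MB_N :: "nat \<Rightarrow> nat \<Rightarrow> nat \<Rightarrow> nat \<Rightarrow> int" where
  "MB_N m n p q = 2 * (int m + int n) - int p - int q"

definition MB_nu :: "nat \<Rightarrow> nat \<Rightarrow> (nat \<Rightarrow> complex) \<Rightarrow> (nat \<Rightarrow> complex) \<Rightarrow> complex" where
  "MB_nu p q a b = (\<Sum>j=1..p. a j) - (\<Sum>j=1..q. b j)"

definition MB_mu ::
  "nat \<Rightarrow> nat \<Rightarrow> nat \<Rightarrow> nat \<Rightarrow> (nat \<Rightarrow> complex) \<Rightarrow> (nat \<Rightarrow> complex) \<Rightarrow> complex" where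
  "MB_mu m n p q a b =
     (\<Sum>j=1..n. a j) - (\<Sum>j=n+1..p. a j) + (\<Sum>j=1..m. b j) - (\<Sum>j=m+1..q. b j)"

section \<open>The seven cases and the table of contours\<close>

datatype MB_case = Case_I | Case_II | Case_III | Case_IV | Case_V | Case_VI | Case_VII

fun MB_in_case ::
  "MB_case \<Rightarrow> nat \<Rightarrow> nat \<Rightarrow> nat \<Rightarrow> nat \<Rightarrow> (nat \<Rightarrow> complex) \<Rightarrow> (nat \<Rightarrow> complex) \<Rightarrow> complex \<Rightarrow> bool" where
  "MB_in_case Case_I m n p q a b \<alpha> \<longleftrightarrow> MB_N m n p q > 0"
| "MB_in_case Case_II m n p q a b \<alpha> \<longleftrightarrow> MB_N m n p q = 0 \<and> Re \<alpha> \<ge> 0 \<and>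
     4 * \<alpha> \<noteq> (of_nat p - of_nat q) * \<i> \<and> 4 * \<alpha> \<noteq> - (of_nat p - of_nat q) * \<i>"
| "MB_in_case Case_III m n p q a b \<alpha> \<longleftrightarrow> MB_N m n p q = 0 \<and>
     4 * \<alpha> = (of_nat q - of_nat p) * \<i> \<and> 4 * \<alpha> \<noteq> 0 \<and>
     MB_mu m n p q a b \<noteq> 0 \<and> Arg (MB_mu m n p q a b) \<noteq> pi / 2"
| "MB_in_case Case_IV m n p q a b \<alpha> \<longleftrightarrow> MB_N m n p q = 0 \<and>
     4 * \<alpha> = (of_nat p - of_nat q) * \<i> \<and> 4 * \<alpha> \<noteq> 0 \<and>
     MB_mu m n p q a b \<noteq> 0 \<and> Arg (MB_mu m n p q a b) \<noteq> - pi / 2"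
| "MB_in_case Case_V m n p q a b \<alpha> \<longleftrightarrow> MB_N m n p q = 0 \<and> \<alpha> = 0 \<and> p = q \<and>
     Re (MB_mu m n p q a b) \<noteq> 0"
| "MB_in_case Case_VI m n p q a b \<alpha> \<longleftrightarrow> MB_N m n p q = 0 \<and> \<alpha> = 0 \<and> p = q \<and>
     MB_mu m n p q a b = 0 \<and> Re (MB_nu p q a b) < 0"
| "MB_in_case Case_VII m n p q a b \<alpha> \<longleftrightarrow> MB_N m n p q = 0 \<and> \<alpha> = 0 \<and> p = q \<and>
     MB_mu m n p q a b = 0 \<and> MB_nu p q a b = 0"

definition MB_admissible ::
  "nat \<Rightarrow> nat \<Rightarrow> nat \<Rightarrow> nat \<Rightarrow> (nat \<Rightarrow> complex) \<Rightarrow> (nat \<Rightarrow> complex) \<Rightarrow> real \<Rightarrow> complex \<Rightarrow> bool" where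
  "MB_admissible m n p q a b \<tau> \<alpha> \<longleftrightarrow>
     MB_Lambda_plus n p a \<tau> \<inter> MB_Lambda_minus m q b \<tau> = {} \<and>
     (\<exists>c. MB_in_case c m n p q a b \<alpha>)"

text \<open>The next two relations select angles according to \<open>\<mu>\<close>. They use \<^const>\<open>is_Arg\<close>, so that a
  negative real \<open>\<mu>\<close> has both \<open>pi\<close> and \<open>- pi\<close> as arguments.\<close>

definition MB_upper_angle_mu :: "complex \<Rightarrow> real \<Rightarrow> real \<Rightarrow> bool" where
  "MB_upper_angle_mu \<mu> \<epsilon> \<theta> \<longleftrightarrow>
     Im \<mu> < 0 \<and> \<theta> = pi / 2 \<or>
     (\<exists>\<phi>\<in>{0..<pi/2}. is_Arg \<mu> \<phi>) \<and> \<theta> = \<epsilon> \<or>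
     (\<exists>\<phi>\<in>{pi/2<..pi}. is_Arg \<mu> \<phi>) \<and> \<theta> = pi - \<epsilon>"

definition MB_lower_angle_mu :: "complex \<Rightarrow> real \<Rightarrow> real \<Rightarrow> bool" where
  "MB_lower_angle_mu \<mu> \<epsilon> \<theta> \<longleftrightarrow>
     Im \<mu> > 0 \<and> \<theta> = - pi / 2 \<or>
     (\<exists>\<phi>\<in>{- pi/2<..0}. is_Arg \<mu> \<phi>) \<and> \<theta> = - \<epsilon> \<or>
     (\<exists>\<phi>\<in>{- pi..<- pi/2}. is_Arg \<mu> \<phi>) \<and> \<theta> = - pi + \<epsilon>"

text \<open>\<open>MB_angles c p q \<mu> \<alpha> z \<epsilon> \<theta>p \<theta>m\<close>: in case \<open>c\<close> the table of contours assigns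
  \<open>\<theta>p\<close>, \<open>\<theta>m\<close> to the upper and the lower ray. In \<^const>\<open>Case_II\<close> with \<open>Re \<alpha> = 0\<close> the quantities
  \<open>4 * \<i> * \<alpha> + q - p\<close> and \<open>4 * \<i> * \<alpha> + p - q\<close> are real; \<^const>\<open>Re\<close> only changes their type.\<close>
fun MB_angles ::
  "MB_case \<Rightarrow> nat \<Rightarrow> nat \<Rightarrow> complex \<Rightarrow> complex \<Rightarrow> real \<Rightarrow> real \<Rightarrow> real \<Rightarrow> real \<Rightarrow> bool" where
  "MB_angles Case_I p q \<mu> \<alpha> z \<epsilon> \<theta>p \<theta>m \<longleftrightarrow> \<theta>p = pi / 2 \<and> \<theta>m = - pi / 2"
| "MB_angles Case_II p q \<mu> \<alpha> z \<epsilon> \<theta>p \<theta>m \<longleftrightarrow>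
     Re \<alpha> > 0 \<and> \<theta>p = pi / 2 \<and> \<theta>m = - pi / 2 \<or>
     Re \<alpha> = 0 \<and>
       (let u = Re (4 * \<i> * \<alpha> + of_nat q - of_nat p) in
          u > 0 \<and> \<theta>p = 3 * pi / 4 \<or> u < 0 \<and> \<theta>p = pi / 4) \<and>
       (let v = Re (4 * \<i> * \<alpha> + of_nat p - of_nat q) in
          v > 0 \<and> \<theta>m = - pi / 4 \<or> v < 0 \<and> \<theta>m = - 3 * pi / 4)"
| "MB_angles Case_III p q \<mu> \<alpha> z \<epsilon> \<theta>p \<theta>m \<longleftrightarrow> MB_upper_angle_mu \<mu> \<epsilon> \<theta>p \<and>
     (p > q \<and> \<theta>m = - pi / 4 \<or> p < q \<and> \<theta>m = - 3 * pi / 4)"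
| "MB_angles Case_IV p q \<mu> \<alpha> z \<epsilon> \<theta>p \<theta>m \<longleftrightarrow> (p > q \<and> \<theta>p = pi / 4 \<or> p < q \<and> \<theta>p = 3 * pi / 4) \<and>
     MB_lower_angle_mu \<mu> \<epsilon> \<theta>m"
| "MB_angles Case_V p q \<mu> \<alpha> z \<epsilon> \<theta>p \<theta>m \<longleftrightarrow> MB_upper_angle_mu \<mu> \<epsilon> \<theta>p \<and> MB_lower_angle_mu \<mu> \<epsilon> \<theta>m"
| "MB_angles Case_VI p q \<mu> \<alpha> z \<epsilon> \<theta>p \<theta>m \<longleftrightarrow> \<theta>p = pi / 2 \<and> \<theta>m = - pi / 2"
| "MB_angles Case_VII p q \<mu> \<alpha> z \<epsilon> \<theta>p \<theta>m \<longleftrightarrow>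
     z > 1 \<and> \<theta>p = \<epsilon> \<and> \<theta>m = - \<epsilon> \<or>
     0 < z \<and> z < 1 \<and> \<theta>p = pi - \<epsilon> \<and> \<theta>m = - (pi - \<epsilon>)"

definition MB_table ::
  "nat \<Rightarrow> nat \<Rightarrow> nat \<Rightarrow> nat \<Rightarrow> (nat \<Rightarrow> complex) \<Rightarrow> (nat \<Rightarrow> complex) \<Rightarrow> complex \<Rightarrow>
   real \<Rightarrow> real \<Rightarrow> real \<Rightarrow> real \<Rightarrow> bool" where
  "MB_table m n p q a b \<alpha> z \<epsilon> \<theta>p \<theta>m \<longleftrightarrow>
     (\<exists>c. MB_in_case c m n p q a b \<alpha> \<and> MB_angles c p q (MB_mu m n p q a b) \<alpha> z \<epsilon> \<theta>p \<theta>m)"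

text \<open>\<open>MB_contour P M \<theta>p \<theta>m \<gamma>\<close>: \<open>\<gamma>\<close> is a simple curve that comes from infinity along a ray of
  angle \<open>\<theta>m\<close>, goes to infinity along a ray of angle \<open>\<theta>p\<close>, and splits the plane into two domains, one
  containing \<open>P\<close> and all large positive numbers, the other containing \<open>M\<close>. As the curve
  travels from the lower to the upper half-plane, the domain containing \<open>M\<close> lies on its left.\<close>
definition MB_contour ::
  "complex set \<Rightarrow> complex set \<Rightarrow> real \<Rightarrow> real \<Rightarrow> (real \<Rightarrow> complex) \<Rightarrow> bool" where
  "MB_contour P M \<theta>p \<theta>m \<gamma> \<longleftrightarrow>
     \<theta>p \<in> {0<..<pi} \<and> \<theta>m \<in> {- pi<..<0} \<and>
     \<gamma> piecewise_C1_differentiable_on UNIV \<and> inj \<gamma> \<and>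
     (\<exists>cp cm T. \<forall>t\<ge>T. \<gamma> t = cp + of_real t * cis \<theta>p \<and> \<gamma> (- t) = cm + of_real t * cis \<theta>m) \<and>
     (\<exists>R L. R \<noteq> L \<and> components (- range \<gamma>) = {R, L} \<and>
        P \<subseteq> R \<and> (\<forall>\<^sub>F x::real in at_top. of_real x \<in> R) \<and> M \<subseteq> L)"

section \<open>The Meijer-Barnes K-function\<close>

text \<open>The value at a positive real \<open>z\<close>: the common value of the integrals along all
  contours allowed by the table, for all sufficiently small \<open>\<epsilon>\<close>. The Henstock-Kurzweil
  integral over the real line comprises improper integrals.\<close>
definition MB_K_pos ::
  "nat \<Rightarrow> nat \<Rightarrow> nat \<Rightarrow> nat \<Rightarrow> (nat \<Rightarrow> complex) \<Rightarrow> (nat \<Rightarrow> complex) \<Rightarrow> real \<Rightarrow> complex \<Rightarrow> real \<Rightarrow> complex" where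
  "MB_K_pos m n p q a b \<tau> \<alpha> z =
     (THE y. \<forall>\<^sub>F \<epsilon> in at_right 0. \<forall>\<theta>p \<theta>m \<gamma>.
        MB_table m n p q a b \<alpha> z \<epsilon> \<theta>p \<theta>m \<and>
        MB_contour (MB_Lambda_plus n p a \<tau>) (MB_Lambda_minus m q b \<tau>) \<theta>p \<theta>m \<gamma> \<longrightarrow>
        ((\<lambda>t. MB_integrand m n p q a b \<tau> (\<gamma> t) * exp (of_real pi * \<alpha> / of_real \<tau> * (\<gamma> t)\<^sup>2) *
              of_real z powr (- \<gamma> t) * vector_derivative \<gamma> (at t))
           has_integral (2 * of_real pi * \<i> * y)) UNIV)"

text \<open>The admitted values of \<open>arg z\<close>.\<close>
definition MB_args ::
  "nat \<Rightarrow> nat \<Rightarrow> nat \<Rightarrow> nat \<Rightarrow> (nat \<Rightarrow> complex) \<Rightarrow> (nat \<Rightarrow> complex) \<Rightarrow> real \<Rightarrow> complex \<Rightarrow> real set" where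
  "MB_args m n p q a b \<tau> \<alpha> =
     (if MB_in_case Case_VII m n p q a b \<alpha> then {0}
      else if MB_in_case Case_VI m n p q a b \<alpha>
        then {\<phi>. \<bar>\<phi>\<bar> < - (pi * Re (MB_nu p q a b) / (2 * \<tau>))}
      else UNIV)"

text \<open>Points \<open>z\<close> of the Riemann surface of the logarithm are represented by \<open>w = ln z\<close>, so
  \<open>\<bar>z\<bar> = exp (Re w)\<close> and \<open>arg z = Im w\<close>. Outside \<^const>\<open>Case_VII\<close> the function is the analytic
  continuation from the real line to the strip of all \<open>w\<close> with admitted imaginary part;
  the continuation is determined on that strip only.\<close>
definition MB_K ::
  "nat \<Rightarrow> nat \<Rightarrow> nat \<Rightarrow> nat \<Rightarrow> (nat \<Rightarrow> complex) \<Rightarrow> (nat \<Rightarrow> complex) \<Rightarrow> real \<Rightarrow> complex \<Rightarrow>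
   complex \<Rightarrow> complex" where
  "MB_K m n p q a b \<tau> \<alpha> =
     (if MB_in_case Case_VII m n p q a b \<alpha> then (\<lambda>w. MB_K_pos m n p q a b \<tau> \<alpha> (exp (Re w)))
      else (SOME f. f holomorphic_on {w. Im w \<in> MB_args m n p q a b \<tau> \<alpha>} \<and>
                    (\<forall>x::real. f (of_real x) = MB_K_pos m n p q a b \<tau> \<alpha> (exp x))))"

section \<open>Leading poles\<close>

definition MB_lambda_sharp :: "nat \<Rightarrow> nat \<Rightarrow> (nat \<Rightarrow> complex) \<Rightarrow> real \<Rightarrow> real" where
  "MB_lambda_sharp m q b \<tau> = Max ((\<lambda>j. Re (b j)) ` {m+1..q}) - \<tau> - 1"

definition MB_Lambda_sharp :: "nat \<Rightarrow> nat \<Rightarrow> (nat \<Rightarrow> complex) \<Rightarrow> real \<Rightarrow> complex set" where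
  "MB_Lambda_sharp m q b \<tau> = {s \<in> MB_Lambda_minus m q b \<tau>. Re s = MB_lambda_sharp m q b \<tau>}"

text \<open>Multiplicity as a pole; \<open>0\<close> if the singularity is removable.\<close>
definition pole_mult :: "(complex \<Rightarrow> complex) \<Rightarrow> complex \<Rightarrow> nat" where
  "pole_mult f s = nat (- zorder f s)"

text \<open>The filter \<open>z \<rightarrow> 0\<close>, \<open>arg z \<in> S\<close>, in the coordinate \<open>w = ln z\<close>.\<close>
definition to_zero_in_sector :: "real set \<Rightarrow> complex filter" where
  "to_zero_in_sector S = inf (filtercomap Re at_bot) (principal {w. Im w \<in> S})"

end

theory Submission
  imports Defs "HOL-Real_Asymp.Real_Asymp"
begin

text \<open>The integrand decays along every ray that the table of contours allows, by Stirling's formula for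
  the double gamma function. The latter follows from a telescoping argument: up to a quadratic
  polynomial, \<open>ln G\<close> is determined by its mixed difference with steps \<open>1\<close> and \<open>\<tau>\<close>, so that only the
  explicit main term matters. Under the assumption on the table the integral can be moved to a
  wedge that opens to the left, with real apex \<open>c\<close> slightly to the left of the leading poles. The
  shift picks up finitely many residues, and the residue at a pole \<open>s\<close> is \<open>exp (- s * w)\<close> times a
  polynomial in \<open>w = ln z\<close>. The integral over the wedge is \<open>O(\<bar>z\<bar> powr - c)\<close>, since its integrand is
  dominated by that at finitely many fixed values of \<open>z\<close>. The same representation gives the analytic
  continuation in \<open>z\<close>.\<close>

text \<open>A contour is given only through the two components of its complement, so the residues it
  collects have to be read off from winding numbers. Both families of poles are infinite, and no
  bound for the kernel is at hand near the left poles. For this reason no contour integral is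
  evaluated as a series of residues. Two contours are compared with each other: the same circle cuts
  both, the closing arcs coincide except near their ends, where the kernel decays, and only the
  finitely many poles that change sides remain. A wedge replaces the vertical line because some rows
  of the table give decay only in directions that point strictly to the left. Both sides of the
  wedge lie in Re s <= c, which produces the factor |z| powr - c. The apex c is generic, since the
  wedge must miss all poles, and \<delta> is the distance from c to the leading real part.
  \<open>MB_K_pos\<close> asks for a unique value, so some contour must exist at all. This is not
  evident, because poles of both kinds may lie on one horizontal line in the wrong order; a small
  shear of the plane separates them.\<close>

section \<open>Estimates for the logarithm and for the lattice sum\<close>

text \<open>The tail of the Mercator series is dominated by a geometric series with ratio at most
  1/2. The summand for k = 0 vanishes because division by zero gives zero, so the partial sum starts
  with u.\<close>

lemma Ln_1_plus_remainder:
  assumes "cmod u \<le> 1/2"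
  shows "cmod (Ln (1 + u) - (\<Sum>k<n. - ((- u) ^ k) / of_nat k)) \<le> 2 * cmod u ^ n"
proof -
  let ?f = "\<lambda>k. - ((- u) ^ k) / (of_nat k :: complex)"
  have *: "(\<lambda>k. ?f (k + n)) sums (Ln (1 + u) - (\<Sum>k<n. ?f k))"
    using Ln_series'[of u] assms by (intro sums_split_initial_segment) auto
  have g: "(\<lambda>k. cmod u ^ n * cmod u ^ k) sums (cmod u ^ n * (1 / (1 - cmod u)))"
    using assms by (intro sums_mult geometric_sums) auto
  have "norm (\<Sum>k. ?f (k + n)) \<le> (\<Sum>k. cmod u ^ n * cmod u ^ k)"
  proof (rule norm_suminf_le)
    show "norm (?f (k + n)) \<le> cmod u ^ n * cmod u ^ k" for k
    proof (cases "k + n = 0")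
      case False
      then have "cmod u ^ (k + n) / real (k + n) \<le> cmod u ^ (k + n) / 1"
        by (intro divide_left_mono) auto
      then show ?thesis
        unfolding norm_divide norm_minus_cancel norm_power norm_of_nat
        by (simp only: div_by_1 power_add mult.commute)
    qed auto
    show "summable (\<lambda>k. cmod u ^ n * cmod u ^ k)"
      using g by (rule sums_summable)
  qed
  also have "(\<Sum>k. ?f (k + n)) = Ln (1 + u) - (\<Sum>k<n. ?f k)"
    using * by (rule sums_unique[symmetric])
  also have "(\<Sum>k. cmod u ^ n * cmod u ^ k) = cmod u ^ n * (1 / (1 - cmod u))"
    using g by (rule sums_unique[symmetric])
  also have "\<dots> \<le> cmod u ^ n * 2"
  proof (rule mult_left_mono)
    show "1 / (1 - cmod u) \<le> 2"
      using assms by (simp add: pos_divide_le_eq)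
  qed auto
  finally show ?thesis by (simp only: mult.commute)
qed

lemma Ln_1_plus_remainder3:
  assumes "cmod u \<le> 1/2"
  shows "cmod (Ln (1 + u) - u + u\<^sup>2 / 2) \<le> 2 * cmod u ^ 3"
  using Ln_1_plus_remainder[OF assms, of 3]
  by (simp add: eval_nat_numeral algebra_simps)

lemma Ln_1_plus_remainder5:
  assumes "cmod u \<le> 1/2"
  shows "cmod (Ln (1 + u) - (u - u\<^sup>2 / 2 + u ^ 3 / 3 - u ^ 4 / 4)) \<le> 2 * cmod u ^ 5"
  using Ln_1_plus_remainder[OF assms, of 5]
  by (simp add: eval_nat_numeral algebra_simps)

text \<open>Since 1 + k + l is at least 1 + k and at least 1 + l, its cube dominates the product of
  their powers with exponent 3/2. The double sum is thus bounded by the square of a convergent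
  series.\<close>

lemma summable_on_lattice_cube:
  "(\<lambda>(k,l). 1 / (1 + real k + real l) ^ 3) summable_on (UNIV :: (nat \<times> nat) set)"
proof -
  define g :: "nat \<Rightarrow> real" where "g = (\<lambda>k. 1 / (1 + real k) powr (3/2))"
  have "summable (\<lambda>k. real (Suc k) powr (-(3/2)))"
    by (subst summable_Suc_iff) (simp add: summable_real_powr_iff)
  then have "summable g"
    by (simp add: g_def powr_minus field_simps)
  then have g: "g summable_on UNIV"
    by (subst summable_on_UNIV_nonneg_real_iff) (auto simp: g_def)
  have g0: "g k \<ge> 0" for k by (simp add: g_def)
  have "(\<lambda>x. norm (g (fst x) * g (snd x))) summable_on (Sigma UNIV (\<lambda>_. UNIV))"
  proof (rule iffD2[OF Infinite_Sum.abs_summable_on_Sigma_iff], intro conjI ballI)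
    have *: "(\<lambda>y. norm (g (fst (x, y)) * g (snd (x, y)))) = (\<lambda>y. g x * g y)" for x
      using g0 by (simp add: abs_mult)
    show "(\<lambda>y. norm (g (fst (x, y)) * g (snd (x, y)))) summable_on UNIV" for x
      unfolding * by (rule summable_on_cmult_right[OF g])
    have "norm (\<Sum>\<^sub>\<infinity>y. norm (g (fst (x, y)) * g (snd (x, y)))) = (\<Sum>\<^sub>\<infinity>y. g y) * g x" for x
      unfolding * using g0 by (simp add: infsum_cmult_right' infsum_nonneg abs_mult)
    then show "(\<lambda>x. norm (\<Sum>\<^sub>\<infinity>y. norm (g (fst (x, y)) * g (snd (x, y))))) summable_on UNIV"
      using summable_on_cmult_right[OF g] by simp
  qed
  then have "(\<lambda>x. g (fst x) * g (snd x)) summable_on UNIV"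
    using g0 by (simp add: abs_mult)
  then show ?thesis
  proof (rule summable_on_comparison_test)
    fix x :: "nat \<times> nat"
    obtain k l where x: "x = (k, l)" by force
    let ?y = "1 + real k + real l"
    have "(1 + real k) powr (3/2) * (1 + real l) powr (3/2) \<le> ?y powr (3/2) * ?y powr (3/2)"
      by (intro mult_mono powr_mono2) auto
    also have "\<dots> = ?y powr 3"
      by (simp add: powr_add[symmetric])
    also have "\<dots> = ?y ^ 3" by simp
    finally have "1 / ?y ^ 3 \<le> 1 / ((1 + real k) powr (3/2) * (1 + real l) powr (3/2))"
      by (intro divide_left_mono mult_pos_pos) auto
    then show "(case x of (k, l) \<Rightarrow> 1 / (1 + real k + real l) ^ 3) \<le> g (fst x) * g (snd x)"
      by (simp add: x g_def)
  qed (auto)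
qed

section \<open>The canonical product\<close>

definition lattice :: "real \<Rightarrow> nat \<times> nat \<Rightarrow> real" where
  "lattice \<tau> = (\<lambda>(k, l). real k * \<tau> + real l)"

text \<open>Weierstrass factor of genus 2: the inverse cubes of the lattice points are summable, the
  inverse squares are not.\<close>

definition primary_factor :: "real \<Rightarrow> complex \<Rightarrow> nat \<times> nat \<Rightarrow> complex" where
  "primary_factor \<tau> z x = (1 + z / of_real (lattice \<tau> x)) * exp (- (z / of_real (lattice \<tau> x)) + (z / of_real (lattice \<tau> x))\<^sup>2 / 2)"

definition log_factor :: "real \<Rightarrow> complex \<Rightarrow> nat \<times> nat \<Rightarrow> complex" where
  "log_factor \<tau> z x = Ln (1 + z / of_real (lattice \<tau> x)) - z / of_real (lattice \<tau> x) + (z / of_real (lattice \<tau> x))\<^sup>2 / 2"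

definition double_product :: "real \<Rightarrow> complex \<Rightarrow> complex" where
  "double_product \<tau> z = Lim (finite_subsets_at_top (UNIV - {(0, 0)})) (\<lambda>F. \<Prod>x\<in>F. primary_factor \<tau> z x)"

lemma barnes_G_eq:
  "barnes_G \<tau> z = z / of_real \<tau> *
     exp (of_real (barnes_a \<tau>) * (z / of_real \<tau>) + of_real (barnes_b \<tau>) * (z\<^sup>2 / (2 * (of_real \<tau>)\<^sup>2))) *
     double_product \<tau> z"
  unfolding barnes_G_def double_product_def primary_factor_def lattice_def Let_def
  by (simp add: case_prod_unfold)

lemma lattice_ge:
  assumes "\<tau> > 0"
  shows "lattice \<tau> (k, l) \<ge> min \<tau> 1 * (real k + real l)"
proof -
  have "min \<tau> 1 * real k \<le> \<tau> * real k" "min \<tau> 1 * real l \<le> 1 * real l"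
    by (intro mult_right_mono; simp)+
  then show ?thesis by (simp add: lattice_def algebra_simps)
qed

lemma lattice_nonneg: "\<tau> > 0 \<Longrightarrow> lattice \<tau> x \<ge> 0"
  by (cases x) (simp add: lattice_def)

lemma lattice_pos: "\<tau> > 0 \<Longrightarrow> x \<noteq> (0,0) \<Longrightarrow> lattice \<tau> x > 0"
  proof -
  assume t: "\<tau> > 0" and x: "x \<noteq> (0,0)"
  obtain k l where kl: "x = (k, l)" by force
  then have "k + l > 0" using x by (cases k; cases l) auto
  then have "real k + real l > 0" by linarith
  then have "min \<tau> 1 * (real k + real l) > 0" using t by simp
  with lattice_ge[OF t, of k l] show ?thesis unfolding kl by linarith
qed

lemma finite_lattice_le:
  assumes "\<tau> > 0"
  shows "finite {x. lattice \<tau> x \<le> R}"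
proof -
  define c where "c = min \<tau> 1"
  have c: "c > 0" using assms by (simp add: c_def)
  have "{x. lattice \<tau> x \<le> R} \<subseteq> {..nat \<lceil>R / c\<rceil>} \<times> {..nat \<lceil>R / c\<rceil>}"
  proof (intro subsetI, elim CollectE)
    fix x assume "lattice \<tau> x \<le> R"
    moreover obtain k l where x: "x = (k, l)" by force
    ultimately have "lattice \<tau> (k, l) \<le> R" by simp
    with lattice_ge[OF assms, of k l] have "c * (real k + real l) \<le> R" by (simp add: c_def)
    then have "real k + real l \<le> R / c" using c by (simp add: field_simps)
    then have "real k \<le> R / c" "real l \<le> R / c" by linarith+
    then show "x \<in> {..nat \<lceil>R / c\<rceil>} \<times> {..nat \<lceil>R / c\<rceil>}"
      unfolding x by (auto simp: le_nat_iff) linarith+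
  qed
  then show ?thesis by (rule finite_subset) auto
qed

lemma summable_on_inverse_lattice_cube:
  assumes "\<tau> > 0"
  shows "(\<lambda>x. 1 / lattice \<tau> x ^ 3) summable_on (UNIV - {(0,0)})"
proof -
  \<comment> \<open>Away from the origin k + l >= 1, so 1 + k + l <= 2 (k + l); the factor 1/2
    absorbs this.\<close>
  define c where "c = min \<tau> 1 / 2"
  have c: "c > 0" using assms by (simp add: c_def)
  have "(\<lambda>x. (1 / c ^ 3) * (case x of (k,l) \<Rightarrow> 1 / (1 + real k + real l) ^ 3)) summable_on (UNIV - {(0,0)})"
    by (rule summable_on_cmult_right[OF summable_on_subset_banach[OF summable_on_lattice_cube]]) auto
  then show ?thesis
  proof (rule summable_on_comparison_test)
    fix x :: "nat \<times> nat" assume x: "x \<in> UNIV - {(0,0)}"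
    obtain k l where kl: "x = (k, l)" by force
    have "k + l \<ge> 1" using x kl by (cases k; cases l) auto
    then have "real k + real l \<ge> 1" by linarith
    then have "c * (1 + real k + real l) \<le> c * (2 * (real k + real l))"
      using c by (intro mult_left_mono) auto
    also have "\<dots> = min \<tau> 1 * (real k + real l)" by (simp add: c_def)
    also have "\<dots> \<le> lattice \<tau> x"
      using lattice_ge[OF assms, of k l] by (simp add: kl)
    finally have "(c * (1 + real k + real l)) ^ 3 \<le> lattice \<tau> x ^ 3"
      using c by (intro power_mono) auto
    then have "1 / lattice \<tau> x ^ 3 \<le> 1 / (c * (1 + real k + real l)) ^ 3"
      using c x lattice_pos[OF assms, of x]
      by (intro divide_left_mono mult_pos_pos zero_less_power) auto
    then show "1 / lattice \<tau> x ^ 3 \<le> (1 / c ^ 3) * (case x of (k,l) \<Rightarrow> 1 / (1 + real k + real l) ^ 3)"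
      by (simp add: kl power_mult_distrib)
    show "0 \<le> 1 / lattice \<tau> x ^ 3" using lattice_nonneg[OF assms, of x] by simp
  qed
qed

text \<open>Outside this finite set |z / lattice point| <= 1/2 for all |z| <= R, so the factors
  there have small logarithms and no zeros.\<close>

definition small_lattice :: "real \<Rightarrow> real \<Rightarrow> (nat \<times> nat) set" where
  "small_lattice \<tau> R = {x. x \<noteq> (0,0) \<and> lattice \<tau> x \<le> 2 * R}"

lemma finite_small_lattice: "\<tau> > 0 \<Longrightarrow> finite (small_lattice \<tau> R)"
  unfolding small_lattice_def by (rule finite_subset[OF _ finite_lattice_le[of \<tau> "2*R"]]) auto

lemma log_factor_bound:
  assumes "\<tau> > 0" "cmod z \<le> R" "x \<in> UNIV - {(0,0)} - small_lattice \<tau> R"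
  shows "cmod (z / of_real (lattice \<tau> x)) \<le> 1/2" "cmod (log_factor \<tau> z x) \<le> 2 * R ^ 3 * (1 / lattice \<tau> x ^ 3)"
    "exp (log_factor \<tau> z x) = primary_factor \<tau> z x"
proof -
  have p: "lattice \<tau> x > 0" using assms lattice_pos[of \<tau> x] by auto
  have "lattice \<tau> x > 2 * R" using assms(3) by (auto simp: small_lattice_def)
  then have u: "cmod (z / of_real (lattice \<tau> x)) \<le> 1/2"
    using assms(2) p by (simp add: norm_divide divide_simps)
  then show "cmod (z / of_real (lattice \<tau> x)) \<le> 1/2" .
  have "cmod (log_factor \<tau> z x) \<le> 2 * cmod (z / of_real (lattice \<tau> x)) ^ 3"
    unfolding log_factor_def by (rule Ln_1_plus_remainder3[OF u])
  also have "\<dots> \<le> 2 * (R / lattice \<tau> x) ^ 3"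
    using p assms(2) by (intro mult_left_mono power_mono) (auto simp: norm_divide divide_right_mono)
  finally show "cmod (log_factor \<tau> z x) \<le> 2 * R ^ 3 * (1 / lattice \<tau> x ^ 3)"
    by (simp add: power_divide)
  have "1 + z / of_real (lattice \<tau> x) \<noteq> 0"
  proof
    assume "1 + z / of_real (lattice \<tau> x) = 0"
    then have "z / of_real (lattice \<tau> x) = -1" by (metis add_eq_0_iff)
    with u show False by simp
  qed
  then have "exp (Ln (1 + z / of_real (lattice \<tau> x))) = 1 + z / of_real (lattice \<tau> x)"
    by (rule exp_Ln)
  moreover have "log_factor \<tau> z x = Ln (1 + z / of_real (lattice \<tau> x)) + (- (z / of_real (lattice \<tau> x)) + (z / of_real (lattice \<tau> x))\<^sup>2 / 2)"
    by (simp add: log_factor_def)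
  ultimately show "exp (log_factor \<tau> z x) = primary_factor \<tau> z x"
    unfolding primary_factor_def by (simp only: exp_add)
qed

definition tail_log :: "real \<Rightarrow> real \<Rightarrow> complex \<Rightarrow> complex" where
  "tail_log \<tau> R z = (\<Sum>\<^sub>\<infinity>x\<in>UNIV - {(0,0)} - small_lattice \<tau> R. log_factor \<tau> z x)"

lemma summable_on_tail_bound:
  assumes "\<tau> > 0"
  shows "(\<lambda>x. 2 * R ^ 3 * (1 / lattice \<tau> x ^ 3)) summable_on (UNIV - {(0,0)} - small_lattice \<tau> R)"
  by (rule summable_on_cmult_right[OF summable_on_subset_banach[OF summable_on_inverse_lattice_cube[OF assms]]]) auto

lemma has_sum_tail_log:
  assumes "\<tau> > 0" "cmod z \<le> R"
  shows "(log_factor \<tau> z has_sum tail_log \<tau> R z) (UNIV - {(0,0)} - small_lattice \<tau> R)"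
  unfolding tail_log_def
proof (rule has_sum_infsum)
  have "(\<lambda>x. norm (log_factor \<tau> z x)) summable_on (UNIV - {(0,0)} - small_lattice \<tau> R)"
    by (rule Infinite_Sum.abs_summable_on_comparison_test'[OF summable_on_tail_bound[OF assms(1), of R]])
       (use log_factor_bound(2)[OF assms] in auto)
  then show "log_factor \<tau> z summable_on (UNIV - {(0,0)} - small_lattice \<tau> R)"
    by (rule abs_summable_summable)
qed

text \<open>The bound for the logarithms does not depend on z in the closed disc, so the M-test
  along finite sets gives uniform convergence.\<close>

lemma tail_log_holomorphic:
  assumes "\<tau> > 0"
  shows "tail_log \<tau> R holomorphic_on ball 0 R"
proof -
  let ?X = "UNIV - {(0,0)} - small_lattice \<tau> R"
  have *: "(\<lambda>z. log_factor \<tau> z x) holomorphic_on cball 0 R" if x: "x \<in> ?X" for x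
  proof -
    have "1 + z / of_real (lattice \<tau> x) \<notin> \<real>\<^sub>\<le>\<^sub>0" if "z \<in> cball 0 R" for z :: complex
    proof -
      have "cmod (z / of_real (lattice \<tau> x)) \<le> 1/2"
        using log_factor_bound(1)[OF assms _ x, of z] that by auto
      moreover have "Re (1 + u) > 0" if "cmod u \<le> 1/2" for u
        using abs_Re_le_cmod[of u] that by simp
      ultimately have "Re (1 + z / of_real (lattice \<tau> x)) > 0" by blast
      then show ?thesis by (auto simp: complex_nonpos_Reals_iff)
    qed
    moreover have "lattice \<tau> x \<noteq> 0" using lattice_pos[OF assms, of x] x by auto
    ultimately show ?thesis unfolding log_factor_def
      by (intro holomorphic_intros) auto
  qed
  have ul: "uniform_limit (cball 0 R) (\<lambda>X z. \<Sum>x\<in>X. log_factor \<tau> z x) (tail_log \<tau> R) (finite_subsets_at_top ?X)"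
    unfolding tail_log_def
    by (rule Weierstrass_m_test_general[OF _ summable_on_tail_bound[OF assms, of R]])
       (use log_factor_bound(2)[OF assms] in auto)
  have ev: "\<forall>\<^sub>F X in finite_subsets_at_top ?X. continuous_on (cball 0 R) (\<lambda>z. \<Sum>x\<in>X. log_factor \<tau> z x)
      \<and> (\<lambda>z. \<Sum>x\<in>X. log_factor \<tau> z x) holomorphic_on ball 0 R"
  proof (rule eventually_finite_subsets_at_top_weakI)
    fix X assume "finite X" "X \<subseteq> ?X"
    then have "(\<lambda>z. \<Sum>x\<in>X. log_factor \<tau> z x) holomorphic_on cball 0 R"
      by (intro holomorphic_on_sum *) auto
    then show "continuous_on (cball 0 R) (\<lambda>z. \<Sum>x\<in>X. log_factor \<tau> z x)
      \<and> (\<lambda>z. \<Sum>x\<in>X. log_factor \<tau> z x) holomorphic_on ball 0 R"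
      using holomorphic_on_imp_continuous_on holomorphic_on_subset[OF _ ball_subset_cball] by blast
  qed
  show ?thesis
    by (rule holomorphic_uniform_limit[OF ev ul]) auto
qed

text \<open>A finite index set that contains \<open>small_lattice \<tau> R\<close> splits into it
  and a rest whose product is the exponential of a partial sum of a convergent series. The argument
  works along the net of finite sets, as the unordered product demands.\<close>

lemma double_product_tendsto:
  assumes "\<tau> > 0" "cmod z \<le> R"
  shows "((\<lambda>F. \<Prod>x\<in>F. primary_factor \<tau> z x) \<longlongrightarrow> (\<Prod>x\<in>small_lattice \<tau> R. primary_factor \<tau> z x) * exp (tail_log \<tau> R z))
           (finite_subsets_at_top (UNIV - {(0,0)}))"
proof -
  let ?S = "UNIV - {(0,0)} :: (nat \<times> nat) set"
  let ?B = "small_lattice \<tau> R"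
  have fB: "finite ?B" by (rule finite_small_lattice[OF assms(1)])
  have BS: "?B \<subseteq> ?S" by (auto simp: small_lattice_def)
  have "((\<lambda>F. \<Sum>x\<in>F. log_factor \<tau> z x) \<longlongrightarrow> tail_log \<tau> R z) (finite_subsets_at_top (?S - ?B))"
    using has_sum_tail_log[OF assms] by (simp add: has_sum_def)
  \<comment> \<open>Removal of a fixed finite set carries large finite sets to large finite subsets
    of the complement.\<close>
  moreover have "filterlim (\<lambda>F. F - ?B) (finite_subsets_at_top (?S - ?B)) (finite_subsets_at_top ?S)"
    unfolding filterlim_finite_subsets_at_top
  proof (intro allI impI)
    fix X :: "(nat \<times> nat) set" assume X: "finite X \<and> X \<subseteq> ?S - ?B"
    have "\<forall>\<^sub>F F in finite_subsets_at_top ?S. finite F \<and> X \<subseteq> F \<and> F \<subseteq> ?S"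
      using X by (auto simp: eventually_finite_subsets_at_top)
    then show "\<forall>\<^sub>F F in finite_subsets_at_top ?S. finite (F - ?B) \<and> X \<subseteq> F - ?B \<and> F - ?B \<subseteq> ?S - ?B"
      by eventually_elim (use X in auto)
  qed
  ultimately have "((\<lambda>F. \<Sum>x\<in>F - ?B. log_factor \<tau> z x) \<longlongrightarrow> tail_log \<tau> R z) (finite_subsets_at_top ?S)"
    by (rule filterlim_compose)
  then have lim: "((\<lambda>F. (\<Prod>x\<in>?B. primary_factor \<tau> z x) * exp (\<Sum>x\<in>F - ?B. log_factor \<tau> z x)) \<longlongrightarrow>
      (\<Prod>x\<in>?B. primary_factor \<tau> z x) * exp (tail_log \<tau> R z)) (finite_subsets_at_top ?S)"
    by (intro tendsto_intros)
  have "\<forall>\<^sub>F F in finite_subsets_at_top ?S. finite F \<and> ?B \<subseteq> F \<and> F \<subseteq> ?S"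
    using fB BS by (auto simp: eventually_finite_subsets_at_top)
  then have "\<forall>\<^sub>F F in finite_subsets_at_top ?S. (\<Prod>x\<in>?B. primary_factor \<tau> z x) * exp (\<Sum>x\<in>F - ?B. log_factor \<tau> z x)
       = (\<Prod>x\<in>F. primary_factor \<tau> z x)"
  proof eventually_elim
    case (elim F)
    have "exp (\<Sum>x\<in>F - ?B. log_factor \<tau> z x) = (\<Prod>x\<in>F - ?B. exp (log_factor \<tau> z x))"
      using elim by (simp add: exp_sum)
    also have "\<dots> = (\<Prod>x\<in>F - ?B. primary_factor \<tau> z x)"
      using elim by (intro prod.cong refl log_factor_bound(3)[OF assms]) auto
    finally show ?case
      using elim prod.subset_diff[of ?B F "primary_factor \<tau> z"] by (simp add: mult.commute)
  qed
  from Lim_transform_eventually[OF lim this] show ?thesis .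
qed

lemma double_product_eq:
  assumes "\<tau> > 0" "cmod z \<le> R"
  shows "double_product \<tau> z = (\<Prod>x\<in>small_lattice \<tau> R. primary_factor \<tau> z x) * exp (tail_log \<tau> R z)"
  unfolding double_product_def
  by (intro tendsto_Lim double_product_tendsto assms) auto

lemma double_product_holomorphic:
  assumes "\<tau> > 0"
  shows "double_product \<tau> holomorphic_on A"
proof -
  have "double_product \<tau> analytic_on UNIV"
    unfolding analytic_on_def
  proof (intro ballI)
    fix z :: complex
    define R where "R = cmod z + 1"
    have "(\<lambda>z. (\<Prod>x\<in>small_lattice \<tau> R. primary_factor \<tau> z x) * exp (tail_log \<tau> R z)) holomorphic_on ball 0 R"
    proof -
      have "complex_of_real (lattice \<tau> x) \<noteq> 0" if "x \<in> small_lattice \<tau> R" for x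
        using lattice_pos[OF assms, of x] that by (simp add: small_lattice_def)
      then show ?thesis
        unfolding primary_factor_def
        by (intro holomorphic_intros tail_log_holomorphic[OF assms]) auto
    qed
    then have "double_product \<tau> holomorphic_on ball 0 R"
      by (rule holomorphic_transform) (simp add: double_product_eq[OF assms, of _ R])
    moreover have "ball z 1 \<subseteq> ball 0 R"
    proof
      fix w assume "w \<in> ball z 1"
      then have "cmod (w - z) < 1" by (simp add: dist_norm norm_minus_commute)
      with norm_triangle_sub[of w z] show "w \<in> ball 0 R" by (simp add: R_def)
    qed
    ultimately have "double_product \<tau> holomorphic_on ball z 1"
      by (rule holomorphic_on_subset)
    then show "\<exists>e>0. double_product \<tau> holomorphic_on ball z e"
      by (intro exI[of _ 1]) simp
  qed
  then show ?thesis by (rule holomorphic_on_subset[OF analytic_imp_holomorphic]) simp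
qed

text \<open>The exponential of the tail has no zeros, so the zeros come from the finitely many
  factors in the representation with R = |z|.\<close>

lemma double_product_eq_0_iff:
  assumes "\<tau> > 0"
  shows "double_product \<tau> z = 0 \<longleftrightarrow> (\<exists>x. x \<noteq> (0,0) \<and> z = - of_real (lattice \<tau> x))"
proof -
  have *: "primary_factor \<tau> z x = 0 \<longleftrightarrow> z = - of_real (lattice \<tau> x)" if "x \<noteq> (0,0)" for x
  proof -
    have L: "complex_of_real (lattice \<tau> x) \<noteq> 0" using lattice_pos[OF assms that] by simp
    have "primary_factor \<tau> z x = 0 \<longleftrightarrow> 1 + z / of_real (lattice \<tau> x) = 0"
      by (simp add: primary_factor_def)
    also have "\<dots> \<longleftrightarrow> of_real (lattice \<tau> x) + z = 0"
      using L by (simp add: add_divide_eq_iff)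
    also have "\<dots> \<longleftrightarrow> z = - of_real (lattice \<tau> x)"
      by (simp only: eq_neg_iff_add_eq_0 add.commute)
    finally show ?thesis .
  qed
  have "double_product \<tau> z = 0 \<longleftrightarrow> (\<exists>x\<in>small_lattice \<tau> (cmod z). z = - of_real (lattice \<tau> x))"
    using finite_small_lattice[OF assms, of "cmod z"] *
    unfolding double_product_eq[OF assms order_refl] mult_eq_0_iff
    by (simp add: small_lattice_def)
  also have "\<dots> \<longleftrightarrow> (\<exists>x. x \<noteq> (0,0) \<and> z = - of_real (lattice \<tau> x))"
  proof -
    \<comment> \<open>If z is minus a lattice point, that point equals |z| <= 2 |z|, so its index
      belongs to \<open>small_lattice\<close> for R = |z|.\<close>
    have "lattice \<tau> x \<le> 2 * cmod z" if "z = - of_real (lattice \<tau> x)" for x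
      using lattice_nonneg[OF assms, of x] that by simp
    then show ?thesis unfolding small_lattice_def by blast
  qed
  finally show ?thesis .
qed

lemma barnes_G_holomorphic:
  assumes "\<tau> > 0"
  shows "barnes_G \<tau> holomorphic_on A"
proof -
  have "barnes_G \<tau> = (\<lambda>z. z / of_real \<tau> *
     exp (of_real (barnes_a \<tau>) * (z / of_real \<tau>) + of_real (barnes_b \<tau>) * (z\<^sup>2 / (2 * (of_real \<tau>)\<^sup>2))) *
     double_product \<tau> z)" by (rule ext) (rule barnes_G_eq)
  moreover have "(\<lambda>z. z / of_real \<tau> *
     exp (of_real (barnes_a \<tau>) * (z / of_real \<tau>) + of_real (barnes_b \<tau>) * (z\<^sup>2 / (2 * (of_real \<tau>)\<^sup>2))) *
     double_product \<tau> z) holomorphic_on A"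
    using assms by (intro holomorphic_intros double_product_holomorphic) simp_all
  ultimately show ?thesis by (simp only:)
qed

text \<open>The prefactor z supplies the zero of index (0,0), which the double product
  omits.\<close>

lemma barnes_G_eq_0_iff:
  assumes "\<tau> > 0"
  shows "barnes_G \<tau> z = 0 \<longleftrightarrow> (\<exists>k l. z = - (of_nat l * of_real \<tau>) - of_nat k)"
proof -
  have "barnes_G \<tau> z = 0 \<longleftrightarrow> z = 0 \<or> double_product \<tau> z = 0"
    using assms by (simp add: barnes_G_eq)
  also have "\<dots> \<longleftrightarrow> z = - of_real (lattice \<tau> (0,0)) \<or> (\<exists>x. x \<noteq> (0,0) \<and> z = - of_real (lattice \<tau> x))"
    unfolding double_product_eq_0_iff[OF assms] by (simp add: lattice_def)
  also have "\<dots> \<longleftrightarrow> (\<exists>x. z = - of_real (lattice \<tau> x))"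
    by metis
  also have "\<dots> \<longleftrightarrow> (\<exists>l k. z = - of_real (lattice \<tau> (l, k)))"
    by (rule split_paired_Ex)
  also have "\<dots> \<longleftrightarrow> (\<exists>l k. z = - (of_nat l * of_real \<tau>) - of_nat k)"
    by (simp add: lattice_def)
  also have "\<dots> \<longleftrightarrow> (\<exists>k l. z = - (of_nat l * of_real \<tau>) - of_nat k)"
    by (rule ex_comm)
  finally show ?thesis .
qed

section \<open>Asymptotics of the canonical product\<close>

text \<open>Half of the double Bernoulli polynomial of degree 2 with periods 1 and \<tau>.\<close>

definition bern_poly :: "real \<Rightarrow> complex \<Rightarrow> complex" where
  "bern_poly \<tau> z = (6 * z\<^sup>2 - 6 * (1 + of_real \<tau>) * z + (1 + (of_real \<tau>)\<^sup>2 + 3 * of_real \<tau>)) / (12 * of_real \<tau>)"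

text \<open>Polynomial part in the asymptotics of ln G. The coefficient -3/(4 \<tau>) of the square
  is forced: it removes the constant term from \<open>stirling_defect\<close>.\<close>

definition stirling_poly :: "real \<Rightarrow> complex \<Rightarrow> complex" where
  "stirling_poly \<tau> z = (2 * (1 + of_real \<tau>) * z - 3 * z\<^sup>2) / (4 * of_real \<tau>)"

definition stirling_main :: "real \<Rightarrow> complex \<Rightarrow> complex" where
  "stirling_main \<tau> z = bern_poly \<tau> z * Ln z + stirling_poly \<tau> z"

text \<open>The amount by which the mixed difference of \<open>stirling_main\<close> with steps 1
  and \<tau> misses Ln z. Over the lattice translates of z the mixed differences telescope, so it is
  enough that the defects are summable.\<close>

definition stirling_defect :: "real \<Rightarrow> complex \<Rightarrow> complex" where
  "stirling_defect \<tau> z = Ln z - stirling_main \<tau> z + stirling_main \<tau> (z + 1) + stirling_main \<tau> (z + of_real \<tau>)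
     - stirling_main \<tau> (z + (1 + of_real \<tau>))"

text \<open>Adding h > 0 turns a point towards the positive axis: Im (1 + h / z) has the sign
  opposite to Im z. So the two principal arguments add up to a principal argument, and the logarithm
  of the product splits.\<close>

lemma Ln_add_of_real:
  assumes "z \<notin> \<real>\<^sub>\<le>\<^sub>0" "h > 0"
  shows "Ln (z + of_real h) = Ln z + Ln (1 + of_real h / z)"
proof -
  have z0: "z \<noteq> 0" using assms(1) by auto
  define w where "w = 1 + of_real h / z"
  have w0: "w \<noteq> 0"
  proof
    assume "w = 0"
    then have "z = - of_real h" using z0 by (simp add: w_def divide_simps eq_neg_iff_add_eq_0)
    then show False using assms by (auto simp: complex_nonpos_Reals_iff)
  qed
  have eq: "z + of_real h = z * w" using z0 by (simp add: w_def distrib_left)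
  have imw: "Im w = - (h * Im z) / (cmod z)\<^sup>2"
    by (simp add: w_def Im_divide cmod_power2)
  have pz: "(cmod z)\<^sup>2 > 0" using z0 by simp
  have bz: "- pi < Im (Ln z)" "Im (Ln z) \<le> pi" and bw: "- pi < Im (Ln w)" "Im (Ln w) \<le> pi"
    using z0 w0 mpi_less_Im_Ln Im_Ln_le_pi by auto
  have "Ln (z * w) = Ln z + Ln w"
  proof (rule Ln_times_simple[OF z0 w0])
    consider "Im z > 0" | "Im z < 0" | "Im z = 0" by linarith
    then have "- pi < Im (Ln z) + Im (Ln w) \<and> Im (Ln z) + Im (Ln w) \<le> pi"
    proof cases
      case 1
      then have "Im w < 0" using imw pz assms(2) by (simp add: divide_neg_pos)
      moreover have "0 \<le> Im w" if "0 \<le> Im (Ln w)"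
        using Im_Ln_pos_le[OF w0] bw that by blast
      ultimately have "Im (Ln w) < 0" by linarith
      moreover have "0 < Im (Ln z)" using Im_Ln_pos_lt[OF z0] 1 by blast
      ultimately show ?thesis using bz bw by linarith
    next
      case 2
      then have "Im w > 0" using imw pz assms(2) by (simp add: divide_neg_pos mult_pos_neg)
      then have "Im (Ln w) > 0" using Im_Ln_pos_lt[OF w0] by blast
      moreover have "0 \<le> Im z" if "0 \<le> Im (Ln z)"
        using Im_Ln_pos_le[OF z0] bz that by blast
      ultimately have "Im (Ln w) > 0" "Im (Ln z) < 0" using 2 by linarith+
      then show ?thesis using bz bw by linarith
    next
      case 3
      then have "Re z > 0" using assms(1) z0 by (auto simp: complex_nonpos_Reals_iff complex_eq_iff not_le)
      with 3 have z: "z = of_real (Re z)" by (simp add: complex_eq_iff)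
      have "Im (Ln z) = 0" using \<open>Re z > 0\<close> by (subst z) (simp add: Ln_of_real)
      then show ?thesis using bw by linarith
    qed
    then show "- pi < Im (Ln z) + Im (Ln w)" "Im (Ln z) + Im (Ln w) \<le> pi" by auto
  qed
  then show ?thesis unfolding eq w_def .
qed

lemma bern_poly_bound:
  assumes "\<tau> > 0" "1 \<le> x" "cmod w \<le> 2 * x"
  shows "cmod (bern_poly \<tau> w) \<le> (24 + 12 * (1 + \<tau>) + (1 + \<tau>\<^sup>2 + 3 * \<tau>)) / (12 * \<tau>) * x\<^sup>2"
proof -
  have e: "1 + (complex_of_real \<tau>)\<^sup>2 + 3 * of_real \<tau> = of_real (1 + \<tau>\<^sup>2 + 3 * \<tau>)"
    "6 * (1 + complex_of_real \<tau>) = of_real (6 * (1 + \<tau>))" by simp_all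
  have "cmod (6 * w\<^sup>2 - 6 * (1 + of_real \<tau>) * w + (1 + (of_real \<tau>)\<^sup>2 + 3 * of_real \<tau>)) \<le>
        cmod (6 * w\<^sup>2) + cmod (of_real (6 * (1 + \<tau>)) * w) + cmod (of_real (1 + \<tau>\<^sup>2 + 3 * \<tau>))"
    unfolding e by (intro order_trans[OF norm_triangle_ineq] add_right_mono norm_triangle_ineq4)
  also have "\<dots> = 6 * (cmod w)\<^sup>2 + 6 * (1 + \<tau>) * cmod w + (1 + \<tau>\<^sup>2 + 3 * \<tau>)"
    using assms(1) by (simp only: norm_mult norm_power norm_of_real) (simp add: abs_of_nonneg)
  also have "\<dots> \<le> 6 * (2 * x)\<^sup>2 + 6 * (1 + \<tau>) * (2 * x) + (1 + \<tau>\<^sup>2 + 3 * \<tau>)"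
    using assms by (intro add_mono mult_left_mono power_mono) auto
  also have "\<dots> \<le> 24 * x\<^sup>2 + 12 * (1 + \<tau>) * x\<^sup>2 + (1 + \<tau>\<^sup>2 + 3 * \<tau>) * x\<^sup>2"
  proof -
    have "x \<le> x\<^sup>2" "1 \<le> x\<^sup>2" using assms(2) by (simp_all add: power2_eq_square mult_ge1_I mult_left_mono)
    then have "12 * (1 + \<tau>) * x \<le> 12 * (1 + \<tau>) * x\<^sup>2" "(1 + \<tau>\<^sup>2 + 3 * \<tau>) * 1 \<le> (1 + \<tau>\<^sup>2 + 3 * \<tau>) * x\<^sup>2"
      using assms(1) by (intro mult_left_mono; simp)+
    moreover have "6 * (2 * x)\<^sup>2 = 24 * x\<^sup>2" "6 * (1 + \<tau>) * (2 * x) = 12 * (1 + \<tau>) * x"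
      by (simp_all add: power2_eq_square)
    ultimately show ?thesis by (intro add_mono) (simp_all only: mult_1_right order_refl)
  qed
  finally show ?thesis
    using assms(1) unfolding bern_poly_def norm_divide
    by (simp add: norm_mult pos_divide_le_eq) (simp add: algebra_simps)
qed

text \<open>In terms of u = 1 / z with z * u = 1 this is a polynomial identity. B and C are the
  lower coefficients of the shifted quadratic 6 z^2 + B z + C, and the other factor is the Taylor
  polynomial of Ln (1 + h / z) of degree 4.\<close>

lemma bern_poly_expansion:
  fixes z h t :: complex
  assumes "z \<noteq> 0"
  defines "B \<equiv> 12 * h - 6 * (1 + t)" and "C \<equiv> 6 * h\<^sup>2 - 6 * (1 + t) * h + (1 + t\<^sup>2 + 3 * t)"
  shows "(6 * (z + h)\<^sup>2 - 6 * (1 + t) * (z + h) + (1 + t\<^sup>2 + 3 * t)) * (h / z - (h / z)\<^sup>2 / 2 + (h / z) ^ 3 / 3 - (h / z) ^ 4 / 4)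
    = 6 * h * z + (B * h - 3 * h\<^sup>2) + (2 * h ^ 3 - B * h\<^sup>2 / 2 + C * h) / z
      + (- 3 * h ^ 4 / 2 + B * h ^ 3 / 3 - C * h\<^sup>2 / 2) / z\<^sup>2 + (C * h ^ 3 / 3 - B * h ^ 4 / 4) / z ^ 3 - (C * h ^ 4 / 4) / z ^ 4"
proof -
  define u where "u = 1 / z"
  have zu: "z * u = 1" using assms(1) by (simp add: u_def)
  have hz: "h / z = h * u" "x / z = x * u" "x / z\<^sup>2 = x * u ^ 2" "x / z ^ 3 = x * u ^ 3" "x / z ^ 4 = x * u ^ 4" for x
    by (simp_all add: u_def power_divide)
  have poly: "6 * (z + h)\<^sup>2 - 6 * (1 + t) * (z + h) + (1 + t\<^sup>2 + 3 * t) = 6 * z\<^sup>2 + B * z + C"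
    unfolding B_def C_def by (simp add: power2_eq_square algebra_simps)
  have "(6 * z\<^sup>2 + B * z + C) * (h * u - (h * u)\<^sup>2 / 2 + (h * u) ^ 3 / 3 - (h * u) ^ 4 / 4)
     = 6 * h * (z * (z * u)) + (B * h * (z * u) - 3 * h\<^sup>2 * (z * u)\<^sup>2) + (2 * h ^ 3 * (z * u)\<^sup>2 * u - B * h\<^sup>2 / 2 * (z * u) * u + C * h * u)
      + (- 3 * h ^ 4 / 2 * (z * u)\<^sup>2 + B * h ^ 3 / 3 * (z * u) - C * h\<^sup>2 / 2) * u\<^sup>2 + (C * h ^ 3 / 3 - B * h ^ 4 / 4 * (z * u)) * u ^ 3 - (C * h ^ 4 / 4) * u ^ 4"
    by (simp add: eval_nat_numeral field_simps)
  then show ?thesis unfolding poly hz zu by (simp add: algebra_simps)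
qed

text \<open>As \<open>bern_poly\<close> grows like |z|^2, expanding the logarithms to degree 4
  leaves an error O(|z|^-3), just summable over the lattice. In the combination of h = 1, \<tau> and
  1 + \<tau> the coefficients of Ln z, z, 1, 1 / z and 1 / z^2 cancel. The assumption |z| >= 2 (1 +
  \<tau>) makes every |h / z| at most 1/2.\<close>

lemma stirling_defect_bound:
  assumes "\<tau> > 0"
  obtains C where "C \<ge> 0"
    "\<And>z. z \<notin> \<real>\<^sub>\<le>\<^sub>0 \<Longrightarrow> cmod z \<ge> 2 * (1 + \<tau>) \<Longrightarrow> cmod (stirling_defect \<tau> z) \<le> C / cmod z ^ 3"
proof -
  define t where "t = complex_of_real \<tau>"
  have t0: "t \<noteq> 0" using assms by (simp add: t_def)
  define K where "K = (24 + 12 * (1 + \<tau>) + (1 + \<tau>\<^sup>2 + 3 * \<tau>)) / (12 * \<tau>)"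
  have K: "K \<ge> 0" unfolding K_def using assms by (intro divide_nonneg_nonneg) auto
  define B where "B = (\<lambda>h. 12 * h - 6 * (1 + t))"
  define E where "E = (\<lambda>h. 6 * h\<^sup>2 - 6 * (1 + t) * h + (1 + t\<^sup>2 + 3 * t))"
  define c3 where "c3 = (\<lambda>h. E h * h ^ 3 / 3 - B h * h ^ 4 / 4)"
  define c4 where "c4 = (\<lambda>h. E h * h ^ 4 / 4)"
  define D3 where "D3 = cmod ((c3 1 + c3 t - c3 (1 + t)) / (12 * t))"
  define D4 where "D4 = cmod ((c4 1 + c4 t - c4 (1 + t)) / (12 * t))"
  define C where "C = D3 + D4 + 3 * (K * (2 * (1 + \<tau>) ^ 5))"
  define T where "T = (\<lambda>u::complex. u - u\<^sup>2 / 2 + u ^ 3 / 3 - u ^ 4 / 4)"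
  show ?thesis
  proof (rule that[of C])
    show "C \<ge> 0" using K assms by (simp add: C_def D3_def D4_def)
    fix z assume z: "z \<notin> \<real>\<^sub>\<le>\<^sub>0" "cmod z \<ge> 2 * (1 + \<tau>)"
    have z0: "z \<noteq> 0" using z(1) by auto
    have "1 \<le> 2 * (1 + \<tau>)" using assms by simp
    then have z1: "cmod z \<ge> 1" using z(2) by (rule order_trans)
    define rem where "rem = (\<lambda>h. bern_poly \<tau> (z + h) * (Ln (1 + h / z) - T (h / z)))"
    have main: "stirling_main \<tau> (z + of_real h) = bern_poly \<tau> (z + of_real h) * Ln z + bern_poly \<tau> (z + of_real h) * T (of_real h / z)
        + stirling_poly \<tau> (z + of_real h) + rem (of_real h)" if "h > 0" for h
      unfolding stirling_main_def Ln_add_of_real[OF z(1) that] rem_def by (simp add: algebra_simps)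
    have rem: "cmod (rem (of_real h)) \<le> K * (2 * (1 + \<tau>) ^ 5) / cmod z ^ 3" if h: "h > 0" "h \<le> 1 + \<tau>" for h
    proof -
      have u: "cmod (of_real h / z) = h / cmod z" using h by (simp add: norm_divide)
      have u2: "h / cmod z \<le> 1/2" using h z z1 by (simp add: divide_simps) 
      have "cmod (z + of_real h) \<le> cmod z + h" using norm_triangle_ineq[of z "of_real h"] h by simp
      then have b1: "cmod (bern_poly \<tau> (z + of_real h)) \<le> K * (cmod z)\<^sup>2"
        unfolding K_def using h z by (intro bern_poly_bound[OF assms z1]) auto
      have "cmod (Ln (1 + of_real h / z) - T (of_real h / z)) \<le> 2 * (h / cmod z) ^ 5"
        using Ln_1_plus_remainder5[of "of_real h / z"] u u2 unfolding T_def by simp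
      also have "\<dots> \<le> 2 * ((1 + \<tau>) / cmod z) ^ 5"
        using h z1 by (intro mult_left_mono power_mono divide_right_mono) auto
      finally have "cmod (rem (of_real h)) \<le> (K * (cmod z)\<^sup>2) * (2 * ((1 + \<tau>) / cmod z) ^ 5)"
        unfolding rem_def norm_mult using b1 K by (intro mult_mono) auto
      also have "\<dots> = K * (2 * (1 + \<tau>) ^ 5) / cmod z ^ 3"
        using z1 by (simp add: power_divide eval_nat_numeral divide_simps)
      finally show ?thesis .
    qed
    have ex: "bern_poly \<tau> (z + h) * T (h / z) = (6 * h * z + (B h * h - 3 * h\<^sup>2) + (2 * h ^ 3 - B h * h\<^sup>2 / 2 + E h * h) / z
      + (- 3 * h ^ 4 / 2 + B h * h ^ 3 / 3 - E h * h\<^sup>2 / 2) / z\<^sup>2 + c3 h / z ^ 3 - c4 h / z ^ 4) / (12 * t)" for h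
      unfolding bern_poly_def T_def t_def[symmetric] times_divide_eq_left B_def E_def c3_def c4_def
      by (subst bern_poly_expansion[OF z0]) (rule refl)
    \<comment> \<open>The coefficient of Ln z: the mixed difference of \<open>bern_poly\<close> is 1
      and compensates the explicit Ln z.\<close>
    have q: "bern_poly \<tau> (z + 1) + bern_poly \<tau> (z + t) - bern_poly \<tau> (z + (1 + t)) - bern_poly \<tau> z + 1 = 0"
      unfolding bern_poly_def t_def[symmetric] using t0 by (simp add: field_simps power2_eq_square)
    have p: "stirling_poly \<tau> (z + 1) + stirling_poly \<tau> (z + t) - stirling_poly \<tau> (z + (1 + t)) - stirling_poly \<tau> z = 3 / 2"
      unfolding stirling_poly_def t_def[symmetric] using t0 by (simp add: field_simps power2_eq_square)
    \<comment> \<open>Divided by 12 t this is -3/2 and cancels the 3/2 from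
      \<open>stirling_poly\<close>; the next two identities remove 1 / z and 1 / z^2.\<close>
    have s0: "(B 1 * 1 - 3 * 1\<^sup>2) + (B t * t - 3 * t\<^sup>2) - (B (1 + t) * (1 + t) - 3 * (1 + t)\<^sup>2) = - 18 * t"
      unfolding B_def by (simp add: power2_eq_square algebra_simps)
    have s1: "(2 * 1 ^ 3 - B 1 * 1\<^sup>2 / 2 + E 1 * 1) + (2 * t ^ 3 - B t * t\<^sup>2 / 2 + E t * t) - (2 * (1 + t) ^ 3 - B (1 + t) * (1 + t)\<^sup>2 / 2 + E (1 + t) * (1 + t)) = 0"
      unfolding B_def E_def by (simp add: eval_nat_numeral field_simps)
    have s2: "(- 3 * 1 ^ 4 / 2 + B 1 * 1 ^ 3 / 3 - E 1 * 1\<^sup>2 / 2) + (- 3 * t ^ 4 / 2 + B t * t ^ 3 / 3 - E t * t\<^sup>2 / 2)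
       - (- 3 * (1 + t) ^ 4 / 2 + B (1 + t) * (1 + t) ^ 3 / 3 - E (1 + t) * (1 + t)\<^sup>2 / 2) = 0"
      unfolding B_def E_def by (simp add: eval_nat_numeral field_simps)
    have "bern_poly \<tau> (z + 1) * T (1 / z) + bern_poly \<tau> (z + t) * T (t / z) - bern_poly \<tau> (z + (1 + t)) * T ((1 + t) / z)
      = ((6 * 1 * z + 6 * t * z - 6 * (1 + t) * z)
        + ((B 1 * 1 - 3 * 1\<^sup>2) + (B t * t - 3 * t\<^sup>2) - (B (1 + t) * (1 + t) - 3 * (1 + t)\<^sup>2))
        + ((2 * 1 ^ 3 - B 1 * 1\<^sup>2 / 2 + E 1 * 1) + (2 * t ^ 3 - B t * t\<^sup>2 / 2 + E t * t) - (2 * (1 + t) ^ 3 - B (1 + t) * (1 + t)\<^sup>2 / 2 + E (1 + t) * (1 + t))) / z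
        + ((- 3 * 1 ^ 4 / 2 + B 1 * 1 ^ 3 / 3 - E 1 * 1\<^sup>2 / 2) + (- 3 * t ^ 4 / 2 + B t * t ^ 3 / 3 - E t * t\<^sup>2 / 2)
       - (- 3 * (1 + t) ^ 4 / 2 + B (1 + t) * (1 + t) ^ 3 / 3 - E (1 + t) * (1 + t)\<^sup>2 / 2)) / z\<^sup>2
        + (c3 1 + c3 t - c3 (1 + t)) / z ^ 3 - (c4 1 + c4 t - c4 (1 + t)) / z ^ 4) / (12 * t)"
      unfolding ex by (simp only: add_divide_distrib diff_divide_distrib) (simp only: algebra_simps)
    also have "\<dots> = - 3 / 2 + (c3 1 + c3 t - c3 (1 + t)) / (12 * t) / z ^ 3 - (c4 1 + c4 t - c4 (1 + t)) / (12 * t) / z ^ 4"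
      unfolding s0 s1 s2 using t0 z0 by (simp add: add_divide_distrib diff_divide_distrib algebra_simps)
    finally have sumT: "bern_poly \<tau> (z + 1) * T (1 / z) + bern_poly \<tau> (z + t) * T (t / z) - bern_poly \<tau> (z + (1 + t)) * T ((1 + t) / z)
      = - 3 / 2 + (c3 1 + c3 t - c3 (1 + t)) / (12 * t) / z ^ 3 - (c4 1 + c4 t - c4 (1 + t)) / (12 * t) / z ^ 4" .
    have "stirling_defect \<tau> z = (bern_poly \<tau> (z + 1) + bern_poly \<tau> (z + t) - bern_poly \<tau> (z + (1 + t)) - bern_poly \<tau> z + 1) * Ln z
       + (bern_poly \<tau> (z + 1) * T (1 / z) + bern_poly \<tau> (z + t) * T (t / z) - bern_poly \<tau> (z + (1 + t)) * T ((1 + t) / z))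
       + (stirling_poly \<tau> (z + 1) + stirling_poly \<tau> (z + t) - stirling_poly \<tau> (z + (1 + t)) - stirling_poly \<tau> z)
       + (rem 1 + rem t - rem (1 + t))"
      using main[of 1] main[of \<tau>] main[of "1 + \<tau>"] assms
      unfolding stirling_defect_def t_def[symmetric] stirling_main_def[of \<tau> z] by (simp add: t_def algebra_simps)
    also have "\<dots> = (c3 1 + c3 t - c3 (1 + t)) / (12 * t) / z ^ 3 - (c4 1 + c4 t - c4 (1 + t)) / (12 * t) / z ^ 4 + (rem 1 + rem t - rem (1 + t))"
      unfolding q p sumT by simp
    also have "cmod \<dots> \<le> D3 / cmod z ^ 3 + D4 / cmod z ^ 4 + (cmod (rem 1) + cmod (rem t) + cmod (rem (1 + t)))"
      unfolding D3_def D4_def norm_power[symmetric] norm_divide[symmetric]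
      by (intro order_trans[OF norm_triangle_ineq] order_trans[OF norm_triangle_ineq4] add_mono order_refl)
    also have "\<dots> \<le> D3 / cmod z ^ 3 + D4 / cmod z ^ 3 + (K * (2 * (1 + \<tau>) ^ 5) / cmod z ^ 3 + K * (2 * (1 + \<tau>) ^ 5) / cmod z ^ 3 + K * (2 * (1 + \<tau>) ^ 5) / cmod z ^ 3)"
    proof (intro add_mono order_refl)
      show "D4 / cmod z ^ 4 \<le> D4 / cmod z ^ 3"
        using z1 by (intro divide_left_mono power_increasing) (auto simp: D4_def)
      show "cmod (rem 1) \<le> K * (2 * (1 + \<tau>) ^ 5) / cmod z ^ 3" using rem[of 1] assms by simp
      show "cmod (rem t) \<le> K * (2 * (1 + \<tau>) ^ 5) / cmod z ^ 3" using rem[of \<tau>] assms by (simp add: t_def)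
      show "cmod (rem (1 + t)) \<le> K * (2 * (1 + \<tau>) ^ 5) / cmod z ^ 3" using rem[of "1 + \<tau>"] assms by (simp add: t_def)
    qed
    also have "\<dots> = C / cmod z ^ 3"
      by (simp add: C_def add_divide_distrib algebra_simps)
    finally show "cmod (stirling_defect \<tau> z) \<le> C / cmod z ^ 3" .
  qed
qed

section \<open>From the mixed difference to the Stirling formula in sectors\<close>

lemma polar_notin_nonpos:
  assumes "r > 0" "\<bar>\<theta>\<bar> < pi"
  shows "complex_of_real r * cis \<theta> \<notin> \<real>\<^sub>\<le>\<^sub>0"
proof
  assume "complex_of_real r * cis \<theta> \<in> \<real>\<^sub>\<le>\<^sub>0"
  then have *: "r * cos \<theta> \<le> 0" "r * sin \<theta> = 0" by (auto simp: complex_nonpos_Reals_iff)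
  then have "sin \<theta> = 0" using assms by simp
  then have "\<theta> = 0" using assms(2) sin_eq_0_pi by force
  then show False using * assms by simp
qed

lemma add_of_real_notin_nonpos:
  assumes "z \<notin> \<real>\<^sub>\<le>\<^sub>0" "x \<ge> 0"
  shows "z + complex_of_real x \<notin> \<real>\<^sub>\<le>\<^sub>0"
  using assms by (auto simp: complex_nonpos_Reals_iff)

text \<open>The square of the left side minus that of the right side equals (1 + cos \<epsilon>) / 2
  * (r - x)^2 + 2 r x (cos \<theta> + cos \<epsilon>), by sin^2 (\<epsilon> / 2) = (1 - cos
  \<epsilon>) / 2. Both terms are nonnegative in the sector.\<close>

lemma polar_add_lower_bound:
  assumes "r \<ge> 0" "x \<ge> 0" "0 < \<epsilon>" "\<epsilon> < pi" "\<bar>\<theta>\<bar> \<le> pi - \<epsilon>"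
  shows "cmod (of_real r * cis \<theta> + of_real x) \<ge> sin (\<epsilon> / 2) * (r + x)"
proof (rule power2_le_imp_le)
  have "cos (pi - \<epsilon>) \<le> cos \<bar>\<theta>\<bar>" using assms by (intro cos_monotone_0_pi_le) auto
  then have c: "- cos \<epsilon> \<le> cos \<theta>" by simp
  have s: "(sin (\<epsilon> / 2))\<^sup>2 = (1 - cos \<epsilon>) / 2"
    using cos_double_sin[of "\<epsilon> / 2"] by simp
  have "0 \<le> 1 + cos \<epsilon>" using cos_ge_minus_one[of \<epsilon>] by linarith
  then have "0 \<le> (1 + cos \<epsilon>) / 2 * (r - x)\<^sup>2" by simp
  moreover have "0 \<le> 2 * (r * x) * (cos \<theta> + cos \<epsilon>)"
    using assms c by (intro mult_nonneg_nonneg[of _ "cos \<theta> + cos \<epsilon>"]) auto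
  ultimately have "0 \<le> (1 + cos \<epsilon>) / 2 * (r - x)\<^sup>2 + 2 * (r * x) * (cos \<theta> + cos \<epsilon>)"
    by (rule add_nonneg_nonneg)
  then have "(1 - cos \<epsilon>) / 2 * (r + x)\<^sup>2 \<le> r\<^sup>2 + x\<^sup>2 + 2 * r * x * cos \<theta>"
    by (simp add: power2_eq_square field_simps)
  also have "\<dots> = r\<^sup>2 * ((cos \<theta>)\<^sup>2 + (sin \<theta>)\<^sup>2) + x\<^sup>2 + 2 * r * x * cos \<theta>" by (simp del: sin_cos_squared_add sin_cos_squared_add2 add: sin_cos_squared_add2)
  also have "\<dots> = (r * cos \<theta> + x)\<^sup>2 + (r * sin \<theta>)\<^sup>2"
  proof -
    have "r\<^sup>2 * (a\<^sup>2 + b\<^sup>2) + x\<^sup>2 + 2 * r * x * a = (r * a + x)\<^sup>2 + (r * b)\<^sup>2" for a b :: real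
      by (simp add: power2_eq_square algebra_simps)
    then show ?thesis .
  qed
  also have "\<dots> = (cmod (of_real r * cis \<theta> + of_real x))\<^sup>2"
    unfolding cmod_power2 by simp
  finally show "(sin (\<epsilon> / 2) * (r + x))\<^sup>2 \<le> (cmod (of_real r * cis \<theta> + of_real x))\<^sup>2"
    by (simp add: power_mult_distrib s)
qed auto

lemma log_factor_summable:
  assumes "\<tau> > 0"
  shows "log_factor \<tau> z summable_on (UNIV - {(0,0)})"
proof -
  let ?S = "UNIV - {(0,0)} :: (nat \<times> nat) set"
  let ?B = "small_lattice \<tau> (cmod z)"
  have "log_factor \<tau> z summable_on (?S - ?B)"
    using has_sum_tail_log[OF assms order_refl] by (rule has_sum_imp_summable)
  moreover have "log_factor \<tau> z summable_on ?B"
    by (rule summable_on_finite[OF finite_small_lattice[OF assms]])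
  ultimately have "log_factor \<tau> z summable_on ((?S - ?B) \<union> ?B)"
    by (rule summable_on_Un_disjoint) auto
  moreover have "(?S - ?B) \<union> ?B = ?S" by (auto simp: small_lattice_def)
  ultimately show ?thesis by simp
qed

text \<open>Off the nonpositive axis no primary factor vanishes, so each is the exponential of its
  \<open>log_factor\<close> and no finite product has to be split off.\<close>

lemma double_product_eq_exp:
  assumes "\<tau> > 0" "z \<notin> \<real>\<^sub>\<le>\<^sub>0"
  shows "double_product \<tau> z = exp (\<Sum>\<^sub>\<infinity>x\<in>UNIV - {(0,0)}. log_factor \<tau> z x)"
proof -
  let ?F = "finite_subsets_at_top (UNIV - {(0,0)} :: (nat \<times> nat) set)"
  have "((\<lambda>F. \<Sum>x\<in>F. log_factor \<tau> z x) \<longlongrightarrow> (\<Sum>\<^sub>\<infinity>x\<in>UNIV - {(0,0)}. log_factor \<tau> z x)) ?F"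
    using has_sum_infsum[OF log_factor_summable[OF assms(1)]] by (simp add: has_sum_def)
  then have "((\<lambda>F. exp (\<Sum>x\<in>F. log_factor \<tau> z x)) \<longlongrightarrow> exp (\<Sum>\<^sub>\<infinity>x\<in>UNIV - {(0,0)}. log_factor \<tau> z x)) ?F"
    by (rule tendsto_exp)
  moreover have "\<forall>\<^sub>F F in ?F. exp (\<Sum>x\<in>F. log_factor \<tau> z x) = (\<Prod>x\<in>F. primary_factor \<tau> z x)"
  proof (rule eventually_finite_subsets_at_top_weakI)
    fix F :: "(nat \<times> nat) set" assume F: "finite F" "F \<subseteq> UNIV - {(0,0)}"
    have "exp (log_factor \<tau> z x) = primary_factor \<tau> z x" if "x \<in> F" for x
    proof -
      define L where "L = lattice \<tau> x"
      have L: "L > 0" using lattice_pos[OF assms(1), of x] that F by (auto simp: L_def)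
      have "1 + z / of_real L \<noteq> 0"
      proof
        assume "1 + z / of_real L = 0"
        then have "z = - of_real L" using L by (simp add: divide_simps add.commute eq_neg_iff_add_eq_0)
        then show False using assms(2) L by (simp add: complex_nonpos_Reals_iff)
      qed
      then have "exp (Ln (1 + z / of_real L)) = 1 + z / of_real L" by (rule exp_Ln)
      moreover have "log_factor \<tau> z x = Ln (1 + z / of_real L) + (- (z / of_real L) + (z / of_real L)\<^sup>2 / 2)"
        by (simp add: log_factor_def L_def)
      ultimately show ?thesis unfolding primary_factor_def L_def by (simp only: exp_add)
    qed
    then show "exp (\<Sum>x\<in>F. log_factor \<tau> z x) = (\<Prod>x\<in>F. primary_factor \<tau> z x)"
      using F by (simp add: exp_sum)
  qed
  ultimately have "((\<lambda>F. \<Prod>x\<in>F. primary_factor \<tau> z x) \<longlongrightarrow> exp (\<Sum>\<^sub>\<infinity>x\<in>UNIV - {(0,0)}. log_factor \<tau> z x)) ?F"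
    by (rule Lim_transform_eventually)
  then show ?thesis unfolding double_product_def by (intro tendsto_Lim) auto
qed

lemma telescope_square:
  fixes g :: "nat \<Rightarrow> nat \<Rightarrow> 'a :: ab_group_add"
  shows "(\<Sum>(k,l)\<in>{..<K} \<times> {..<K}. g k l - g k (Suc l) - g (Suc k) l + g (Suc k) (Suc l)) = g 0 0 - g 0 K - g K 0 + g K K"
proof -
  have "(\<Sum>(k,l)\<in>{..<K} \<times> {..<K}. g k l - g k (Suc l) - g (Suc k) l + g (Suc k) (Suc l))
      = (\<Sum>k<K. \<Sum>l<K. (g k l - g (Suc k) l) - (g k (Suc l) - g (Suc k) (Suc l)))"
    by (simp add: sum.cartesian_product algebra_simps)
  also have "\<dots> = (\<Sum>k<K. (g k 0 - g (Suc k) 0) - (g k K - g (Suc k) K))"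
    by (subst sum_lessThan_telescope') simp
  also have "\<dots> = (\<Sum>k<K. (g k 0 - g k K) - (g (Suc k) 0 - g (Suc k) K))"
    by (simp add: algebra_simps)
  also have "\<dots> = (g 0 0 - g 0 K) - (g K 0 - g K K)"
    by (subst sum_lessThan_telescope') simp
  finally show ?thesis by (simp add: algebra_simps)
qed

text \<open>Up to a quadratic polynomial in \<open>z\<close>, the translates of \<^const>\<open>stirling_main\<close> tend to \<open>0\<close>.\<close>
lemma stirling_main_translate:
  assumes "\<tau> > 0"
  obtains a b c :: "real \<Rightarrow> complex" where
    "\<And>z. ((\<lambda>X. stirling_main \<tau> (z + of_real X) - (a X + b X * z + c X * z\<^sup>2)) \<longlongrightarrow> 0) at_top"
proof -
  define t where "t = complex_of_real \<tau>"
  have t0: "t \<noteq> 0" using assms by (simp add: t_def)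
  define B1 where "B1 = (\<lambda>X. (12 * of_real X - 6 * (1 + t)) / (12 * t))"
  \<comment> \<open>The three functions collect the terms of degree 0, 1 and 2 in z of
    \<open>bern_poly\<close> at X + z times ln X + z / X - z^2 / (2 X^2), plus
    \<open>stirling_poly\<close>. The terms of degree 3 and 4 form P below, which vanishes as X
    grows.\<close>
  define a where "a = (\<lambda>X. bern_poly \<tau> (of_real X) * of_real (ln X) + stirling_poly \<tau> (of_real X))"
  define b where "b = (\<lambda>X. B1 X * of_real (ln X) + bern_poly \<tau> (of_real X) / of_real X + (2 * (1 + t) - 6 * of_real X) / (4 * t))"
  define c where "c = (\<lambda>X. of_real (ln X) / (2 * t) + B1 X / of_real X - bern_poly \<tau> (of_real X) / (2 * (of_real X)\<^sup>2) - 3 / (4 * t))"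
  define K where "K = (24 + 12 * (1 + \<tau>) + (1 + \<tau>\<^sup>2 + 3 * \<tau>)) / (12 * \<tau>)"
  have K: "K \<ge> 0" unfolding K_def using assms by (intro divide_nonneg_nonneg) auto
  show ?thesis
  proof (rule that[of a b c])
    fix z :: complex
    define P where "P = (\<lambda>X. z ^ 3 * (of_real (1 / X) / (2 * t) - (12 * of_real (1 / X) - 6 * (1 + t) * of_real (1 / X ^ 2)) / (24 * t)) - z ^ 4 * of_real (1 / X ^ 2) / (4 * t))"
    define rem where "rem = (\<lambda>X. bern_poly \<tau> (z + of_real X) * (Ln (1 + z / of_real X) - z / of_real X + (z / of_real X)\<^sup>2 / 2))"
    have "((\<lambda>X::real. 1 / X) \<longlongrightarrow> 0) at_top" "((\<lambda>X::real. 1 / X ^ 2) \<longlongrightarrow> 0) at_top" by real_asymp+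
    from this[THEN tendsto_of_real, where 'a=complex] 
    have lims: "((\<lambda>X::real. complex_of_real (1 / X)) \<longlongrightarrow> 0) at_top" "((\<lambda>X::real. complex_of_real (1 / X ^ 2)) \<longlongrightarrow> 0) at_top"
      by simp_all
    have "(P \<longlongrightarrow> z ^ 3 * (0 / (2 * t) - (12 * 0 - 6 * (1 + t) * 0) / (24 * t)) - z ^ 4 * 0 / (4 * t)) at_top"
      unfolding P_def using t0 by (intro tendsto_intros lims) auto
    then have P: "(P \<longlongrightarrow> 0) at_top" by simp
    have ev: "\<forall>\<^sub>F X in at_top. X > (0::real) \<and> X \<ge> 1 \<and> X \<ge> 2 * cmod z"
      by (intro eventually_conj eventually_gt_at_top eventually_ge_at_top)
    have rem: "(rem \<longlongrightarrow> 0) at_top"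
    proof (rule Lim_null_comparison)
      show "\<forall>\<^sub>F X in at_top. norm (rem X) \<le> K * (2 * cmod z ^ 3) / X"
        using ev
      proof eventually_elim
        case (elim X)
        have "cmod (z + of_real X) \<le> 2 * X"
          using norm_triangle_ineq[of z "of_real X"] elim by simp
        then have b1: "cmod (bern_poly \<tau> (z + of_real X)) \<le> K * X\<^sup>2"
          unfolding K_def using elim by (intro bern_poly_bound[OF assms]) auto
        have u: "cmod (z / of_real X) = cmod z / X" using elim by (simp add: norm_divide)
        have "cmod (Ln (1 + z / of_real X) - z / of_real X + (z / of_real X)\<^sup>2 / 2) \<le> 2 * (cmod z / X) ^ 3"
          unfolding u[symmetric] using elim by (intro Ln_1_plus_remainder3) (simp add: u)
        then have "norm (rem X) \<le> (K * X\<^sup>2) * (2 * (cmod z / X) ^ 3)"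
          unfolding rem_def norm_mult using b1 K by (intro mult_mono) auto
        also have "\<dots> = K * (2 * cmod z ^ 3) / X"
          using elim by (simp add: power_divide eval_nat_numeral divide_simps)
        finally show ?case .
      qed
      show "((\<lambda>X. K * (2 * cmod z ^ 3) / X) \<longlongrightarrow> 0) at_top" by real_asymp
    qed
    have eq: "\<forall>\<^sub>F X in at_top. P X + rem X = stirling_main \<tau> (z + of_real X) - (a X + b X * z + c X * z\<^sup>2)"
      using ev
    proof eventually_elim
      case (elim X)
      define x where "x = complex_of_real X"
      have x0: "x \<noteq> 0" using elim by (simp add: x_def)
      have "cmod (z / x) \<le> 1 / 2" using elim by (simp add: norm_divide x_def)
      have "1 + z / x \<noteq> 0"
      proof
        assume "1 + z / x = 0"
        then have "z / x = -1" by (simp add: add_eq_0_iff)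
        with \<open>cmod (z / x) \<le> 1 / 2\<close> show False by simp
      qed
      then have "Ln (x * (1 + z / x)) = of_real (ln X) + Ln (1 + z / x)"
        unfolding x_def using elim by (subst Ln_times_of_real) (auto simp: Ln_of_real)
      moreover have "x * (1 + z / x) = z + x" using x0 by (simp add: algebra_simps)
      ultimately have L: "Ln (z + x) = of_real (ln X) + Ln (1 + z / x)" by simp
      define l where "l = complex_of_real (ln X)"
      have e1: "bern_poly \<tau> (z + x) = bern_poly \<tau> x + B1 X * z + z\<^sup>2 / (2 * t)"
        unfolding bern_poly_def B1_def t_def[symmetric] x_def[symmetric] using t0 by (simp add: field_simps power2_eq_square)
      have e2: "stirling_poly \<tau> (z + x) = stirling_poly \<tau> x + (2 * (1 + t) - 6 * x) / (4 * t) * z - 3 / (4 * t) * z\<^sup>2"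
        unfolding stirling_poly_def t_def[symmetric] using t0 by (simp add: field_simps power2_eq_square)
      have PX: "P X = z ^ 3 * (1 / (2 * t * x) - B1 X / (2 * x\<^sup>2)) - z ^ 4 / (4 * t * x\<^sup>2)"
        unfolding P_def B1_def x_def[symmetric] of_real_divide of_real_power of_real_1 using t0 x0
        by (simp add: field_simps power2_eq_square)
      define E where "E = bern_poly \<tau> x"
      define M where "M = Ln (1 + z / x)"
      have "stirling_main \<tau> (z + x) - (a X + b X * z + c X * z\<^sup>2) - rem X
          = (E + B1 X * z + z\<^sup>2 / (2 * t)) * (z / x - (z / x)\<^sup>2 / 2) - E / x * z - (B1 X / x - E / (2 * x\<^sup>2)) * z\<^sup>2"
        unfolding stirling_main_def a_def b_def c_def rem_def x_def[symmetric] L e1 e2 l_def[symmetric] E_def[symmetric] M_def[symmetric]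
        by (simp add: algebra_simps power2_eq_square add_divide_distrib)
      also have "\<dots> = P X" unfolding PX using x0 t0 by (simp add: field_simps eval_nat_numeral)
      finally show ?case unfolding x_def by (simp add: algebra_simps)
    qed
    show "((\<lambda>X. stirling_main \<tau> (z + of_real X) - (a X + b X * z + c X * z\<^sup>2)) \<longlongrightarrow> 0) at_top"
      using Lim_transform_eventually[OF tendsto_add[OF P rem] eq] by simp
  qed
qed

text \<open>First and second differences at three equally spaced points recover the coefficients, so
  these converge, and the limit is quadratic on all of S.\<close>

lemma quadratic_limit:
  fixes a b c :: "nat \<Rightarrow> complex" and f :: "complex \<Rightarrow> complex"
  assumes lim: "\<And>z. z \<in> S \<Longrightarrow> (\<lambda>n. a n + b n * z + c n * z\<^sup>2) \<longlonglongrightarrow> f z"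
    and x: "x \<in> S" "x + 1 \<in> S" "x + 2 \<in> S"
  obtains A B C where "\<And>z. z \<in> S \<Longrightarrow> f z = A + B * z + C * z\<^sup>2"
proof -
  define C where "C = (f x - 2 * f (x + 1) + f (x + 2)) / 2"
  define B where "B = f (x + 1) - f x - C * (2 * x + 1)"
  define A where "A = f x - B * x - C * x\<^sup>2"
  let ?q = "\<lambda>n z. a n + b n * z + c n * z\<^sup>2"
  have C: "c \<longlonglongrightarrow> C"
  proof -
    have "(\<lambda>n. (?q n x - 2 * ?q n (x + 1) + ?q n (x + 2)) / 2) \<longlonglongrightarrow> C"
      unfolding C_def by (intro tendsto_intros lim x) auto
    moreover have "(?q n x - 2 * ?q n (x + 1) + ?q n (x + 2)) / 2 = c n" for n
      by (simp add: power2_eq_square algebra_simps)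
    ultimately show ?thesis by simp
  qed
  have B: "b \<longlonglongrightarrow> B"
  proof -
    have "(\<lambda>n. ?q n (x + 1) - ?q n x - c n * (2 * x + 1)) \<longlonglongrightarrow> B"
      unfolding B_def by (intro tendsto_diff tendsto_mult tendsto_const lim x C)
    moreover have "?q n (x + 1) - ?q n x - c n * (2 * x + 1) = b n" for n
      by (simp add: power2_eq_square algebra_simps)
    ultimately show ?thesis by simp
  qed
  have A: "a \<longlonglongrightarrow> A"
  proof -
    have "(\<lambda>n. ?q n x - b n * x - c n * x\<^sup>2) \<longlonglongrightarrow> A"
      unfolding A_def by (intro tendsto_diff tendsto_mult tendsto_const lim x C B)
    then show ?thesis by simp
  qed
  show ?thesis
  proof (rule that[of A B C])
    fix z assume "z \<in> S"
    from lim[OF this] show "f z = A + B * z + C * z\<^sup>2"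
      by (rule LIMSEQ_unique) (intro tendsto_intros A B C)
  qed
qed

text \<open>Telescoping lives on squares, whereas infinite sums and the double product are limits
  along finite sets. The squares are cofinal, so those limits can be computed along them.\<close>

lemma filterlim_square_finite_subsets:
  "filterlim (\<lambda>K. {..<K} \<times> {..<K}) (finite_subsets_at_top (UNIV :: (nat \<times> nat) set)) sequentially"
  unfolding filterlim_finite_subsets_at_top
proof (intro allI impI)
  fix X :: "(nat \<times> nat) set" assume X: "finite X \<and> X \<subseteq> UNIV"
  obtain M where M: "\<And>x. x \<in> fst ` X \<union> snd ` X \<Longrightarrow> x < M"
    using X finite_nat_bounded[of "fst ` X \<union> snd ` X"] by blast
  show "\<forall>\<^sub>F K in sequentially. finite ({..<K} \<times> {..<K}) \<and> X \<subseteq> {..<K} \<times> {..<K} \<and> {..<K} \<times> {..<K} \<subseteq> UNIV"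
    using eventually_ge_at_top[of M]
  proof eventually_elim
    case (elim K)
    have "X \<subseteq> {..<K} \<times> {..<K}"
    proof
      fix x assume "x \<in> X"
      then have "fst x < M" "snd x < M" using M by auto
      then show "x \<in> {..<K} \<times> {..<K}" using elim by (cases x) auto
    qed
    then show ?case by auto
  qed
qed

lemma filterlim_punctured_square_finite_subsets:
  "filterlim (\<lambda>K. {..<K} \<times> {..<K} - {(0,0)}) (finite_subsets_at_top (UNIV - {(0,0)} :: (nat \<times> nat) set)) sequentially"
  unfolding filterlim_finite_subsets_at_top
proof (intro allI impI)
  fix X :: "(nat \<times> nat) set" assume X: "finite X \<and> X \<subseteq> UNIV - {(0,0)}"
  then have "\<forall>\<^sub>F K in sequentially. finite ({..<K} \<times> {..<K}) \<and> X \<subseteq> {..<K} \<times> {..<K} \<and> {..<K} \<times> {..<K} \<subseteq> UNIV"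
    using filterlim_square_finite_subsets unfolding filterlim_finite_subsets_at_top by blast
  then show "\<forall>\<^sub>F K in sequentially. finite ({..<K} \<times> {..<K} - {(0,0)}) \<and> X \<subseteq> {..<K} \<times> {..<K} - {(0,0)}
      \<and> {..<K} \<times> {..<K} - {(0,0)} \<subseteq> UNIV - {(0,0)}"
    by eventually_elim (use X in auto)
qed

text \<open>D z below is Ln z plus the logarithm of the product, minus the main term and minus the
  sum of the defects. On a square of side K the sums telescope to the far corners, where
  \<open>stirling_main\<close> is quadratic in z up to o(1). So D is a limit of quadratics, hence
  quadratic; its coefficients enter A and B and are never computed. The sum of the defects is
  bounded uniformly in each sector.\<close>

theorem barnes_G_stirling:
  assumes \<tau>: "\<tau> > 0"
  obtains A B :: complex where
    "\<And>\<epsilon>. 0 < \<epsilon> \<Longrightarrow> \<epsilon> < pi \<Longrightarrow> \<exists>R C. R > 0 \<and> (\<forall>r\<ge>R. \<forall>\<theta>. \<bar>\<theta>\<bar> \<le> pi - \<epsilon> \<longrightarrow>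
       barnes_G \<tau> (of_real r * cis \<theta>) \<noteq> 0 \<and>
       \<bar>ln (cmod (barnes_G \<tau> (of_real r * cis \<theta>))) - Re (bern_poly \<tau> (of_real r * cis \<theta>) * Complex (ln r) \<theta>
          + A * (of_real r * cis \<theta>) + B * (of_real r * cis \<theta>)\<^sup>2)\<bar> \<le> C)"
proof -
  define t where "t = complex_of_real \<tau>"
  have t0: "t \<noteq> 0" using \<tau> by (simp add: t_def)
  obtain C0 where C0: "C0 \<ge> 0"
    "\<And>z. z \<notin> \<real>\<^sub>\<le>\<^sub>0 \<Longrightarrow> cmod z \<ge> 2 * (1 + \<tau>) \<Longrightarrow> cmod (stirling_defect \<tau> z) \<le> C0 / cmod z ^ 3"
    using stirling_defect_bound[OF \<tau>] by metis
  define c where "c = min \<tau> 1"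
  have c: "c > 0" "c \<le> 1" using \<tau> by (auto simp: c_def)
  define M where "M = (\<lambda>x :: nat \<times> nat. case x of (k, l) \<Rightarrow> 1 / (1 + real k + real l) ^ 3)"
  have M: "M summable_on UNIV" unfolding M_def by (rule summable_on_lattice_cube)
  \<comment> \<open>By \<open>polar_add_lower_bound\<close>, r >= Rad \<epsilon> puts all lattice
    translates of a point of the sector at modulus at least 2 (1 + \<tau>); the summand 1 ensures r
    >= 1.\<close>
  define Rad where "Rad = (\<lambda>\<epsilon>. 1 + 2 * (1 + \<tau>) / sin (\<epsilon> / 2))"
  define defect where "defect = (\<lambda>z x. stirling_defect \<tau> (z + of_real (lattice \<tau> x)))"
  have sin_pos: "sin (\<epsilon> / 2) > 0" if "0 < \<epsilon>" "\<epsilon> < pi" for \<epsilon> :: real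
    using that by (intro sin_gt_zero) auto
  have Rad1: "Rad \<epsilon> \<ge> 1" if "0 < \<epsilon>" "\<epsilon> < pi" for \<epsilon>
    using sin_pos[OF that] \<tau> by (simp add: Rad_def)
  have defect_le: "cmod (defect (of_real r * cis \<theta>) x) \<le> C0 / (sin (\<epsilon> / 2) * c) ^ 3 * M x"
    if \<epsilon>: "0 < \<epsilon>" "\<epsilon> < pi" and r: "r \<ge> Rad \<epsilon>" and \<theta>: "\<bar>\<theta>\<bar> \<le> pi - \<epsilon>" for \<epsilon> r \<theta> x
  proof -
    obtain k l where kl: "x = (k, l)" by force
    let ?s = "sin (\<epsilon> / 2)"
    let ?w = "of_real r * cis \<theta> + of_real (lattice \<tau> x)"
    have s: "?s > 0" by (rule sin_pos[OF \<epsilon>])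
    have r1: "r \<ge> 1" using Rad1[OF \<epsilon>] r by linarith
    have w: "cmod ?w \<ge> ?s * (r + lattice \<tau> x)"
      using r1 \<epsilon> \<theta> lattice_nonneg[OF \<tau>, of x] by (intro polar_add_lower_bound) auto
    have "?s * (2 * (1 + \<tau>) / ?s) \<le> ?s * (r + lattice \<tau> x)"
      using s r lattice_nonneg[OF \<tau>, of x] unfolding Rad_def by (intro mult_left_mono) auto
    then have "2 * (1 + \<tau>) \<le> cmod ?w" using w s by simp
    moreover have "?w \<notin> \<real>\<^sub>\<le>\<^sub>0"
      using r1 \<epsilon> \<theta> lattice_nonneg[OF \<tau>, of x] by (intro add_of_real_notin_nonpos polar_notin_nonpos) auto
    ultimately have 1: "cmod (defect (of_real r * cis \<theta>) x) \<le> C0 / cmod ?w ^ 3"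
      unfolding defect_def using C0(2) by blast
    have "c * 1 \<le> 1 * r" using c r1 by (intro mult_mono) auto
    then have "c * (1 + real k + real l) \<le> r + lattice \<tau> x"
      using lattice_ge[OF \<tau>, of k l] unfolding c_def[symmetric] kl by (simp add: algebra_simps)
    then have "?s * (c * (1 + real k + real l)) \<le> ?s * (r + lattice \<tau> x)" using s by (intro mult_left_mono) auto
    also note w
    finally have "(?s * c * (1 + real k + real l)) ^ 3 \<le> cmod ?w ^ 3"
      using s c by (intro power_mono) (auto simp: mult.assoc)
    then have "C0 / cmod ?w ^ 3 \<le> C0 / (?s * c * (1 + real k + real l)) ^ 3"
    proof -
      have "?s * c * (1 + real k + real l) > 0" using s c by (intro mult_pos_pos) auto
      moreover have "0 < 2 * (1 + \<tau>)" using \<tau> by simp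
      then have "cmod ?w > 0" using \<open>2 * (1 + \<tau>) \<le> cmod ?w\<close> by (rule less_le_trans)
      ultimately show ?thesis using C0(1) \<open>_ ^ 3 \<le> cmod ?w ^ 3\<close>
        by (intro divide_left_mono mult_pos_pos[of "cmod ?w ^ 3"] zero_less_power)
    qed
    also have "\<dots> = C0 / (?s * c) ^ 3 * M x"
      by (simp add: M_def kl power_mult_distrib)
    finally show ?thesis using 1 by linarith
  qed
  \<comment> \<open>Union of all truncated sectors. The quadratic is determined on the whole set, so
    A and B do not depend on the sector.\<close>
  define S where "S = {z. \<exists>\<epsilon> r \<theta>. 0 < \<epsilon> \<and> \<epsilon> < pi \<and> r \<ge> Rad \<epsilon> \<and> \<bar>\<theta>\<bar> \<le> pi - \<epsilon> \<and> z = of_real r * cis \<theta>}"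
  have S_slit: "z \<notin> \<real>\<^sub>\<le>\<^sub>0" if "z \<in> S" for z
  proof -
    from that obtain \<epsilon> r \<theta> where *: "0 < \<epsilon>" "\<epsilon> < pi" "r \<ge> Rad \<epsilon>" "\<bar>\<theta>\<bar> \<le> pi - \<epsilon>" "z = of_real r * cis \<theta>"
      unfolding S_def by blast
    moreover have "r > 0" using Rad1[OF *(1,2)] *(3) by linarith
    ultimately show ?thesis using polar_notin_nonpos[of r \<theta>] by simp
  qed
  have defect_has_sum: "(defect z has_sum infsum (defect z) UNIV) UNIV" if "z \<in> S" for z
  proof (rule has_sum_infsum)
    from that obtain \<epsilon> r \<theta> where *: "0 < \<epsilon>" "\<epsilon> < pi" "r \<ge> Rad \<epsilon>" "\<bar>\<theta>\<bar> \<le> pi - \<epsilon>" "z = of_real r * cis \<theta>"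
      unfolding S_def by blast
    have "(\<lambda>x. norm (defect z x)) summable_on UNIV"
      by (rule Infinite_Sum.abs_summable_on_comparison_test'[OF summable_on_cmult_right[OF M, of "C0 / (sin (\<epsilon> / 2) * c) ^ 3"]])
         (use defect_le[OF *(1-4)] *(5) in simp)
    then show "defect z summable_on UNIV" by (rule abs_summable_summable)
  qed
  let ?sq = "\<lambda>K. {..<K} \<times> {..<K} :: (nat \<times> nat) set"
  define D where "D = (\<lambda>z. Ln z + (\<Sum>\<^sub>\<infinity>x\<in>UNIV - {(0,0)}. log_factor \<tau> z x) - stirling_main \<tau> z - infsum (defect z) UNIV)"
  have D_lim: "(\<lambda>K. Ln z + (\<Sum>x\<in>?sq K - {(0,0)}. log_factor \<tau> z x) - stirling_main \<tau> z - (\<Sum>x\<in>?sq K. defect z x)) \<longlonglongrightarrow> D z"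
    if "z \<in> S" for z
    unfolding D_def
    using filterlim_compose[OF has_sum_infsum[OF log_factor_summable[OF \<tau>], unfolded has_sum_def] filterlim_punctured_square_finite_subsets]
      filterlim_compose[OF defect_has_sum[OF that, unfolded has_sum_def] filterlim_square_finite_subsets]
    by (intro tendsto_intros)
  obtain a b c2 where abc: "\<And>z. ((\<lambda>X. stirling_main \<tau> (z + of_real X) - (a X + b X * z + c2 X * z\<^sup>2)) \<longlongrightarrow> 0) at_top"
    using stirling_main_translate[OF \<tau>] by metis
  define L where "L = (\<lambda>x. complex_of_real (lattice \<tau> x))"
  define s0 s1 s2 where "s0 = (\<lambda>K. \<Sum>x\<in>?sq K - {(0,0)}. - complex_of_real (ln (lattice \<tau> x)))"
    and "s1 = (\<lambda>K. \<Sum>x\<in>?sq K - {(0,0)}. - 1 / L x)" and "s2 = (\<lambda>K. \<Sum>x\<in>?sq K - {(0,0)}. 1 / (2 * (L x)\<^sup>2))"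
  \<comment> \<open>Coefficients belonging to the square of side K: g comes from the correction
    terms of the logarithms, f from the far corners at K, K \<tau> and K (1 + \<tau>).\<close>
  define q where "q = (\<lambda>f g K. g (K::nat) - f (real K) - f (real K * \<tau>) + f (real K * (1 + \<tau>)) :: complex)"
  have q_lim: "(\<lambda>K. q a s0 K + q b s1 K * z + q c2 s2 K * z\<^sup>2) \<longlonglongrightarrow> D z" if zS: "z \<in> S" for z
  proof -
    have zs: "z \<notin> \<real>\<^sub>\<le>\<^sub>0" by (rule S_slit[OF zS])
    let ?d = "\<lambda>X. stirling_main \<tau> (z + of_real X) - (a X + b X * z + c2 X * z\<^sup>2)"
    have l: "filterlim (\<lambda>K. real K) at_top sequentially" "filterlim (\<lambda>K. real K * \<tau>) at_top sequentially"
        "filterlim (\<lambda>K. real K * (1 + \<tau>)) at_top sequentially"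
      using \<tau> by real_asymp+
    have "(\<lambda>K. ?d (real K) + ?d (real K * \<tau>) - ?d (real K * (1 + \<tau>))) \<longlonglongrightarrow> 0 + 0 - 0"
      by (intro tendsto_add tendsto_diff filterlim_compose[OF abc l(1)] filterlim_compose[OF abc l(2)] filterlim_compose[OF abc l(3)])
    then have d0: "(\<lambda>K. ?d (real K) + ?d (real K * \<tau>) - ?d (real K * (1 + \<tau>))) \<longlonglongrightarrow> 0" by simp
    have eq: "Ln z + (\<Sum>x\<in>?sq K - {(0,0)}. log_factor \<tau> z x) - stirling_main \<tau> z - (\<Sum>x\<in>?sq K. defect z x)
        + (?d (real K) + ?d (real K * \<tau>) - ?d (real K * (1 + \<tau>)))
        = q a s0 K + q b s1 K * z + q c2 s2 K * z\<^sup>2" if K: "K > 0" for K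
    proof -
      define g where "g = (\<lambda>k l. stirling_main \<tau> (z + of_real (real k * \<tau> + real l)))"
      have lf: "log_factor \<tau> z x = Ln (z + L x) + (- of_real (ln (lattice \<tau> x))) + (- 1 / L x) * z + 1 / (2 * (L x)\<^sup>2) * z\<^sup>2"
        if "x \<in> ?sq K - {(0,0)}" for x
      proof -
        have p: "lattice \<tau> x > 0" using lattice_pos[OF \<tau>, of x] that by auto
        have "z + L x \<noteq> 0" using add_of_real_notin_nonpos[OF zs, of "lattice \<tau> x"] p unfolding L_def
          by (metis less_imp_le nonpos_Reals_zero_I)
        then have "Ln ((z + L x) / of_real (lattice \<tau> x)) = Ln (z + L x) - of_real (ln (lattice \<tau> x))"
          using p by (subst Ln_divide_of_real) (auto simp: Ln_of_real)
        moreover have "(z + L x) / of_real (lattice \<tau> x) = 1 + z / L x"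
          using p by (simp add: L_def add_divide_distrib)
        ultimately show ?thesis unfolding log_factor_def by (simp add: L_def power_divide)
      qed
      have "(\<Sum>x\<in>?sq K - {(0,0)}. log_factor \<tau> z x) = (\<Sum>x\<in>?sq K - {(0,0)}. Ln (z + L x) + (- of_real (ln (lattice \<tau> x))) + (- 1 / L x) * z + 1 / (2 * (L x)\<^sup>2) * z\<^sup>2)"
        by (rule sum.cong[OF refl lf])
      then have "(\<Sum>x\<in>?sq K - {(0,0)}. log_factor \<tau> z x) = (\<Sum>x\<in>?sq K - {(0,0)}. Ln (z + L x)) + s0 K + s1 K * z + s2 K * z\<^sup>2"
        unfolding s0_def s1_def s2_def sum_distrib_right sum.distrib .
      moreover have "Ln z + (\<Sum>x\<in>?sq K - {(0,0)}. Ln (z + L x)) = (\<Sum>x\<in>?sq K. Ln (z + L x))"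
        using K by (subst sum.remove[of "?sq K" "(0,0)"]) (auto simp: L_def lattice_def)
      moreover have "(\<Sum>x\<in>?sq K. defect z x) = (\<Sum>x\<in>?sq K. Ln (z + L x)) - (g 0 0 - g 0 K - g K 0 + g K K)"
        unfolding telescope_square[symmetric] sum_subtractf[symmetric]
      proof (rule sum.cong[OF refl])
        fix x assume "x \<in> ?sq K"
        obtain k l where x: "x = (k, l)" by force
        show "defect z x = Ln (z + L x) - (case x of (k, l) \<Rightarrow> g k l - g k (Suc l) - g (Suc k) l + g (Suc k) (Suc l))"
          unfolding defect_def stirling_defect_def g_def L_def lattice_def x by (simp add: algebra_simps)
      qed
      moreover have "g 0 0 = stirling_main \<tau> z" "g 0 K = stirling_main \<tau> (z + of_real (real K))"
         "g K 0 = stirling_main \<tau> (z + of_real (real K * \<tau>))" "g K K = stirling_main \<tau> (z + of_real (real K * (1 + \<tau>)))"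
        by (simp_all add: g_def algebra_simps)
      ultimately show ?thesis unfolding q_def by (simp add: algebra_simps)
    qed
    have ev: "\<forall>\<^sub>F K in sequentially. Ln z + (\<Sum>x\<in>?sq K - {(0,0)}. log_factor \<tau> z x) - stirling_main \<tau> z - (\<Sum>x\<in>?sq K. defect z x)
        + (?d (real K) + ?d (real K * \<tau>) - ?d (real K * (1 + \<tau>)))
        = q a s0 K + q b s1 K * z + q c2 s2 K * z\<^sup>2"
      using eventually_gt_at_top[of 0] by eventually_elim (rule eq)
    show ?thesis
      using Lim_transform_eventually[OF tendsto_add[OF D_lim[OF zS] d0] ev] by simp
  qed
  have real_S: "complex_of_real r \<in> S" if "r \<ge> Rad (pi / 2)" for r
    unfolding S_def using that pi_gt_zero
    by (intro CollectI exI[of _ "pi / 2"] exI[of _ r] exI[of _ 0]) simp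
  obtain A0 A1 A2 where A: "\<And>z. z \<in> S \<Longrightarrow> D z = A0 + A1 * z + A2 * z\<^sup>2"
    by (rule quadratic_limit[OF q_lim, of S "of_real (Rad (pi / 2))"])
       (use real_S[of "Rad (pi / 2)"] real_S[of "Rad (pi / 2) + 1"] real_S[of "Rad (pi / 2) + 2"] in auto)
  define A where "A = of_real (barnes_a \<tau>) / t + (1 + t) / (2 * t) + A1"
  define B where "B = of_real (barnes_b \<tau>) / (2 * t\<^sup>2) - 3 / (4 * t) + A2"
  have G_eq: "barnes_G \<tau> z = exp (bern_poly \<tau> z * Ln z + A * z + B * z\<^sup>2 + (A0 - of_real (ln \<tau>) + infsum (defect z) UNIV))"
    if zS: "z \<in> S" for z
  proof -
    have z0: "z \<noteq> 0" using S_slit[OF zS] by auto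
    have zt: "z / t = exp (Ln z - of_real (ln \<tau>))"
      using z0 \<tau> by (simp add: exp_diff exp_of_real t_def)
    have gen: "U + S + P = V \<Longrightarrow> Lz + IL = bp + S + I + (A0' + P) \<Longrightarrow> (Lz - l) + U + IL = bp + V + (A0' - l + I)"
      for Lz l U IL bp S I A0' P V :: complex
    proof -
      assume a: "U + S + P = V" and b: "Lz + IL = bp + S + I + (A0' + P)"
      have "(U + S + P) + (Lz + IL) = V + (bp + S + I + (A0' + P))" by (simp only: a b)
      then show "(Lz - l) + U + IL = bp + V + (A0' - l + I)" by (simp add: algebra_simps)
    qed
    have "(of_real (barnes_a \<tau>) * (z / t) + of_real (barnes_b \<tau>) * (z\<^sup>2 / (2 * t\<^sup>2))) + stirling_poly \<tau> z + (A1 * z + A2 * z\<^sup>2)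
        = A * z + B * z\<^sup>2"
      unfolding A_def B_def stirling_poly_def t_def[symmetric] using t0 by (simp add: field_simps power2_eq_square)
    moreover have "Ln z + (\<Sum>\<^sub>\<infinity>x\<in>UNIV - {(0,0)}. log_factor \<tau> z x) = bern_poly \<tau> z * Ln z + stirling_poly \<tau> z + infsum (defect z) UNIV + (A0 + (A1 * z + A2 * z\<^sup>2))"
      using A[OF zS] unfolding D_def stirling_main_def by (simp add: algebra_simps)
    ultimately have "(Ln z - of_real (ln \<tau>)) + (of_real (barnes_a \<tau>) * (z / t) + of_real (barnes_b \<tau>) * (z\<^sup>2 / (2 * t\<^sup>2))) + (\<Sum>\<^sub>\<infinity>x\<in>UNIV - {(0,0)}. log_factor \<tau> z x)
       = bern_poly \<tau> z * Ln z + (A * z + B * z\<^sup>2) + (A0 - of_real (ln \<tau>) + infsum (defect z) UNIV)"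
      by (rule gen)
    then have "(Ln z - of_real (ln \<tau>)) + (of_real (barnes_a \<tau>) * (z / t) + of_real (barnes_b \<tau>) * (z\<^sup>2 / (2 * t\<^sup>2))) + (\<Sum>\<^sub>\<infinity>x\<in>UNIV - {(0,0)}. log_factor \<tau> z x)
       = bern_poly \<tau> z * Ln z + A * z + B * z\<^sup>2 + (A0 - of_real (ln \<tau>) + infsum (defect z) UNIV)"
      by (simp only: add.assoc)
    then show ?thesis
      unfolding barnes_G_eq double_product_eq_exp[OF \<tau> S_slit[OF zS]] t_def[symmetric]
      by (metis (no_types) zt exp_add)
  qed
  show ?thesis
  proof (rule that[of A B])
    fix \<epsilon> :: real assume \<epsilon>: "0 < \<epsilon>" "\<epsilon> < pi"
    define C where "C = \<bar>Re (A0 - of_real (ln \<tau>))\<bar> + infsum (\<lambda>x. C0 / (sin (\<epsilon> / 2) * c) ^ 3 * M x) UNIV"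
    show "\<exists>R C. R > 0 \<and> (\<forall>r\<ge>R. \<forall>\<theta>. \<bar>\<theta>\<bar> \<le> pi - \<epsilon> \<longrightarrow>
       barnes_G \<tau> (of_real r * cis \<theta>) \<noteq> 0 \<and>
       \<bar>ln (cmod (barnes_G \<tau> (of_real r * cis \<theta>))) - Re (bern_poly \<tau> (of_real r * cis \<theta>) * Complex (ln r) \<theta>
          + A * (of_real r * cis \<theta>) + B * (of_real r * cis \<theta>)\<^sup>2)\<bar> \<le> C)"
    proof (rule exI[of _ "Rad \<epsilon>"], rule exI[of _ C], intro conjI allI impI)
      show "Rad \<epsilon> > 0" using Rad1[OF \<epsilon>] by linarith
      fix r \<theta> assume r: "Rad \<epsilon> \<le> r" and \<theta>: "\<bar>\<theta>\<bar> \<le> pi - \<epsilon>"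
      have r0: "r > 0" using Rad1[OF \<epsilon>] r by linarith
      define z where "z = complex_of_real r * cis \<theta>"
      have zS: "z \<in> S" unfolding S_def z_def using \<epsilon> r \<theta> by blast
      have "Ln z = Complex (ln r) \<theta>"
      proof -
        have "exp (Complex (ln r) \<theta>) = z" using r0 by (simp add: z_def exp_eq_polar)
        then show ?thesis using \<theta> \<epsilon> Ln_exp[of "Complex (ln r) \<theta>"] by simp
      qed
      note G = G_eq[OF zS, unfolded this]
      show "barnes_G \<tau> (of_real r * cis \<theta>) \<noteq> 0" using G unfolding z_def by simp
      have "cmod (infsum (defect z) UNIV) \<le> infsum (\<lambda>x. C0 / (sin (\<epsilon> / 2) * c) ^ 3 * M x) UNIV"
        by (rule norm_infsum_le[OF defect_has_sum[OF zS] has_sum_infsum[OF summable_on_cmult_right[OF M]]])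
           (use defect_le[OF \<epsilon> r \<theta>] in \<open>simp add: z_def\<close>)
      then have i: "\<bar>Re (infsum (defect z) UNIV)\<bar> \<le> infsum (\<lambda>x. C0 / (sin (\<epsilon> / 2) * c) ^ 3 * M x) UNIV"
        using abs_Re_le_cmod order_trans by blast
      have "ln (cmod (barnes_G \<tau> z)) = Re (bern_poly \<tau> z * Complex (ln r) \<theta> + A * z + B * z\<^sup>2 + (A0 - of_real (ln \<tau>) + infsum (defect z) UNIV))"
        unfolding G by simp
      then show "\<bar>ln (cmod (barnes_G \<tau> (of_real r * cis \<theta>))) - Re (bern_poly \<tau> (of_real r * cis \<theta>) * Complex (ln r) \<theta>
          + A * (of_real r * cis \<theta>) + B * (of_real r * cis \<theta>)\<^sup>2)\<bar> \<le> C"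
        unfolding z_def[symmetric] C_def using i by simp
    qed
  qed
qed

section \<open>Growth of the integrand\<close>

text \<open>Main part of ln G (\<beta> + z) for w = ln z. The term \<beta> z / (2 \<tau>) is z^2 /
  (2 \<tau>) times the first-order part \<beta> / z of Ln (1 + \<beta> / z). Everything of size O(ln
  |z|) is dropped.\<close>

definition shift_main :: "real \<Rightarrow> complex \<Rightarrow> complex \<Rightarrow> complex \<Rightarrow> complex \<Rightarrow> complex \<Rightarrow> complex" where
  "shift_main \<tau> A B \<beta> z w = z\<^sup>2 * w / (2 * of_real \<tau>) - (1 + of_real \<tau>) / (2 * of_real \<tau>) * z * w + A * z + B * z\<^sup>2
     + \<beta> * (z * w / of_real \<tau> + z / (2 * of_real \<tau>) + 2 * B * z)"

text \<open>\<open>A\<close> and \<open>B\<close> absorb the constants \<open>a(\<tau>)\<close>, \<open>b(\<tau>)\<close>; they cancel from the growth of the integrand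
  wherever it matters.\<close>
definition stirling_for :: "real \<Rightarrow> complex \<Rightarrow> complex \<Rightarrow> bool" where
  "stirling_for \<tau> A B \<longleftrightarrow> (\<forall>\<epsilon>. 0 < \<epsilon> \<longrightarrow> \<epsilon> < pi \<longrightarrow> (\<exists>R C. R > 0 \<and> (\<forall>r\<ge>R. \<forall>\<theta>. \<bar>\<theta>\<bar> \<le> pi - \<epsilon> \<longrightarrow>
       barnes_G \<tau> (of_real r * cis \<theta>) \<noteq> 0 \<and>
       \<bar>ln (cmod (barnes_G \<tau> (of_real r * cis \<theta>))) - Re (bern_poly \<tau> (of_real r * cis \<theta>) * Complex (ln r) \<theta>
          + A * (of_real r * cis \<theta>) + B * (of_real r * cis \<theta>)\<^sup>2)\<bar> \<le> C)))"

lemma stirling_for_exists: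
  assumes "\<tau> > 0"
  obtains A B where "stirling_for \<tau> A B"
  using barnes_G_stirling[OF assms] unfolding stirling_for_def by metis

text \<open>With L = Ln (1 + \<beta> / z), of size |\<beta>| / r, the point \<beta> + z has the
  logarithm l + L. Its argument moves by at most \<epsilon> / 2, so the Stirling formula for the
  larger sector applies. The terms z^2 (L - \<beta> / z) and z L stay bounded; of what is dropped
  only a constant times l grows, like ln r.\<close>

lemma barnes_G_shift_stirling:
  assumes \<tau>: "\<tau> > 0" and AB: "stirling_for \<tau> A B" and \<epsilon>: "0 < \<epsilon>" "\<epsilon> < pi"
  shows "\<exists>R C. R \<ge> 3 \<and> C \<ge> 0 \<and> (\<forall>r\<ge>R. \<forall>\<theta>. \<bar>\<theta>\<bar> \<le> pi - \<epsilon> \<longrightarrow>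
     barnes_G \<tau> (\<beta> + of_real r * cis \<theta>) \<noteq> 0 \<and>
     \<bar>ln (cmod (barnes_G \<tau> (\<beta> + of_real r * cis \<theta>))) - Re (shift_main \<tau> A B \<beta> (of_real r * cis \<theta>) (Complex (ln r) \<theta>))\<bar> \<le> C * ln r)"
proof -
  define t where "t = complex_of_real \<tau>"
  have t0: "t \<noteq> 0" using \<tau> by (simp add: t_def)
  have "0 < \<epsilon> / 2" "\<epsilon> / 2 < pi" using \<epsilon> by auto
  then obtain R0 C0 where R0: "R0 > 0" "\<And>r \<theta>. r \<ge> R0 \<Longrightarrow> \<bar>\<theta>\<bar> \<le> pi - \<epsilon> / 2 \<Longrightarrow>
       barnes_G \<tau> (of_real r * cis \<theta>) \<noteq> 0 \<and>
       \<bar>ln (cmod (barnes_G \<tau> (of_real r * cis \<theta>))) - Re (bern_poly \<tau> (of_real r * cis \<theta>) * Complex (ln r) \<theta>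
          + A * (of_real r * cis \<theta>) + B * (of_real r * cis \<theta>)\<^sup>2)\<bar> \<le> C0"
    using AB unfolding stirling_for_def by metis
  define k0 where "k0 = bern_poly \<tau> \<beta>"
  define h where "h = \<beta> / t - (1 + t) / (2 * t)"
  define C1 where "C1 = \<bar>C0\<bar> + cmod (1 / (2 * t)) * (2 * (cmod \<beta>)\<^sup>2) + cmod h * (2 * cmod \<beta>) + cmod k0 + cmod (A * \<beta>) + cmod (B * \<beta>\<^sup>2)"
  define C where "C = C1 + cmod k0 * (1 + pi)"
  \<comment> \<open>The summand |\<beta>| * 4 / \<epsilon> keeps the argument of \<beta> + z within
    \<epsilon> / 2 of \<theta>; the summands R0 and 2 |\<beta>| give |\<beta> / z| <= 1/2 and
    |\<beta> + z| >= R0.\<close>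
  define R where "R = 3 + R0 + cmod \<beta> * (4 / \<epsilon> + 2)"
  have C1: "C1 \<ge> 0" by (simp add: C1_def)
  show ?thesis
  proof (rule exI[of _ R], rule exI[of _ C], intro conjI allI impI)
    have "0 \<le> cmod \<beta> * (4 / \<epsilon> + 2)" using \<epsilon> by simp
    then show "R \<ge> 3" using R0 unfolding R_def by linarith
    show "C \<ge> 0" using C1 pi_gt_zero by (simp add: C_def)
    fix r \<theta> assume r: "R \<le> r" and \<theta>: "\<bar>\<theta>\<bar> \<le> pi - \<epsilon>"
    define z where "z = complex_of_real r * cis \<theta>"
    define l where "l = Complex (ln r) \<theta>"
    have r3: "r \<ge> 3" "r \<ge> R0 + 2 * cmod \<beta>" "r \<ge> cmod \<beta> * (4 / \<epsilon>)"
    proof -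
      define x where "x = cmod \<beta> * (4 / \<epsilon>)"
      define y where "y = cmod \<beta>"
      have "0 \<le> x" "0 \<le> y" using \<epsilon> by (simp_all add: x_def y_def)
      moreover have "R = 3 + R0 + (x + y * 2)" by (simp only: R_def x_def y_def distrib_left)
      ultimately have "r \<ge> 3" "r \<ge> R0 + 2 * y" "r \<ge> x"
        using r R0(1) by linarith+
      then show "r \<ge> 3" "r \<ge> R0 + 2 * cmod \<beta>" "r \<ge> cmod \<beta> * (4 / \<epsilon>)"
        unfolding x_def y_def by auto
    qed
    have cz: "cmod z = r" using r3 by (simp add: z_def norm_mult)
    have z0: "z \<noteq> 0" using cz r3 by auto
    have zl: "z = exp l" using r3 by (simp add: z_def l_def exp_eq_polar)
    define u where "u = \<beta> / z"
    define L where "L = Ln (1 + u)"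
    have cu: "cmod u = cmod \<beta> / r" by (simp add: u_def norm_divide cz)
    have u2: "cmod u \<le> 1 / 2" unfolding cu using r3 R0 by (simp add: divide_simps)
    have L1: "cmod L \<le> 2 * cmod u" using Ln_1_plus_remainder[OF u2, of 1] by (simp add: L_def)
    have L2: "cmod (L - u) \<le> 2 * (cmod u)\<^sup>2" using Ln_1_plus_remainder[OF u2, of 2] by (simp add: L_def eval_nat_numeral)
    have "1 + u \<noteq> 0"
    proof
      assume "1 + u = 0"
      then have "u = -1" by (simp add: add_eq_0_iff)
      with u2 show False by simp
    qed
    then have eL: "exp L = 1 + u" by (simp add: L_def)
    define w where "w = \<beta> + z"
    have "w = z * (1 + u)" using z0 by (simp add: w_def u_def distrib_left)
    then have wl: "w = exp (l + L)" by (simp only: exp_add eL zl[symmetric])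
    define r' where "r' = cmod w"
    define \<theta>' where "\<theta>' = Im (l + L)"
    have wp1: "w = of_real r' * cis \<theta>'"
      unfolding r'_def \<theta>'_def wl by (subst exp_eq_polar) simp
    moreover have "ln r' = Re (l + L)" by (simp add: r'_def wl)
    then have wp2: "Complex (ln r') \<theta>' = l + L" unfolding \<theta>'_def by (simp add: complex_eq_iff)
    note wp = wp1 wp2
    have "r' \<ge> R0"
    proof -
      have "r \<le> r' + cmod \<beta>" unfolding r'_def cz[symmetric] w_def using norm_triangle_ineq4[of "\<beta> + z" \<beta>] by simp
      then show ?thesis using r3(2) norm_ge_zero[of \<beta>] by linarith
    qed
    moreover have "\<bar>\<theta>'\<bar> \<le> pi - \<epsilon> / 2"
    proof -
      have "2 * cmod u \<le> \<epsilon> / 2" unfolding cu using r3 \<epsilon> by (simp add: divide_simps mult.commute)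
      then have "\<bar>Im L\<bar> \<le> \<epsilon> / 2" using L1 abs_Im_le_cmod[of L] by linarith
      then show ?thesis using \<theta> unfolding \<theta>'_def l_def by simp
    qed
    ultimately have G: "barnes_G \<tau> w \<noteq> 0" "\<bar>ln (cmod (barnes_G \<tau> w)) - Re (bern_poly \<tau> w * (l + L) + A * w + B * w\<^sup>2)\<bar> \<le> C0"
      using R0(2)[of r' \<theta>'] unfolding wp(1)[symmetric] wp(2) by auto
    show "barnes_G \<tau> (\<beta> + of_real r * cis \<theta>) \<noteq> 0" using G(1) by (simp add: w_def z_def)
    have bw: "bern_poly \<tau> w = z\<^sup>2 / (2 * t) + h * z + k0"
      unfolding bern_poly_def w_def h_def k0_def t_def[symmetric] using t0 by (simp add: field_simps power2_eq_square)
    have zu: "z * u = \<beta>" using z0 by (simp add: u_def)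
    have "bern_poly \<tau> w * (l + L) + A * w + B * w\<^sup>2 - shift_main \<tau> A B \<beta> z l
      = k0 * l + 1 / (2 * t) * (z\<^sup>2 * (L - u)) + z / (2 * t) * (z * u - \<beta>) + h * (z * L) + k0 * L + A * \<beta> + B * \<beta>\<^sup>2"
      unfolding bw unfolding shift_main_def t_def[symmetric] w_def h_def using t0 by (simp add: field_simps power2_eq_square)
    then have "bern_poly \<tau> w * (l + L) + A * w + B * w\<^sup>2 - shift_main \<tau> A B \<beta> z l
      = k0 * l + 1 / (2 * t) * (z\<^sup>2 * (L - u)) + h * (z * L) + k0 * L + A * \<beta> + B * \<beta>\<^sup>2"
      by (simp add: zu)
    also have "cmod \<dots> \<le> cmod (k0 * l) + cmod (1 / (2 * t) * (z\<^sup>2 * (L - u))) + cmod (h * (z * L)) + cmod (k0 * L) + cmod (A * \<beta>) + cmod (B * \<beta>\<^sup>2)"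
      by (intro order_trans[OF norm_triangle_ineq] add_mono order_refl)
    also have "\<dots> \<le> cmod k0 * (ln r + pi) + cmod (1 / (2 * t)) * (2 * (cmod \<beta>)\<^sup>2) + cmod h * (2 * cmod \<beta>) + cmod k0 + cmod (A * \<beta>) + cmod (B * \<beta>\<^sup>2)"
    proof (intro add_mono order_refl)
      have "cmod l \<le> \<bar>ln r\<bar> + \<bar>\<theta>\<bar>" using cmod_le[of l] by (simp add: l_def)
      also have "\<dots> \<le> ln r + pi" using r3 \<theta> \<epsilon> by simp
      finally show "cmod (k0 * l) \<le> cmod k0 * (ln r + pi)" by (simp add: norm_mult mult_left_mono)
      have "cmod (z\<^sup>2 * (L - u)) \<le> r\<^sup>2 * (2 * (cmod u)\<^sup>2)"
        using L2 by (simp add: norm_mult norm_power cz mult_left_mono)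
      also have "\<dots> = 2 * (cmod \<beta>)\<^sup>2" unfolding cu using r3 by (simp add: power_divide)
      finally show "cmod (1 / (2 * t) * (z\<^sup>2 * (L - u))) \<le> cmod (1 / (2 * t)) * (2 * (cmod \<beta>)\<^sup>2)"
        unfolding norm_mult[of "1 / (2 * t)"] by (rule mult_left_mono) simp
      have "cmod (z * L) \<le> r * (2 * cmod u)"
        using L1 r3 by (simp add: norm_mult cz mult_left_mono)
      also have "\<dots> = 2 * cmod \<beta>" unfolding cu using r3 by simp
      finally show "cmod (h * (z * L)) \<le> cmod h * (2 * cmod \<beta>)"
        unfolding norm_mult[of h] by (rule mult_left_mono) simp
      have "cmod L \<le> 1" using L1 u2 by linarith
      then show "cmod (k0 * L) \<le> cmod k0" by (simp add: norm_mult mult_left_le)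
    qed
    also have "\<dots> + C0 \<le> C1 + cmod k0 * (ln r + pi)" unfolding C1_def by simp
    finally have D: "cmod (bern_poly \<tau> w * (l + L) + A * w + B * w\<^sup>2 - shift_main \<tau> A B \<beta> z l) + C0 \<le> C1 + cmod k0 * (ln r + pi)" by simp
    have ln1: "1 \<le> ln r"
    proof -
      have "exp 1 \<le> r" using exp_le r3 by linarith
      then show ?thesis using r3 by (simp add: ln_ge_iff)
    qed
    have "C1 * 1 \<le> C1 * ln r" "cmod k0 * (pi * 1) \<le> cmod k0 * (pi * ln r)"
      using ln1 C1 by (intro mult_left_mono; simp)+
    moreover have "C * ln r = C1 * ln r + cmod k0 * ln r + cmod k0 * (pi * ln r)"
      "cmod k0 * (ln r + pi) = cmod k0 * ln r + cmod k0 * (pi * 1)" by (simp_all add: C_def algebra_simps)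
    ultimately have "C1 + cmod k0 * (ln r + pi) \<le> C * ln r" by linarith
    moreover have "\<bar>ln (cmod (barnes_G \<tau> w)) - Re (shift_main \<tau> A B \<beta> z l)\<bar> \<le> C0 + cmod (bern_poly \<tau> w * (l + L) + A * w + B * w\<^sup>2 - shift_main \<tau> A B \<beta> z l)"
      using G(2) abs_Re_le_cmod[of "bern_poly \<tau> w * (l + L) + A * w + B * w\<^sup>2 - shift_main \<tau> A B \<beta> z l"]
      unfolding minus_complex.sel by linarith
    ultimately show "\<bar>ln (cmod (barnes_G \<tau> (\<beta> + of_real r * cis \<theta>))) - Re (shift_main \<tau> A B \<beta> (of_real r * cis \<theta>) (Complex (ln r) \<theta>))\<bar> \<le> C * ln r"
      using D unfolding w_def[symmetric] z_def[symmetric] l_def[symmetric] by linarith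
  qed
qed

lemma prod_barnes_G_stirling:
  assumes \<tau>: "\<tau> > 0" and AB: "stirling_for \<tau> A B" and \<epsilon>: "0 < \<epsilon>" "\<epsilon> < pi" and J: "finite J"
  shows "\<exists>R C. R \<ge> 3 \<and> C \<ge> 0 \<and> (\<forall>r\<ge>R. \<forall>\<theta>. \<bar>\<theta>\<bar> \<le> pi - \<epsilon> \<longrightarrow>
     (\<Prod>j\<in>J. barnes_G \<tau> (\<beta> j + of_real r * cis \<theta>)) \<noteq> 0 \<and>
     \<bar>ln (cmod (\<Prod>j\<in>J. barnes_G \<tau> (\<beta> j + of_real r * cis \<theta>))) - Re (\<Sum>j\<in>J. shift_main \<tau> A B (\<beta> j) (of_real r * cis \<theta>) (Complex (ln r) \<theta>))\<bar> \<le> C * ln r)"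
  using J
proof (induction J rule: finite_induct)
  case empty
  show ?case by (intro exI[of _ 3] exI[of _ 0]) simp
next
  case (insert x J)
  obtain R1 C1 where 1: "R1 \<ge> 3" "C1 \<ge> 0" "\<And>r \<theta>. r\<ge>R1 \<Longrightarrow> \<bar>\<theta>\<bar> \<le> pi - \<epsilon> \<Longrightarrow>
     (\<Prod>j\<in>J. barnes_G \<tau> (\<beta> j + of_real r * cis \<theta>)) \<noteq> 0 \<and>
     \<bar>ln (cmod (\<Prod>j\<in>J. barnes_G \<tau> (\<beta> j + of_real r * cis \<theta>))) - Re (\<Sum>j\<in>J. shift_main \<tau> A B (\<beta> j) (of_real r * cis \<theta>) (Complex (ln r) \<theta>))\<bar> \<le> C1 * ln r"
    using insert.IH by blast
  obtain R2 C2 where 2: "R2 \<ge> 3" "C2 \<ge> 0" "\<And>r \<theta>. r\<ge>R2 \<Longrightarrow> \<bar>\<theta>\<bar> \<le> pi - \<epsilon> \<Longrightarrow>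
     barnes_G \<tau> (\<beta> x + of_real r * cis \<theta>) \<noteq> 0 \<and>
     \<bar>ln (cmod (barnes_G \<tau> (\<beta> x + of_real r * cis \<theta>))) - Re (shift_main \<tau> A B (\<beta> x) (of_real r * cis \<theta>) (Complex (ln r) \<theta>))\<bar> \<le> C2 * ln r"
    using barnes_G_shift_stirling[OF \<tau> AB \<epsilon>] by blast
  show ?case
  proof (rule exI[of _ "max R1 R2"], rule exI[of _ "C1 + C2"], intro conjI allI impI)
    show "max R1 R2 \<ge> 3" "C1 + C2 \<ge> 0" using 1 2 by auto
    fix r \<theta> assume r: "max R1 R2 \<le> r" and \<theta>: "\<bar>\<theta>\<bar> \<le> pi - \<epsilon>"
    have a: "(\<Prod>j\<in>J. barnes_G \<tau> (\<beta> j + of_real r * cis \<theta>)) \<noteq> 0"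
     "\<bar>ln (cmod (\<Prod>j\<in>J. barnes_G \<tau> (\<beta> j + of_real r * cis \<theta>))) - Re (\<Sum>j\<in>J. shift_main \<tau> A B (\<beta> j) (of_real r * cis \<theta>) (Complex (ln r) \<theta>))\<bar> \<le> C1 * ln r"
      using 1(3)[of r \<theta>] r \<theta> by auto
    have b: "barnes_G \<tau> (\<beta> x + of_real r * cis \<theta>) \<noteq> 0"
     "\<bar>ln (cmod (barnes_G \<tau> (\<beta> x + of_real r * cis \<theta>))) - Re (shift_main \<tau> A B (\<beta> x) (of_real r * cis \<theta>) (Complex (ln r) \<theta>))\<bar> \<le> C2 * ln r"
      using 2(3)[of r \<theta>] r \<theta> by auto
    show "(\<Prod>j\<in>insert x J. barnes_G \<tau> (\<beta> j + of_real r * cis \<theta>)) \<noteq> 0"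
      using a b insert.hyps by simp
    have "ln (cmod (\<Prod>j\<in>insert x J. barnes_G \<tau> (\<beta> j + of_real r * cis \<theta>))) =
      ln (cmod (barnes_G \<tau> (\<beta> x + of_real r * cis \<theta>))) + ln (cmod (\<Prod>j\<in>J. barnes_G \<tau> (\<beta> j + of_real r * cis \<theta>)))"
      unfolding prod.insert[OF insert.hyps] norm_mult using a(1) b(1) by (intro ln_mult_pos) auto
    then show "\<bar>ln (cmod (\<Prod>j\<in>insert x J. barnes_G \<tau> (\<beta> j + of_real r * cis \<theta>))) - Re (\<Sum>j\<in>insert x J. shift_main \<tau> A B (\<beta> j) (of_real r * cis \<theta>) (Complex (ln r) \<theta>))\<bar> \<le> (C1 + C2) * ln r"
      using a(2) b(2) unfolding sum.insert[OF insert.hyps] plus_complex.sel distrib_right by linarith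
  qed
qed

lemma sum_shift_main:
  "(\<Sum>j\<in>J. shift_main \<tau> A B (\<beta> j) z w) = of_nat (card J) * shift_main \<tau> A B 0 z w
     + (\<Sum>j\<in>J. \<beta> j) * (z * w / of_real \<tau> + z / (2 * of_real \<tau>) + 2 * B * z)"
  unfolding shift_main_def by (simp add: sum.distrib sum_distrib_right)

text \<open>Main part of the logarithm of the integrand for w = ln s, ordered by growth: s^2 ln s,
  s^2, s ln s, s. The sign \<sigma> is that of Im s and enters through ln (- s) = ln s - \<i>
  \<sigma> pi.\<close>

definition MB_exponent :: "nat \<Rightarrow> nat \<Rightarrow> nat \<Rightarrow> nat \<Rightarrow> (nat \<Rightarrow> complex) \<Rightarrow> (nat \<Rightarrow> complex) \<Rightarrow> real \<Rightarrow> complex \<Rightarrow> complex \<Rightarrow> real \<Rightarrow> complex \<Rightarrow> complex \<Rightarrow> complex" where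
  "MB_exponent m n p q a b \<tau> A B \<sigma> s w =
     of_int (MB_N m n p q) / (2 * of_real \<tau>) * s\<^sup>2 * w
   + (of_int (MB_N m n p q) * B - \<i> * of_real (\<sigma> * pi) * (of_nat m + of_nat n - of_nat p) / (2 * of_real \<tau>)) * s\<^sup>2
   + ((1 + of_real \<tau>) / (2 * of_real \<tau>) * of_int (MB_N m n p q) - MB_mu m n p q a b / of_real \<tau>) * s * w
   + (A * (of_nat p - of_nat q) + (1 / (2 * of_real \<tau>) + 2 * B) * ((1 + of_real \<tau>) * (of_nat m + of_nat n - of_nat q) - MB_mu m n p q a b)
      - \<i> * of_real (\<sigma> * pi) * (1 + of_real \<tau>) / (2 * of_real \<tau>) * (of_nat m + of_nat n - of_nat p)
      + \<i> * of_real (\<sigma> * pi) / of_real \<tau> * ((\<Sum>j=1..m. b j) - (\<Sum>j=n+1..p. a j))) * s"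

text \<open>The factors at \<open>b j - s\<close> and \<open>a j - s\<close> are evaluated in the
  direction \<theta> - \<sigma> pi. Keeping \<sigma> \<theta> between \<epsilon> and pi - \<epsilon>
  puts both directions into the sector where the Stirling formula holds.\<close>

lemma MB_integrand_stirling:
  assumes \<tau>: "\<tau> > 0" and AB: "stirling_for \<tau> A B" and \<epsilon>: "0 < \<epsilon>" "\<epsilon> < pi" and mn: "m \<le> q" "n \<le> p"
  shows "\<exists>R C. R \<ge> 3 \<and> C \<ge> 0 \<and> (\<forall>r\<ge>R. \<forall>\<theta>. \<forall>\<sigma>\<in>{1,-1}. \<epsilon> \<le> \<sigma> * \<theta> \<and> \<sigma> * \<theta> \<le> pi - \<epsilon> \<longrightarrow>
     MB_integrand m n p q a b \<tau> (of_real r * cis \<theta>) \<noteq> 0 \<and>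
     \<bar>ln (cmod (MB_integrand m n p q a b \<tau> (of_real r * cis \<theta>))) - Re (MB_exponent m n p q a b \<tau> A B \<sigma> (of_real r * cis \<theta>) (Complex (ln r) \<theta>))\<bar> \<le> C * ln r)"
proof -
  define t where "t = complex_of_real \<tau>"
  have t0: "t \<noteq> 0" using \<tau> by (simp add: t_def)
  obtain R1 C1 where 1: "R1 \<ge> 3" "C1 \<ge> 0" "\<And>r \<theta>. r\<ge>R1 \<Longrightarrow> \<bar>\<theta>\<bar> \<le> pi - \<epsilon> \<Longrightarrow>
     (\<Prod>j=1..m. barnes_G \<tau> (b j + of_real r * cis \<theta>)) \<noteq> 0 \<and>
     \<bar>ln (cmod (\<Prod>j=1..m. barnes_G \<tau> (b j + of_real r * cis \<theta>))) - Re (\<Sum>j=1..m. shift_main \<tau> A B (b j) (of_real r * cis \<theta>) (Complex (ln r) \<theta>))\<bar> \<le> C1 * ln r"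
    using prod_barnes_G_stirling[OF \<tau> AB \<epsilon> finite_atLeastAtMost[of 1 m], of b] by blast
  obtain R2 C2 where 2: "R2 \<ge> 3" "C2 \<ge> 0" "\<And>r \<theta>. r\<ge>R2 \<Longrightarrow> \<bar>\<theta>\<bar> \<le> pi - \<epsilon> \<Longrightarrow>
     (\<Prod>j=1..n. barnes_G \<tau> ((1 + t - a j) + of_real r * cis \<theta>)) \<noteq> 0 \<and>
     \<bar>ln (cmod (\<Prod>j=1..n. barnes_G \<tau> ((1 + t - a j) + of_real r * cis \<theta>))) - Re (\<Sum>j=1..n. shift_main \<tau> A B (1 + t - a j) (of_real r * cis \<theta>) (Complex (ln r) \<theta>))\<bar> \<le> C2 * ln r"
    using prod_barnes_G_stirling[OF \<tau> AB \<epsilon> finite_atLeastAtMost[of 1 n], of "\<lambda>j. 1 + t - a j"] by blast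
  obtain R3 C3 where 3: "R3 \<ge> 3" "C3 \<ge> 0" "\<And>r \<theta>. r\<ge>R3 \<Longrightarrow> \<bar>\<theta>\<bar> \<le> pi - \<epsilon> \<Longrightarrow>
     (\<Prod>j=m+1..q. barnes_G \<tau> ((1 + t - b j) + of_real r * cis \<theta>)) \<noteq> 0 \<and>
     \<bar>ln (cmod (\<Prod>j=m+1..q. barnes_G \<tau> ((1 + t - b j) + of_real r * cis \<theta>))) - Re (\<Sum>j=m+1..q. shift_main \<tau> A B (1 + t - b j) (of_real r * cis \<theta>) (Complex (ln r) \<theta>))\<bar> \<le> C3 * ln r"
    using prod_barnes_G_stirling[OF \<tau> AB \<epsilon> finite_atLeastAtMost[of "m+1" q], of "\<lambda>j. 1 + t - b j"] by blast
  obtain R4 C4 where 4: "R4 \<ge> 3" "C4 \<ge> 0" "\<And>r \<theta>. r\<ge>R4 \<Longrightarrow> \<bar>\<theta>\<bar> \<le> pi - \<epsilon> \<Longrightarrow>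
     (\<Prod>j=n+1..p. barnes_G \<tau> (a j + of_real r * cis \<theta>)) \<noteq> 0 \<and>
     \<bar>ln (cmod (\<Prod>j=n+1..p. barnes_G \<tau> (a j + of_real r * cis \<theta>))) - Re (\<Sum>j=n+1..p. shift_main \<tau> A B (a j) (of_real r * cis \<theta>) (Complex (ln r) \<theta>))\<bar> \<le> C4 * ln r"
    using prod_barnes_G_stirling[OF \<tau> AB \<epsilon> finite_atLeastAtMost[of "n+1" p], of a] by blast
  show ?thesis
  proof (rule exI[of _ "max (max R1 R2) (max R3 R4)"], rule exI[of _ "C1 + C2 + C3 + C4"], intro conjI allI impI ballI; (elim conjE)?)
    show "max (max R1 R2) (max R3 R4) \<ge> 3" "C1 + C2 + C3 + C4 \<ge> 0" using 1 2 3 4 by auto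
    fix r \<theta> \<sigma> :: real assume r: "max (max R1 R2) (max R3 R4) \<le> r" and \<sigma>: "\<sigma> \<in> {1,-1}" and \<theta>: "\<epsilon> \<le> \<sigma> * \<theta>" "\<sigma> * \<theta> \<le> pi - \<epsilon>"
    define s where "s = complex_of_real r * cis \<theta>"
    define l where "l = Complex (ln r) \<theta>"
    define \<theta>' where "\<theta>' = \<theta> - \<sigma> * pi"
    define P where "P = \<i> * complex_of_real (\<sigma> * pi)"
    have th: "\<bar>\<theta>\<bar> \<le> pi - \<epsilon>" "\<bar>\<theta>'\<bar> \<le> pi - \<epsilon>" using \<sigma> \<theta> \<epsilon> by (auto simp: \<theta>'_def)
    have s': "of_real r * cis \<theta>' = - s" using \<sigma> by (auto simp: s_def \<theta>'_def complex_eq_iff cos_diff sin_diff cos_add sin_add)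
    have l': "Complex (ln r) \<theta>' = l - P" by (simp add: l_def \<theta>'_def P_def complex_eq_iff)
    have a1: "(\<Prod>j=1..m. barnes_G \<tau> (b j - s)) \<noteq> 0"
      "\<bar>ln (cmod (\<Prod>j=1..m. barnes_G \<tau> (b j - s))) - Re (\<Sum>j=1..m. shift_main \<tau> A B (b j) (- s) (l - P))\<bar> \<le> C1 * ln r"
      using 1(3)[OF _ th(2), of r] r unfolding s' l' by auto
    have a2: "(\<Prod>j=1..n. barnes_G \<tau> ((1 + t - a j) + s)) \<noteq> 0"
      "\<bar>ln (cmod (\<Prod>j=1..n. barnes_G \<tau> ((1 + t - a j) + s))) - Re (\<Sum>j=1..n. shift_main \<tau> A B (1 + t - a j) s l)\<bar> \<le> C2 * ln r"
      using 2(3)[OF _ th(1), of r] r unfolding s_def[symmetric] l_def[symmetric] by auto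
    have a3: "(\<Prod>j=m+1..q. barnes_G \<tau> ((1 + t - b j) + s)) \<noteq> 0"
      "\<bar>ln (cmod (\<Prod>j=m+1..q. barnes_G \<tau> ((1 + t - b j) + s))) - Re (\<Sum>j=m+1..q. shift_main \<tau> A B (1 + t - b j) s l)\<bar> \<le> C3 * ln r"
      using 3(3)[OF _ th(1), of r] r unfolding s_def[symmetric] l_def[symmetric] by auto
    have a4: "(\<Prod>j=n+1..p. barnes_G \<tau> (a j - s)) \<noteq> 0"
      "\<bar>ln (cmod (\<Prod>j=n+1..p. barnes_G \<tau> (a j - s))) - Re (\<Sum>j=n+1..p. shift_main \<tau> A B (a j) (- s) (l - P))\<bar> \<le> C4 * ln r"
      using 4(3)[OF _ th(2), of r] r unfolding s' l' by auto
    have I: "MB_integrand m n p q a b \<tau> s = ((\<Prod>j=1..m. barnes_G \<tau> (b j - s)) * (\<Prod>j=1..n. barnes_G \<tau> ((1 + t - a j) + s))) /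
       ((\<Prod>j=m+1..q. barnes_G \<tau> ((1 + t - b j) + s)) * (\<Prod>j=n+1..p. barnes_G \<tau> (a j - s)))"
      unfolding MB_integrand_def t_def by simp
    show "MB_integrand m n p q a b \<tau> (of_real r * cis \<theta>) \<noteq> 0"
      unfolding s_def[symmetric] I using a1 a2 a3 a4 by simp
    have pos: "0 < cmod (\<Prod>j=1..m. barnes_G \<tau> (b j - s))" "0 < cmod (\<Prod>j=1..n. barnes_G \<tau> ((1 + t - a j) + s))"
      "0 < cmod (\<Prod>j=m+1..q. barnes_G \<tau> ((1 + t - b j) + s))" "0 < cmod (\<Prod>j=n+1..p. barnes_G \<tau> (a j - s))"
      unfolding zero_less_norm_iff by (fact a1 a2 a3 a4)+
    have ln: "ln (cmod (MB_integrand m n p q a b \<tau> s)) = ln (cmod (\<Prod>j=1..m. barnes_G \<tau> (b j - s))) + ln (cmod (\<Prod>j=1..n. barnes_G \<tau> ((1 + t - a j) + s)))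
       - ln (cmod (\<Prod>j=m+1..q. barnes_G \<tau> ((1 + t - b j) + s))) - ln (cmod (\<Prod>j=n+1..p. barnes_G \<tau> (a j - s)))"
      unfolding I norm_divide norm_mult using pos by (simp only: ln_div mult_pos_pos ln_mult_pos) simp
    define X where "X = s * l / t + s / (2 * t) + 2 * B * s"
    define Y where "Y = - s * (l - P) / t + - s / (2 * t) + 2 * B * - s"
    define E0 E1 where "E0 = shift_main \<tau> A B 0 s l" and "E1 = shift_main \<tau> A B 0 (- s) (l - P)"
    define Sa1 Sa2 Sb1 Sb2 where S: "Sa1 = (\<Sum>j=1..n. a j)" "Sa2 = (\<Sum>j=n+1..p. a j)" "Sb1 = (\<Sum>j=1..m. b j)" "Sb2 = (\<Sum>j=m+1..q. b j)"
    define i where "i = 1 / (2 * t)"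
    have d: "x / (2 * t) = x * i" "x / t = 2 * x * i" for x using t0 by (simp_all add: i_def)
    have sub: "(\<Sum>j=k+1..l. 1 + t - f j) = (of_nat l - of_nat k) * (1 + t) - (\<Sum>j=k+1..l. f j)" if "k \<le> l" for k l f
      using that by (simp add: sum_subtractf of_nat_diff)
    have "(\<Sum>j=1..m. shift_main \<tau> A B (b j) (- s) (l - P)) + (\<Sum>j=1..n. shift_main \<tau> A B (1 + t - a j) s l)
        - (\<Sum>j=m+1..q. shift_main \<tau> A B (1 + t - b j) s l) - (\<Sum>j=n+1..p. shift_main \<tau> A B (a j) (- s) (l - P))
      = (of_nat m * E1 + Sb1 * Y) + (of_nat n * E0 + (of_nat n * (1 + t) - Sa1) * X)
        - ((of_nat q - of_nat m) * E0 + ((of_nat q - of_nat m) * (1 + t) - Sb2) * X) - ((of_nat p - of_nat n) * E1 + Sa2 * Y)"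
      unfolding sum_shift_main t_def[symmetric] X_def[symmetric] Y_def[symmetric] E0_def[symmetric] E1_def[symmetric]
        sub[OF mn(1)] sub[of 0 n, simplified] S[symmetric] using mn by (simp add: of_nat_diff S sum_subtractf)
    also have "\<dots> = MB_exponent m n p q a b \<tau> A B \<sigma> s l"
      unfolding MB_exponent_def MB_mu_def MB_N_def t_def[symmetric] P_def[symmetric] S[symmetric] E0_def E1_def shift_main_def X_def Y_def d
      by (simp add: algebra_simps power2_eq_square)
    finally have E: "Re (MB_exponent m n p q a b \<tau> A B \<sigma> s l) = Re (\<Sum>j=1..m. shift_main \<tau> A B (b j) (- s) (l - P)) + Re (\<Sum>j=1..n. shift_main \<tau> A B (1 + t - a j) s l)
        - Re (\<Sum>j=m+1..q. shift_main \<tau> A B (1 + t - b j) s l) - Re (\<Sum>j=n+1..p. shift_main \<tau> A B (a j) (- s) (l - P))"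
      by (metis plus_complex.sel(1) minus_complex.sel(1))
    show "\<bar>ln (cmod (MB_integrand m n p q a b \<tau> (of_real r * cis \<theta>))) - Re (MB_exponent m n p q a b \<tau> A B \<sigma> (of_real r * cis \<theta>) (Complex (ln r) \<theta>))\<bar> \<le> (C1 + C2 + C3 + C4) * ln r"
      unfolding s_def[symmetric] l_def[symmetric] ln E distrib_right using a1(2) a2(2) a3(2) a4(2) by linarith
  qed
qed

section \<open>Decay of the kernel along rays in the four growth regimes\<close>

text \<open>The rate may be negative and then limits the growth. A full sector is required so that
  rays with a shifted starting point are covered too.\<close>

definition decays :: "(complex \<Rightarrow> complex) \<Rightarrow> real \<Rightarrow> real \<Rightarrow> bool" where
  "decays F \<phi> \<kappa> \<longleftrightarrow> (\<exists>\<eta>>0. \<exists>R. \<forall>r\<ge>R. \<forall>\<theta>. \<bar>\<theta> - \<phi>\<bar> \<le> \<eta> \<longrightarrow> cmod (F (of_real r * cis \<theta>)) \<le> exp (- \<kappa> * r))"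

text \<open>Here g is the leading scale. By continuity f stays below - c in a sector, and c * g r
  eventually outweighs the lower-order term C * h r together with \<kappa> * r.\<close>

lemma decaysI_leading:
  fixes f g h :: "real \<Rightarrow> real"
  assumes bound: "\<eta> > 0" "\<And>r \<theta>. r \<ge> R \<Longrightarrow> \<bar>\<theta> - \<phi>\<bar> \<le> \<eta> \<Longrightarrow> F (of_real r * cis \<theta>) \<noteq> 0 \<and>
      ln (cmod (F (of_real r * cis \<theta>))) \<le> f \<theta> * g r + C * h r"
    and f: "isCont f \<phi>" "f \<phi> < - c"
    and g: "\<forall>\<^sub>F r in at_top. g r \<ge> 0" "\<forall>\<^sub>F r in at_top. C * h r + \<kappa> * r \<le> c * g r"
  shows "decays F \<phi> \<kappa>"
proof -
  have "\<forall>\<^sub>F \<theta> in at \<phi>. f \<theta> < - c"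
    using f by (intro order_tendstoD(2)[of f "f \<phi>"]) (auto simp: isCont_def)
  then obtain d where d: "d > 0" "\<And>\<theta>. \<theta> \<noteq> \<phi> \<Longrightarrow> dist \<theta> \<phi> < d \<Longrightarrow> f \<theta> < - c"
    unfolding eventually_at by auto
  obtain R1 where R1: "\<And>r. r \<ge> R1 \<Longrightarrow> g r \<ge> 0" "\<And>r. r \<ge> R1 \<Longrightarrow> C * h r + \<kappa> * r \<le> c * g r"
    using eventually_conj[OF g] unfolding eventually_at_top_linorder by blast
  show ?thesis
    unfolding decays_def
  proof (rule exI[of _ "min \<eta> (d / 2)"], intro conjI, use bound(1) d(1) in simp, rule exI[of _ "max R R1"], intro allI impI)
    fix r \<theta> assume r: "max R R1 \<le> r" and \<theta>: "\<bar>\<theta> - \<phi>\<bar> \<le> min \<eta> (d / 2)"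
    have "f \<theta> \<le> - c" using d(2)[of \<theta>] f(2) \<theta> d(1) by (cases "\<theta> = \<phi>") (auto simp: dist_real_def)
    then have "f \<theta> * g r \<le> - c * g r" using R1(1)[of r] r by (intro mult_right_mono) auto
    moreover have F: "F (of_real r * cis \<theta>) \<noteq> 0" "ln (cmod (F (of_real r * cis \<theta>))) \<le> f \<theta> * g r + C * h r"
      using bound(2)[of r \<theta>] r \<theta> by auto
    ultimately have "ln (cmod (F (of_real r * cis \<theta>))) \<le> - \<kappa> * r"
      using R1(2)[of r] r by auto
    then have "exp (ln (cmod (F (of_real r * cis \<theta>)))) \<le> exp (- \<kappa> * r)" by simp
    then show "cmod (F (of_real r * cis \<theta>)) \<le> exp (- \<kappa> * r)" using F(1) by simp
  qed
qed

definition MB_kernel :: "nat \<Rightarrow> nat \<Rightarrow> nat \<Rightarrow> nat \<Rightarrow> (nat \<Rightarrow> complex) \<Rightarrow> (nat \<Rightarrow> complex) \<Rightarrow> real \<Rightarrow> complex \<Rightarrow> complex \<Rightarrow> complex" where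
  "MB_kernel m n p q a b \<tau> \<alpha> s = MB_integrand m n p q a b \<tau> s * exp (of_real pi * \<alpha> / of_real \<tau> * s\<^sup>2)"

text \<open>The linear coefficient \<open>c4\<close> is made explicit only for p = q, N = 0 and
  \<mu> = 0, where the linear term decides the decay. There A and B drop out and \<nu> appears,
  because \<mu> - \<nu> is twice the difference of the first sum over b and the second sum over
  a.\<close>

lemma MB_kernel_growth:
  assumes \<tau>: "\<tau> > 0" and mn: "m \<le> q" "n \<le> p" and \<sigma>: "\<sigma> \<in> {1,-1}" and \<phi>: "0 < \<sigma> * \<phi>" "\<sigma> * \<phi> < pi"
  obtains B \<eta> R C c4 where "\<eta> > 0" "R \<ge> 3" "C \<ge> 0"
    "\<And>r \<theta>. r \<ge> R \<Longrightarrow> \<bar>\<theta> - \<phi>\<bar> \<le> \<eta> \<Longrightarrow> \<bar>\<theta>\<bar> \<le> pi \<and> MB_kernel m n p q a b \<tau> \<alpha> (of_real r * cis \<theta>) \<noteq> 0 \<and>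
       ln (cmod (MB_kernel m n p q a b \<tau> \<alpha> (of_real r * cis \<theta>))) \<le>
         of_int (MB_N m n p q) / (2 * \<tau>) * Re ((of_real r * cis \<theta>)\<^sup>2 * Complex (ln r) \<theta>)
       + Re ((of_int (MB_N m n p q) * B - \<i> * of_real (\<sigma> * pi) * (of_nat m + of_nat n - of_nat p) / (2 * of_real \<tau>) + of_real pi * \<alpha> / of_real \<tau>) * (of_real r * cis \<theta>)\<^sup>2)
       + Re (((1 + of_real \<tau>) / (2 * of_real \<tau>) * of_int (MB_N m n p q) - MB_mu m n p q a b / of_real \<tau>) * (of_real r * cis \<theta>) * Complex (ln r) \<theta>)
       + Re (c4 * (of_real r * cis \<theta>)) + C * ln r"
    "p = q \<Longrightarrow> MB_N m n p q = 0 \<Longrightarrow> MB_mu m n p q a b = 0 \<Longrightarrow> c4 = - \<i> * of_real (\<sigma> * pi) * MB_nu p q a b / (2 * of_real \<tau>)"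
proof -
  obtain A B where AB: "stirling_for \<tau> A B" using stirling_for_exists[OF \<tau>] .
  \<comment> \<open>Half the distance of \<sigma> \<phi> from the ends of (0, pi): directions within
    \<epsilon> of \<phi> still have distance at least \<epsilon> from them.\<close>
  define \<epsilon> where "\<epsilon> = min (\<sigma> * \<phi>) (pi - \<sigma> * \<phi>) / 2"
  have \<epsilon>: "0 < \<epsilon>" "\<epsilon> < pi" "2 * \<epsilon> \<le> \<sigma> * \<phi>" "2 * \<epsilon> \<le> pi - \<sigma> * \<phi>" using \<phi> by (auto simp: \<epsilon>_def min_def)
  obtain R C where RC: "R \<ge> 3" "C \<ge> 0" "\<And>r \<theta>. r \<ge> R \<Longrightarrow> \<epsilon> \<le> \<sigma> * \<theta> \<Longrightarrow> \<sigma> * \<theta> \<le> pi - \<epsilon> \<Longrightarrow>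
     MB_integrand m n p q a b \<tau> (of_real r * cis \<theta>) \<noteq> 0 \<and>
     \<bar>ln (cmod (MB_integrand m n p q a b \<tau> (of_real r * cis \<theta>))) - Re (MB_exponent m n p q a b \<tau> A B \<sigma> (of_real r * cis \<theta>) (Complex (ln r) \<theta>))\<bar> \<le> C * ln r"
    using MB_integrand_stirling[OF \<tau> AB \<epsilon>(1,2) mn, of a b] \<sigma> by meson
  define c4 where "c4 = A * (of_nat p - of_nat q) + (1 / (2 * of_real \<tau>) + 2 * B) * ((1 + of_real \<tau>) * (of_nat m + of_nat n - of_nat q) - MB_mu m n p q a b)
      - \<i> * of_real (\<sigma> * pi) * (1 + of_real \<tau>) / (2 * of_real \<tau>) * (of_nat m + of_nat n - of_nat p)
      + \<i> * of_real (\<sigma> * pi) / of_real \<tau> * ((\<Sum>j=1..m. b j) - (\<Sum>j=n+1..p. a j))"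
  show ?thesis
  proof (rule that[of \<epsilon> R C B c4])
    show "\<epsilon> > 0" "R \<ge> 3" "C \<ge> 0" by fact+
    fix r \<theta> assume r: "r \<ge> R" and \<theta>: "\<bar>\<theta> - \<phi>\<bar> \<le> \<epsilon>"
    have "\<epsilon> \<le> \<sigma> * \<theta>" "\<sigma> * \<theta> \<le> pi - \<epsilon>" "\<bar>\<theta>\<bar> \<le> pi"
      using \<sigma> \<theta> \<epsilon> by auto
    define s where "s = complex_of_real r * cis \<theta>"
    define l where "l = Complex (ln r) \<theta>"
    define x where "x = of_real pi * \<alpha> / of_real \<tau> * s\<^sup>2"
    have I: "MB_integrand m n p q a b \<tau> s \<noteq> 0"
      "ln (cmod (MB_integrand m n p q a b \<tau> s)) \<le> Re (MB_exponent m n p q a b \<tau> A B \<sigma> s l) + C * ln r"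
      using RC(3)[OF r \<open>\<epsilon> \<le> _\<close> \<open>\<sigma> * \<theta> \<le> _\<close>] unfolding s_def[symmetric] l_def[symmetric] by auto
    have K: "MB_kernel m n p q a b \<tau> \<alpha> s \<noteq> 0" "ln (cmod (MB_kernel m n p q a b \<tau> \<alpha> s)) = ln (cmod (MB_integrand m n p q a b \<tau> s)) + Re x"
      using I(1) unfolding MB_kernel_def x_def[symmetric] by (simp_all add: norm_mult ln_mult_pos)
    have "MB_exponent m n p q a b \<tau> A B \<sigma> s l + x = of_real (of_int (MB_N m n p q) / (2 * \<tau>)) * (s\<^sup>2 * l)
       + (of_int (MB_N m n p q) * B - \<i> * of_real (\<sigma> * pi) * (of_nat m + of_nat n - of_nat p) / (2 * of_real \<tau>) + of_real pi * \<alpha> / of_real \<tau>) * s\<^sup>2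
       + ((1 + of_real \<tau>) / (2 * of_real \<tau>) * of_int (MB_N m n p q) - MB_mu m n p q a b / of_real \<tau>) * s * l
       + c4 * s"
      unfolding MB_exponent_def c4_def x_def by (simp add: algebra_simps)
    moreover have rm: "Re (complex_of_real c * y) = c * Re y" for c y by simp
    ultimately have E: "Re (MB_exponent m n p q a b \<tau> A B \<sigma> s l) + Re x = of_int (MB_N m n p q) / (2 * \<tau>) * Re (s\<^sup>2 * l)
       + Re ((of_int (MB_N m n p q) * B - \<i> * of_real (\<sigma> * pi) * (of_nat m + of_nat n - of_nat p) / (2 * of_real \<tau>) + of_real pi * \<alpha> / of_real \<tau>) * s\<^sup>2)
       + Re (((1 + of_real \<tau>) / (2 * of_real \<tau>) * of_int (MB_N m n p q) - MB_mu m n p q a b / of_real \<tau>) * s * l)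
       + Re (c4 * s)"
      unfolding rm[symmetric] plus_complex.sel(1)[symmetric] by (simp only:)
    show "\<bar>\<theta>\<bar> \<le> pi \<and> MB_kernel m n p q a b \<tau> \<alpha> (of_real r * cis \<theta>) \<noteq> 0 \<and>
       ln (cmod (MB_kernel m n p q a b \<tau> \<alpha> (of_real r * cis \<theta>))) \<le>
         of_int (MB_N m n p q) / (2 * \<tau>) * Re ((of_real r * cis \<theta>)\<^sup>2 * Complex (ln r) \<theta>)
       + Re ((of_int (MB_N m n p q) * B - \<i> * of_real (\<sigma> * pi) * (of_nat m + of_nat n - of_nat p) / (2 * of_real \<tau>) + of_real pi * \<alpha> / of_real \<tau>) * (of_real r * cis \<theta>)\<^sup>2)
       + Re (((1 + of_real \<tau>) / (2 * of_real \<tau>) * of_int (MB_N m n p q) - MB_mu m n p q a b / of_real \<tau>) * (of_real r * cis \<theta>) * Complex (ln r) \<theta>)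
       + Re (c4 * (of_real r * cis \<theta>)) + C * ln r"
      unfolding s_def[symmetric] l_def[symmetric] E[symmetric] K(2) using \<open>\<bar>\<theta>\<bar> \<le> pi\<close> K(1) I(2) by simp
  next
    assume pq: "p = q" and N: "MB_N m n p q = 0" and mu: "MB_mu m n p q a b = 0"
    have "int m + int n = int q" using N pq by (simp add: MB_N_def)
    then have mnq: "of_nat m + of_nat n = (of_nat q :: complex)" by (metis of_int_add of_int_of_nat_eq)
    have sa: "(\<Sum>j=1..p. a j) = (\<Sum>j=1..n. a j) + (\<Sum>j=n+1..p. a j)" 
      using mn(2) sum.ub_add_nat[of 1 n a "p - n"] by simp
    have sb: "(\<Sum>j=1..q. b j) = (\<Sum>j=1..m. b j) + (\<Sum>j=m+1..q. b j)" 
      using mn(1) sum.ub_add_nat[of 1 m b "q - m"] by simp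
    have D: "(\<Sum>j=1..m. b j) - (\<Sum>j=n+1..p. a j) = (MB_mu m n p q a b - MB_nu p q a b) / 2"
      unfolding MB_mu_def MB_nu_def sa sb by simp
    show "c4 = - \<i> * of_real (\<sigma> * pi) * MB_nu p q a b / (2 * of_real \<tau>)"
      unfolding c4_def D mu using pq mnq by simp
  qed
qed

lemma cis_square: "(cis \<theta>)\<^sup>2 = cis (2 * \<theta>)"
  by (simp only: power2_eq_square cis_mult mult_2)

text \<open>r >= 3 gives ln r >= 1. The term s ln s has two bounds: a crude one for use as an error
  term, and one that keeps its direction for use as the leading term.\<close>

lemma polar_Re_bounds:
  fixes x :: complex
  assumes r: "r \<ge> 3" and \<theta>: "\<bar>\<theta>\<bar> \<le> pi"
  defines "s \<equiv> complex_of_real r * cis \<theta>" and "l \<equiv> Complex (ln r) \<theta>"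
  shows "Re (x * s) \<le> cmod x * r" "Re (x * s\<^sup>2) \<le> cmod x * r\<^sup>2" "Re (x * s * l) \<le> cmod x * (1 + pi) * (r * ln r)"
    "Re (x * s * l) \<le> Re (x * cis \<theta>) * (r * ln r) + cmod x * pi * r"
    "Re (s\<^sup>2 * l) \<le> cos (2 * \<theta>) * (r\<^sup>2 * ln r) + pi * r\<^sup>2"
    "1 \<le> ln r" "ln r \<le> r"
proof -
  have cs: "cmod s = r" using r by (simp add: s_def norm_mult)
  show ln1: "1 \<le> ln r"
  proof -
    have "exp 1 \<le> r" using exp_le r by linarith
    then show ?thesis using r by (simp add: ln_ge_iff)
  qed
  show "ln r \<le> r" using ln_le_minus_one[of r] r by simp
  have cl: "cmod l \<le> (1 + pi) * ln r"
  proof -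
    have "cmod l \<le> \<bar>ln r\<bar> + \<bar>\<theta>\<bar>" using cmod_le[of l] by (simp add: l_def)
    also have "\<dots> \<le> ln r + pi * 1" using ln1 \<theta> by simp
    also have "\<dots> \<le> ln r + pi * ln r" using ln1 by (intro add_left_mono mult_left_mono) auto
    finally show ?thesis by (simp add: distrib_right)
  qed
  show "Re (x * s) \<le> cmod x * r" using complex_Re_le_cmod[of "x * s"] by (simp add: norm_mult cs)
  show "Re (x * s\<^sup>2) \<le> cmod x * r\<^sup>2" using complex_Re_le_cmod[of "x * s\<^sup>2"] by (simp add: norm_mult norm_power cs)
  have "Re (x * s * l) \<le> cmod x * r * cmod l" using complex_Re_le_cmod[of "x * s * l"] by (simp add: norm_mult cs)
  also have "\<dots> \<le> cmod x * r * ((1 + pi) * ln r)" using cl r by (intro mult_left_mono) auto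
  finally show "Re (x * s * l) \<le> cmod x * (1 + pi) * (r * ln r)" by (simp add: mult_ac)
  have "x * s * l = (x * cis \<theta>) * of_real (r * ln r) + x * s * (\<i> * of_real \<theta>)"
  proof -
    have "l = of_real (ln r) + \<i> * of_real \<theta>" by (simp add: l_def complex_eq_iff)
    then show ?thesis unfolding s_def by (simp add: algebra_simps)
  qed
  moreover have "Re (y * complex_of_real c) = Re y * c" for y c by simp
  ultimately have e: "Re (x * s * l) = Re (x * cis \<theta>) * (r * ln r) + Re (x * s * (\<i> * of_real \<theta>))"
    by (simp only: plus_complex.sel(1))
  have "Re (x * s * (\<i> * of_real \<theta>)) \<le> cmod x * r * \<bar>\<theta>\<bar>"
    using complex_Re_le_cmod[of "x * s * (\<i> * of_real \<theta>)"] by (simp add: norm_mult cs)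
  also have "\<dots> \<le> cmod x * r * pi" using \<theta> r by (intro mult_left_mono) auto
  finally show "Re (x * s * l) \<le> Re (x * cis \<theta>) * (r * ln r) + cmod x * pi * r" unfolding e by (simp add: mult_ac)
  have "s\<^sup>2 = of_real (r\<^sup>2) * cis (2 * \<theta>)" by (simp add: s_def power_mult_distrib cis_square)
  then have e2: "Re (s\<^sup>2 * l) = cos (2 * \<theta>) * (r\<^sup>2 * ln r) + r\<^sup>2 * (- (sin (2 * \<theta>) * \<theta>))"
    by (simp add: l_def algebra_simps)
  have "\<bar>sin (2 * \<theta>) * \<theta>\<bar> \<le> 1 * pi"
    unfolding abs_mult using \<theta> by (intro mult_mono) auto
  then have "r\<^sup>2 * (- (sin (2 * \<theta>) * \<theta>)) \<le> r\<^sup>2 * pi" by (intro mult_left_mono) auto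
  then show "Re (s\<^sup>2 * l) \<le> cos (2 * \<theta>) * (r\<^sup>2 * ln r) + pi * r\<^sup>2" unfolding e2 by (simp only: mult.commute add_left_mono)
qed

context
  fixes m n p q :: nat and a b :: "nat \<Rightarrow> complex" and \<tau> :: real and \<alpha> :: complex and \<sigma> \<phi> :: real
  assumes \<tau>: "\<tau> > 0" and mn: "m \<le> q" "n \<le> p" and \<sigma>: "\<sigma> \<in> {1,-1}" and \<phi>: "0 < \<sigma> * \<phi>" "\<sigma> * \<phi> < pi"
begin

text \<open>The scale is r^2 ln r with factor N cos (2 \<theta>) / (2 \<tau>); all other terms are
  O(r^2), so every rate \<kappa> is reached.\<close>

lemma MB_kernel_decays_N_pos:
  assumes N: "MB_N m n p q > 0" and c: "cos (2 * \<phi>) < 0"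
  shows "decays (MB_kernel m n p q a b \<tau> \<alpha>) \<phi> \<kappa>"
proof -
  obtain B \<eta> R C c4 where *: "\<eta> > 0" "R \<ge> 3" "C \<ge> 0"
    "\<And>r \<theta>. r \<ge> R \<Longrightarrow> \<bar>\<theta> - \<phi>\<bar> \<le> \<eta> \<Longrightarrow> \<bar>\<theta>\<bar> \<le> pi \<and> MB_kernel m n p q a b \<tau> \<alpha> (of_real r * cis \<theta>) \<noteq> 0 \<and>
       ln (cmod (MB_kernel m n p q a b \<tau> \<alpha> (of_real r * cis \<theta>))) \<le>
         of_int (MB_N m n p q) / (2 * \<tau>) * Re ((of_real r * cis \<theta>)\<^sup>2 * Complex (ln r) \<theta>)
       + Re ((of_int (MB_N m n p q) * B - \<i> * of_real (\<sigma> * pi) * (of_nat m + of_nat n - of_nat p) / (2 * of_real \<tau>) + of_real pi * \<alpha> / of_real \<tau>) * (of_real r * cis \<theta>)\<^sup>2)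
       + Re (((1 + of_real \<tau>) / (2 * of_real \<tau>) * of_int (MB_N m n p q) - MB_mu m n p q a b / of_real \<tau>) * (of_real r * cis \<theta>) * Complex (ln r) \<theta>)
       + Re (c4 * (of_real r * cis \<theta>)) + C * ln r"
    using MB_kernel_growth[OF \<tau> mn \<sigma> \<phi>, of a b \<alpha>] by metis
  define c1 where "c1 = of_int (MB_N m n p q) / (2 * \<tau>)"
  have c1: "c1 > 0" using N \<tau> by (simp add: c1_def)
  define c2 where "c2 = of_int (MB_N m n p q) * B - \<i> * of_real (\<sigma> * pi) * (of_nat m + of_nat n - of_nat p) / (2 * of_real \<tau>) + of_real pi * \<alpha> / of_real \<tau>"
  define c3 where "c3 = (1 + of_real \<tau>) / (2 * of_real \<tau>) * of_int (MB_N m n p q) - MB_mu m n p q a b / of_real \<tau>"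
  define K where "K = c1 * pi + cmod c2 + cmod c3 * (1 + pi) + cmod c4 + C"
  show ?thesis
  proof (rule decaysI_leading[where f = "\<lambda>\<theta>. c1 * cos (2 * \<theta>)" and g = "\<lambda>r. r\<^sup>2 * ln r" and h = "\<lambda>r. r\<^sup>2" and C = K and c = "- c1 * cos (2 * \<phi>) / 2", OF *(1)])
    fix r \<theta> :: real assume r: "r \<ge> R" and \<theta>: "\<bar>\<theta> - \<phi>\<bar> \<le> \<eta>"
    define s where "s = complex_of_real r * cis \<theta>"
    define l where "l = Complex (ln r) \<theta>"
    have 0: "\<bar>\<theta>\<bar> \<le> pi" "MB_kernel m n p q a b \<tau> \<alpha> s \<noteq> 0"
      "ln (cmod (MB_kernel m n p q a b \<tau> \<alpha> s)) \<le> c1 * Re (s\<^sup>2 * l) + Re (c2 * s\<^sup>2) + Re (c3 * s * l) + Re (c4 * s) + C * ln r"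
      using *(4)[OF r \<theta>] unfolding s_def l_def c1_def c2_def c3_def by auto
    have r3: "r \<ge> 3" using r *(2) by linarith
    note b = polar_Re_bounds[OF r3 0(1), folded s_def l_def]
    have rr: "r \<le> r\<^sup>2" "r * ln r \<le> r\<^sup>2" using b(7) r3 by (simp_all add: power2_eq_square mult_left_mono)
    have "c1 * Re (s\<^sup>2 * l) \<le> c1 * (cos (2 * \<theta>) * (r\<^sup>2 * ln r) + pi * r\<^sup>2)"
      using b(5) c1 by (intro mult_left_mono) auto
    moreover have "Re (c3 * s * l) \<le> cmod c3 * (1 + pi) * r\<^sup>2"
      by (rule order_trans[OF b(3) mult_left_mono[OF rr(2)]]) auto
    moreover have "Re (c4 * s) \<le> cmod c4 * r\<^sup>2"
      by (rule order_trans[OF b(1) mult_left_mono[OF rr(1)]]) auto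
    moreover have "C * ln r \<le> C * r\<^sup>2"
      using b(7) rr(1) *(3) by (intro mult_left_mono) auto
    ultimately have "ln (cmod (MB_kernel m n p q a b \<tau> \<alpha> s)) \<le> c1 * (cos (2 * \<theta>) * (r\<^sup>2 * ln r) + pi * r\<^sup>2) + cmod c2 * r\<^sup>2 + cmod c3 * (1 + pi) * r\<^sup>2 + cmod c4 * r\<^sup>2 + C * r\<^sup>2"
      using 0(3) b(2)[of c2] by linarith
    also have "\<dots> = c1 * cos (2 * \<theta>) * (r\<^sup>2 * ln r) + K * r\<^sup>2" unfolding K_def by (simp add: algebra_simps)
    finally show "MB_kernel m n p q a b \<tau> \<alpha> (of_real r * cis \<theta>) \<noteq> 0 \<and>
      ln (cmod (MB_kernel m n p q a b \<tau> \<alpha> (of_real r * cis \<theta>))) \<le> c1 * cos (2 * \<theta>) * (r\<^sup>2 * ln r) + K * r\<^sup>2"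
      using 0(2) unfolding s_def by blast
  next
    show "isCont (\<lambda>\<theta>. c1 * cos (2 * \<theta>)) \<phi>" by (intro continuous_intros)
    have neg: "c1 * cos (2 * \<phi>) < 0" using c1 c by (rule mult_pos_neg)
    then show "c1 * cos (2 * \<phi>) < - (- c1 * cos (2 * \<phi>) / 2)" by linarith
    define d where "d = - c1 * cos (2 * \<phi>) / 2"
    have d: "d > 0" using neg by (simp add: d_def)
    show "\<forall>\<^sub>F r in at_top. 0 \<le> r\<^sup>2 * ln (r::real)" by real_asymp
    show "\<forall>\<^sub>F r in at_top. K * r\<^sup>2 + \<kappa> * r \<le> (- c1 * cos (2 * \<phi>) / 2) * (r\<^sup>2 * ln r)"
      unfolding d_def[symmetric] using d by real_asymp
  qed
qed

text \<open>N = 0 means m + n - p = (q - p) / 2. This turns the coefficient of s^2 into (pi /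
  \<tau>) (\<alpha> + \<i> \<sigma> (p - q) / 4); whether it vanishes in a half-plane is what
  separates cases (ii) to (v) of the table.\<close>

lemma MB_kernel_growth_N0:
  assumes N: "MB_N m n p q = 0"
  obtains \<eta> R C c4 where "\<eta> > 0" "R \<ge> 3" "C \<ge> 0"
    "\<And>r \<theta>. r \<ge> R \<Longrightarrow> \<bar>\<theta> - \<phi>\<bar> \<le> \<eta> \<Longrightarrow> \<bar>\<theta>\<bar> \<le> pi \<and> MB_kernel m n p q a b \<tau> \<alpha> (of_real r * cis \<theta>) \<noteq> 0 \<and>
       ln (cmod (MB_kernel m n p q a b \<tau> \<alpha> (of_real r * cis \<theta>))) \<le>
         Re (of_real (pi / \<tau>) * (\<alpha> + \<i> * of_real \<sigma> * (of_nat p - of_nat q) / 4) * (of_real r * cis \<theta>)\<^sup>2)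
       + Re (- MB_mu m n p q a b / of_real \<tau> * (of_real r * cis \<theta>) * Complex (ln r) \<theta>)
       + Re (c4 * (of_real r * cis \<theta>)) + C * ln r"
    "p = q \<Longrightarrow> MB_mu m n p q a b = 0 \<Longrightarrow> c4 = - \<i> * of_real (\<sigma> * pi) * MB_nu p q a b / (2 * of_real \<tau>)"
proof -
  have "2 * (int m + int n) = int p + int q" using N by (simp add: MB_N_def)
  then have "2 * (of_nat m + of_nat n) = (of_nat p + of_nat q :: complex)"
    by (metis of_int_add of_int_mult of_int_numeral of_int_of_nat_eq)
  then have e: "of_nat m + of_nat n - of_nat p = (of_nat q - of_nat p :: complex) / 2" by (simp add: field_simps)
  have c2: "of_int 0 * B - \<i> * of_real (\<sigma> * pi) * (of_nat m + of_nat n - of_nat p) / (2 * of_real \<tau>) + of_real pi * \<alpha> / of_real \<tau>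
     = of_real (pi / \<tau>) * (\<alpha> + \<i> * of_real \<sigma> * (of_nat p - of_nat q) / 4)" for B
    unfolding e using \<tau> by (simp add: field_simps)
  have c3: "(1 + of_real \<tau>) / (2 * of_real \<tau>) * of_int 0 - MB_mu m n p q a b / of_real \<tau> = - MB_mu m n p q a b / of_real \<tau>"
    by simp
  show ?thesis
    by (rule MB_kernel_growth[OF \<tau> mn \<sigma> \<phi>, of a b \<alpha>], unfold N c2 c3, rule that)
       (simp_all only: of_int_0 div_0 mult_zero_left add_0 simp_thms)
qed

text \<open>The scale is r^2, and the remaining terms are O(r ln r).\<close>

lemma MB_kernel_decays_quadratic:
  assumes N: "MB_N m n p q = 0" and c: "Re (of_real (pi / \<tau>) * (\<alpha> + \<i> * of_real \<sigma> * (of_nat p - of_nat q) / 4) * cis (2 * \<phi>)) < 0"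
  shows "decays (MB_kernel m n p q a b \<tau> \<alpha>) \<phi> \<kappa>"
proof -
  obtain \<eta> R C c4 where *: "\<eta> > 0" "R \<ge> 3" "C \<ge> 0"
    "\<And>r \<theta>. r \<ge> R \<Longrightarrow> \<bar>\<theta> - \<phi>\<bar> \<le> \<eta> \<Longrightarrow> \<bar>\<theta>\<bar> \<le> pi \<and> MB_kernel m n p q a b \<tau> \<alpha> (of_real r * cis \<theta>) \<noteq> 0 \<and>
       ln (cmod (MB_kernel m n p q a b \<tau> \<alpha> (of_real r * cis \<theta>))) \<le>
         Re (of_real (pi / \<tau>) * (\<alpha> + \<i> * of_real \<sigma> * (of_nat p - of_nat q) / 4) * (of_real r * cis \<theta>)\<^sup>2)
       + Re (- MB_mu m n p q a b / of_real \<tau> * (of_real r * cis \<theta>) * Complex (ln r) \<theta>)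
       + Re (c4 * (of_real r * cis \<theta>)) + C * ln r"
    using MB_kernel_growth_N0[OF N] by metis
  define c2 where "c2 = of_real (pi / \<tau>) * (\<alpha> + \<i> * of_real \<sigma> * (of_nat p - of_nat q) / 4)"
  define c3 where "c3 = - MB_mu m n p q a b / of_real \<tau>"
  define K where "K = cmod c3 * (1 + pi) + cmod c4 + C"
  show ?thesis
  proof (rule decaysI_leading[where f = "\<lambda>\<theta>. Re (c2 * cis (2 * \<theta>))" and g = "\<lambda>r. r\<^sup>2" and h = "\<lambda>r. r * ln r" and C = K and c = "- Re (c2 * cis (2 * \<phi>)) / 2", OF *(1)])
    fix r \<theta> :: real assume r: "r \<ge> R" and \<theta>: "\<bar>\<theta> - \<phi>\<bar> \<le> \<eta>"
    define s where "s = complex_of_real r * cis \<theta>"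
    define l where "l = Complex (ln r) \<theta>"
    have 0: "\<bar>\<theta>\<bar> \<le> pi" "MB_kernel m n p q a b \<tau> \<alpha> s \<noteq> 0"
      "ln (cmod (MB_kernel m n p q a b \<tau> \<alpha> s)) \<le> Re (c2 * s\<^sup>2) + Re (c3 * s * l) + Re (c4 * s) + C * ln r"
      using *(4)[OF r \<theta>] unfolding s_def l_def c2_def c3_def by auto
    have r3: "r \<ge> 3" using r *(2) by linarith
    note b = polar_Re_bounds[OF r3 0(1), folded s_def l_def]
    have "r * 1 \<le> r * ln r" "1 * ln r \<le> r * ln r" using b(6) r3 by (intro mult_left_mono mult_right_mono; simp)+
    then have rr: "r \<le> r * ln r" "ln r \<le> r * ln r" by simp_all
    have "s\<^sup>2 = of_real (r\<^sup>2) * cis (2 * \<theta>)" by (simp add: s_def power_mult_distrib cis_square)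
    then have "c2 * s\<^sup>2 = of_real (r\<^sup>2) * (c2 * cis (2 * \<theta>))" by (simp only: mult_ac)
    then have "Re (c2 * s\<^sup>2) = Re (c2 * cis (2 * \<theta>)) * r\<^sup>2" by (simp only: Re_complex_of_real times_complex.sel Im_complex_of_real) simp
    moreover have "Re (c4 * s) \<le> cmod c4 * (r * ln r)"
      by (rule order_trans[OF b(1) mult_left_mono[OF rr(1)]]) auto
    moreover have "C * ln r \<le> C * (r * ln r)"
      using rr *(3) by (intro mult_left_mono) auto
    ultimately have "ln (cmod (MB_kernel m n p q a b \<tau> \<alpha> s)) \<le> Re (c2 * cis (2 * \<theta>)) * r\<^sup>2 + cmod c3 * (1 + pi) * (r * ln r) + cmod c4 * (r * ln r) + C * (r * ln r)"
      using 0(3) b(3)[of c3] by linarith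
    also have "\<dots> = Re (c2 * cis (2 * \<theta>)) * r\<^sup>2 + K * (r * ln r)" unfolding K_def by (simp only: distrib_right add.assoc)
    finally show "MB_kernel m n p q a b \<tau> \<alpha> (of_real r * cis \<theta>) \<noteq> 0 \<and>
      ln (cmod (MB_kernel m n p q a b \<tau> \<alpha> (of_real r * cis \<theta>))) \<le> Re (c2 * cis (2 * \<theta>)) * r\<^sup>2 + K * (r * ln r)"
      using 0(2) unfolding s_def by blast
  next
    have "(\<lambda>\<theta>. Re (c2 * cis (2 * \<theta>))) = (\<lambda>\<theta>. Re c2 * cos (2 * \<theta>) - Im c2 * sin (2 * \<theta>))" by (rule ext) simp
    then show "isCont (\<lambda>\<theta>. Re (c2 * cis (2 * \<theta>))) \<phi>" by (simp only:) (intro continuous_intros)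
    have neg: "Re (c2 * cis (2 * \<phi>)) < 0" using c unfolding c2_def .
    then show "Re (c2 * cis (2 * \<phi>)) < - (- Re (c2 * cis (2 * \<phi>)) / 2)" by linarith
    define d where "d = - Re (c2 * cis (2 * \<phi>)) / 2"
    have d: "d > 0" using neg by (simp add: d_def)
    show "\<forall>\<^sub>F r in at_top. 0 \<le> (r::real)\<^sup>2" by simp
    show "\<forall>\<^sub>F r in at_top. K * (r * ln r) + \<kappa> * r \<le> (- Re (c2 * cis (2 * \<phi>)) / 2) * r\<^sup>2"
      unfolding d_def[symmetric] using d by real_asymp
  qed
qed

text \<open>Once the quadratic coefficient vanishes, - \<mu> s ln s / \<tau> leads on the scale r ln
  r; in the direction \<phi> its sign is that of - Re (\<mu> cis \<phi>).\<close>

lemma MB_kernel_decays_log: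
  assumes N: "MB_N m n p q = 0" and q0: "\<alpha> + \<i> * of_real \<sigma> * (of_nat p - of_nat q) / 4 = 0" and c: "Re (MB_mu m n p q a b * cis \<phi>) > 0"
  shows "decays (MB_kernel m n p q a b \<tau> \<alpha>) \<phi> \<kappa>"
proof -
  obtain \<eta> R C c4 where *: "\<eta> > 0" "R \<ge> 3" "C \<ge> 0"
    "\<And>r \<theta>. r \<ge> R \<Longrightarrow> \<bar>\<theta> - \<phi>\<bar> \<le> \<eta> \<Longrightarrow> \<bar>\<theta>\<bar> \<le> pi \<and> MB_kernel m n p q a b \<tau> \<alpha> (of_real r * cis \<theta>) \<noteq> 0 \<and>
       ln (cmod (MB_kernel m n p q a b \<tau> \<alpha> (of_real r * cis \<theta>))) \<le>
         Re (of_real (pi / \<tau>) * (\<alpha> + \<i> * of_real \<sigma> * (of_nat p - of_nat q) / 4) * (of_real r * cis \<theta>)\<^sup>2)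
       + Re (- MB_mu m n p q a b / of_real \<tau> * (of_real r * cis \<theta>) * Complex (ln r) \<theta>)
       + Re (c4 * (of_real r * cis \<theta>)) + C * ln r"
    using MB_kernel_growth_N0[OF N] by metis
  define c3 where "c3 = - MB_mu m n p q a b / of_real \<tau>"
  define K where "K = cmod c3 * pi + cmod c4 + C"
  have c3: "c3 * cis \<theta> = of_real (- 1 / \<tau>) * (MB_mu m n p q a b * cis \<theta>)" for \<theta>
    by (simp add: c3_def)
  show ?thesis
  proof (rule decaysI_leading[where f = "\<lambda>\<theta>. Re (c3 * cis \<theta>)" and g = "\<lambda>r. r * ln r" and h = "\<lambda>r. r" and C = K and c = "- Re (c3 * cis \<phi>) / 2", OF *(1)])
    fix r \<theta> :: real assume r: "r \<ge> R" and \<theta>: "\<bar>\<theta> - \<phi>\<bar> \<le> \<eta>"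
    define s where "s = complex_of_real r * cis \<theta>"
    define l where "l = Complex (ln r) \<theta>"
    have 0: "\<bar>\<theta>\<bar> \<le> pi" "MB_kernel m n p q a b \<tau> \<alpha> s \<noteq> 0"
      "ln (cmod (MB_kernel m n p q a b \<tau> \<alpha> s)) \<le> Re (c3 * s * l) + Re (c4 * s) + C * ln r"
      using *(4)[OF r \<theta>] unfolding s_def l_def c3_def q0 by auto
    have r3: "r \<ge> 3" using r *(2) by linarith
    note b = polar_Re_bounds[OF r3 0(1), folded s_def l_def]
    have "C * ln r \<le> C * r" using b(7) *(3) by (intro mult_left_mono) auto
    then have "ln (cmod (MB_kernel m n p q a b \<tau> \<alpha> s)) \<le> Re (c3 * cis \<theta>) * (r * ln r) + cmod c3 * pi * r + cmod c4 * r + C * r"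
      using 0(3) b(4)[of c3] b(1)[of c4] by linarith
    also have "\<dots> = Re (c3 * cis \<theta>) * (r * ln r) + K * r" unfolding K_def by (simp only: distrib_right add.assoc)
    finally show "MB_kernel m n p q a b \<tau> \<alpha> (of_real r * cis \<theta>) \<noteq> 0 \<and>
      ln (cmod (MB_kernel m n p q a b \<tau> \<alpha> (of_real r * cis \<theta>))) \<le> Re (c3 * cis \<theta>) * (r * ln r) + K * r"
      using 0(2) unfolding s_def by blast
  next
    have "(\<lambda>\<theta>. Re (c3 * cis \<theta>)) = (\<lambda>\<theta>. Re c3 * cos \<theta> - Im c3 * sin \<theta>)" by (rule ext) simp
    then show "isCont (\<lambda>\<theta>. Re (c3 * cis \<theta>)) \<phi>" by (simp only:) (intro continuous_intros)
    have neg: "Re (c3 * cis \<phi>) < 0" unfolding c3 using c \<tau> by (simp only: Re_complex_of_real times_complex.sel Im_complex_of_real) (simp add: divide_simps)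
    then show "Re (c3 * cis \<phi>) < - (- Re (c3 * cis \<phi>) / 2)" by linarith
    define d where "d = - Re (c3 * cis \<phi>) / 2"
    have d: "d > 0" using neg by (simp add: d_def)
    show "\<forall>\<^sub>F r in at_top. 0 \<le> (r::real) * ln r" by real_asymp
    show "\<forall>\<^sub>F r in at_top. K * r + \<kappa> * r \<le> (- Re (c3 * cis \<phi>) / 2) * (r * ln r)"
      unfolding d_def[symmetric] using d by real_asymp
  qed
qed

text \<open>The leading term is itself linear in r, so only rates below its coefficient are reached.
  For \<phi> = pi / 2 and - pi / 2 this bound is the half-width of the sector in case (vi).\<close>

lemma MB_kernel_decays_linear:
  assumes N: "MB_N m n p q = 0" and pq: "p = q" "\<alpha> = 0" "MB_mu m n p q a b = 0"
    and c: "\<kappa> < Re (\<i> * of_real \<sigma> * MB_nu p q a b * cis \<phi>) * pi / (2 * \<tau>)"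
  shows "decays (MB_kernel m n p q a b \<tau> \<alpha>) \<phi> \<kappa>"
proof -
  obtain \<eta> R C c4 where *: "\<eta> > 0" "R \<ge> 3" "C \<ge> 0"
    "\<And>r \<theta>. r \<ge> R \<Longrightarrow> \<bar>\<theta> - \<phi>\<bar> \<le> \<eta> \<Longrightarrow> \<bar>\<theta>\<bar> \<le> pi \<and> MB_kernel m n p q a b \<tau> \<alpha> (of_real r * cis \<theta>) \<noteq> 0 \<and>
       ln (cmod (MB_kernel m n p q a b \<tau> \<alpha> (of_real r * cis \<theta>))) \<le>
         Re (of_real (pi / \<tau>) * (\<alpha> + \<i> * of_real \<sigma> * (of_nat p - of_nat q) / 4) * (of_real r * cis \<theta>)\<^sup>2)
       + Re (- MB_mu m n p q a b / of_real \<tau> * (of_real r * cis \<theta>) * Complex (ln r) \<theta>)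
       + Re (c4 * (of_real r * cis \<theta>)) + C * ln r"
    "c4 = - \<i> * of_real (\<sigma> * pi) * MB_nu p q a b / (2 * of_real \<tau>)"
    using MB_kernel_growth_N0[OF N] pq by metis
  have c4: "Re (c4 * cis \<theta>) = - (Re (\<i> * of_real \<sigma> * MB_nu p q a b * cis \<theta>) * pi / (2 * \<tau>))" for \<theta>
  proof -
    have "c4 * cis \<theta> = of_real (- pi / (2 * \<tau>)) * (\<i> * of_real \<sigma> * MB_nu p q a b * cis \<theta>)"
      by (simp add: *(5))
    then show ?thesis by (simp only: Re_complex_of_real times_complex.sel(1)[of "complex_of_real _"] Im_complex_of_real) simp
  qed
  define d where "d = (\<kappa> - Re (c4 * cis \<phi>)) / 2"
  have "\<kappa> < - Re (c4 * cis \<phi>)" using c unfolding c4 by simp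
  then have d: "\<kappa> < d" "Re (c4 * cis \<phi>) < - d" unfolding d_def by (simp_all only: field_simps)
  show ?thesis
  proof (rule decaysI_leading[where f = "\<lambda>\<theta>. Re (c4 * cis \<theta>)" and g = "\<lambda>r. r" and h = "\<lambda>r. ln r" and C = C and c = d, OF *(1)])
    fix r \<theta> :: real assume r: "r \<ge> R" and \<theta>: "\<bar>\<theta> - \<phi>\<bar> \<le> \<eta>"
    have "c4 * (of_real r * cis \<theta>) = of_real r * (c4 * cis \<theta>)" by (simp only: mult_ac)
    then have "Re (c4 * (of_real r * cis \<theta>)) = Re (c4 * cis \<theta>) * r" by (simp only: Re_complex_of_real times_complex.sel(1)[of "complex_of_real _"] Im_complex_of_real) simp
    then show "MB_kernel m n p q a b \<tau> \<alpha> (of_real r * cis \<theta>) \<noteq> 0 \<and>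
      ln (cmod (MB_kernel m n p q a b \<tau> \<alpha> (of_real r * cis \<theta>))) \<le> Re (c4 * cis \<theta>) * r + C * ln r"
      using *(4)[OF r \<theta>] pq by simp
  next
    have "(\<lambda>\<theta>. Re (c4 * cis \<theta>)) = (\<lambda>\<theta>. Re c4 * cos \<theta> - Im c4 * sin \<theta>)" by (rule ext) simp
    then show "isCont (\<lambda>\<theta>. Re (c4 * cis \<theta>)) \<phi>" by (simp only:) (intro continuous_intros)
    show "Re (c4 * cis \<phi>) < - d" by (rule d)
    show "\<forall>\<^sub>F r in at_top. 0 \<le> (r::real)" by (rule eventually_ge_at_top)
    define e where "e = d - \<kappa>"
    have e: "e > 0" using d by (simp add: e_def)
    then have "\<forall>\<^sub>F r in at_top. C * ln r \<le> e * r" by real_asymp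
    then show "\<forall>\<^sub>F r in at_top. C * ln r + \<kappa> * r \<le> d * r"
      by eventually_elim (simp add: e_def algebra_simps)
  qed
qed

end

section \<open>Directions of decay determined by \<mu>\<close>

lemma is_Arg_iff: "is_Arg z \<phi> \<longleftrightarrow> Re z = cmod z * cos \<phi> \<and> Im z = cmod z * sin \<phi>"
  by (simp add: is_Arg_def flip: cis_conv_exp) (simp add: complex_eq_iff)

text \<open>The values \<open>\<mu>\<close> for which the table lets the upper ray point into the left half-plane: the integrand
  decays along all rays between a fixed one and those of the table.\<close>
lemma MB_upper_angle_mu_cases:
  assumes ev: "\<forall>\<^sub>F \<epsilon> in at_right 0. \<exists>\<theta>\<ge>pi/2. MB_upper_angle_mu \<mu> \<epsilon> \<theta>" and "\<mu> \<noteq> 0"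
  obtains \<phi> where "pi / 2 \<le> \<phi>" "\<phi> < pi"
    "\<forall>\<^sub>F \<epsilon> in at_right 0. \<forall>\<theta>. MB_upper_angle_mu \<mu> \<epsilon> \<theta> \<longrightarrow> \<theta> \<in> {0<..<pi} \<and> (\<forall>\<psi>\<in>closed_segment \<phi> \<theta>. \<psi> \<in> {0<..<pi} \<and> Re (\<mu> * cis \<psi>) > 0)"
proof -
  have small: "\<forall>\<^sub>F \<epsilon> in at_right (0::real). 0 < \<epsilon> \<and> \<epsilon> < e" if "e > 0" for e
    using that by (auto simp: eventually_at_right_field)
  have "\<forall>\<^sub>F \<epsilon> in at_right 0. (\<exists>\<theta>\<ge>pi/2. MB_upper_angle_mu \<mu> \<epsilon> \<theta>) \<and> 0 < \<epsilon> \<and> \<epsilon> < pi / 2"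
    using eventually_conj[OF ev small[of "pi/2"]] by simp
  \<comment> \<open>A single small \<epsilon> shows which alternative of the table holds:
    \<epsilon>0 < pi / 2 <= \<theta>0 excludes the alternative \<theta> = \<epsilon>.\<close>
  then obtain \<epsilon>0 \<theta>0 where 0: "\<theta>0 \<ge> pi / 2" "MB_upper_angle_mu \<mu> \<epsilon>0 \<theta>0" "0 < \<epsilon>0" "\<epsilon>0 < pi / 2"
    using eventually_happens'[OF trivial_limit_at_right_real] by blast
  have uniq: False if "is_Arg \<mu> x" "is_Arg \<mu> y" "0 \<le> x" "x < pi / 2" "pi / 2 < y" "y \<le> pi" for x y
  proof -
    have "cos x > 0" using that by (intro cos_gt_zero_pi) auto
    moreover have "cos (pi - y) > 0" using that by (intro cos_gt_zero_pi) auto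
    moreover have "Re \<mu> = cmod \<mu> * cos x" "Re \<mu> = cmod \<mu> * cos y"
      using that(1,2) unfolding is_Arg_iff by blast+
    then have "cmod \<mu> * cos x = cmod \<mu> * cos y" by (rule trans[OF sym])
    ultimately show False using \<open>\<mu> \<noteq> 0\<close> by simp
  qed
  from 0(2) consider "Im \<mu> < 0" | x where "x \<in> {pi/2<..pi}" "is_Arg \<mu> x"
  proof -
    have "\<theta>0 \<noteq> \<epsilon>0" using 0 by linarith
    with 0(2) that show ?thesis unfolding MB_upper_angle_mu_def by blast
  qed
  then show ?thesis
  proof cases
    case 1
    have Im: "Im \<mu> = cmod \<mu> * sin x" if "is_Arg \<mu> x" for x
      using that unfolding is_Arg_iff by simp
    have no: "\<not> is_Arg \<mu> x" if "0 \<le> x" "x \<le> pi" for x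
    proof
      assume "is_Arg \<mu> x"
      then have "Im \<mu> \<ge> 0" using Im[of x] sin_ge_zero[OF that] by simp
      then show False using 1 by simp
    qed
    have th: "\<theta> = pi / 2" if u: "MB_upper_angle_mu \<mu> \<epsilon> \<theta>" for \<epsilon> \<theta>
    proof -
      have "\<not> (\<exists>\<phi>\<in>{0..<pi/2}. is_Arg \<mu> \<phi>)" "\<not> (\<exists>\<phi>\<in>{pi/2<..pi}. is_Arg \<mu> \<phi>)"
        using no pi_gt_zero by auto
      then show ?thesis using u unfolding MB_upper_angle_mu_def by blast
    qed
    show ?thesis
    proof (rule that[of "pi / 2"])
      have "\<theta> \<in> {0<..<pi} \<and> (\<forall>\<psi>\<in>closed_segment (pi / 2) \<theta>. \<psi> \<in> {0<..<pi} \<and> Re (\<mu> * cis \<psi>) > 0)"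
        if "MB_upper_angle_mu \<mu> \<epsilon> \<theta>" for \<epsilon> \<theta>
        unfolding th[OF that] using 1 pi_gt_zero by simp
      then show "\<forall>\<^sub>F \<epsilon> in at_right 0. \<forall>\<theta>. MB_upper_angle_mu \<mu> \<epsilon> \<theta> \<longrightarrow> \<theta> \<in> {0<..<pi} \<and> (\<forall>\<psi>\<in>closed_segment (pi / 2) \<theta>. \<psi> \<in> {0<..<pi} \<and> Re (\<mu> * cis \<psi>) > 0)"
        by (intro always_eventually allI impI)
    qed (use pi_gt_zero in auto)
  next
    case 2
    \<comment> \<open>Midpoint of 3 pi / 2 - x, beyond which Re (\<mu> cis \<psi>) is positive, and
      pi. The table angle pi - \<epsilon> approaches pi, so decay is needed all the way from \<phi>
      towards pi.\<close>
    define \<phi> where "\<phi> = 5 * pi / 4 - x / 2"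
    have \<phi>: "pi / 2 \<le> \<phi>" "\<phi> < pi" using 2 pi_gt_zero by (auto simp: \<phi>_def)
    have pos: "Re (\<mu> * cis \<psi>) > 0" if "\<phi> \<le> \<psi>" "\<psi> < pi" for \<psi>
    proof -
      have e: "Re (\<mu> * cis \<psi>) = cmod \<mu> * cos (x + \<psi>)"
        using 2(2) unfolding is_Arg_iff by (simp add: cos_add algebra_simps)
      have "cos (x + \<psi> - 2 * pi) > 0"
        using that 2 \<phi> by (intro cos_gt_zero_pi) (auto simp: \<phi>_def field_simps)
      then have "cos (x + \<psi>) > 0" using cos_periodic[of "x + \<psi> - 2 * pi"] by simp
      then show ?thesis unfolding e using \<open>\<mu> \<noteq> 0\<close> by simp
    qed
    have "0 \<le> Im \<mu>"
    proof -
      have "Im \<mu> = cmod \<mu> * sin x" using 2(2) unfolding is_Arg_iff by blast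
      moreover have "sin x \<ge> 0" using 2 pi_gt_zero by (intro sin_ge_zero) auto
      ultimately show ?thesis by simp
    qed
    then have th: "\<theta> = pi - \<epsilon>" if u: "MB_upper_angle_mu \<mu> \<epsilon> \<theta>" for \<epsilon> \<theta>
    proof -
      have "\<not> (\<exists>\<phi>\<in>{0..<pi/2}. is_Arg \<mu> \<phi>)" using uniq[OF _ 2(2)] 2(1) by auto
      then show ?thesis using u \<open>0 \<le> Im \<mu>\<close> unfolding MB_upper_angle_mu_def by auto
    qed
    show ?thesis
    proof (rule that[OF \<phi>])
      show "\<forall>\<^sub>F \<epsilon> in at_right 0. \<forall>\<theta>. MB_upper_angle_mu \<mu> \<epsilon> \<theta> \<longrightarrow> \<theta> \<in> {0<..<pi} \<and> (\<forall>\<psi>\<in>closed_segment \<phi> \<theta>. \<psi> \<in> {0<..<pi} \<and> Re (\<mu> * cis \<psi>) > 0)"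
      proof (rule eventually_mono[OF small[of "pi - \<phi>"]])
        show "0 < pi - \<phi>" using \<phi> by simp
        fix \<epsilon> assume "0 < \<epsilon> \<and> \<epsilon> < pi - \<phi>"
        then have e: "0 < \<epsilon>" "\<phi> \<le> pi - \<epsilon>" by auto
        show "\<forall>\<theta>. MB_upper_angle_mu \<mu> \<epsilon> \<theta> \<longrightarrow> \<theta> \<in> {0<..<pi} \<and> (\<forall>\<psi>\<in>closed_segment \<phi> \<theta>. \<psi> \<in> {0<..<pi} \<and> Re (\<mu> * cis \<psi>) > 0)"
        proof (intro allI impI)
          fix \<theta> assume "MB_upper_angle_mu \<mu> \<epsilon> \<theta>"
          then have \<theta>: "\<theta> = pi - \<epsilon>" by (rule th)
          show "\<theta> \<in> {0<..<pi} \<and> (\<forall>\<psi>\<in>closed_segment \<phi> \<theta>. \<psi> \<in> {0<..<pi} \<and> Re (\<mu> * cis \<psi>) > 0)"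
            using e \<phi> pos pi_gt_zero unfolding \<theta> by (auto simp: closed_segment_eq_real_ivl)
        qed
      qed
    qed
  qed
qed

text \<open>Conjugation exchanges the half-planes and negates arguments, so the lower ray is reduced
  to the upper one.\<close>

lemma MB_lower_angle_mu_cnj: "MB_lower_angle_mu \<mu> \<epsilon> \<theta> \<longleftrightarrow> MB_upper_angle_mu (cnj \<mu>) \<epsilon> (- \<theta>)"
proof -
  have i: "{- pi/2<..0} = uminus ` {0..<pi/2}" "{- pi..<- pi/2} = uminus ` {pi/2<..pi}" by simp_all
  have c: "is_Arg (cnj \<mu>) x \<longleftrightarrow> is_Arg \<mu> (- x)" for x
    unfolding is_Arg_iff by auto
  have 1: "(\<exists>\<phi>\<in>{0..<pi/2}. is_Arg (cnj \<mu>) \<phi>) \<longleftrightarrow> (\<exists>\<phi>\<in>{- pi/2<..0}. is_Arg \<mu> \<phi>)"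
    "(\<exists>\<phi>\<in>{pi/2<..pi}. is_Arg (cnj \<mu>) \<phi>) \<longleftrightarrow> (\<exists>\<phi>\<in>{- pi..<- pi/2}. is_Arg \<mu> \<phi>)"
    unfolding i bex_simps c by (rule refl)+
  show ?thesis
    unfolding MB_lower_angle_mu_def MB_upper_angle_mu_def 1 by (auto simp: neg_equal_iff_equal)
qed

lemma MB_lower_angle_mu_cases:
  assumes ev: "\<forall>\<^sub>F \<epsilon> in at_right 0. \<exists>\<theta>\<le>-pi/2. MB_lower_angle_mu \<mu> \<epsilon> \<theta>" and "\<mu> \<noteq> 0"
  obtains \<phi> where "- pi < \<phi>" "\<phi> \<le> - pi / 2"
    "\<forall>\<^sub>F \<epsilon> in at_right 0. \<forall>\<theta>. MB_lower_angle_mu \<mu> \<epsilon> \<theta> \<longrightarrow> \<theta> \<in> {-pi<..<0} \<and> (\<forall>\<psi>\<in>closed_segment \<phi> \<theta>. \<psi> \<in> {-pi<..<0} \<and> Re (\<mu> * cis \<psi>) > 0)"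
proof -
  have "\<forall>\<^sub>F \<epsilon> in at_right 0. \<exists>\<theta>\<ge>pi/2. MB_upper_angle_mu (cnj \<mu>) \<epsilon> \<theta>"
    using ev
  proof (rule eventually_mono)
    fix \<epsilon> assume "\<exists>\<theta>\<le>-pi/2. MB_lower_angle_mu \<mu> \<epsilon> \<theta>"
    then obtain \<theta> where "\<theta> \<le> - pi / 2" "MB_upper_angle_mu (cnj \<mu>) \<epsilon> (- \<theta>)"
      unfolding MB_lower_angle_mu_cnj by blast
    then show "\<exists>\<theta>\<ge>pi/2. MB_upper_angle_mu (cnj \<mu>) \<epsilon> \<theta>" by (intro exI[of _ "- \<theta>"]) simp
  qed
  moreover have "cnj \<mu> \<noteq> 0" using \<open>\<mu> \<noteq> 0\<close> by simp
  ultimately obtain \<phi> where \<phi>: "pi / 2 \<le> \<phi>" "\<phi> < pi"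
    "\<forall>\<^sub>F \<epsilon> in at_right 0. \<forall>\<theta>. MB_upper_angle_mu (cnj \<mu>) \<epsilon> \<theta> \<longrightarrow> \<theta> \<in> {0<..<pi} \<and> (\<forall>\<psi>\<in>closed_segment \<phi> \<theta>. \<psi> \<in> {0<..<pi} \<and> Re (cnj \<mu> * cis \<psi>) > 0)"
    by (rule MB_upper_angle_mu_cases)
  have seg: "- \<psi> \<in> closed_segment \<phi> (- \<theta>)" if "\<psi> \<in> closed_segment (- \<phi>) \<theta>" for \<psi> \<theta> :: real
    using that by (auto simp: closed_segment_eq_real_ivl split: if_splits)
  have re: "Re (\<mu> * cis \<psi>) = Re (cnj \<mu> * cis (- \<psi>))" for \<psi> by simp
  show ?thesis
  proof (rule that[of "- \<phi>"])
    show "\<forall>\<^sub>F \<epsilon> in at_right 0. \<forall>\<theta>. MB_lower_angle_mu \<mu> \<epsilon> \<theta> \<longrightarrow> \<theta> \<in> {-pi<..<0} \<and> (\<forall>\<psi>\<in>closed_segment (- \<phi>) \<theta>. \<psi> \<in> {-pi<..<0} \<and> Re (\<mu> * cis \<psi>) > 0)"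
      using \<phi>(3)
    proof (rule eventually_mono, intro allI impI)
      fix \<epsilon> \<theta> assume *: "\<forall>\<theta>. MB_upper_angle_mu (cnj \<mu>) \<epsilon> \<theta> \<longrightarrow> \<theta> \<in> {0<..<pi} \<and> (\<forall>\<psi>\<in>closed_segment \<phi> \<theta>. \<psi> \<in> {0<..<pi} \<and> Re (cnj \<mu> * cis \<psi>) > 0)"
        and "MB_lower_angle_mu \<mu> \<epsilon> \<theta>"
      then have "- \<theta> \<in> {0<..<pi}" and **: "\<And>\<psi>. \<psi> \<in> closed_segment \<phi> (- \<theta>) \<Longrightarrow> \<psi> \<in> {0<..<pi} \<and> Re (cnj \<mu> * cis \<psi>) > 0"
        by (auto simp: MB_lower_angle_mu_cnj)
      moreover have "\<psi> \<in> {-pi<..<0} \<and> Re (\<mu> * cis \<psi>) > 0" if "\<psi> \<in> closed_segment (- \<phi>) \<theta>" for \<psi>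
        using **[OF seg[OF that]] unfolding re by auto
      ultimately show "\<theta> \<in> {-pi<..<0} \<and> (\<forall>\<psi>\<in>closed_segment (- \<phi>) \<theta>. \<psi> \<in> {-pi<..<0} \<and> Re (\<mu> * cis \<psi>) > 0)"
        by auto
    qed
  qed (use \<phi> in auto)
qed

text \<open>The points \<open>w\<close> on which the \<open>K\<close>-function is analysed.\<close>
definition MB_domain :: "nat \<Rightarrow> nat \<Rightarrow> nat \<Rightarrow> nat \<Rightarrow> (nat \<Rightarrow> complex) \<Rightarrow> (nat \<Rightarrow> complex) \<Rightarrow> real \<Rightarrow> complex \<Rightarrow> complex set" where
  "MB_domain m n p q a b \<tau> \<alpha> =
     (if MB_in_case Case_VII m n p q a b \<alpha> then {w. Im w = 0 \<and> Re w < 0} else {w. Im w \<in> MB_args m n p q a b \<tau> \<alpha>})"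

text \<open>\<open>decay_rate F \<phi> w\<close>: \<open>F s * exp (- s * w)\<close> decays exponentially in a sector around the direction \<open>\<phi>\<close>.\<close>
definition decay_rate :: "(complex \<Rightarrow> complex) \<Rightarrow> real \<Rightarrow> complex \<Rightarrow> bool" where
  "decay_rate F \<phi> w \<longleftrightarrow> (\<exists>\<kappa>. \<kappa> > - cos \<phi> * Re w + sin \<phi> * Im w \<and> decays F \<phi> \<kappa>)"

lemma decay_rate_if_decays: "(\<And>\<kappa>. decays F \<phi> \<kappa>) \<Longrightarrow> decay_rate F \<phi> w"
  unfolding decay_rate_def by (intro exI[of _ "- cos \<phi> * Re w + sin \<phi> * Im w + 1"]) simp

section \<open>Contours\<close>

text \<open>The piece of the curve over [u, v], reparametrised by the unit interval so that path
  integrals and the residue theorem apply.\<close>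

definition seg :: "(real \<Rightarrow> complex) \<Rightarrow> real \<Rightarrow> real \<Rightarrow> real \<Rightarrow> complex" where
  "seg \<gamma> u v = (\<lambda>x. \<gamma> ((v - u) * x + u))"

lemma valid_path_seg:
  assumes "\<gamma> piecewise_C1_differentiable_on UNIV"
  shows "valid_path (seg \<gamma> u v)"
proof -
  have "(\<gamma> \<circ> (\<lambda>x. (v - u) *\<^sub>R x + u)) piecewise_C1_differentiable_on {0..1}"
    by (rule piecewise_C1_differentiable_affine[OF piecewise_C1_differentiable_on_subset[OF assms subset_UNIV]])
  then show ?thesis by (simp add: valid_path_def seg_def o_def)
qed

lemma pathstart_seg [simp]: "pathstart (seg \<gamma> u v) = \<gamma> u"
  and pathfinish_seg [simp]: "pathfinish (seg \<gamma> u v) = \<gamma> v"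
  by (simp_all add: seg_def pathstart_def pathfinish_def)

lemma path_image_seg:
  assumes "u < v"
  shows "path_image (seg \<gamma> u v) = \<gamma> ` {u..v}"
proof -
  have "(\<lambda>x. (v - u) * x + u) ` {0..1} = {u..v}"
    using assms by (subst image_affinity_atLeastAtMost) auto
  moreover have "path_image (seg \<gamma> u v) = \<gamma> ` ((\<lambda>x. (v - u) * x + u) ` {0..1})"
    by (simp only: path_image_def seg_def image_image)
  ultimately show ?thesis by (simp only:)
qed

text \<open>Affine substitution; the finitely many parameters without derivative do not affect the
  integral. This links the parameter integrals in the definition of K with path integrals.\<close>

lemma has_contour_integral_seg:
  assumes \<gamma>: "\<gamma> piecewise_C1_differentiable_on UNIV" and uv: "u < v"
  shows "(f has_contour_integral I) (seg \<gamma> u v) \<longleftrightarrow>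
    ((\<lambda>t. f (\<gamma> t) * vector_derivative \<gamma> (at t)) has_integral I) {u..v}"
proof -
  define m where "m = v - u"
  have m: "m > 0" using uv by (simp add: m_def)
  define h where "h = (\<lambda>t. f (\<gamma> t) * vector_derivative \<gamma> (at t))"
  obtain S where S: "finite S" "\<gamma> C1_differentiable_on (UNIV - S)"
    using \<gamma> unfolding piecewise_C1_differentiable_on_def by blast
  define S' where "S' = (\<lambda>t. (t - u) / m) ` S"
  have S': "finite S'" using S by (simp add: S'_def)
  have vd: "vector_derivative (seg \<gamma> u v) (at x) = of_real m * vector_derivative \<gamma> (at (m * x + u))" if "x \<notin> S'" for x
  proof -
    have "m * x + u \<notin> S"
    proof
      assume "m * x + u \<in> S"
      then have "((m * x + u) - u) / m \<in> S'" unfolding S'_def by blast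
      then show False using that m by simp
    qed
    then have "\<gamma> differentiable at (m * x + u)" using S(2) by (auto simp: C1_differentiable_on_eq)
    then have 1: "(\<gamma> has_vector_derivative vector_derivative \<gamma> (at (m * x + u))) (at (m * x + u))"
      by (simp add: vector_derivative_works)
    have 2: "((\<lambda>x. m * x + u) has_vector_derivative m) (at x)"
      by (auto intro!: derivative_eq_intros simp: has_real_derivative_iff_has_vector_derivative[symmetric])
    have "((\<gamma> \<circ> (\<lambda>x. m * x + u)) has_vector_derivative m *\<^sub>R vector_derivative \<gamma> (at (m * x + u))) (at x)"
      by (rule vector_diff_chain_at[OF 2 1])
    then show ?thesis unfolding seg_def m_def[symmetric] o_def
      by (simp add: vector_derivative_at scaleR_conv_of_real)
  qed
  have "(f has_contour_integral I) (seg \<gamma> u v) \<longleftrightarrow>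
      ((\<lambda>x. f (seg \<gamma> u v x) * vector_derivative (seg \<gamma> u v) (at x)) has_integral I) {0..1}"
    by (rule has_contour_integral)
  also have "\<dots> \<longleftrightarrow> ((\<lambda>x. m *\<^sub>R h (m *\<^sub>R x + u)) has_integral I) {0..1}"
  proof (rule has_integral_spike_finite_eq[OF S'])
    fix x assume "x \<in> {0..1} - S'"
    then show "m *\<^sub>R h (m *\<^sub>R x + u) = f (seg \<gamma> u v x) * vector_derivative (seg \<gamma> u v) (at x)"
      using vd[of x] by (simp add: h_def seg_def m_def[symmetric] scaleR_conv_of_real)
  qed
  also have "\<dots> \<longleftrightarrow> ((\<lambda>x. h (m *\<^sub>R x + u)) has_integral (I /\<^sub>R m ^ DIM(real))) {0..1}"
    using has_integral_cmul_iff[of m "\<lambda>x. h (m *\<^sub>R x + u)" "I /\<^sub>R m ^ DIM(real)" "{0..1}"] m by simp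
  also have "{0..1} = cbox ((u - u) /\<^sub>R m) ((v - u) /\<^sub>R m)" using m by (simp add: m_def)
  also have "((\<lambda>x. h (m *\<^sub>R x + u)) has_integral (I /\<^sub>R m ^ DIM(real))) (cbox ((u - u) /\<^sub>R m) ((v - u) /\<^sub>R m)) \<longleftrightarrow> (h has_integral I) (cbox u v)"
    by (rule has_integral_affinity_iff[OF m])
  finally show ?thesis by (simp add: h_def)
qed

section \<open>Curves that end in two rays\<close>

lemma winding_number_zero_unbounded:
  assumes "path g" "pathfinish g = pathstart g" "connected T" "\<not> bounded T" "p \<in> T" "T \<inter> path_image g = {}"
  shows "winding_number g p = 0"
proof (rule winding_number_zero_in_outside[OF assms(1,2)])
  have "T \<subseteq> connected_component_set (- path_image g) p"
    using assms by (intro connected_component_maximal) auto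
  then have "\<not> bounded (connected_component_set (- path_image g) p)"
    using assms(4) bounded_subset by blast
  then show "p \<in> outside (path_image g)" using assms(5,6) unfolding outside_def by blast
qed

lemma Arg_add_of_real_small:
  fixes c :: complex
  assumes "\<eta> > 0"
  shows "\<forall>\<^sub>F t in at_top. t > 0 \<and> \<bar>Arg (c + of_real t)\<bar> < \<eta>"
proof -
  have "((\<lambda>t::real. 1 / t) \<longlongrightarrow> 0) at_top" by real_asymp
  from tendsto_of_real[OF this, where 'a=complex] have "((\<lambda>t::real. 1 + c * of_real (1 / t)) \<longlongrightarrow> 1 + c * of_real 0) at_top"
    by (rule tendsto_add[OF tendsto_const tendsto_mult[OF tendsto_const]])
  moreover have "isCont Arg (1::complex)" by (intro continuous_at_Arg) (auto simp: complex_nonpos_Reals_iff)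
  ultimately have "((\<lambda>t::real. Arg (1 + c * of_real (1 / t))) \<longlongrightarrow> Arg 1) at_top"
    by (intro isCont_tendsto_compose[of _ Arg]) simp_all
  then have "\<forall>\<^sub>F t in at_top. \<bar>Arg (1 + c * of_real (1 / t))\<bar> < \<eta>"
    using tendstoD[OF _ assms, of _ "Arg 1"] Arg_eq_0[of 1] by (simp add: dist_real_def)
  then show ?thesis using eventually_gt_at_top[of 0]
  proof eventually_elim
    case (elim t)
    have "c + of_real t = of_real t * (1 + c * of_real (1 / t))" using elim by (simp add: field_simps)
    then have "Arg (c + of_real t) = Arg (1 + c * of_real (1 / t))" using elim by (simp only: Arg_times_of_real)
    then show ?case using elim by simp
  qed
qed

text \<open>Rotation by - \<theta> reduces the claim to the fact that the argument of c + t tends to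
  0. A shifted ray thus has polar angles close to \<theta>, where a bound in a sector can be
  used.\<close>

lemma ray_polar:
  assumes "\<eta> > 0"
  shows "\<forall>\<^sub>F t in at_top. t > 0 \<and> (\<exists>\<alpha>. \<bar>\<alpha> - \<theta>\<bar> < \<eta> \<and> c + of_real t * cis \<theta> = of_real (cmod (c + of_real t * cis \<theta>)) * cis \<alpha>)"
  using Arg_add_of_real_small[OF assms, of "c * cis (- \<theta>)"]
proof eventually_elim
  case (elim t)
  define w where "w = c * cis (- \<theta>) + of_real t"
  have e: "c + of_real t * cis \<theta> = w * cis \<theta>"
    by (simp add: w_def distrib_right mult.assoc cis_mult)
  have "w = of_real (cmod w) * cis (Arg w)" by (simp only: rcis_def[symmetric] rcis_cmod_Arg)
  then have "w * cis \<theta> = (of_real (cmod w) * cis (Arg w)) * cis \<theta>" by (rule arg_cong)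
  also have "\<dots> = of_real (cmod w) * cis (Arg w + \<theta>)" by (simp only: mult.assoc cis_mult)
  finally have "w * cis \<theta> = of_real (cmod w) * cis (Arg w + \<theta>)" .
  then have "w * cis \<theta> = of_real (cmod (w * cis \<theta>)) * cis (Arg w + \<theta>)" by (simp add: norm_mult)
  then show ?case using elim unfolding e by (intro conjI exI[of _ "Arg w + \<theta>"]) (auto simp: w_def)
qed

text \<open>The square of the modulus is |c|^2 + 2 s x + s^2 with |x| <= |c|, which increases for s
  >= |c|.\<close>

lemma norm_ray_mono:
  assumes "cmod c \<le> s" "s \<le> t"
  shows "cmod (c + of_real s * cis \<theta>) \<le> cmod (c + of_real t * cis \<theta>)"
proof (rule power2_le_imp_le)
  define x where "x = Re c * cos \<theta> + Im c * sin \<theta>"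
  have sq: "(cmod (c + of_real u * cis \<theta>))\<^sup>2 = (cmod c)\<^sup>2 + 2 * u * x + u\<^sup>2" for u
  proof -
    have "(cmod (c + of_real u * cis \<theta>))\<^sup>2 = (Re c + u * cos \<theta>)\<^sup>2 + (Im c + u * sin \<theta>)\<^sup>2" by (simp add: cmod_power2)
    also have "\<dots> = (Re c)\<^sup>2 + (Im c)\<^sup>2 + 2 * u * x + u\<^sup>2 * ((cos \<theta>)\<^sup>2 + (sin \<theta>)\<^sup>2)"
    proof -
      have "(e + u * a)\<^sup>2 + (f + u * b)\<^sup>2 = e\<^sup>2 + f\<^sup>2 + 2 * u * (e * a + f * b) + u\<^sup>2 * (a\<^sup>2 + b\<^sup>2)" for a b e f :: real
        by (simp add: power2_eq_square algebra_simps)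
      then show ?thesis unfolding x_def .
    qed
    finally show ?thesis by (simp add: cmod_power2)
  qed
  have "x = Re (c * cis (- \<theta>))" by (simp add: x_def)
  then have "\<bar>x\<bar> \<le> cmod c" using abs_Re_le_cmod[of "c * cis (- \<theta>)"] by (simp add: norm_mult)
  then have "0 \<le> (t - s) * (2 * x + t + s)" using assms by (intro mult_nonneg_nonneg) linarith+
  then show "(cmod (c + of_real s * cis \<theta>))\<^sup>2 \<le> (cmod (c + of_real t * cis \<theta>))\<^sup>2"
    unfolding sq by (simp add: power2_eq_square algebra_simps)
qed simp

text \<open>T exceeds |cp| and |cm| so that the modulus is monotone along both ends. The piece
  between the two cuts by a large circle therefore stays in the disc.\<close>

locale ray_curve =
  fixes \<gamma> :: "real \<Rightarrow> complex" and \<theta>p \<theta>m :: real and cp cm :: complex and T :: real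
  assumes PC1: "\<gamma> piecewise_C1_differentiable_on UNIV"
    and T: "T > 0" "T \<ge> cmod cp" "T \<ge> cmod cm"
    and ray_p: "\<And>t. t \<ge> T \<Longrightarrow> \<gamma> t = cp + of_real t * cis \<theta>p"
    and ray_m: "\<And>t. t \<ge> T \<Longrightarrow> \<gamma> (- t) = cm + of_real t * cis \<theta>m"
    and \<theta>p: "0 < \<theta>p" "\<theta>p < pi" and \<theta>m: "- pi < \<theta>m" "\<theta>m < 0"
begin

lemma cont: "continuous_on A \<gamma>"
  using PC1 continuous_on_subset unfolding piecewise_C1_differentiable_on_def by blast

text \<open>\<open>cut \<rho> t1 t2 \<alpha> \<beta>\<close>: the circle of radius \<open>\<rho>\<close> cuts the rays at the parameters \<open>t1\<close> and \<open>- t2\<close>,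
  at the angles \<open>\<alpha>\<close> and \<open>\<beta>\<close>.\<close>
definition cut :: "real \<Rightarrow> real \<Rightarrow> real \<Rightarrow> real \<Rightarrow> real \<Rightarrow> real \<Rightarrow> bool" where
  "cut \<eta> \<rho> t1 t2 \<alpha> \<beta> \<longleftrightarrow> t1 \<ge> T \<and> t2 \<ge> T \<and> t1 \<ge> \<rho> - T \<and> t2 \<ge> \<rho> - T \<and> \<gamma> t1 = of_real \<rho> * cis \<alpha> \<and> \<gamma> (- t2) = of_real \<rho> * cis \<beta>
     \<and> \<bar>\<alpha> - \<theta>p\<bar> < \<eta> \<and> \<bar>\<beta> - \<theta>m\<bar> < \<eta> \<and> (\<forall>t\<in>{- t2..t1}. cmod (\<gamma> t) \<le> \<rho>)"

text \<open>The intermediate value theorem yields a point of modulus \<rho> on each end;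
  monotonicity of the modulus keeps the piece in between inside the disc. The lower bound \<rho> - T
  for the parameters makes these pieces exhaust the curve.\<close>

lemma cut_exists:
  assumes "\<eta> > 0"
  shows "\<exists>\<rho>0>0. \<forall>\<rho>\<ge>\<rho>0. \<exists>t1 t2 \<alpha> \<beta>. cut \<eta> \<rho> t1 t2 \<alpha> \<beta>"
proof -
  obtain T1 where T1: "\<forall>t\<ge>T1. t > 0 \<and> (\<exists>\<alpha>. \<bar>\<alpha> - \<theta>p\<bar> < \<eta> \<and> cp + of_real t * cis \<theta>p = of_real (cmod (cp + of_real t * cis \<theta>p)) * cis \<alpha>)"
    using ray_polar[OF assms, of \<theta>p cp] unfolding eventually_at_top_linorder ..
  obtain T2 where T2: "\<forall>t\<ge>T2. t > 0 \<and> (\<exists>\<alpha>. \<bar>\<alpha> - \<theta>m\<bar> < \<eta> \<and> cm + of_real t * cis \<theta>m = of_real (cmod (cm + of_real t * cis \<theta>m)) * cis \<alpha>)"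
    using ray_polar[OF assms, of \<theta>m cm] unfolding eventually_at_top_linorder ..
  define T3 where "T3 = max T (max T1 T2)"
  have "compact (\<gamma> ` {- T3..T3})" by (intro compact_continuous_image cont) simp
  then have "bounded (\<gamma> ` {- T3..T3})" by (rule compact_imp_bounded)
  then obtain B where "\<forall>x\<in>\<gamma> ` {- T3..T3}. cmod x \<le> B" unfolding bounded_iff ..
  then have B: "cmod (\<gamma> t) \<le> B" if "t \<in> {- T3..T3}" for t using that by blast
  have T3: "T3 \<ge> T" "T3 > 0" "T3 \<ge> T1" "T3 \<ge> T2" using T by (auto simp: T3_def)
  define \<rho>0 where "\<rho>0 = max (max 1 B) T3"
  show ?thesis
  proof (rule exI[of _ \<rho>0], intro conjI allI impI)
    show "\<rho>0 > 0" by (simp add: \<rho>0_def)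
    fix \<rho> assume \<rho>: "\<rho> \<ge> \<rho>0"
    have ivt: "\<exists>t\<ge>T3. cmod (c + of_real t * cis \<theta>) = \<rho>"
      if c: "cmod c \<le> T" "cmod (c + of_real T3 * cis \<theta>) \<le> \<rho>" for c \<theta>
    proof -
      let ?f = "\<lambda>t. cmod (c + of_real t * cis \<theta>)"
      have "cmod (of_real (\<rho> + T) * cis \<theta>) - cmod c \<le> ?f (\<rho> + T)"
        using norm_diff_ineq[of "of_real (\<rho> + T) * cis \<theta>" c] by (simp add: add.commute)
      moreover have "cmod (of_real (\<rho> + T) * cis \<theta>) = \<rho> + T" using \<rho> T by (simp add: norm_mult \<rho>0_def del: of_real_add)
      ultimately have "\<rho> \<le> ?f (\<rho> + T)" using c(1) by linarith
      moreover have "T3 \<le> \<rho> + T" using \<rho> T by (simp add: \<rho>0_def)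
      moreover have "continuous_on {T3..\<rho> + T} ?f" by (intro continuous_intros)
      ultimately show ?thesis using IVT'[of ?f T3 \<rho> "\<rho> + T"] c(2) by auto
    qed
    have B\<rho>: "cmod (\<gamma> t) \<le> \<rho>" if "t \<in> {- T3..T3}" for t using B[OF that] \<rho> by (simp add: \<rho>0_def)
    have "cmod (cp + of_real T3 * cis \<theta>p) \<le> \<rho>" using B\<rho>[of T3] ray_p[of T3] T3 by simp
    then obtain t1 where t1: "t1 \<ge> T3" "cmod (cp + of_real t1 * cis \<theta>p) = \<rho>" using ivt[OF T(2)] by blast
    have "cmod (cm + of_real T3 * cis \<theta>m) \<le> \<rho>" using B\<rho>[of "- T3"] ray_m[of T3] T3 by simp
    then obtain t2 where t2: "t2 \<ge> T3" "cmod (cm + of_real t2 * cis \<theta>m) = \<rho>" using ivt[OF T(3)] by blast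
    obtain \<alpha> where \<alpha>: "\<bar>\<alpha> - \<theta>p\<bar> < \<eta>" "\<gamma> t1 = of_real \<rho> * cis \<alpha>" 
    proof -
      have "T1 \<le> t1" "T \<le> t1" using t1 T3 by linarith+
      then show ?thesis using T1[rule_format, of t1] t1(2) ray_p[of t1] that by auto
    qed
    obtain \<beta> where \<beta>: "\<bar>\<beta> - \<theta>m\<bar> < \<eta>" "\<gamma> (- t2) = of_real \<rho> * cis \<beta>" 
    proof -
      have "T2 \<le> t2" "T \<le> t2" using t2 T3 by linarith+
      then show ?thesis using T2[rule_format, of t2] t2(2) ray_m[of t2] that by auto
    qed
    have "\<rho> \<le> cmod cp + t1" using norm_triangle_ineq[of cp "of_real t1 * cis \<theta>p"] t1 T3 by (simp add: norm_mult)
    moreover have "\<rho> \<le> cmod cm + t2" using norm_triangle_ineq[of cm "of_real t2 * cis \<theta>m"] t2 T3 by (simp add: norm_mult)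
    moreover have "cmod (\<gamma> t) \<le> \<rho>" if t: "t \<in> {- t2..t1}" for t
    proof -
      consider "t \<in> {- T3..T3}" | "t > T3" | "t < - T3" by force
      then show ?thesis
      proof cases
        case 1 then show ?thesis by (rule B\<rho>)
      next
        case 2
        then have "cmod (\<gamma> t) = cmod (cp + of_real t * cis \<theta>p)" using ray_p[of t] T3 by simp
        also have "\<dots> \<le> cmod (cp + of_real t1 * cis \<theta>p)" using 2 t T3 T by (intro norm_ray_mono) auto
        finally show ?thesis using t1 by simp
      next
        case 3
        then have "cmod (\<gamma> t) = cmod (cm + of_real (- t) * cis \<theta>m)" using ray_m[of "- t"] T3 by simp
        also have "\<dots> \<le> cmod (cm + of_real t2 * cis \<theta>m)" using 3 t T3 T by (intro norm_ray_mono) auto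
        finally show ?thesis using t2 by simp
      qed
    qed
    ultimately show "\<exists>t1 t2 \<alpha> \<beta>. cut \<eta> \<rho> t1 t2 \<alpha> \<beta>"
      using t1 t2 T3 \<alpha> \<beta> T unfolding cut_def by (intro exI[of _ t1] exI[of _ t2] exI[of _ \<alpha>] exI[of _ \<beta>]) auto
  qed
qed

text \<open>The end rays have nonzero sine and leave every horizontal strip, so the curve meets the
  strip of the poles only in a bounded part.\<close>

lemma strip_bounded:
  obtains X where "X > 0" "\<And>t. \<bar>Im (\<gamma> t)\<bar> \<le> H \<Longrightarrow> \<bar>Re (\<gamma> t)\<bar> < X"
proof -
  have sp: "sin \<theta>p > 0" using \<theta>p by (intro sin_gt_zero) auto
  have "sin (- \<theta>m) > 0" using \<theta>m by (intro sin_gt_zero) auto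
  then have sm: "sin \<theta>m < 0" by simp
  define T1 where "T1 = T + (\<bar>H\<bar> + cmod cp) / sin \<theta>p + (\<bar>H\<bar> + cmod cm) / (- sin \<theta>m)"
  have q: "(\<bar>H\<bar> + cmod cp) / sin \<theta>p \<ge> 0" "(\<bar>H\<bar> + cmod cm) / (- sin \<theta>m) \<ge> 0" 
    by (intro divide_nonneg_nonneg; use sp sm in simp)+
  have "compact (\<gamma> ` {- T1..T1})" by (intro compact_continuous_image cont) simp
  then have "bounded (\<gamma> ` {- T1..T1})" by (rule compact_imp_bounded)
  then obtain B where "\<forall>x\<in>\<gamma> ` {- T1..T1}. cmod x \<le> B" unfolding bounded_iff ..
  then have B: "cmod (\<gamma> t) \<le> B" if "t \<in> {- T1..T1}" for t using that by blast
  show ?thesis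
  proof (rule that[of "\<bar>B\<bar> + 1"])
    fix t assume t: "\<bar>Im (\<gamma> t)\<bar> \<le> H"
    have "t \<le> T1"
    proof (rule ccontr)
      assume "\<not> t \<le> T1"
      then have a: "t > T1" by simp
      have g: "Im (\<gamma> t) = Im cp + t * sin \<theta>p" using a q by (subst ray_p) (auto simp: T1_def)
      have "(\<bar>H\<bar> + cmod cp) / sin \<theta>p < t" using a q T unfolding T1_def by linarith
      then have "\<bar>H\<bar> + cmod cp < t * sin \<theta>p" using sp by (simp add: pos_divide_less_eq)
      then show False using t g abs_Im_le_cmod[of cp] by linarith
    qed
    moreover have "- T1 \<le> t"
    proof (rule ccontr)
      assume "\<not> - T1 \<le> t"
      then have a: "- t > T1" by simp
      have g: "Im (\<gamma> t) = Im cm + (- t) * sin \<theta>m" using ray_m[of "- t"] a q by (simp add: T1_def)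
      have "(\<bar>H\<bar> + cmod cm) / (- sin \<theta>m) < - t" using a q T unfolding T1_def by linarith
      then have "\<bar>H\<bar> + cmod cm < - t * (- sin \<theta>m)" using sm by (simp add: neg_less_divide_eq)
      then show False using t g abs_Im_le_cmod[of cm] by (simp add: abs_le_iff)
    qed
    ultimately have "cmod (\<gamma> t) \<le> B" using B by auto
    then show "\<bar>Re (\<gamma> t)\<bar> < \<bar>B\<bar> + 1" using abs_Re_le_cmod[of "\<gamma> t"] by linarith
  qed simp
qed

end

section \<open>Loops closed by circular arcs and their winding numbers\<close>

lemma connected_path_subset:
  assumes "open S" "connected S" "x \<in> S" "y \<in> S"
  obtains K where "connected K" "compact K" "x \<in> K" "y \<in> K" "K \<subseteq> (S :: complex set)"
proof -
  have "path_connected S" using assms by (simp add: connected_open_path_connected)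
  then obtain g where g: "path g" "path_image g \<subseteq> S" "pathstart g = x" "pathfinish g = y"
    using assms(3,4) unfolding path_connected_def by blast
  show ?thesis
    using g by (intro that[of "path_image g"]) (auto simp: connected_path_image compact_path_image)
qed

lemma unbounded_half_line:
  fixes d :: real
  assumes "d = 1 \<or> d = - 1"
  shows "\<not> bounded ((\<lambda>t. p + of_real (d * t)) ` {0..}) \<and> connected ((\<lambda>t. p + complex_of_real (d * t)) ` {0..})"
proof
  show "connected ((\<lambda>t. p + complex_of_real (d * t)) ` {0..})"
    by (intro connected_continuous_image continuous_intros) auto
  show "\<not> bounded ((\<lambda>t. p + complex_of_real (d * t)) ` {0..})"
  proof
    assume "bounded ((\<lambda>t. p + complex_of_real (d * t)) ` {0..})"
    then obtain B where B: "\<forall>x\<in>(\<lambda>t. p + complex_of_real (d * t)) ` {0..}. cmod x \<le> B" unfolding bounded_iff ..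
    define t where "t = \<bar>B\<bar> + cmod p + 1"
    have "p + complex_of_real (d * t) \<in> (\<lambda>t. p + complex_of_real (d * t)) ` {0..}"
      by (rule imageI) (simp add: t_def)
    then have "cmod (p + of_real (d * t)) \<le> B" using B by blast
    moreover have "cmod (of_real (d * t)) - cmod p \<le> cmod (p + of_real (d * t))"
      using norm_diff_ineq[of "complex_of_real (d * t)" p] by (simp add: add.commute)
    moreover have "cmod (complex_of_real (d * t)) = t" using assms unfolding norm_of_real abs_mult by (elim disjE) (simp_all add: t_def)
    ultimately show False by (simp add: t_def)
  qed
qed

lemma path_image_arc:
  assumes "a \<le> b"
  shows "path_image (part_circlepath 0 \<rho> a b) = (\<lambda>t. of_real \<rho> * cis t) ` {a..b}"
  unfolding path_image_part_circlepath[OF assms] by (auto simp: cis_conv_exp)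

lemma sin_mono_imp:
  assumes "0 < a" "a < pi" "a \<le> t" "cos t > 0" "t \<le> pi"
  shows "sin a \<le> sin t"
proof -
  have "t < pi / 2"
  proof (rule ccontr)
    assume "\<not> t < pi / 2"
    then have "cos (pi - t) \<ge> 0" using assms by (intro cos_ge_zero) auto
    then show False using assms by simp
  qed
  then show ?thesis using assms by (intro sin_monotone_2pi_le) auto
qed

context ray_curve
begin

text \<open>The tolerance \<eta> keeps the angles of the cuts strictly inside the two half-planes.
  The number g bounds the sines at the four extreme angles from below, so the ends of the arcs have
  |Im| >= \<rho> g and lie above or below the strip of poles for large \<rho>.\<close>

definition arc_gap :: "real \<Rightarrow> real \<Rightarrow> bool" where
  "arc_gap \<eta> g \<longleftrightarrow> 0 < \<eta> \<and> \<eta> < \<theta>p \<and> \<theta>p + \<eta> < pi \<and> \<eta> < - \<theta>m \<and> - \<theta>m + \<eta> < pi \<and> 0 < g \<and>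
     g \<le> sin (\<theta>p - \<eta>) \<and> g \<le> sin (\<theta>p + \<eta>) \<and> g \<le> sin (- \<theta>m - \<eta>) \<and> g \<le> sin (- \<theta>m + \<eta>)"

lemma arc_gap_exists:
  assumes "\<eta>0 > 0"
  obtains \<eta> g where "arc_gap \<eta> g" "\<eta> \<le> \<eta>0"
proof -
  define \<eta> where "\<eta> = min \<eta>0 (min (min \<theta>p (pi - \<theta>p)) (min (- \<theta>m) (pi + \<theta>m)) / 2)"
  define x where "x = min (min \<theta>p (pi - \<theta>p)) (min (- \<theta>m) (pi + \<theta>m))"
  have "x \<le> \<theta>p" "x \<le> pi - \<theta>p" "x \<le> - \<theta>m" "x \<le> pi + \<theta>m"
    unfolding x_def by (simp_all add: min_le_iff_disj)
  moreover from min.cobounded1[of \<eta>0 "x / 2"] min.cobounded2[of \<eta>0 "x / 2"]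
  have "\<eta> \<le> x / 2" "\<eta> \<le> \<eta>0" unfolding \<eta>_def x_def by blast+
  moreover have "0 < \<eta>" using \<theta>p \<theta>m assms by (simp add: \<eta>_def)
  ultimately have \<eta>: "0 < \<eta>" "\<eta> < \<theta>p" "\<theta>p + \<eta> < pi" "\<eta> < - \<theta>m" "- \<theta>m + \<eta> < pi" "\<eta> \<le> \<eta>0"
    using \<theta>p \<theta>m by linarith+
  define g where "g = min (min (sin (\<theta>p - \<eta>)) (sin (\<theta>p + \<eta>))) (min (sin (- \<theta>m - \<eta>)) (sin (- \<theta>m + \<eta>)))"
  have "sin (\<theta>p - \<eta>) > 0" "sin (\<theta>p + \<eta>) > 0" "sin (- \<theta>m - \<eta>) > 0" "sin (- \<theta>m + \<eta>) > 0"
    using \<eta> \<theta>p \<theta>m by (auto intro!: sin_gt_zero)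
  then have "arc_gap \<eta> g" unfolding arc_gap_def using \<eta> by (simp add: g_def min_le_iff_disj)
  then show ?thesis using \<eta> that by blast
qed

text \<open>In the right half-plane the left arc consists of at most two pieces next to its ends,
  where the sine is at least that of the extreme angle. A low horizontal half-line to the right
  therefore misses it.\<close>

lemma left_arc_Im:
  assumes g: "arc_gap \<eta> g" and ab: "\<bar>\<alpha> - \<theta>p\<bar> < \<eta>" "\<bar>\<beta> - \<theta>m\<bar> < \<eta>" and \<rho>: "\<rho> > 0"
    and s: "s \<in> path_image (part_circlepath 0 \<rho> \<alpha> (\<beta> + 2 * pi))" "Re s > 0"
  shows "\<rho> * g \<le> \<bar>Im s\<bar>"
proof -
  have "\<alpha> \<le> \<beta> + 2 * pi" using g ab unfolding arc_gap_def by linarith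
  then obtain t where t: "s = of_real \<rho> * cis t" "\<alpha> \<le> t" "t \<le> \<beta> + 2 * pi"
    using s(1) unfolding path_image_arc[OF \<open>\<alpha> \<le> _\<close>] by (elim imageE) (simp only: atLeastAtMost_iff)
  have c: "cos t > 0" using s(2) \<rho> unfolding t by (simp add: zero_less_mult_iff)
  have "g \<le> \<bar>sin t\<bar>"
  proof (cases "t \<le> pi")
    case True
    have "sin (\<theta>p - \<eta>) \<le> sin t" using g ab t True c unfolding arc_gap_def by (intro sin_mono_imp) auto
    then show ?thesis using g unfolding arc_gap_def by linarith
  next
    case False
    have "sin (- \<theta>m - \<eta>) \<le> sin (2 * pi - t)" using g ab t False c unfolding arc_gap_def by (intro sin_mono_imp) auto
    then show ?thesis using g unfolding arc_gap_def by simp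
  qed
  then have "\<rho> * g \<le> \<rho> * \<bar>sin t\<bar>" using \<rho> by (intro mult_left_mono) auto
  then show ?thesis using \<rho> unfolding t by (simp add: abs_mult)
qed

lemma right_arc_Im:
  assumes g: "arc_gap \<eta> g" and ab: "\<bar>\<alpha> - \<theta>p\<bar> < \<eta>" "\<bar>\<beta> - \<theta>m\<bar> < \<eta>" and \<rho>: "\<rho> > 0"
    and s: "s \<in> path_image (part_circlepath 0 \<rho> \<beta> \<alpha>)" "Re s < 0"
  shows "\<rho> * g \<le> \<bar>Im s\<bar>"
proof -
  have "\<beta> \<le> \<alpha>" using g ab unfolding arc_gap_def by linarith
  then obtain t where t: "s = of_real \<rho> * cis t" "\<beta> \<le> t" "t \<le> \<alpha>"
    using s(1) unfolding path_image_arc[OF \<open>\<beta> \<le> _\<close>] by (elim imageE) (simp only: atLeastAtMost_iff)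
  have c: "cos t < 0" using s(2) \<rho> unfolding t by (simp add: mult_less_0_iff)
  have "g \<le> \<bar>sin t\<bar>"
  proof (cases "0 \<le> t")
    case True
    have "sin (pi - (\<theta>p + \<eta>)) \<le> sin (pi - t)" using g ab t True c \<theta>p unfolding arc_gap_def by (intro sin_mono_imp) auto
    then show ?thesis using g unfolding arc_gap_def by simp
  next
    case False
    have "sin (pi - (- \<theta>m + \<eta>)) \<le> sin (pi + t)" using g ab t False c \<theta>m unfolding arc_gap_def by (intro sin_mono_imp) auto
    then show ?thesis using g unfolding arc_gap_def by (simp add: sin_diff sin_add)
  qed
  then have "\<rho> * g \<le> \<rho> * \<bar>sin t\<bar>" using \<rho> by (intro mult_left_mono) auto
  then show ?thesis using \<rho> unfolding t by (simp add: abs_mult)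
qed

text \<open>The cut curve closed through the angle pi, so that it runs counterclockwise around the
  poles on the left. \<open>right_loop\<close> closes the same piece through the angle 0 instead;
  the two loops differ by the full circle.\<close>

definition left_loop :: "real \<Rightarrow> real \<Rightarrow> real \<Rightarrow> real \<Rightarrow> real \<Rightarrow> real \<Rightarrow> complex" where
  "left_loop \<rho> t1 t2 \<alpha> \<beta> = seg \<gamma> (- t2) t1 +++ part_circlepath 0 \<rho> \<alpha> (\<beta> + 2 * pi)"

definition right_loop :: "real \<Rightarrow> real \<Rightarrow> real \<Rightarrow> real \<Rightarrow> real \<Rightarrow> real \<Rightarrow> complex" where
  "right_loop \<rho> t1 t2 \<alpha> \<beta> = seg \<gamma> (- t2) t1 +++ reversepath (part_circlepath 0 \<rho> \<beta> \<alpha>)"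

lemma cis_shift_2pi: "cis (\<beta> + 2 * pi) = cis \<beta>"
  by (simp add: complex_eq_iff)

lemma arc_ends:
  "pathstart (part_circlepath 0 \<rho> a b) = of_real \<rho> * cis a" "pathfinish (part_circlepath 0 \<rho> a b) = of_real \<rho> * cis b"
  by (simp_all add: cis_conv_exp)

context
  fixes \<eta> g \<rho> t1 t2 \<alpha> \<beta>
  assumes gap: "arc_gap \<eta> g" and cut: "cut \<eta> \<rho> t1 t2 \<alpha> \<beta>" and \<rho>: "\<rho> > 0"
begin

lemma cut_facts:
  shows "- t2 < t1" "\<gamma> t1 = of_real \<rho> * cis \<alpha>" "\<gamma> (- t2) = of_real \<rho> * cis \<beta>"
    "\<bar>\<alpha> - \<theta>p\<bar> < \<eta>" "\<bar>\<beta> - \<theta>m\<bar> < \<eta>" "\<alpha> < \<beta> + 2 * pi" "\<beta> < \<alpha>"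
proof -
  have c: "t1 \<ge> T" "t2 \<ge> T" "\<gamma> t1 = of_real \<rho> * cis \<alpha>" "\<gamma> (- t2) = of_real \<rho> * cis \<beta>"
     "\<bar>\<alpha> - \<theta>p\<bar> < \<eta>" "\<bar>\<beta> - \<theta>m\<bar> < \<eta>" using cut unfolding cut_def by blast+
  show "- t2 < t1" using c(1,2) T by linarith
  show "\<alpha> < \<beta> + 2 * pi" "\<beta> < \<alpha>" using c(5,6) gap unfolding arc_gap_def by linarith+
qed (use cut in \<open>auto simp: cut_def\<close>)

lemma left_loop_path:
  "valid_path (left_loop \<rho> t1 t2 \<alpha> \<beta>)" "pathfinish (left_loop \<rho> t1 t2 \<alpha> \<beta>) = pathstart (left_loop \<rho> t1 t2 \<alpha> \<beta>)"
  "path_image (left_loop \<rho> t1 t2 \<alpha> \<beta>) = \<gamma> ` {- t2..t1} \<union> path_image (part_circlepath 0 \<rho> \<alpha> (\<beta> + 2 * pi))"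
proof -
  have e: "pathfinish (seg \<gamma> (- t2) t1) = pathstart (part_circlepath 0 \<rho> \<alpha> (\<beta> + 2 * pi))"
    unfolding arc_ends pathfinish_seg using cut_facts(2) .
  show "valid_path (left_loop \<rho> t1 t2 \<alpha> \<beta>)"
    unfolding left_loop_def by (intro valid_path_join valid_path_seg PC1 valid_path_part_circlepath e)
  show "pathfinish (left_loop \<rho> t1 t2 \<alpha> \<beta>) = pathstart (left_loop \<rho> t1 t2 \<alpha> \<beta>)"
    unfolding left_loop_def pathfinish_join pathstart_join arc_ends pathstart_seg cut_facts(3) cis_shift_2pi ..
  show "path_image (left_loop \<rho> t1 t2 \<alpha> \<beta>) = \<gamma> ` {- t2..t1} \<union> path_image (part_circlepath 0 \<rho> \<alpha> (\<beta> + 2 * pi))"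
    unfolding left_loop_def path_image_join[OF e] path_image_seg[OF cut_facts(1)] ..
qed

lemma right_loop_path:
  "valid_path (right_loop \<rho> t1 t2 \<alpha> \<beta>)" "pathfinish (right_loop \<rho> t1 t2 \<alpha> \<beta>) = pathstart (right_loop \<rho> t1 t2 \<alpha> \<beta>)"
  "path_image (right_loop \<rho> t1 t2 \<alpha> \<beta>) = \<gamma> ` {- t2..t1} \<union> path_image (part_circlepath 0 \<rho> \<beta> \<alpha>)"
proof -
  have e: "pathfinish (seg \<gamma> (- t2) t1) = pathstart (reversepath (part_circlepath 0 \<rho> \<beta> \<alpha>))"
    unfolding pathstart_reversepath arc_ends pathfinish_seg using cut_facts(2) .
  show "valid_path (right_loop \<rho> t1 t2 \<alpha> \<beta>)"
    unfolding right_loop_def by (intro valid_path_join valid_path_seg PC1 valid_path_imp_reverse valid_path_part_circlepath e)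
  show "pathfinish (right_loop \<rho> t1 t2 \<alpha> \<beta>) = pathstart (right_loop \<rho> t1 t2 \<alpha> \<beta>)"
    unfolding right_loop_def pathfinish_join pathstart_join pathfinish_reversepath arc_ends pathstart_seg cut_facts(3) ..
  show "path_image (right_loop \<rho> t1 t2 \<alpha> \<beta>) = \<gamma> ` {- t2..t1} \<union> path_image (part_circlepath 0 \<rho> \<beta> \<alpha>)"
    unfolding right_loop_def path_image_join[OF e] path_image_seg[OF cut_facts(1)] path_image_reversepath ..
qed

text \<open>The common piece of the curve cancels, and the two arcs together form the circle, which
  winds once around every point of the disc. So it is enough to know one of the two loops to have
  winding number 0.\<close>

lemma winding_number_loops:
  assumes p: "cmod p < \<rho>" "p \<notin> range \<gamma>"
  shows "winding_number (left_loop \<rho> t1 t2 \<alpha> \<beta>) p = winding_number (right_loop \<rho> t1 t2 \<alpha> \<beta>) p + 1"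
proof -
  let ?L = "part_circlepath 0 \<rho> \<alpha> (\<beta> + 2 * pi)" and ?R = "part_circlepath 0 \<rho> \<beta> \<alpha>" and ?C = "part_circlepath 0 \<rho> \<beta> (\<beta> + 2 * pi)"
  let ?g = "seg \<gamma> (- t2) t1"
  have arc: "p \<notin> path_image (part_circlepath 0 \<rho> a b)" if "cmod p < \<rho>" "a \<le> b" for a b p
    unfolding path_image_arc[OF that(2)] using that(1) \<rho> by (auto simp: norm_mult)
  have gp: "p \<notin> path_image ?g" unfolding path_image_seg[OF cut_facts(1)] using p by auto
  have vg: "path ?g" by (intro valid_path_imp_path valid_path_seg PC1)
  have L: "winding_number (left_loop \<rho> t1 t2 \<alpha> \<beta>) p = winding_number ?g p + winding_number ?L p"
    unfolding left_loop_def using vg gp arc[OF p(1), of \<alpha> "\<beta> + 2 * pi"] cut_facts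
    by (intro winding_number_join) (auto simp: arc_ends simp del: pathstart_part_circlepath pathfinish_part_circlepath)
  have R: "winding_number (right_loop \<rho> t1 t2 \<alpha> \<beta>) p = winding_number ?g p + winding_number (reversepath ?R) p"
    unfolding right_loop_def using vg gp arc[OF p(1), of \<beta> \<alpha>] cut_facts
    by (intro winding_number_join) (auto simp: arc_ends simp del: pathstart_part_circlepath pathfinish_part_circlepath reversepath_part_circlepath)
  have R': "winding_number (reversepath ?R) p = - winding_number ?R p"
    using arc[OF p(1), of \<beta> \<alpha>] cut_facts by (intro winding_number_reversepath) auto
  \<comment> \<open>On circular arcs the winding number is an explicit parameter integral, so
    joining arcs becomes additivity over intervals.\<close>
  have wn: "winding_number (part_circlepath 0 \<rho> a b) p = integral {a..b} (\<lambda>t. 1 / (of_real \<rho> * cis t - p) * of_real \<rho> * \<i> * cis t) / (2 * of_real pi * \<i>)"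
    if "a < b" "cmod p < \<rho>" for a b p
    using winding_number_valid_path[OF valid_path_part_circlepath arc[OF that(2), of a b]] that
    by (simp add: contour_integral_part_circlepath_eq)
  have C: "winding_number ?C p = winding_number ?R p + winding_number ?L p"
  proof -
    have "of_real \<rho> * cis t - p \<noteq> 0" for t
    proof
      assume "of_real \<rho> * cis t - p = 0"
      then have "cmod p = cmod (of_real \<rho> * cis t)" by simp
      then show False using p \<rho> by (simp add: norm_mult)
    qed
    then have "(\<lambda>t. 1 / (of_real \<rho> * cis t - p) * of_real \<rho> * \<i> * cis t) integrable_on {\<beta>..\<beta> + 2 * pi}"
      by (intro integrable_continuous_real continuous_intros) auto
    then have "integral {\<beta>..\<alpha>} (\<lambda>t. 1 / (of_real \<rho> * cis t - p) * of_real \<rho> * \<i> * cis t) + integral {\<alpha>..\<beta> + 2 * pi} (\<lambda>t. 1 / (of_real \<rho> * cis t - p) * of_real \<rho> * \<i> * cis t)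
       = integral {\<beta>..\<beta> + 2 * pi} (\<lambda>t. 1 / (of_real \<rho> * cis t - p) * of_real \<rho> * \<i> * cis t)"
      using cut_facts by (intro Henstock_Kurzweil_Integration.integral_combine) auto
    then show ?thesis using cut_facts p(1) pi_gt_zero by (simp add: wn add_divide_distrib[symmetric])
  qed
  have "winding_number ?C p = winding_number ?C 0"
  proof (rule winding_number_eq[of _ _ "ball 0 \<rho>"])
    show "pathfinish ?C = pathstart ?C" unfolding arc_ends cis_shift_2pi ..
    show "ball 0 \<rho> \<inter> path_image ?C = {}" using arc[of _ \<beta> "\<beta> + 2 * pi"] pi_gt_zero by auto
  qed (use p \<rho> in auto)
  also have "\<dots> = integral {\<beta>..\<beta> + 2 * pi} (\<lambda>t. \<i>) / (2 * of_real pi * \<i>)"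
    using \<rho> pi_gt_zero by (subst wn) (auto intro!: arg_cong2[where f = "(/)"] integral_cong)
  also have "\<dots> = 1" using pi_gt_zero by (simp add: scaleR_conv_of_real)
  finally have "winding_number ?L p = 1 - winding_number ?R p"
    unfolding C by (simp add: eq_diff_eq add.commute)
  then show ?thesis unfolding L R R' by (simp only:) simp
qed

text \<open>The horizontal half-line from p to the right avoids the curve because Re p >= X, and
  avoids the left arc by \<open>left_arc_Im\<close>; p lies outside the loop.\<close>

lemma winding_number_far_right:
  assumes H: "H < \<rho> * g" and X: "\<And>t. \<bar>Im (\<gamma> t)\<bar> \<le> H \<Longrightarrow> \<bar>Re (\<gamma> t)\<bar> < X" "X > 0"
    and p: "\<bar>Im p\<bar> \<le> H" "Re p \<ge> X"
  shows "winding_number (left_loop \<rho> t1 t2 \<alpha> \<beta>) p = 0"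
proof (rule winding_number_zero_unbounded[of _ "(\<lambda>t. p + of_real (1 * t)) ` {0..}"])
  show "path (left_loop \<rho> t1 t2 \<alpha> \<beta>)" by (intro valid_path_imp_path left_loop_path)
  show "(\<lambda>t. p + of_real (1 * t)) ` {0..} \<inter> path_image (left_loop \<rho> t1 t2 \<alpha> \<beta>) = {}"
  proof (rule ccontr)
    assume "\<not> ?thesis"
    then obtain t where t: "t \<ge> 0" "p + of_real t \<in> path_image (left_loop \<rho> t1 t2 \<alpha> \<beta>)" by auto
    define s where "s = p + of_real t"
    have s: "\<bar>Im s\<bar> \<le> H" "Re s \<ge> X" using p t by (auto simp: s_def)
    from t(2) consider u where "s = \<gamma> u" | "s \<in> path_image (part_circlepath 0 \<rho> \<alpha> (\<beta> + 2 * pi))"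
      unfolding left_loop_path s_def[symmetric] by blast
    then show False
    proof cases
      case 1 then show False using X(1)[of u] s by auto
    next
      case 2
      then show False using left_arc_Im[OF gap cut_facts(4,5) \<rho> 2] s X(2) H by linarith
    qed
  qed
qed (use unbounded_half_line[of 1 p] left_loop_path in auto)

text \<open>The half-line to the left shows that p lies outside \<open>right_loop\<close>; passing
  to \<open>left_loop\<close> adds 1.\<close>

lemma winding_number_far_left:
  assumes H: "H < \<rho> * g" and X: "\<And>t. \<bar>Im (\<gamma> t)\<bar> \<le> H \<Longrightarrow> \<bar>Re (\<gamma> t)\<bar> < X" "X > 0"
    and p: "\<bar>Im p\<bar> \<le> H" "Re p \<le> - X" "cmod p < \<rho>"
  shows "winding_number (left_loop \<rho> t1 t2 \<alpha> \<beta>) p = 1"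
proof -
  have "winding_number (right_loop \<rho> t1 t2 \<alpha> \<beta>) p = 0"
  proof (rule winding_number_zero_unbounded[of _ "(\<lambda>t. p + of_real (- 1 * t)) ` {0..}"])
    show "path (right_loop \<rho> t1 t2 \<alpha> \<beta>)" by (intro valid_path_imp_path right_loop_path)
    show "(\<lambda>t. p + of_real (- 1 * t)) ` {0..} \<inter> path_image (right_loop \<rho> t1 t2 \<alpha> \<beta>) = {}"
    proof (rule ccontr)
      assume "\<not> ?thesis"
      then obtain t where t: "t \<ge> 0" "p + of_real (- t) \<in> path_image (right_loop \<rho> t1 t2 \<alpha> \<beta>)" by auto
      define s where "s = p + of_real (- t)"
      have s: "\<bar>Im s\<bar> \<le> H" "Re s \<le> - X" using p t by (auto simp: s_def)
      from t(2) consider u where "s = \<gamma> u" | "s \<in> path_image (part_circlepath 0 \<rho> \<beta> \<alpha>)"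
        unfolding right_loop_path s_def[symmetric] by blast
      then show False
      proof cases
        case 1 then show False using X(1)[of u] s by auto
      next
        case 2
        then show False using right_arc_Im[OF gap cut_facts(4,5) \<rho> 2] s X(2) H by linarith
      qed
    qed
  qed (use unbounded_half_line[of "-1" p] right_loop_path in auto)
  moreover have "p \<notin> range \<gamma>"
  proof
    assume "p \<in> range \<gamma>"
    then show False using X(1) p by force
  qed
  ultimately show ?thesis using winding_number_loops[OF p(3)] by simp
qed

end

end

text \<open>What the locations of the poles share with \<^const>\<open>MB_Lambda_plus\<close> and \<^const>\<open>MB_Lambda_minus\<close>.\<close>
locale pole_sets =
  fixes P M :: "complex set" and H :: real
  assumes strip: "\<And>s. s \<in> P \<union> M \<Longrightarrow> \<bar>Im s\<bar> \<le> H"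
    and finite_left: "\<And>x. finite {s\<in>P. Re s \<le> x}" and finite_right: "\<And>x. finite {s\<in>M. x \<le> Re s}"
    and disjoint: "P \<inter> M = {}"
begin

lemma finite_ball: "finite {s \<in> P \<union> M. cmod s \<le> r}"
proof -
  have "{s \<in> P \<union> M. cmod s \<le> r} \<subseteq> {s\<in>P. Re s \<le> r} \<union> {s\<in>M. - r \<le> Re s}"
  proof
    fix s assume "s \<in> {s \<in> P \<union> M. cmod s \<le> r}"
    moreover have "\<bar>Re s\<bar> \<le> cmod s" by (rule abs_Re_le_cmod)
    ultimately show "s \<in> {s\<in>P. Re s \<le> r} \<union> {s\<in>M. - r \<le> Re s}" by auto
  qed
  then show ?thesis by (rule finite_subset) (intro finite_UnI finite_left finite_right)
qed

lemma closed_poles: "closed (P \<union> M)"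
  unfolding closed_def
proof (subst open_subopen, intro ballI)
  fix x assume x: "x \<in> - (P \<union> M)"
  let ?T = "ball 0 (cmod x + 1) - {s \<in> P \<union> M. cmod s \<le> cmod x + 1}"
  have "open ?T" by (intro open_Diff open_ball finite_imp_closed finite_ball)
  moreover have "x \<in> ?T" using x by auto
  moreover have "?T \<subseteq> - (P \<union> M)" by auto
  ultimately show "\<exists>T. open T \<and> x \<in> T \<and> T \<subseteq> - (P \<union> M)" by blast
qed

text \<open>Countability lets radii, slopes and abscissas be chosen that avoid all poles.\<close>

lemma countable_poles: "countable (P \<union> M)"
proof -
  have "P \<union> M \<subseteq> (\<Union>n::nat. {s \<in> P \<union> M. cmod s \<le> real n})"
  proof
    fix s assume s: "s \<in> P \<union> M"
    obtain n :: nat where n: "cmod s \<le> real n" using real_arch_simple ..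
    show "s \<in> (\<Union>n::nat. {s \<in> P \<union> M. cmod s \<le> real n})" by (rule UN_I[of n]) (use s n in simp_all)
  qed
  moreover have "countable (\<Union>n::nat. {s \<in> P \<union> M. cmod s \<le> real n})"
    by (intro countable_UN[OF countableI_type] countable_finite finite_ball)
  ultimately show ?thesis by (rule countable_subset)
qed

end

section \<open>Separating curves: winding numbers and residues\<close>

context ray_curve
begin

text \<open>The image is a compact piece together with two closed rays. Closedness makes the
  components of the complement open, so their points can be joined by paths.\<close>

lemma closed_range: "closed (range \<gamma>)"
proof -
  have ray: "closed {s. Im ((s - c) * cis (- \<theta>)) = 0 \<and> T \<le> Re ((s - c) * cis (- \<theta>))}" for c \<theta>
    by (intro closed_Collect_conj closed_Collect_eq closed_Collect_le continuous_intros)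
  have ray_eq: "{s. Im ((s - c) * cis (- \<theta>)) = 0 \<and> T \<le> Re ((s - c) * cis (- \<theta>))} = (\<lambda>t. c + of_real t * cis \<theta>) ` {T..}" for c \<theta>
  proof (intro set_eqI iffI)
    fix s assume "s \<in> {s. Im ((s - c) * cis (- \<theta>)) = 0 \<and> T \<le> Re ((s - c) * cis (- \<theta>))}"
    then have s: "(s - c) * cis (- \<theta>) = of_real (Re ((s - c) * cis (- \<theta>)))" "T \<le> Re ((s - c) * cis (- \<theta>))" by (auto simp: complex_eq_iff)
    have "s = c + ((s - c) * cis (- \<theta>)) * cis \<theta>" by (simp add: mult.assoc cis_mult)
    also have "\<dots> = c + of_real (Re ((s - c) * cis (- \<theta>))) * cis \<theta>" by (subst s(1)) (rule refl)
    finally show "s \<in> (\<lambda>t. c + of_real t * cis \<theta>) ` {T..}" using s(2) by blast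
  next
    fix s assume "s \<in> (\<lambda>t. c + of_real t * cis \<theta>) ` {T..}"
    then obtain t where t: "t \<ge> T" "s = c + of_real t * cis \<theta>" by auto
    have e: "(s - c) * cis (- \<theta>) = of_real t" unfolding t(2) by (simp add: mult.assoc cis_mult)
    show "s \<in> {s. Im ((s - c) * cis (- \<theta>)) = 0 \<and> T \<le> Re ((s - c) * cis (- \<theta>))}"
      unfolding mem_Collect_eq e using t(1) by (simp only: Im_complex_of_real Re_complex_of_real)
  qed
  have "t \<in> {- T..T} \<union> ({T..} \<union> uminus ` {T..})" for t
    using image_eqI[of t uminus "- t" "{T..}"] by force
  then have "{- T..T} \<union> ({T..} \<union> uminus ` {T..}) = UNIV" by blast
  then have "range \<gamma> = \<gamma> ` {- T..T} \<union> (\<gamma> ` {T..} \<union> \<gamma> ` (uminus ` {T..}))"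
    by (simp only: image_Un[symmetric])
  also have "\<gamma> ` {T..} = (\<lambda>t. cp + of_real t * cis \<theta>p) ` {T..}" by (intro image_cong refl ray_p) auto
  also have "\<gamma> ` (uminus ` {T..}) = (\<lambda>t. cm + of_real t * cis \<theta>m) ` {T..}"
    unfolding image_image by (intro image_cong refl ray_m) auto
  finally have e: "range \<gamma> = \<gamma> ` {- T..T} \<union> ((\<lambda>t. cp + of_real t * cis \<theta>p) ` {T..} \<union> (\<lambda>t. cm + of_real t * cis \<theta>m) ` {T..})" .
  have "compact (\<gamma> ` {- T..T})" by (intro compact_continuous_image cont) simp
  then show ?thesis unfolding e ray_eq[symmetric] by (intro closed_Un ray compact_imp_closed)
qed

end

locale separating_curve = ray_curve + pole_sets +
  fixes R L :: "complex set"
  assumes RL: "R \<noteq> L" "components (- range \<gamma>) = {R, L}"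
    and P_R: "P \<subseteq> R" and M_L: "M \<subseteq> L" and R_right: "\<forall>\<^sub>F x::real in at_top. of_real x \<in> R"
begin

lemma R_open: "open R" and L_open: "open L" and R_connected: "connected R" and L_connected: "connected L"
  and R_avoids: "R \<inter> range \<gamma> = {}" and L_avoids: "L \<inter> range \<gamma> = {}" and RL_Un: "R \<union> L = - range \<gamma>"
proof -
  have o: "open (- range \<gamma>)" using closed_range by (simp add: closed_def)
  have c: "R \<in> components (- range \<gamma>)" "L \<in> components (- range \<gamma>)" using RL by auto
  show "open R" "open L" using open_components[OF o] c by auto
  show "connected R" "connected L" using in_components_connected c by auto
  show "R \<inter> range \<gamma> = {}" "L \<inter> range \<gamma> = {}" using in_components_subset[OF c(1)] in_components_subset[OF c(2)] by auto
  show "R \<union> L = - range \<gamma>" using Union_components[of "- range \<gamma>"] RL by auto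
qed

lemma poles_avoid: "(P \<union> M) \<inter> range \<gamma> = {}"
  using P_R M_L R_avoids L_avoids by blast

text \<open>Inside R a compact path joins p to a large positive number, from where the positive axis
  leads to infinity. For large \<rho> the arc misses the path by its modulus and the half-line by
  \<open>left_arc_Im\<close>, so p lies outside the loop.\<close>

lemma winding_number_R:
  assumes gap: "arc_gap \<eta> g" and p: "p \<in> R"
  shows "\<exists>\<rho>0>0. \<forall>\<rho>\<ge>\<rho>0. \<forall>t1 t2 \<alpha> \<beta>. cut \<eta> \<rho> t1 t2 \<alpha> \<beta> \<longrightarrow> winding_number (left_loop \<rho> t1 t2 \<alpha> \<beta>) p = 0"
proof -
  have g: "g > 0" using gap by (simp add: arc_gap_def)
  obtain x0 where x0: "\<forall>x\<ge>x0. complex_of_real x \<in> R" using R_right unfolding eventually_at_top_linorder ..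
  define x where "x = max x0 1"
  have x: "x \<ge> x0" "x > 0" by (auto simp: x_def)
  obtain K where K: "connected K" "compact K" "p \<in> K" "of_real x \<in> K" "K \<subseteq> R"
    using connected_path_subset[OF R_open R_connected p x0[rule_format, OF x(1)]] by blast
  have "bounded K" using K(2) by (rule compact_imp_bounded)
  then obtain B where B: "\<forall>s\<in>K. cmod s \<le> B" unfolding bounded_iff ..
  let ?h = "(\<lambda>t. complex_of_real x + of_real (1 * t)) ` {0..}"
  have hl: "\<not> bounded ?h" "connected ?h" using unbounded_half_line[of 1 "of_real x"] by auto
  show ?thesis
  proof (rule exI[of _ "\<bar>B\<bar> + 1"], intro conjI allI impI)
    fix \<rho> t1 t2 \<alpha> \<beta> assume \<rho>: "\<rho> \<ge> \<bar>B\<bar> + 1" and cut: "cut \<eta> \<rho> t1 t2 \<alpha> \<beta>"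
    have \<rho>0: "\<rho> > 0" using \<rho> by linarith
    note facts = cut_facts[OF gap cut \<rho>0] and lp = left_loop_path[OF gap cut \<rho>0]
    show "winding_number (left_loop \<rho> t1 t2 \<alpha> \<beta>) p = 0"
    proof (rule winding_number_zero_unbounded[of _ "K \<union> ?h"])
      show "path (left_loop \<rho> t1 t2 \<alpha> \<beta>)" by (intro valid_path_imp_path lp)
      show "pathfinish (left_loop \<rho> t1 t2 \<alpha> \<beta>) = pathstart (left_loop \<rho> t1 t2 \<alpha> \<beta>)" by (rule lp)
      have "of_real x \<in> K \<inter> ?h" using K(4) by force
      then show "connected (K \<union> ?h)" using K(1) hl(2) by (intro connected_Un) auto
      show "\<not> bounded (K \<union> ?h)" using hl(1) by simp
      show "p \<in> K \<union> ?h" using K(3) by simp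
      have "K \<inter> path_image (part_circlepath 0 \<rho> \<alpha> (\<beta> + 2 * pi)) = {}"
      proof -
        have "cmod s = \<rho>" if "s \<in> path_image (part_circlepath 0 \<rho> \<alpha> (\<beta> + 2 * pi))" for s
          using that \<rho>0 facts(6) unfolding path_image_arc[OF less_imp_le[OF facts(6)]] by (auto simp: norm_mult)
        moreover have "cmod s < \<rho>" if "s \<in> K" for s using B that \<rho> by force
        ultimately show ?thesis by force
      qed
      moreover have "?h \<inter> path_image (part_circlepath 0 \<rho> \<alpha> (\<beta> + 2 * pi)) = {}"
      proof -
        have "s \<notin> path_image (part_circlepath 0 \<rho> \<alpha> (\<beta> + 2 * pi))" if s: "s \<in> ?h" for s
        proof
          assume a: "s \<in> path_image (part_circlepath 0 \<rho> \<alpha> (\<beta> + 2 * pi))"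
          have "Re s > 0" "Im s = 0" using s x by auto
          then show False using left_arc_Im[OF gap facts(4,5) \<rho>0 a] mult_pos_pos[OF \<rho>0 g] by simp
        qed
        then show ?thesis by blast
      qed
      moreover have "K \<inter> range \<gamma> = {}" using K(5) R_avoids by blast
      moreover have "?h \<inter> range \<gamma> = {}"
      proof -
        have "?h \<subseteq> R"
        proof
          fix s assume "s \<in> ?h"
          then obtain t where "t \<ge> 0" "s = of_real (x + t)" by auto
          then show "s \<in> R" using x0[rule_format, of "x + t"] x by simp
        qed
        then show ?thesis using R_avoids by blast
      qed
      ultimately show "(K \<union> ?h) \<inter> path_image (left_loop \<rho> t1 t2 \<alpha> \<beta>) = {}" unfolding lp(3) by blast
    qed
  qed simp
qed

text \<open>A reference point x far to the left has winding number 1. The winding number is constant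
  along a compact path from x to p inside L, once \<rho> is so large that the arc misses the
  path.\<close>

lemma winding_number_L:
  assumes gap: "arc_gap \<eta> g" and p: "p \<in> L"
  shows "\<exists>\<rho>0>0. \<forall>\<rho>\<ge>\<rho>0. \<forall>t1 t2 \<alpha> \<beta>. cut \<eta> \<rho> t1 t2 \<alpha> \<beta> \<longrightarrow> winding_number (left_loop \<rho> t1 t2 \<alpha> \<beta>) p = 1"
proof -
  have g: "g > 0" and \<eta>: "\<eta> > 0" using gap by (simp_all add: arc_gap_def)
  obtain X where X: "X > 0" "\<And>t. \<bar>Im (\<gamma> t)\<bar> \<le> 0 \<Longrightarrow> \<bar>Re (\<gamma> t)\<bar> < X" using strip_bounded[of 0] by blast
  define x where "x = complex_of_real (- X)"
  have wx: "winding_number (left_loop \<rho> t1 t2 \<alpha> \<beta>) x = 1" if cut: "cut \<eta> \<rho> t1 t2 \<alpha> \<beta>" and \<rho>: "\<rho> > X" for \<rho> t1 t2 \<alpha> \<beta>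
  proof -
    have "\<rho> > 0" using \<rho> X by linarith
    then show ?thesis
      using winding_number_far_left[where p = x and H = 0, OF gap cut \<open>\<rho> > 0\<close> _ X(2) X(1)] g \<rho> X by (simp add: x_def)
  qed
  \<comment> \<open>Otherwise x would lie in R and have winding number 0 for large \<rho>. Here the
    purely topological description of L meets its position on the left.\<close>
  have "x \<in> L"
  proof (rule ccontr)
    assume "x \<notin> L"
    moreover have "x \<notin> range \<gamma>"
    proof
      assume "x \<in> range \<gamma>"
      then obtain t where "\<gamma> t = x" by auto
      then show False using X(2)[of t] by (simp add: x_def)
    qed
    ultimately have "x \<in> R" using RL_Un by blast
    from winding_number_R[OF gap this] obtain \<rho>0 where \<rho>0: "\<forall>\<rho>\<ge>\<rho>0. \<forall>t1 t2 \<alpha> \<beta>. cut \<eta> \<rho> t1 t2 \<alpha> \<beta> \<longrightarrow> winding_number (left_loop \<rho> t1 t2 \<alpha> \<beta>) x = 0" by blast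
    obtain \<rho>1 where \<rho>1: "\<forall>\<rho>\<ge>\<rho>1. \<exists>t1 t2 \<alpha> \<beta>. cut \<eta> \<rho> t1 t2 \<alpha> \<beta>" using cut_exists[OF \<eta>] by blast
    define \<rho> where "\<rho> = max (max \<rho>0 \<rho>1) (X + 1)"
    have \<rho>: "\<rho> \<ge> \<rho>0" "\<rho> \<ge> \<rho>1" "\<rho> > X" by (auto simp: \<rho>_def)
    obtain t1 t2 \<alpha> \<beta> where "cut \<eta> \<rho> t1 t2 \<alpha> \<beta>" using \<rho>1 \<rho>(2) by blast
    then have "winding_number (left_loop \<rho> t1 t2 \<alpha> \<beta>) x = 0" "winding_number (left_loop \<rho> t1 t2 \<alpha> \<beta>) x = 1"
      using \<rho>0 \<rho>(1) wx[OF _ \<rho>(3)] by blast+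
    then show False by simp
  qed
  obtain K where K: "connected K" "compact K" "p \<in> K" "x \<in> K" "K \<subseteq> L"
    using connected_path_subset[OF L_open L_connected p \<open>x \<in> L\<close>] by blast
  have "bounded K" using K(2) by (rule compact_imp_bounded)
  then obtain B where B: "\<forall>s\<in>K. cmod s \<le> B" unfolding bounded_iff ..
  show ?thesis
  proof (rule exI[of _ "\<bar>B\<bar> + X + 1"], intro conjI allI impI)
    show "\<bar>B\<bar> + X + 1 > 0" using X by linarith
    fix \<rho> t1 t2 \<alpha> \<beta> assume \<rho>: "\<rho> \<ge> \<bar>B\<bar> + X + 1" and cut: "cut \<eta> \<rho> t1 t2 \<alpha> \<beta>"
    have \<rho>0: "\<rho> > 0" "\<rho> > X" using \<rho> X by linarith+
    note facts = cut_facts[OF gap cut \<rho>0(1)] and lp = left_loop_path[OF gap cut \<rho>0(1)]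
    have "winding_number (left_loop \<rho> t1 t2 \<alpha> \<beta>) p = winding_number (left_loop \<rho> t1 t2 \<alpha> \<beta>) x"
    proof (rule winding_number_eq[OF _ lp(2) K(3,4,1)])
      show "path (left_loop \<rho> t1 t2 \<alpha> \<beta>)" by (intro valid_path_imp_path lp)
      have "K \<inter> path_image (part_circlepath 0 \<rho> \<alpha> (\<beta> + 2 * pi)) = {}"
      proof -
        have "cmod s = \<rho>" if "s \<in> path_image (part_circlepath 0 \<rho> \<alpha> (\<beta> + 2 * pi))" for s
          using that \<rho>0 facts(6) unfolding path_image_arc[OF less_imp_le[OF facts(6)]] by (auto simp: norm_mult)
        moreover have "cmod s < \<rho>" if "s \<in> K" for s using B that \<rho> X(1) by force
        ultimately show ?thesis by force
      qed
      moreover have "K \<inter> range \<gamma> = {}" using K(5) L_avoids by blast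
      ultimately show "K \<inter> path_image (left_loop \<rho> t1 t2 \<alpha> \<beta>) = {}" unfolding lp(3) by blast
    qed
    then show "winding_number (left_loop \<rho> t1 t2 \<alpha> \<beta>) p = 1" using wx[OF cut \<rho>0(2)] by simp
  qed
qed

text \<open>The thresholds of the two previous lemmas depend on the pole, and there are infinitely
  many poles. The component argument is needed only for the finite set E; the remaining poles lie so
  far to the right or to the left that a horizontal half-line decides, with one threshold for
  all.\<close>

lemma winding_number_poles:
  assumes gap: "arc_gap \<eta> g"
  shows "\<exists>\<rho>0>0. \<forall>\<rho>\<ge>\<rho>0. \<forall>t1 t2 \<alpha> \<beta>. cut \<eta> \<rho> t1 t2 \<alpha> \<beta> \<longrightarrow> (\<forall>p\<in>P \<union> M. cmod p < \<rho> \<longrightarrow> 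
     winding_number (left_loop \<rho> t1 t2 \<alpha> \<beta>) p = (if p \<in> M then 1 else 0))"
proof -
  have g: "g > 0" using gap by (simp add: arc_gap_def)
  obtain X where X: "X > 0" "\<And>t. \<bar>Im (\<gamma> t)\<bar> \<le> H \<Longrightarrow> \<bar>Re (\<gamma> t)\<bar> < X" using strip_bounded[of H] by blast
  define E where "E = {s\<in>P. Re s \<le> X} \<union> {s\<in>M. - X \<le> Re s}"
  have E: "finite E" unfolding E_def by (intro finite_UnI finite_left finite_right)
  have "\<exists>\<rho>0>0. \<forall>\<rho>\<ge>\<rho>0. \<forall>t1 t2 \<alpha> \<beta>. cut \<eta> \<rho> t1 t2 \<alpha> \<beta> \<longrightarrow> winding_number (left_loop \<rho> t1 t2 \<alpha> \<beta>) p = (if p \<in> M then 1 else 0)"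
    if "p \<in> E" for p
  proof (cases "p \<in> M")
    case True
    then show ?thesis using winding_number_L[OF gap, of p] M_L by auto
  next
    case False
    then have "p \<in> P" using that by (auto simp: E_def)
    then show ?thesis using winding_number_R[OF gap, of p] P_R False by auto
  qed
  then obtain r where r: "\<And>p. p \<in> E \<Longrightarrow> r p > 0 \<and> (\<forall>\<rho>\<ge>r p. \<forall>t1 t2 \<alpha> \<beta>. cut \<eta> \<rho> t1 t2 \<alpha> \<beta> \<longrightarrow> winding_number (left_loop \<rho> t1 t2 \<alpha> \<beta>) p = (if p \<in> M then 1 else 0))"
    by metis
  \<comment> \<open>The sum exceeds each threshold r p, and |H| / g lifts the ends of the arcs out
    of the strip of poles.\<close>
  define \<rho>0 where "\<rho>0 = 1 + \<bar>H\<bar> / g + (\<Sum>p\<in>E. r p)"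
  have sum0: "(\<Sum>p\<in>E. r p) \<ge> 0" using r by (intro sum_nonneg) (auto intro: less_imp_le)
  have q0: "\<bar>H\<bar> / g \<ge> 0" using g by simp
  show ?thesis
  proof (rule exI[of _ \<rho>0], intro conjI allI impI ballI)
    show "\<rho>0 > 0" unfolding \<rho>0_def using sum0 q0 by linarith
    fix \<rho> t1 t2 \<alpha> \<beta> p assume \<rho>: "\<rho> \<ge> \<rho>0" and cut: "cut \<eta> \<rho> t1 t2 \<alpha> \<beta>" and p: "p \<in> P \<union> M" "cmod p < \<rho>"
    have \<rho>': "\<rho> > 0" "\<bar>H\<bar> / g < \<rho>" using \<rho> sum0 q0 unfolding \<rho>0_def by linarith+
    then have Hg: "H < \<rho> * g" using g by (simp add: pos_divide_less_eq)
    show "winding_number (left_loop \<rho> t1 t2 \<alpha> \<beta>) p = (if p \<in> M then 1 else 0)"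
    proof (cases "p \<in> E")
      case True
      have "r p \<le> (\<Sum>p\<in>E. r p)" using True E r by (intro member_le_sum) (auto intro: less_imp_le)
      then have "\<rho> \<ge> r p" using \<rho> q0 unfolding \<rho>0_def by linarith
      then show ?thesis using r[OF True] cut by blast
    next
      case False
      then have "p \<in> M \<and> Re p \<le> - X \<or> p \<in> P \<and> p \<notin> M \<and> Re p \<ge> X" using p disjoint by (auto simp: E_def)
      then consider "p \<in> M" "Re p \<le> - X" | "p \<in> P" "p \<notin> M" "Re p \<ge> X" by blast
      then show ?thesis
      proof cases
        case 1
        then show ?thesis using winding_number_far_left[OF gap cut \<rho>'(1) Hg X(2,1) strip[OF p(1)] _ p(2)] by simp
      next
        case 2
        then show ?thesis using winding_number_far_right[OF gap cut \<rho>'(1) Hg X(2,1) strip[OF p(1)]] by simp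
      qed
    qed
  qed
qed

text \<open>The residue theorem for \<open>left_loop\<close>. Radii that are moduli of poles are
  excluded so that the arc avoids all singularities; the radii are otherwise arbitrary and two
  curves can share one.\<close>

lemma contour_residues:
  assumes F: "F holomorphic_on - (P \<union> M)" and gap: "arc_gap \<eta> g"
  shows "\<exists>\<rho>0>0. \<forall>\<rho>\<ge>\<rho>0. \<rho> \<notin> cmod ` (P \<union> M) \<longrightarrow> (\<forall>t1 t2 \<alpha> \<beta>. cut \<eta> \<rho> t1 t2 \<alpha> \<beta> \<longrightarrow>
     (\<lambda>t. F (\<gamma> t) * vector_derivative \<gamma> (at t)) integrable_on {- t2..t1} \<and>
     integral {- t2..t1} (\<lambda>t. F (\<gamma> t) * vector_derivative \<gamma> (at t))
       + integral {\<alpha>..\<beta> + 2 * pi} (\<lambda>t. F (of_real \<rho> * cis t) * of_real \<rho> * \<i> * cis t)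
     = 2 * of_real pi * \<i> * (\<Sum>p | p \<in> M \<and> cmod p \<le> \<rho>. residue F p))"
proof -
  obtain \<rho>0 where \<rho>0: "\<rho>0 > 0" "\<And>\<rho> t1 t2 \<alpha> \<beta> p. \<rho> \<ge> \<rho>0 \<Longrightarrow> cut \<eta> \<rho> t1 t2 \<alpha> \<beta> \<Longrightarrow> p \<in> P \<union> M \<Longrightarrow> cmod p < \<rho> \<Longrightarrow>
     winding_number (left_loop \<rho> t1 t2 \<alpha> \<beta>) p = (if p \<in> M then 1 else 0)"
    using winding_number_poles[OF gap] by blast
  show ?thesis
  proof (rule exI[of _ \<rho>0], rule conjI[OF \<rho>0(1)], intro allI impI)
    fix \<rho> t1 t2 \<alpha> \<beta> assume \<rho>: "\<rho> \<ge> \<rho>0" "\<rho> \<notin> cmod ` (P \<union> M)" and cut: "cut \<eta> \<rho> t1 t2 \<alpha> \<beta>"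
    have \<rho>p: "\<rho> > 0" using \<rho> \<rho>0 by linarith
    note facts = cut_facts[OF gap cut \<rho>p] and lp = left_loop_path[OF gap cut \<rho>p]
    define Q where "Q = {s \<in> P \<union> M. cmod s \<le> \<rho>}"
    have Q: "finite Q" unfolding Q_def by (rule finite_ball)
    have Q_lt: "cmod s < \<rho>" if "s \<in> Q" for s using that \<rho>(2) unfolding Q_def by (auto simp: less_le)
    \<comment> \<open>The minimum of E is the radius of a slightly larger open disc that contains
      the loop but no further pole; \<rho> + 1 serves when no pole is close.\<close>
    define E where "E = insert (\<rho> + 1) (cmod ` {s \<in> P \<union> M. cmod s \<le> \<rho> + 1} \<inter> {\<rho><..})"
    have E: "finite E" "E \<noteq> {}" unfolding E_def using finite_ball by auto
    define \<rho>' where "\<rho>' = Min E"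
    have \<rho>': "\<rho>' > \<rho>" unfolding \<rho>'_def using E by (subst Min_gr_iff) (auto simp: E_def)
    have out: "s \<in> Q" if "s \<in> P \<union> M" "cmod s < \<rho>'" for s
    proof (rule ccontr)
      assume "s \<notin> Q"
      then have a: "cmod s > \<rho>" using that by (auto simp: Q_def)
      have "\<rho>' \<le> \<rho> + 1" unfolding \<rho>'_def using E by (intro Min_le) (auto simp: E_def)
      then have "cmod s \<in> E" using that a by (auto simp: E_def)
      then have "\<rho>' \<le> cmod s" unfolding \<rho>'_def using E by (intro Min_le) auto
      then show False using that by simp
    qed
    define S where "S = ball (0::complex) \<rho>'"
    have hol: "F holomorphic_on S - Q"
      by (rule holomorphic_on_subset[OF F]) (use out in \<open>auto simp: S_def\<close>)
    have arc_norm: "cmod s = \<rho>" if "s \<in> path_image (part_circlepath 0 \<rho> \<alpha> (\<beta> + 2 * pi))" for s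
      using that \<rho>p unfolding path_image_arc[OF less_imp_le[OF facts(6)]] by (auto simp: norm_mult)
    have seg_sub: "\<gamma> ` {- t2..t1} \<subseteq> S - Q"
    proof
      fix s assume "s \<in> \<gamma> ` {- t2..t1}"
      then have "cmod s \<le> \<rho>" "s \<in> range \<gamma>" using cut by (auto simp: cut_def)
      then show "s \<in> S - Q" using \<rho>' poles_avoid by (auto simp: S_def Q_def)
    qed
    have arc_sub: "path_image (part_circlepath 0 \<rho> \<alpha> (\<beta> + 2 * pi)) \<subseteq> S - Q"
      using arc_norm Q_lt \<rho>' by (force simp: S_def)
    have sub: "path_image (left_loop \<rho> t1 t2 \<alpha> \<beta>) \<subseteq> S - Q" unfolding lp(3) using seg_sub arc_sub by blast
    have op: "open (S - Q)" using Q by (simp add: S_def open_Diff finite_imp_closed)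
    have wn0: "\<forall>z. z \<notin> S \<longrightarrow> winding_number (left_loop \<rho> t1 t2 \<alpha> \<beta>) z = 0"
      using sub lp by (intro allI impI winding_number_zero_outside[of _ S]) (auto simp: S_def valid_path_imp_path)
    have res: "contour_integral (left_loop \<rho> t1 t2 \<alpha> \<beta>) F = 2 * of_real pi * \<i> * (\<Sum>p\<in>Q. winding_number (left_loop \<rho> t1 t2 \<alpha> \<beta>) p * residue F p)"
      using Residue_theorem[OF _ _ Q hol lp(1,2) sub wn0] by (simp add: S_def)
    have "(\<Sum>p\<in>Q. winding_number (left_loop \<rho> t1 t2 \<alpha> \<beta>) p * residue F p) = (\<Sum>p\<in>Q. if p \<in> M then residue F p else 0)"
    proof (rule sum.cong[OF refl])
      fix p assume "p \<in> Q"
      then have "winding_number (left_loop \<rho> t1 t2 \<alpha> \<beta>) p = (if p \<in> M then 1 else 0)"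
        using \<rho>0(2)[OF \<rho>(1) cut _ Q_lt] by (auto simp: Q_def)
      then show "winding_number (left_loop \<rho> t1 t2 \<alpha> \<beta>) p * residue F p = (if p \<in> M then residue F p else 0)" by simp
    qed
    also have "\<dots> = (\<Sum>p\<in>Q \<inter> M. residue F p)" using Q by (rule sum.inter_restrict[symmetric])
    also have "Q \<inter> M = {p. p \<in> M \<and> cmod p \<le> \<rho>}" by (auto simp: Q_def)
    finally have sum: "(\<Sum>p\<in>Q. winding_number (left_loop \<rho> t1 t2 \<alpha> \<beta>) p * residue F p) = (\<Sum>p | p \<in> M \<and> cmod p \<le> \<rho>. residue F p)" .
    have i1: "F contour_integrable_on seg \<gamma> (- t2) t1"
      using seg_sub by (intro contour_integrable_holomorphic_simple[OF hol op valid_path_seg[OF PC1]]) (simp add: path_image_seg[OF facts(1)])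
    have i2: "F contour_integrable_on part_circlepath 0 \<rho> \<alpha> (\<beta> + 2 * pi)"
      using arc_sub by (intro contour_integrable_holomorphic_simple[OF hol op]) auto
    have s1: "((\<lambda>t. F (\<gamma> t) * vector_derivative \<gamma> (at t)) has_integral contour_integral (seg \<gamma> (- t2) t1) F) {- t2..t1}"
      using has_contour_integral_integral[OF i1] unfolding has_contour_integral_seg[OF PC1 facts(1)] .
    have s2: "contour_integral (part_circlepath 0 \<rho> \<alpha> (\<beta> + 2 * pi)) F = integral {\<alpha>..\<beta> + 2 * pi} (\<lambda>t. F (of_real \<rho> * cis t) * of_real \<rho> * \<i> * cis t)"
      using facts(6) by (simp add: contour_integral_part_circlepath_eq)
    have "contour_integral (left_loop \<rho> t1 t2 \<alpha> \<beta>) F = contour_integral (seg \<gamma> (- t2) t1) F + contour_integral (part_circlepath 0 \<rho> \<alpha> (\<beta> + 2 * pi)) F"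
      unfolding left_loop_def by (intro contour_integral_join i1 i2 valid_path_seg PC1 valid_path_part_circlepath)
    then show "(\<lambda>t. F (\<gamma> t) * vector_derivative \<gamma> (at t)) integrable_on {- t2..t1} \<and>
     integral {- t2..t1} (\<lambda>t. F (\<gamma> t) * vector_derivative \<gamma> (at t))
       + integral {\<alpha>..\<beta> + 2 * pi} (\<lambda>t. F (of_real \<rho> * cis t) * of_real \<rho> * \<i> * cis t)
     = 2 * of_real pi * \<i> * (\<Sum>p | p \<in> M \<and> cmod p \<le> \<rho>. residue F p)"
      using res s1 unfolding sum s2 by (auto simp: integral_unique has_integral_integrable)
  qed
qed

end

section \<open>Directions of decay in the seven cases\<close>

text \<open>Fixed directions for the wedge are chosen in the closed left quadrants, while the angles
  of the table may depend on \<epsilon>. Decay in all directions between a fixed angle and the table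
  angle is what later permits turning a ray of the contour into one of the wedge. In cases (i) to
  (v) every rate is available; in (vi) and (vii) the rate depends on the direction and is compared
  with w.\<close>

lemma MB_kernel_decay_upper_lower:
  fixes a b :: "nat \<Rightarrow> complex"
  assumes \<tau>: "\<tau> > 0" and mq: "m < q" and np: "n \<le> p" and ex: "\<exists>c. MB_in_case c m n p q a b \<alpha>"
    and tab: "\<exists>z>0. \<forall>\<^sub>F \<epsilon> in at_right 0. \<exists>\<theta>p \<theta>m. MB_table m n p q a b \<alpha> z \<epsilon> \<theta>p \<theta>m \<and> \<theta>p \<ge> pi / 2 \<and> \<theta>m \<le> - pi / 2"
  obtains \<phi>p \<phi>m where "pi / 2 \<le> \<phi>p" "\<phi>p < pi" "- pi < \<phi>m" "\<phi>m \<le> - pi / 2"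
    "\<And>w. w \<in> MB_domain m n p q a b \<tau> \<alpha> \<Longrightarrow> decay_rate (MB_kernel m n p q a b \<tau> \<alpha>) \<phi>p w"
    "\<And>w. w \<in> MB_domain m n p q a b \<tau> \<alpha> \<Longrightarrow> decay_rate (MB_kernel m n p q a b \<tau> \<alpha>) \<phi>m w"
    "\<And>x. complex_of_real x \<in> MB_domain m n p q a b \<tau> \<alpha> \<Longrightarrow>
       \<forall>\<^sub>F \<epsilon> in at_right 0. (\<exists>\<theta>p \<theta>m. MB_table m n p q a b \<alpha> (exp x) \<epsilon> \<theta>p \<theta>m) \<and>
         (\<forall>\<theta>p \<theta>m. MB_table m n p q a b \<alpha> (exp x) \<epsilon> \<theta>p \<theta>m \<longrightarrow>
           \<theta>p \<in> {0<..<pi} \<and> \<theta>m \<in> {-pi<..<0} \<and>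
           (\<forall>\<psi>\<in>closed_segment \<phi>p \<theta>p. decay_rate (MB_kernel m n p q a b \<tau> \<alpha>) \<psi> (of_real x)) \<and>
           (\<forall>\<psi>\<in>closed_segment \<phi>m \<theta>m. decay_rate (MB_kernel m n p q a b \<tau> \<alpha>) \<psi> (of_real x)))"
proof -
  let ?F = "MB_kernel m n p q a b \<tau> \<alpha>"
  let ?\<mu> = "MB_mu m n p q a b"
  let ?T = "MB_table m n p q a b \<alpha>"
  let ?D = "MB_domain m n p q a b \<tau> \<alpha>"
  have mq': "m \<le> q" using mq by simp
  have ang: "(1::real) \<in> {1,-1}" "(-1::real) \<in> {1,-1}" by auto
  obtain c where c: "MB_in_case c m n p q a b \<alpha>" using ex by blast
  obtain z0 where z0: "z0 > 0" "\<forall>\<^sub>F \<epsilon> in at_right 0. \<exists>\<theta>p \<theta>m. ?T z0 \<epsilon> \<theta>p \<theta>m \<and> \<theta>p \<ge> pi / 2 \<and> \<theta>m \<le> - pi / 2"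
    using tab by blast
  \<comment> \<open>The cases are mutually exclusive, so the table may be read for one case at a
    time.\<close>
  have uniq: "c' = c" if "MB_in_case c' m n p q a b \<alpha>" for c'
  proof -
    define P where "P = (of_nat p - of_nat q :: complex) * \<i>"
    have P1: "(of_nat q - of_nat p :: complex) * \<i> = - P" "- (of_nat p - of_nat q :: complex) * \<i> = - P"
      by (simp_all add: P_def algebra_simps)
    have P0: "P = 0" if "p = q" using that by (simp add: P_def)
    show ?thesis
      using that c P0 by (cases c; cases c'; simp only: MB_in_case.simps P1 P_def[symmetric]; auto)
  qed
  have T_iff: "?T z \<epsilon> \<theta>p \<theta>m \<longleftrightarrow> MB_angles c p q ?\<mu> \<alpha> z \<epsilon> \<theta>p \<theta>m" for z \<epsilon> \<theta>p \<theta>m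
  proof
    assume "?T z \<epsilon> \<theta>p \<theta>m"
    then obtain c' where c': "MB_in_case c' m n p q a b \<alpha>" "MB_angles c' p q ?\<mu> \<alpha> z \<epsilon> \<theta>p \<theta>m"
      unfolding MB_table_def by (elim exE conjE)
    show "MB_angles c p q ?\<mu> \<alpha> z \<epsilon> \<theta>p \<theta>m" using c'(2) unfolding uniq[OF c'(1)] .
  next
    assume "MB_angles c p q ?\<mu> \<alpha> z \<epsilon> \<theta>p \<theta>m"
    with c show "?T z \<epsilon> \<theta>p \<theta>m" unfolding MB_table_def by (intro exI[of _ c] conjI)
  qed
  have T0: "\<forall>\<^sub>F \<epsilon> in at_right 0. \<exists>\<theta>p \<theta>m. MB_angles c p q ?\<mu> \<alpha> z0 \<epsilon> \<theta>p \<theta>m \<and> \<theta>p \<ge> pi / 2 \<and> \<theta>m \<le> - pi / 2"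
    using z0(2) unfolding T_iff .
  have T0_ex: "\<exists>\<epsilon> \<theta>p \<theta>m. MB_angles c p q ?\<mu> \<alpha> z0 \<epsilon> \<theta>p \<theta>m \<and> \<theta>p \<ge> pi / 2 \<and> \<theta>m \<le> - pi / 2"
    using eventually_happens'[OF trivial_limit_at_right_real T0] .
  have small: "\<forall>\<^sub>F \<epsilon> in at_right (0::real). 0 < \<epsilon> \<and> \<epsilon> < e" if "e > 0" for e
    using that by (auto simp: eventually_at_right_field)

  note main = that
  \<comment> \<open>Cases with every rate of decay: neither w nor the value of z matters, as only
    case (vii) has a table that depends on z.\<close>
  have fast: thesis
    if nVII: "c \<noteq> Case_VII" and \<phi>: "pi / 2 \<le> \<phi>p" "\<phi>p < pi" "- pi < \<phi>m" "\<phi>m \<le> - pi / 2"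
      and dp: "\<And>\<kappa>. decays ?F \<phi>p \<kappa>" and dm: "\<And>\<kappa>. decays ?F \<phi>m \<kappa>"
      and ev: "\<forall>\<^sub>F \<epsilon> in at_right 0. \<forall>\<theta>p \<theta>m. MB_angles c p q ?\<mu> \<alpha> z0 \<epsilon> \<theta>p \<theta>m \<longrightarrow>
           \<theta>p \<in> {0<..<pi} \<and> \<theta>m \<in> {-pi<..<0} \<and> (\<forall>\<psi>\<in>closed_segment \<phi>p \<theta>p. \<forall>\<kappa>. decays ?F \<psi> \<kappa>) \<and> (\<forall>\<psi>\<in>closed_segment \<phi>m \<theta>m. \<forall>\<kappa>. decays ?F \<psi> \<kappa>)"
    for \<phi>p \<phi>m
  proof (rule main[OF \<phi>])
    fix w show "decay_rate ?F \<phi>p w" "decay_rate ?F \<phi>m w" by (rule decay_rate_if_decays[OF dp] decay_rate_if_decays[OF dm])+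
  next
    fix x :: real
    have z: "MB_angles c p q ?\<mu> \<alpha> (exp x) \<epsilon> \<theta>p \<theta>m \<longleftrightarrow> MB_angles c p q ?\<mu> \<alpha> z0 \<epsilon> \<theta>p \<theta>m" for \<epsilon> \<theta>p \<theta>m
      using nVII by (cases c) auto
    show "\<forall>\<^sub>F \<epsilon> in at_right 0. (\<exists>\<theta>p \<theta>m. ?T (exp x) \<epsilon> \<theta>p \<theta>m) \<and>
         (\<forall>\<theta>p \<theta>m. ?T (exp x) \<epsilon> \<theta>p \<theta>m \<longrightarrow>
           \<theta>p \<in> {0<..<pi} \<and> \<theta>m \<in> {-pi<..<0} \<and>
           (\<forall>\<psi>\<in>closed_segment \<phi>p \<theta>p. decay_rate ?F \<psi> (of_real x)) \<and>
           (\<forall>\<psi>\<in>closed_segment \<phi>m \<theta>m. decay_rate ?F \<psi> (of_real x)))"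
      unfolding T_iff z using T0 ev
    proof eventually_elim
      case (elim \<epsilon>)
      show ?case
      proof (rule conjI)
        show "\<exists>\<theta>p \<theta>m. MB_angles c p q ?\<mu> \<alpha> z0 \<epsilon> \<theta>p \<theta>m" using elim(1) by blast
        show "\<forall>\<theta>p \<theta>m. MB_angles c p q ?\<mu> \<alpha> z0 \<epsilon> \<theta>p \<theta>m \<longrightarrow>
           \<theta>p \<in> {0<..<pi} \<and> \<theta>m \<in> {-pi<..<0} \<and>
           (\<forall>\<psi>\<in>closed_segment \<phi>p \<theta>p. decay_rate ?F \<psi> (of_real x)) \<and>
           (\<forall>\<psi>\<in>closed_segment \<phi>m \<theta>m. decay_rate ?F \<psi> (of_real x))"
        proof (intro allI impI)
          fix \<theta>p \<theta>m assume "MB_angles c p q ?\<mu> \<alpha> z0 \<epsilon> \<theta>p \<theta>m"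
          then have B: "\<theta>p \<in> {0<..<pi}" "\<theta>m \<in> {-pi<..<0}" "\<forall>\<psi>\<in>closed_segment \<phi>p \<theta>p. \<forall>\<kappa>. decays ?F \<psi> \<kappa>" "\<forall>\<psi>\<in>closed_segment \<phi>m \<theta>m. \<forall>\<kappa>. decays ?F \<psi> \<kappa>"
            using elim(2) by blast+
          show "\<theta>p \<in> {0<..<pi} \<and> \<theta>m \<in> {-pi<..<0} \<and>
           (\<forall>\<psi>\<in>closed_segment \<phi>p \<theta>p. decay_rate ?F \<psi> (of_real x)) \<and>
           (\<forall>\<psi>\<in>closed_segment \<phi>m \<theta>m. decay_rate ?F \<psi> (of_real x))"
            using B by (intro conjI ballI decay_rate_if_decays) simp_all
        qed
      qed
    qed
  qed
  \<comment> \<open>Rows with just one pair of angles: these are the directions of the wedge, and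
    the segments of directions shrink to points.\<close>
  have single: thesis
    if nVII: "c \<noteq> Case_VII" and \<phi>: "pi / 2 \<le> \<phi>p" "\<phi>p < pi" "- pi < \<phi>m" "\<phi>m \<le> - pi / 2"
      and dp: "\<And>\<kappa>. decays ?F \<phi>p \<kappa>" and dm: "\<And>\<kappa>. decays ?F \<phi>m \<kappa>"
      and ang: "\<And>\<epsilon> \<theta>p \<theta>m. MB_angles c p q ?\<mu> \<alpha> z0 \<epsilon> \<theta>p \<theta>m \<Longrightarrow> \<theta>p = \<phi>p \<and> \<theta>m = \<phi>m"
    for \<phi>p \<phi>m
  proof (rule fast[OF nVII \<phi> dp dm], intro always_eventually allI impI)
    fix \<epsilon> \<theta>p \<theta>m assume "MB_angles c p q ?\<mu> \<alpha> z0 \<epsilon> \<theta>p \<theta>m"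
    then have e: "\<theta>p = \<phi>p" "\<theta>m = \<phi>m" using ang by auto
    show "\<theta>p \<in> {0<..<pi} \<and> \<theta>m \<in> {-pi<..<0} \<and> (\<forall>\<psi>\<in>closed_segment \<phi>p \<theta>p. \<forall>\<kappa>. decays ?F \<psi> \<kappa>) \<and> (\<forall>\<psi>\<in>closed_segment \<phi>m \<theta>m. \<forall>\<kappa>. decays ?F \<psi> \<kappa>)"
      unfolding e closed_segment_idem using \<phi> dp dm pi_gt_zero by auto
  qed
  have D: "?D = (if c = Case_VII then {w. Im w = 0 \<and> Re w < 0} else {w. Im w \<in> MB_args m n p q a b \<tau> \<alpha>})"
  proof -
    have "MB_in_case Case_VII m n p q a b \<alpha> \<longleftrightarrow> c = Case_VII"
    proof
      assume "MB_in_case Case_VII m n p q a b \<alpha>"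
      from uniq[OF this] show "c = Case_VII" by (rule sym)
    next
      assume "c = Case_VII"
      with c show "MB_in_case Case_VII m n p q a b \<alpha>" by (simp only:)
    qed
    then show ?thesis unfolding MB_domain_def by (simp only:)
  qed
  have quad_p: "decays ?F (3 * pi / 4) \<kappa>" if "MB_N m n p q = 0" "Re \<alpha> = 0" "4 * Im \<alpha> + real p - real q < 0" for \<kappa>
  proof (rule MB_kernel_decays_quadratic[OF \<tau> mq' np ang(1) _ _ that(1)])
    have "cis (2 * (3 * pi / 4)) = - \<i>"
    proof -
      have "cis (2 * (3 * pi / 4)) = cis (pi + pi / 2)" by (rule arg_cong[of _ _ cis]) simp
      also have "\<dots> = cis pi * cis (pi / 2)" by (rule cis_mult[symmetric])
      finally show ?thesis by (simp add: complex_eq_iff)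
    qed
    then have "Re (of_real (pi / \<tau>) * (\<alpha> + \<i> * of_real 1 * (of_nat p - of_nat q) / 4) * cis (2 * (3 * pi / 4))) = pi / \<tau> * ((4 * Im \<alpha> + real p - real q) / 4)"
      using that(2) by (simp add: field_simps)
    then show "Re (of_real (pi / \<tau>) * (\<alpha> + \<i> * of_real 1 * (of_nat p - of_nat q) / 4) * cis (2 * (3 * pi / 4))) < 0"
      using \<tau> that(3) by (simp only:) (intro mult_pos_neg divide_neg_pos; simp)
  qed (use pi_gt_zero in auto)
  have quad_m: "decays ?F (- 3 * pi / 4) \<kappa>" if "MB_N m n p q = 0" "Re \<alpha> = 0" "- 4 * Im \<alpha> + real p - real q < 0" for \<kappa>
  proof (rule MB_kernel_decays_quadratic[OF \<tau> mq' np ang(2) _ _ that(1)])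
    have "cis (2 * (- 3 * pi / 4)) = \<i>"
    proof -
      have "cis (2 * (- 3 * pi / 4)) = cis (- pi + - pi / 2)" by (rule arg_cong[of _ _ cis]) simp
      also have "\<dots> = cis (- pi) * cis (- pi / 2)" by (rule cis_mult[symmetric])
      finally show ?thesis by (simp add: complex_eq_iff)
    qed
    then have "Re (of_real (pi / \<tau>) * (\<alpha> + \<i> * of_real (-1) * (of_nat p - of_nat q) / 4) * cis (2 * (- 3 * pi / 4))) = pi / \<tau> * ((- 4 * Im \<alpha> + real p - real q) / 4)"
      using that(2) by (simp add: field_simps)
    then show "Re (of_real (pi / \<tau>) * (\<alpha> + \<i> * of_real (-1) * (of_nat p - of_nat q) / 4) * cis (2 * (- 3 * pi / 4))) < 0"
      using \<tau> that(3) by (simp only:) (intro mult_pos_neg divide_neg_pos; simp)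
  qed (use pi_gt_zero in auto)
  have log_p: "decays ?F \<psi> \<kappa>" if "MB_N m n p q = 0" "4 * \<alpha> = (of_nat q - of_nat p) * \<i>" "\<psi> \<in> {0<..<pi}" "Re (?\<mu> * cis \<psi>) > 0" for \<psi> \<kappa>
  proof (rule MB_kernel_decays_log[OF \<tau> mq' np ang(1) _ _ that(1) _ that(4)])
    have "\<alpha> + \<i> * of_real 1 * (of_nat p - of_nat q) / 4 = (4 * \<alpha> + \<i> * (of_nat p - of_nat q)) / 4" by simp
    also have "\<dots> = 0" unfolding that(2) by (simp add: algebra_simps)
    finally show "\<alpha> + \<i> * of_real 1 * (of_nat p - of_nat q) / 4 = 0" .
  qed (use that(3) in auto)
  have log_m: "decays ?F \<psi> \<kappa>" if "MB_N m n p q = 0" "4 * \<alpha> = (of_nat p - of_nat q) * \<i>" "\<psi> \<in> {-pi<..<0}" "Re (?\<mu> * cis \<psi>) > 0" for \<psi> \<kappa>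
  proof (rule MB_kernel_decays_log[OF \<tau> mq' np ang(2) _ _ that(1) _ that(4)])
    have "\<alpha> + \<i> * of_real (-1) * (of_nat p - of_nat q) / 4 = (4 * \<alpha> - \<i> * (of_nat p - of_nat q)) / 4"
      by (simp add: diff_divide_distrib)
    also have "\<dots> = 0" unfolding that(2) by (simp add: algebra_simps)
    finally show "\<alpha> + \<i> * of_real (-1) * (of_nat p - of_nat q) / 4 = 0" .
  qed (use that(3) in auto)
  have mem: "3 * pi / 4 \<in> {0<..<pi}" "- 3 * pi / 4 \<in> {-pi<..<0}" "pi / 2 \<in> {0<..<pi}" "- pi / 2 \<in> {-pi<..<0}"
    "pi / 2 \<le> 3 * pi / 4" "3 * pi / 4 < pi" "- pi < - 3 * pi / 4" "- 3 * pi / 4 \<le> - pi / 2" "pi / 2 < pi" "- pi < - pi / 2" "\<not> pi / 2 \<le> pi / 4" "\<not> - pi / 4 \<le> - pi / 2"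
    using pi_gt_zero by auto
  show thesis
  proof (cases c)
    case Case_I
    have dp: "decays ?F (pi / 2) \<kappa>" for \<kappa>
      by (rule MB_kernel_decays_N_pos[OF \<tau> mq' np ang(1)]) (use c Case_I mem in auto)
    have dm: "decays ?F (- pi / 2) \<kappa>" for \<kappa>
      by (rule MB_kernel_decays_N_pos[OF \<tau> mq' np ang(2)]) (use c Case_I mem in auto)
    show ?thesis
      by (rule single[OF _ order_refl mem(9,10) order_refl dp dm]) (use Case_I in auto)
  next
    case Case_II
    have N: "MB_N m n p q = 0" using c Case_II by simp
    \<comment> \<open>The assumption on the table excludes the angles pi / 4 and - pi / 4, which
      fixes the signs of both real quantities when Re \<alpha> = 0.\<close>
    from T0_ex consider "Re \<alpha> > 0" | "Re \<alpha> = 0" "4 * Im \<alpha> + real p - real q < 0" "- 4 * Im \<alpha> + real p - real q < 0"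
    proof -
      obtain \<epsilon> \<theta>p \<theta>m where A: "MB_angles Case_II p q ?\<mu> \<alpha> z0 \<epsilon> \<theta>p \<theta>m" "\<theta>p \<ge> pi / 2" "\<theta>m \<le> - pi / 2"
        using T0_ex unfolding Case_II by blast
      then have "\<theta>p \<noteq> pi / 4" "\<theta>m \<noteq> - pi / 4" using pi_gt_zero by linarith+
      with A(1) that show ?thesis by (auto simp: Let_def)
    qed
    then show ?thesis
    proof cases
      case 1
      have "cis (2 * (pi / 2)) = -1" "cis (2 * (- pi / 2)) = -1" by (simp_all add: complex_eq_iff)
      then have e: "Re (of_real (pi / \<tau>) * (\<alpha> + \<i> * of_real \<sigma> * (of_nat p - of_nat q) / 4) * cis (2 * (pi / 2))) < 0"
        "Re (of_real (pi / \<tau>) * (\<alpha> + \<i> * of_real \<sigma> * (of_nat p - of_nat q) / 4) * cis (2 * (- pi / 2))) < 0" for \<sigma>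
        using 1 \<tau> by simp_all
      have dp: "decays ?F (pi / 2) \<kappa>" for \<kappa>
        by (rule MB_kernel_decays_quadratic[OF \<tau> mq' np ang(1) _ _ N e(1)]) (use mem in auto)
      have dm: "decays ?F (- pi / 2) \<kappa>" for \<kappa>
        by (rule MB_kernel_decays_quadratic[OF \<tau> mq' np ang(2) _ _ N e(2)]) (use mem in auto)
      show ?thesis
        by (rule single[OF _ order_refl mem(9,10) order_refl dp dm]) (use Case_II 1 in auto)
    next
      case 2
      show ?thesis
        by (rule single[OF _ mem(5-8) quad_p[OF N 2(1,2)] quad_m[OF N 2(1,3)]])
           (use Case_II 2 in \<open>auto simp: Let_def\<close>)
    qed
  next
    case Case_III
    have N: "MB_N m n p q = 0" and al: "4 * \<alpha> = (of_nat q - of_nat p) * \<i>" and mu0: "?\<mu> \<noteq> 0" using c Case_III by auto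
    have a0: "Re \<alpha> = 0" "4 * Im \<alpha> = real q - real p" using arg_cong[OF al, of Re] arg_cong[OF al, of Im] by simp_all
    \<comment> \<open>The lower angle - pi / 4, which belongs to p > q, is incompatible with the
      assumption on the table.\<close>
    have pq: "p < q" 
    proof -
      obtain \<epsilon> \<theta>p \<theta>m where A: "MB_angles Case_III p q ?\<mu> \<alpha> z0 \<epsilon> \<theta>p \<theta>m" "\<theta>m \<le> - pi / 2"
        using T0_ex unfolding Case_III by blast
      then have "\<theta>m \<noteq> - pi / 4" using pi_gt_zero by linarith
      with A(1) show ?thesis by auto
    qed
    have "\<forall>\<^sub>F \<epsilon> in at_right 0. \<exists>\<theta>\<ge>pi/2. MB_upper_angle_mu ?\<mu> \<epsilon> \<theta>"
      using T0 unfolding Case_III by eventually_elim auto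
    from this mu0 obtain \<phi> where \<phi>: "pi / 2 \<le> \<phi>" "\<phi> < pi"
      "\<forall>\<^sub>F \<epsilon> in at_right 0. \<forall>\<theta>. MB_upper_angle_mu ?\<mu> \<epsilon> \<theta> \<longrightarrow> \<theta> \<in> {0<..<pi} \<and> (\<forall>\<psi>\<in>closed_segment \<phi> \<theta>. \<psi> \<in> {0<..<pi} \<and> Re (?\<mu> * cis \<psi>) > 0)"
      by (rule MB_upper_angle_mu_cases)
    have "\<exists>\<epsilon>. (\<exists>\<theta>. MB_upper_angle_mu ?\<mu> \<epsilon> \<theta>) \<and> (\<forall>\<theta>. MB_upper_angle_mu ?\<mu> \<epsilon> \<theta> \<longrightarrow> \<theta> \<in> {0<..<pi} \<and> (\<forall>\<psi>\<in>closed_segment \<phi> \<theta>. \<psi> \<in> {0<..<pi} \<and> Re (?\<mu> * cis \<psi>) > 0))"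
    proof -
      have "\<forall>\<^sub>F \<epsilon> in at_right 0. (\<exists>\<theta>. MB_upper_angle_mu ?\<mu> \<epsilon> \<theta>) \<and> (\<forall>\<theta>. MB_upper_angle_mu ?\<mu> \<epsilon> \<theta> \<longrightarrow> \<theta> \<in> {0<..<pi} \<and> (\<forall>\<psi>\<in>closed_segment \<phi> \<theta>. \<psi> \<in> {0<..<pi} \<and> Re (?\<mu> * cis \<psi>) > 0))"
        using T0 \<phi>(3) unfolding Case_III by eventually_elim auto
      from eventually_happens'[OF trivial_limit_at_right_real this] show ?thesis .
    qed
    then have p0: "\<phi> \<in> {0<..<pi} \<and> Re (?\<mu> * cis \<phi>) > 0" using ends_in_segment(1) by blast
    have dp: "decays ?F \<phi> \<kappa>" for \<kappa> using log_p[OF N al] p0 by blast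
    have dm: "decays ?F (- 3 * pi / 4) \<kappa>" for \<kappa> using quad_m[OF N a0(1)] a0(2) pq by simp
    show ?thesis
    proof (rule fast[OF _ \<phi>(1,2) mem(7,8) dp dm])
      show "\<forall>\<^sub>F \<epsilon> in at_right 0. \<forall>\<theta>p \<theta>m. MB_angles c p q ?\<mu> \<alpha> z0 \<epsilon> \<theta>p \<theta>m \<longrightarrow>
           \<theta>p \<in> {0<..<pi} \<and> \<theta>m \<in> {-pi<..<0} \<and> (\<forall>\<psi>\<in>closed_segment \<phi> \<theta>p. \<forall>\<kappa>. decays ?F \<psi> \<kappa>) \<and> (\<forall>\<psi>\<in>closed_segment (- 3 * pi / 4) \<theta>m. \<forall>\<kappa>. decays ?F \<psi> \<kappa>)"
        using \<phi>(3) unfolding Case_III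
      proof eventually_elim
        case (elim \<epsilon>)
        show ?case
        proof (intro allI impI)
          fix \<theta>p \<theta>m assume "MB_angles Case_III p q ?\<mu> \<alpha> z0 \<epsilon> \<theta>p \<theta>m"
          then have 1: "MB_upper_angle_mu ?\<mu> \<epsilon> \<theta>p" and 2: "\<theta>m = - 3 * pi / 4" using pq by auto
          show "\<theta>p \<in> {0<..<pi} \<and> \<theta>m \<in> {-pi<..<0} \<and> (\<forall>\<psi>\<in>closed_segment \<phi> \<theta>p. \<forall>\<kappa>. decays ?F \<psi> \<kappa>) \<and> (\<forall>\<psi>\<in>closed_segment (- 3 * pi / 4) \<theta>m. \<forall>\<kappa>. decays ?F \<psi> \<kappa>)"
            unfolding 2 closed_segment_idem using elim 1 log_p[OF N al] dm mem by blast
        qed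
      qed
    qed (use Case_III in simp)
  next
    case Case_IV
    have N: "MB_N m n p q = 0" and al: "4 * \<alpha> = (of_nat p - of_nat q) * \<i>" and mu0: "?\<mu> \<noteq> 0" using c Case_IV by auto
    have a0: "Re \<alpha> = 0" "4 * Im \<alpha> = real p - real q" using arg_cong[OF al, of Re] arg_cong[OF al, of Im] by simp_all
    have pq: "p < q" 
    proof -
      obtain \<epsilon> \<theta>p \<theta>m where A: "MB_angles Case_IV p q ?\<mu> \<alpha> z0 \<epsilon> \<theta>p \<theta>m" "\<theta>p \<ge> pi / 2"
        using T0_ex unfolding Case_IV by blast
      then have "\<theta>p \<noteq> pi / 4" using pi_gt_zero by linarith
      with A(1) show ?thesis by auto
    qed
    have "\<forall>\<^sub>F \<epsilon> in at_right 0. \<exists>\<theta>\<le>-pi/2. MB_lower_angle_mu ?\<mu> \<epsilon> \<theta>"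
      using T0 unfolding Case_IV by eventually_elim auto
    from this mu0 obtain \<phi> where \<phi>: "- pi < \<phi>" "\<phi> \<le> - pi / 2"
      "\<forall>\<^sub>F \<epsilon> in at_right 0. \<forall>\<theta>. MB_lower_angle_mu ?\<mu> \<epsilon> \<theta> \<longrightarrow> \<theta> \<in> {-pi<..<0} \<and> (\<forall>\<psi>\<in>closed_segment \<phi> \<theta>. \<psi> \<in> {-pi<..<0} \<and> Re (?\<mu> * cis \<psi>) > 0)"
      by (rule MB_lower_angle_mu_cases)
    have "\<exists>\<epsilon>. (\<exists>\<theta>. MB_lower_angle_mu ?\<mu> \<epsilon> \<theta>) \<and> (\<forall>\<theta>. MB_lower_angle_mu ?\<mu> \<epsilon> \<theta> \<longrightarrow> \<theta> \<in> {-pi<..<0} \<and> (\<forall>\<psi>\<in>closed_segment \<phi> \<theta>. \<psi> \<in> {-pi<..<0} \<and> Re (?\<mu> * cis \<psi>) > 0))"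
    proof -
      have "\<forall>\<^sub>F \<epsilon> in at_right 0. (\<exists>\<theta>. MB_lower_angle_mu ?\<mu> \<epsilon> \<theta>) \<and> (\<forall>\<theta>. MB_lower_angle_mu ?\<mu> \<epsilon> \<theta> \<longrightarrow> \<theta> \<in> {-pi<..<0} \<and> (\<forall>\<psi>\<in>closed_segment \<phi> \<theta>. \<psi> \<in> {-pi<..<0} \<and> Re (?\<mu> * cis \<psi>) > 0))"
        using T0 \<phi>(3) unfolding Case_IV by eventually_elim auto
      from eventually_happens'[OF trivial_limit_at_right_real this] show ?thesis .
    qed
    then have m0: "\<phi> \<in> {-pi<..<0} \<and> Re (?\<mu> * cis \<phi>) > 0" using ends_in_segment(1) by blast
    have dm: "decays ?F \<phi> \<kappa>" for \<kappa> using log_m[OF N al] m0 by blast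
    have dp: "decays ?F (3 * pi / 4) \<kappa>" for \<kappa> using quad_p[OF N a0(1)] a0(2) pq by simp
    show ?thesis
    proof (rule fast[OF _ mem(5,6) \<phi>(1,2) dp dm])
      show "\<forall>\<^sub>F \<epsilon> in at_right 0. \<forall>\<theta>p \<theta>m. MB_angles c p q ?\<mu> \<alpha> z0 \<epsilon> \<theta>p \<theta>m \<longrightarrow>
           \<theta>p \<in> {0<..<pi} \<and> \<theta>m \<in> {-pi<..<0} \<and> (\<forall>\<psi>\<in>closed_segment (3 * pi / 4) \<theta>p. \<forall>\<kappa>. decays ?F \<psi> \<kappa>) \<and> (\<forall>\<psi>\<in>closed_segment \<phi> \<theta>m. \<forall>\<kappa>. decays ?F \<psi> \<kappa>)"
        using \<phi>(3) unfolding Case_IV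
      proof eventually_elim
        case (elim \<epsilon>)
        show ?case
        proof (intro allI impI)
          fix \<theta>p \<theta>m assume "MB_angles Case_IV p q ?\<mu> \<alpha> z0 \<epsilon> \<theta>p \<theta>m"
          then have 1: "MB_lower_angle_mu ?\<mu> \<epsilon> \<theta>m" and 2: "\<theta>p = 3 * pi / 4" using pq by auto
          show "\<theta>p \<in> {0<..<pi} \<and> \<theta>m \<in> {-pi<..<0} \<and> (\<forall>\<psi>\<in>closed_segment (3 * pi / 4) \<theta>p. \<forall>\<kappa>. decays ?F \<psi> \<kappa>) \<and> (\<forall>\<psi>\<in>closed_segment \<phi> \<theta>m. \<forall>\<kappa>. decays ?F \<psi> \<kappa>)"
            unfolding 2 closed_segment_idem using elim 1 log_m[OF N al] dp mem by blast
        qed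
      qed
    qed (use Case_IV in simp)
  next
    case Case_V
    have N: "MB_N m n p q = 0" and a0: "\<alpha> = 0" "p = q" and mu0: "?\<mu> \<noteq> 0" using c Case_V by auto
    have al: "4 * \<alpha> = (of_nat q - of_nat p) * \<i>" "4 * \<alpha> = (of_nat p - of_nat q) * \<i>" using a0 by simp_all
    have "\<forall>\<^sub>F \<epsilon> in at_right 0. \<exists>\<theta>\<ge>pi/2. MB_upper_angle_mu ?\<mu> \<epsilon> \<theta>"
      using T0 unfolding Case_V by eventually_elim auto
    from this mu0 obtain \<phi>p where \<phi>p: "pi / 2 \<le> \<phi>p" "\<phi>p < pi"
      "\<forall>\<^sub>F \<epsilon> in at_right 0. \<forall>\<theta>. MB_upper_angle_mu ?\<mu> \<epsilon> \<theta> \<longrightarrow> \<theta> \<in> {0<..<pi} \<and> (\<forall>\<psi>\<in>closed_segment \<phi>p \<theta>. \<psi> \<in> {0<..<pi} \<and> Re (?\<mu> * cis \<psi>) > 0)"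
      by (rule MB_upper_angle_mu_cases)
    have "\<forall>\<^sub>F \<epsilon> in at_right 0. \<exists>\<theta>\<le>-pi/2. MB_lower_angle_mu ?\<mu> \<epsilon> \<theta>"
      using T0 unfolding Case_V by eventually_elim auto
    from this mu0 obtain \<phi>m where \<phi>m: "- pi < \<phi>m" "\<phi>m \<le> - pi / 2"
      "\<forall>\<^sub>F \<epsilon> in at_right 0. \<forall>\<theta>. MB_lower_angle_mu ?\<mu> \<epsilon> \<theta> \<longrightarrow> \<theta> \<in> {-pi<..<0} \<and> (\<forall>\<psi>\<in>closed_segment \<phi>m \<theta>. \<psi> \<in> {-pi<..<0} \<and> Re (?\<mu> * cis \<psi>) > 0)"
      by (rule MB_lower_angle_mu_cases)
    have "\<forall>\<^sub>F \<epsilon> in at_right 0. (\<exists>\<theta>. MB_upper_angle_mu ?\<mu> \<epsilon> \<theta>) \<and> (\<forall>\<theta>. MB_upper_angle_mu ?\<mu> \<epsilon> \<theta> \<longrightarrow> (\<forall>\<psi>\<in>closed_segment \<phi>p \<theta>. \<psi> \<in> {0<..<pi} \<and> Re (?\<mu> * cis \<psi>) > 0))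
        \<and> (\<exists>\<theta>. MB_lower_angle_mu ?\<mu> \<epsilon> \<theta>) \<and> (\<forall>\<theta>. MB_lower_angle_mu ?\<mu> \<epsilon> \<theta> \<longrightarrow> (\<forall>\<psi>\<in>closed_segment \<phi>m \<theta>. \<psi> \<in> {-pi<..<0} \<and> Re (?\<mu> * cis \<psi>) > 0))"
      using T0 \<phi>p(3) \<phi>m(3) unfolding Case_V by eventually_elim auto
    from eventually_happens'[OF trivial_limit_at_right_real this]
    have "(\<phi>p \<in> {0<..<pi} \<and> Re (?\<mu> * cis \<phi>p) > 0) \<and> (\<phi>m \<in> {-pi<..<0} \<and> Re (?\<mu> * cis \<phi>m) > 0)"
      using ends_in_segment(1) by blast
    then have dp: "decays ?F \<phi>p \<kappa>" and dm: "decays ?F \<phi>m \<kappa>" for \<kappa> using log_p[OF N al(1)] log_m[OF N al(2)] by blast+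
    show ?thesis
    proof (rule fast[OF _ \<phi>p(1,2) \<phi>m(1,2) dp dm])
      show "\<forall>\<^sub>F \<epsilon> in at_right 0. \<forall>\<theta>p \<theta>m. MB_angles c p q ?\<mu> \<alpha> z0 \<epsilon> \<theta>p \<theta>m \<longrightarrow>
           \<theta>p \<in> {0<..<pi} \<and> \<theta>m \<in> {-pi<..<0} \<and> (\<forall>\<psi>\<in>closed_segment \<phi>p \<theta>p. \<forall>\<kappa>. decays ?F \<psi> \<kappa>) \<and> (\<forall>\<psi>\<in>closed_segment \<phi>m \<theta>m. \<forall>\<kappa>. decays ?F \<psi> \<kappa>)"
        using \<phi>p(3) \<phi>m(3) unfolding Case_V
      proof eventually_elim
        case (elim \<epsilon>)
        show ?case
        proof (intro allI impI)
          fix \<theta>p \<theta>m assume "MB_angles Case_V p q ?\<mu> \<alpha> z0 \<epsilon> \<theta>p \<theta>m"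
          then have 1: "MB_upper_angle_mu ?\<mu> \<epsilon> \<theta>p" "MB_lower_angle_mu ?\<mu> \<epsilon> \<theta>m" by auto
          show "\<theta>p \<in> {0<..<pi} \<and> \<theta>m \<in> {-pi<..<0} \<and> (\<forall>\<psi>\<in>closed_segment \<phi>p \<theta>p. \<forall>\<kappa>. decays ?F \<psi> \<kappa>) \<and> (\<forall>\<psi>\<in>closed_segment \<phi>m \<theta>m. \<forall>\<kappa>. decays ?F \<psi> \<kappa>)"
            using elim 1 log_p[OF N al(1)] log_m[OF N al(2)] by blast
        qed
      qed
    qed (use Case_V in simp)
  next
    case Case_VI
    have N: "MB_N m n p q = 0" and pq: "p = q" "\<alpha> = 0" "?\<mu> = 0" and nu: "Re (MB_nu p q a b) < 0" using c Case_VI by auto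
    have nVII: "\<not> MB_in_case MB_case.Case_VII m n p q a b \<alpha>" using nu by auto
    have VI: "MB_in_case MB_case.Case_VI m n p q a b \<alpha>" using c unfolding Case_VI .
    \<comment> \<open>Half-width of the strip in case (vi). It is also the supremum of the rates
      reached in the directions pi / 2 and - pi / 2, so the decay beats |Im w| exactly inside the
      strip.\<close>
    define \<rho> where "\<rho> = - (pi * Re (MB_nu p q a b) / (2 * \<tau>))"
    have \<rho>: "\<rho> > 0" using nu \<tau> by (simp add: \<rho>_def divide_neg_pos mult_pos_neg)
    have args: "MB_args m n p q a b \<tau> \<alpha> = {\<phi>. \<bar>\<phi>\<bar> < \<rho>}" unfolding MB_args_def \<rho>_def by (simp only: VI nVII if_True if_False)
    have dp: "decays ?F (pi / 2) \<kappa>" if "\<kappa> < \<rho>" for \<kappa>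
      by (rule MB_kernel_decays_linear[OF \<tau> mq' np ang(1) _ _ N pq]) (use mem that in \<open>simp_all add: \<rho>_def field_simps\<close>)
    have dm: "decays ?F (- pi / 2) \<kappa>" if "\<kappa> < \<rho>" for \<kappa>
      by (rule MB_kernel_decays_linear[OF \<tau> mq' np ang(2) _ _ N pq]) (use mem that in \<open>simp_all add: \<rho>_def field_simps\<close>)
    have rp: "decay_rate ?F (pi / 2) w" "decay_rate ?F (- pi / 2) w" if "\<bar>Im w\<bar> < \<rho>" for w
    proof -
      obtain \<kappa> where "\<bar>Im w\<bar> < \<kappa>" "\<kappa> < \<rho>" using dense[OF \<open>\<bar>Im w\<bar> < \<rho>\<close>] by blast
      then show "decay_rate ?F (pi / 2) w" "decay_rate ?F (- pi / 2) w"
        unfolding decay_rate_def using dp[of \<kappa>] dm[of \<kappa>] by (intro exI[of _ \<kappa>]; auto)+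
    qed
    show ?thesis
    proof (rule main[of "pi / 2" "- pi / 2"])
      fix w assume "w \<in> ?D"
      then have "\<bar>Im w\<bar> < \<rho>" unfolding D args using Case_VI by simp
      then show "decay_rate ?F (pi / 2) w" "decay_rate ?F (- pi / 2) w" by (rule rp)+
    next
      fix x :: real
      have r: "decay_rate ?F (pi / 2) (of_real x)" "decay_rate ?F (- pi / 2) (of_real x)" using rp[of "of_real x"] \<rho> by simp_all
      show "\<forall>\<^sub>F \<epsilon> in at_right 0. (\<exists>\<theta>p \<theta>m. ?T (exp x) \<epsilon> \<theta>p \<theta>m) \<and>
         (\<forall>\<theta>p \<theta>m. ?T (exp x) \<epsilon> \<theta>p \<theta>m \<longrightarrow>
           \<theta>p \<in> {0<..<pi} \<and> \<theta>m \<in> {-pi<..<0} \<and>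
           (\<forall>\<psi>\<in>closed_segment (pi / 2) \<theta>p. decay_rate ?F \<psi> (of_real x)) \<and>
           (\<forall>\<psi>\<in>closed_segment (- pi / 2) \<theta>m. decay_rate ?F \<psi> (of_real x)))"
        unfolding T_iff Case_VI MB_angles.simps
      proof (intro always_eventually allI conjI impI)
        show "\<exists>\<theta>p \<theta>m. \<theta>p = pi / 2 \<and> \<theta>m = - pi / 2" by blast
        fix \<theta>p \<theta>m assume "\<theta>p = pi / 2 \<and> \<theta>m = - pi / 2"
        then have e: "\<theta>p = pi / 2" "\<theta>m = - pi / 2" by blast+
        show "\<theta>p \<in> {0<..<pi}" "\<theta>m \<in> {-pi<..<0}" unfolding e by (rule mem)+
        show "\<forall>\<psi>\<in>closed_segment (pi / 2) \<theta>p. decay_rate ?F \<psi> (of_real x)"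
          "\<forall>\<psi>\<in>closed_segment (- pi / 2) \<theta>m. decay_rate ?F \<psi> (of_real x)"
          unfolding e closed_segment_idem using r by blast+
      qed
    qed (use mem in auto)
  next
    case Case_VII
    have N: "MB_N m n p q = 0" and pq: "p = q" "\<alpha> = 0" "?\<mu> = 0" and nu: "MB_nu p q a b = 0" using c Case_VII by auto
    have dp: "decays ?F \<psi> \<kappa>" if "\<kappa> < 0" "\<psi> \<in> {0<..<pi}" for \<kappa> \<psi>
      by (rule MB_kernel_decays_linear[OF \<tau> mq' np ang(1) _ _ N pq]) (use that nu in simp_all)
    have dm: "decays ?F \<psi> \<kappa>" if "\<kappa> < 0" "\<psi> \<in> {-pi<..<0}" for \<kappa> \<psi>
      by (rule MB_kernel_decays_linear[OF \<tau> mq' np ang(2) _ _ N pq]) (use that nu in simp_all)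
    \<comment> \<open>In case (vii) the kernel reaches all negative rates only; the missing decay is
      supplied by exp (- s w), since cos \<psi> < 0 and Re w < 0. This is why the domain is
      restricted to |z| < 1.\<close>
    have rp: "decay_rate ?F \<psi> w" if "\<psi> \<in> {pi/2<..<pi}" "Im w = 0" "Re w < 0" for \<psi> w
    proof -
      have "cos (pi - \<psi>) > 0" using that by (intro cos_gt_zero_pi) auto
      then have "- cos \<psi> * Re w < 0" using that by (simp add: mult_neg_neg)
      then obtain \<kappa> where "- cos \<psi> * Re w < \<kappa>" "\<kappa> < 0" using dense[of "- cos \<psi> * Re w" 0] by blast
      then show ?thesis unfolding decay_rate_def using dp[of \<kappa> \<psi>] that pi_gt_zero by (intro exI[of _ \<kappa>]) simp
    qed
    have rm: "decay_rate ?F \<psi> w" if "\<psi> \<in> {-pi<..<-pi/2}" "Im w = 0" "Re w < 0" for \<psi> w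
    proof -
      have "cos (pi + \<psi>) > 0" using that by (intro cos_gt_zero_pi) auto
      then have "- cos \<psi> * Re w < 0" using that by (simp add: mult_neg_neg)
      then obtain \<kappa> where "- cos \<psi> * Re w < \<kappa>" "\<kappa> < 0" using dense[of "- cos \<psi> * Re w" 0] by blast
      then show ?thesis unfolding decay_rate_def using dm[of \<kappa> \<psi>] that pi_gt_zero by (intro exI[of _ \<kappa>]) simp
    qed
    show ?thesis
    proof (rule main[OF mem(5-8)])
      fix w assume "w \<in> ?D"
      then have w: "Im w = 0" "Re w < 0" unfolding D using Case_VII by auto
      show "decay_rate ?F (3 * pi / 4) w" by (rule rp[OF _ w]) (use pi_gt_zero in auto)
      show "decay_rate ?F (- 3 * pi / 4) w" by (rule rm[OF _ w]) (use pi_gt_zero in auto)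
    next
      fix x :: real assume "complex_of_real x \<in> ?D"
      then have x: "x < 0" unfolding D using Case_VII by auto
      have "pi / 4 > 0" by simp
      show "\<forall>\<^sub>F \<epsilon> in at_right 0. (\<exists>\<theta>p \<theta>m. ?T (exp x) \<epsilon> \<theta>p \<theta>m) \<and>
         (\<forall>\<theta>p \<theta>m. ?T (exp x) \<epsilon> \<theta>p \<theta>m \<longrightarrow>
           \<theta>p \<in> {0<..<pi} \<and> \<theta>m \<in> {-pi<..<0} \<and>
           (\<forall>\<psi>\<in>closed_segment (3 * pi / 4) \<theta>p. decay_rate ?F \<psi> (of_real x)) \<and>
           (\<forall>\<psi>\<in>closed_segment (- 3 * pi / 4) \<theta>m. decay_rate ?F \<psi> (of_real x)))"
        using small[OF \<open>pi / 4 > 0\<close>] unfolding T_iff Case_VII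
      proof eventually_elim
        case (elim \<epsilon>)
        have 1: "MB_angles MB_case.Case_VII p q ?\<mu> \<alpha> (exp x) \<epsilon> \<theta>p \<theta>m \<longleftrightarrow> \<theta>p = pi - \<epsilon> \<and> \<theta>m = - (pi - \<epsilon>)" for \<theta>p \<theta>m
          using x by simp
        have 2: "closed_segment (3 * pi / 4) (pi - \<epsilon>) \<subseteq> {pi/2<..<pi}" "closed_segment (- 3 * pi / 4) (- (pi - \<epsilon>)) \<subseteq> {-pi<..<-pi/2}"
        proof -
          have "3 * pi / 4 \<le> pi - \<epsilon>" "- (pi - \<epsilon>) \<le> - 3 * pi / 4" "- 3 * pi / 4 \<noteq> - (pi - \<epsilon>)" using elim by linarith+
          then have s: "closed_segment (3 * pi / 4) (pi - \<epsilon>) = {3 * pi / 4..pi - \<epsilon>}" "closed_segment (- 3 * pi / 4) (- (pi - \<epsilon>)) = {- (pi - \<epsilon>)..- 3 * pi / 4}"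
            unfolding closed_segment_eq_real_ivl by simp_all
          have "pi / 2 < y \<and> y < pi" if "3 * pi / 4 \<le> y" "y \<le> pi - \<epsilon>" for y
            using that elim pi_gt_zero by linarith
          moreover have "- pi < y \<and> y < - pi / 2" if "- (pi - \<epsilon>) \<le> y" "y \<le> - 3 * pi / 4" for y
            using that elim pi_gt_zero by linarith
          ultimately show "closed_segment (3 * pi / 4) (pi - \<epsilon>) \<subseteq> {pi/2<..<pi}" "closed_segment (- 3 * pi / 4) (- (pi - \<epsilon>)) \<subseteq> {-pi<..<-pi/2}"
            unfolding s subset_iff atLeastAtMost_iff greaterThanLessThan_iff by blast+
        qed
        have "decay_rate ?F \<psi> (of_real x)" if "\<psi> \<in> closed_segment (3 * pi / 4) (pi - \<epsilon>)" for \<psi>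
          using rp[of \<psi> "of_real x"] 2(1) that x by auto
        moreover have "decay_rate ?F \<psi> (of_real x)" if "\<psi> \<in> closed_segment (- 3 * pi / 4) (- (pi - \<epsilon>))" for \<psi>
          using rm[of \<psi> "of_real x"] 2(2) that x by auto
        moreover have "pi - \<epsilon> \<in> {0<..<pi}" "- (pi - \<epsilon>) \<in> {-pi<..<0}" using elim by auto
        ultimately show ?case unfolding 1 by simp
      qed
    qed
  qed
qed

section \<open>Improper integrals and uniform decay\<close>

text \<open>Integrating the exponential bound over the tails gives a Cauchy sequence and an explicit
  error. The explicit error yields size and uniform convergence of the wedge integral; independent
  endpoints are needed because a circle cuts the two ends of a curve at different
  parameters.\<close>

lemma has_integral_UNIV_exp_rate:
  fixes h :: "real \<Rightarrow> complex"
  assumes int: "\<And>a b. h integrable_on {a..b}" and \<kappa>: "\<kappa> > 0"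
    and bd: "\<And>t. \<bar>t\<bar> \<ge> T \<Longrightarrow> cmod (h t) \<le> C * exp (- \<kappa> * \<bar>t\<bar>)"
  shows "\<exists>I. (h has_integral I) UNIV \<and> (\<forall>a\<ge>max T 0. cmod (I - integral {- a..a} h) \<le> 2 * (\<bar>C\<bar> / \<kappa>) * exp (- \<kappa> * a)) \<and>
     (\<forall>e>0. \<exists>B. \<forall>t1\<ge>B. \<forall>t2\<ge>B. cmod (integral {- t2..t1} h - I) < e)"
proof -
  define K where "K = \<bar>C\<bar> / \<kappa>"
  have C0: "C * exp (- \<kappa> * \<bar>t\<bar>) \<le> \<bar>C\<bar> * exp (- \<kappa> * \<bar>t\<bar>)" for t by (intro mult_right_mono) auto
  have expint: "((\<lambda>t. \<bar>C\<bar> * exp (- \<kappa> * t)) has_integral K * exp (- \<kappa> * a) - K * exp (- \<kappa> * b)) {a..b}" if "a \<le> b" for a b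
  proof -
    have "((\<lambda>t. \<bar>C\<bar> * exp (- \<kappa> * t)) has_integral (- K * exp (- \<kappa> * b) - (- K * exp (- \<kappa> * a)))) {a..b}"
      using \<kappa> that by (intro fundamental_theorem_of_calculus)
        (auto intro!: derivative_eq_intros simp: has_real_derivative_iff_has_vector_derivative[symmetric] K_def)
    then show ?thesis by simp
  qed
  have pos: "cmod (integral {a..b} h) \<le> K * exp (- \<kappa> * a)" if "T \<le> a" "0 \<le> a" "a \<le> b" for a b
  proof -
    have "cmod (integral {a..b} h) \<le> integral {a..b} (\<lambda>t. \<bar>C\<bar> * exp (- \<kappa> * t))"
    proof (rule integral_norm_bound_integral[OF int has_integral_integrable[OF expint[OF that(3)]]])
      fix t assume "t \<in> {a..b}"
      then have "\<bar>t\<bar> = t" "\<bar>t\<bar> \<ge> T" using that by auto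
      then show "cmod (h t) \<le> \<bar>C\<bar> * exp (- \<kappa> * t)" using order_trans[OF bd[of t] C0[of t]] by (simp only:)
    qed
    also have "\<dots> = K * exp (- \<kappa> * a) - K * exp (- \<kappa> * b)" by (rule integral_unique[OF expint[OF that(3)]])
    also have "\<dots> \<le> K * exp (- \<kappa> * a)" using \<kappa> by (simp add: K_def)
    finally show ?thesis .
  qed
  have neg: "cmod (integral {- b..- a} h) \<le> K * exp (- \<kappa> * a)" if "T \<le> a" "0 \<le> a" "a \<le> b" for a b
  proof -
    have i: "(\<lambda>t. h (- t)) integrable_on {a..b}" using int[of "- b" "- a"] Henstock_Kurzweil_Integration.integrable_reflect_real[where a = "- b" and b = "- a" and f = h] unfolding minus_minus by blast
    have "integral {- b..- a} h = integral {a..b} (\<lambda>t. h (- t))"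
      using Henstock_Kurzweil_Integration.integral_reflect_real[of "- a" "- b" h] by simp
    also have "cmod \<dots> \<le> integral {a..b} (\<lambda>t. \<bar>C\<bar> * exp (- \<kappa> * t))"
    proof (rule integral_norm_bound_integral[OF i has_integral_integrable[OF expint[OF that(3)]]])
      fix t assume "t \<in> {a..b}"
      then have "\<bar>- t\<bar> = t" "\<bar>- t\<bar> \<ge> T" using that by auto
      then show "cmod (h (- t)) \<le> \<bar>C\<bar> * exp (- \<kappa> * t)" using order_trans[OF bd[of "- t"] C0[of "- t"]] by (simp only:)
    qed
    also have "\<dots> = K * exp (- \<kappa> * a) - K * exp (- \<kappa> * b)" by (rule integral_unique[OF expint[OF that(3)]])
    also have "\<dots> \<le> K * exp (- \<kappa> * a)" using \<kappa> by (simp add: K_def)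
    finally show ?thesis .
  qed
  define B0 where "B0 = max T 0"
  have comb: "integral {- b..b'} h = integral {- b..- a} h + integral {- a..a} h + integral {a..b'} h" if "0 \<le> a" "a \<le> b" "a \<le> b'" for a b b'
  proof -
    have "integral {- b..- a} h + integral {- a..b'} h = integral {- b..b'} h"
      using that by (intro Henstock_Kurzweil_Integration.integral_combine int) auto
    moreover have "integral {- a..a} h + integral {a..b'} h = integral {- a..b'} h"
      using that by (intro Henstock_Kurzweil_Integration.integral_combine int) auto
    ultimately show ?thesis by (simp only: add.assoc)
  qed
  have close: "cmod (integral {- t2..t1} h - integral {- a..a} h) \<le> 2 * K * exp (- \<kappa> * a)" if "B0 \<le> a" "a \<le> t1" "a \<le> t2" for a t1 t2
  proof -
    have a: "T \<le> a" "0 \<le> a" using that by (auto simp: B0_def)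
    have "integral {- t2..t1} h - integral {- a..a} h = integral {- t2..- a} h + integral {a..t1} h"
      using comb[OF a(2) that(3,2)] by simp
    also have "cmod \<dots> \<le> cmod (integral {- t2..- a} h) + cmod (integral {a..t1} h)" by (rule norm_triangle_ineq)
    finally show ?thesis using pos[OF a that(2)] neg[OF a that(3)] by simp
  qed
  have small: "\<forall>\<^sub>F a in at_top. 2 * K * exp (- \<kappa> * a) < e" if "e > 0" for e
  proof -
    have "((\<lambda>a. 2 * K * exp (- \<kappa> * a)) \<longlongrightarrow> 0) at_top" using \<kappa> by real_asymp
    then show ?thesis using order_tendstoD(2)[OF _ that] by blast
  qed
  have "Cauchy (\<lambda>n. integral {- real n..real n} h)"
  proof (rule CauchyI)
    fix e :: real assume "e > 0"
    then obtain a where a: "B0 \<le> a" "2 * K * exp (- \<kappa> * a) < e / 2"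
      using eventually_happens'[OF trivial_limit_at_top_linorder eventually_conj[OF eventually_ge_at_top[of B0] small[of "e / 2"]]] by auto
    obtain N :: nat where N: "a \<le> real N" using real_arch_simple ..
    have nrm: "cmod (integral {- real n..real n} h - integral {- a..a} h) < e / 2" if "n \<ge> N" for n
      using close[OF a(1), of "real n" "real n"] a(2) N that by simp
    show "\<exists>M. \<forall>m\<ge>M. \<forall>n\<ge>M. cmod (integral {- real m..real m} h - integral {- real n..real n} h) < e"
    proof (rule exI[of _ N], intro allI impI)
      fix m n assume mn: "m \<ge> N" "n \<ge> N"
      show "cmod (integral {- real m..real m} h - integral {- real n..real n} h) < e"
        using norm_triangle_lt[of "integral {- real m..real m} h - integral {- a..a} h" "- (integral {- real n..real n} h - integral {- a..a} h)" e]
          nrm[OF mn(1)] nrm[OF mn(2)] unfolding norm_minus_cancel by simp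
    qed
  qed
  then obtain I where I: "(\<lambda>n. integral {- real n..real n} h) \<longlonglongrightarrow> I" using Cauchy_convergent_iff convergent_def by blast
  have rate: "cmod (I - integral {- a..a} h) \<le> 2 * K * exp (- \<kappa> * a)" if a: "B0 \<le> a" for a
  proof -
    have "\<forall>\<^sub>F n in sequentially. cmod (integral {- real n..real n} h - integral {- a..a} h) \<le> 2 * K * exp (- \<kappa> * a)"
      using eventually_ge_at_top[of "nat \<lceil>a\<rceil>"]
    proof eventually_elim
      case (elim n) then show ?case by (intro close[OF a]) linarith+
    qed
    moreover have "(\<lambda>n. cmod (integral {- real n..real n} h - integral {- a..a} h)) \<longlonglongrightarrow> cmod (I - integral {- a..a} h)"
      by (intro tendsto_intros I)
    ultimately show ?thesis by (intro tendsto_upperbound[of _ _ sequentially]) auto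
  qed
  have lim: "\<exists>B. \<forall>t1\<ge>B. \<forall>t2\<ge>B. cmod (integral {- t2..t1} h - I) < e" if e: "e > 0" for e
  proof -
    obtain a where a: "B0 \<le> a" "2 * K * exp (- \<kappa> * a) < e / 2"
      using eventually_happens'[OF trivial_limit_at_top_linorder eventually_conj[OF eventually_ge_at_top[of B0] small[of "e / 2"]]] e by auto
    note Ia = rate[OF a(1)]
    show ?thesis
    proof (rule exI[of _ a], intro allI impI)
      fix t1 t2 assume "t1 \<ge> a" "t2 \<ge> a"
      then have "cmod (integral {- t2..t1} h - integral {- a..a} h) \<le> 2 * K * exp (- \<kappa> * a)" by (rule close[OF a(1)])
      then show "cmod (integral {- t2..t1} h - I) < e"
        using Ia a(2) norm_triangle_lt[of "integral {- t2..t1} h - integral {- a..a} h" "- (I - integral {- a..a} h)" e]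
        unfolding norm_minus_cancel by simp
    qed
  qed
  have "(h has_integral I) UNIV"
    unfolding has_integral_alt'[of h I UNIV]
  proof (intro conjI allI impI)
    fix a b :: real show "(\<lambda>x. if x \<in> UNIV then h x else 0) integrable_on cbox a b" using int[of a b] by simp
  next
    fix e :: real assume "e > 0"
    then obtain B where B: "\<forall>t1\<ge>B. \<forall>t2\<ge>B. cmod (integral {- t2..t1} h - I) < e" using lim by blast
    show "\<exists>B>0. \<forall>a b. ball 0 B \<subseteq> cbox a b \<longrightarrow> cmod (integral (cbox a b) (\<lambda>x. if x \<in> UNIV then h x else 0) - I) < e"
    proof (rule exI[of _ "\<bar>B\<bar> + 1"], intro conjI allI impI)
      fix a b :: real assume "ball 0 (\<bar>B\<bar> + 1) \<subseteq> cbox a b"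
      moreover have "\<bar>B\<bar> \<in> ball 0 (\<bar>B\<bar> + 1)" "- \<bar>B\<bar> \<in> ball 0 (\<bar>B\<bar> + 1)" by simp_all
      ultimately have "\<bar>B\<bar> \<in> {a..b}" "- \<bar>B\<bar> \<in> {a..b}" unfolding cbox_interval by blast+
      then have "B \<le> b" "B \<le> - a" by auto
      then have "cmod (integral {- (- a)..b} h - I) < e" using B by blast
      then show "cmod (integral (cbox a b) (\<lambda>x. if x \<in> UNIV then h x else 0) - I) < e" by simp
    qed simp
  qed
  then show ?thesis using rate lim unfolding B0_def K_def by (intro exI[of _ I] conjI) simp_all
qed

lemma has_integral_UNIV_exp_tails:
  fixes h :: "real \<Rightarrow> complex"
  assumes "\<And>a b. h integrable_on {a..b}" "\<kappa> > 0" "\<And>t. \<bar>t\<bar> \<ge> T \<Longrightarrow> cmod (h t) \<le> C * exp (- \<kappa> * \<bar>t\<bar>)"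
  shows "\<exists>I. (h has_integral I) UNIV \<and> (\<forall>e>0. \<exists>B. \<forall>t1\<ge>B. \<forall>t2\<ge>B. cmod (integral {- t2..t1} h - I) < e)"
proof -
  have "\<exists>I. (h has_integral I) UNIV \<and> (\<forall>a\<ge>max T 0. cmod (I - integral {- a..a} h) \<le> 2 * (\<bar>C\<bar> / \<kappa>) * exp (- \<kappa> * a)) \<and>
     (\<forall>e>0. \<exists>B. \<forall>t1\<ge>B. \<forall>t2\<ge>B. cmod (integral {- t2..t1} h - I) < e)"
    by (rule has_integral_UNIV_exp_rate[OF assms])
  then obtain I where "(h has_integral I) UNIV" "\<forall>e>0. \<exists>B. \<forall>t1\<ge>B. \<forall>t2\<ge>B. cmod (integral {- t2..t1} h - I) < e"
    by (elim exE conjE)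
  then show ?thesis by (intro exI[of _ I] conjI)
qed

definition decays_on :: "(complex \<Rightarrow> complex) \<Rightarrow> real set \<Rightarrow> bool" where
  "decays_on F S \<longleftrightarrow> (\<exists>\<kappa>>0. \<exists>\<eta>>0. \<exists>R. \<forall>r\<ge>R. \<forall>\<theta>. \<forall>\<psi>\<in>S. \<bar>\<theta> - \<psi>\<bar> \<le> \<eta> \<longrightarrow> cmod (F (of_real r * cis \<theta>)) \<le> exp (- \<kappa> * r))"

text \<open>Finitely many sectors of half the admissible width cover S. The smallest rate and
  half-width and the largest radius among them serve all directions in S.\<close>

lemma decays_on_compact:
  assumes "compact S" and dec: "\<And>\<psi>. \<psi> \<in> S \<Longrightarrow> \<exists>\<kappa>>0. decays F \<psi> \<kappa>"
  shows "decays_on F S"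
proof -
  have "\<forall>\<psi>\<in>S. \<exists>\<kappa> \<eta> R. \<kappa> > 0 \<and> \<eta> > 0 \<and> (\<forall>r\<ge>R. \<forall>\<theta>. \<bar>\<theta> - \<psi>\<bar> \<le> \<eta> \<longrightarrow> cmod (F (of_real r * cis \<theta>)) \<le> exp (- \<kappa> * r))"
    using dec unfolding decays_def by metis
  then obtain \<kappa> \<eta> R where d: "\<And>\<psi>. \<psi> \<in> S \<Longrightarrow> \<kappa> \<psi> > 0 \<and> \<eta> \<psi> > 0 \<and>
      (\<forall>r\<ge>R \<psi>. \<forall>\<theta>. \<bar>\<theta> - \<psi>\<bar> \<le> \<eta> \<psi> \<longrightarrow> cmod (F (of_real r * cis \<theta>)) \<le> exp (- \<kappa> \<psi> * r))"
    by metis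
  have "\<forall>\<psi>\<in>S. \<psi> \<in> ball \<psi> (\<eta> \<psi> / 2)" using d by simp
  then have "S \<subseteq> (\<Union>\<psi>\<in>S. ball \<psi> (\<eta> \<psi> / 2))" by blast
  then obtain D where D: "D \<subseteq> S" "finite D" "S \<subseteq> (\<Union>\<psi>\<in>D. ball \<psi> (\<eta> \<psi> / 2))"
    using compactE_image[OF assms(1), of S "\<lambda>\<psi>. ball \<psi> (\<eta> \<psi> / 2)"] by auto
  define K where "K = Min (insert 1 (\<kappa> ` D))"
  define E where "E = Min (insert 1 ((\<lambda>\<psi>. \<eta> \<psi> / 2) ` D))"
  define R' where "R' = Max (insert 0 (R ` D))"
  have K: "K > 0" "\<And>\<psi>. \<psi> \<in> D \<Longrightarrow> K \<le> \<kappa> \<psi>" unfolding K_def using D d by (auto simp: subset_iff)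
  have E: "E > 0" unfolding E_def using D d by (auto simp: subset_iff)
  have E2: "E \<le> \<eta> \<psi> / 2" if "\<psi> \<in> D" for \<psi> unfolding E_def using D that by (intro Min_le) auto
  have R': "R' \<ge> 0" "\<And>\<psi>. \<psi> \<in> D \<Longrightarrow> R' \<ge> R \<psi>" unfolding R'_def using D by auto
  show ?thesis unfolding decays_on_def
  proof (rule exI[of _ K], rule conjI[OF K(1)], rule exI[of _ E], rule conjI[OF E], rule exI[of _ R'], intro allI impI ballI)
    fix r \<theta> \<psi> assume r: "r \<ge> R'" and \<psi>: "\<psi> \<in> S" and \<theta>: "\<bar>\<theta> - \<psi>\<bar> \<le> E"
    obtain \<psi>' where \<psi>': "\<psi>' \<in> D" "\<psi> \<in> ball \<psi>' (\<eta> \<psi>' / 2)" using D(3) \<psi> by blast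
    have "\<bar>\<psi> - \<psi>'\<bar> < \<eta> \<psi>' / 2" using \<psi>'(2) by (simp add: dist_real_def abs_minus_commute)
    then have "\<bar>\<theta> - \<psi>'\<bar> \<le> \<eta> \<psi>'" using \<theta> E2[OF \<psi>'(1)] by linarith
    then have "cmod (F (of_real r * cis \<theta>)) \<le> exp (- \<kappa> \<psi>' * r)" using d[of \<psi>'] \<psi>'(1) D(1) R'(2)[OF \<psi>'(1)] r by auto
    also have "\<dots> \<le> exp (- K * r)" using K(2)[OF \<psi>'(1)] R'(1) r by (simp add: mult_right_mono)
    finally show "cmod (F (of_real r * cis \<theta>)) \<le> exp (- K * r)" .
  qed
qed

text \<open>A shift of the starting point changes the modulus by at most |c|, which costs the factor
  exp (\<kappa> |c|), and bends the direction by less than the width of the sector.\<close>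

lemma ray_decay:
  assumes "decays F \<theta> \<kappa>" "\<kappa> > 0"
  shows "\<forall>\<^sub>F t in at_top. cmod (F (c + of_real t * cis \<theta>)) \<le> exp (\<kappa> * cmod c) * exp (- \<kappa> * t)"
proof -
  obtain \<eta> R where d: "\<eta> > 0" "\<And>r \<theta>'. r \<ge> R \<Longrightarrow> \<bar>\<theta>' - \<theta>\<bar> \<le> \<eta> \<Longrightarrow> cmod (F (of_real r * cis \<theta>')) \<le> exp (- \<kappa> * r)"
    using assms unfolding decays_def by blast
  show ?thesis using ray_polar[OF d(1), of \<theta> c] eventually_ge_at_top[of "R + cmod c"]
  proof eventually_elim
    case (elim t)
    then obtain \<alpha> where \<alpha>: "\<bar>\<alpha> - \<theta>\<bar> < \<eta>" "c + of_real t * cis \<theta> = of_real (cmod (c + of_real t * cis \<theta>)) * cis \<alpha>" by blast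
    define r where "r = cmod (c + of_real t * cis \<theta>)"
    have "cmod (of_real t * cis \<theta>) - cmod c \<le> r"
      unfolding r_def using norm_diff_ineq[of "of_real t * cis \<theta>" c] by (simp add: add.commute)
    then have r: "t - cmod c \<le> r" using elim by (simp add: norm_mult)
    have "c + of_real t * cis \<theta> = of_real r * cis \<alpha>" using \<alpha>(2) unfolding r_def .
    then have "cmod (F (c + of_real t * cis \<theta>)) = cmod (F (of_real r * cis \<alpha>))" by (simp only:)
    also have "\<dots> \<le> exp (- \<kappa> * r)" using elim r \<alpha>(1) by (intro d(2)) auto
    also have "\<dots> \<le> exp (\<kappa> * cmod c + - \<kappa> * t)" using mult_left_mono[OF r, of \<kappa>] assms(2) by (simp add: algebra_simps)
    finally show ?case by (simp only: exp_add)
  qed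
qed

context ray_curve
begin

lemma vector_derivative_rays:
  "t > T \<Longrightarrow> vector_derivative \<gamma> (at t) = cis \<theta>p" "t > T \<Longrightarrow> vector_derivative \<gamma> (at (- t)) = - cis \<theta>m"
proof -
  assume t: "t > T"
  have "((\<lambda>t. cp + of_real t * cis \<theta>p) has_vector_derivative 1 * cis \<theta>p) (at t)"
    by (auto intro!: derivative_eq_intros)
  then have "(\<gamma> has_vector_derivative 1 * cis \<theta>p) (at t)"
    by (rule has_vector_derivative_transform_within_open[of _ _ _ "{T<..}"]) (use t in \<open>auto simp: ray_p\<close>)
  then show "vector_derivative \<gamma> (at t) = cis \<theta>p" by (simp add: vector_derivative_at)
next
  assume t: "t > T"
  have "((\<lambda>t. cm + of_real (- t) * cis \<theta>m) has_vector_derivative (- 1) * cis \<theta>m) (at (- t))"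
    by (auto intro!: derivative_eq_intros)
  moreover have "- t \<in> {..<- T}" using t by simp
  ultimately have "(\<gamma> has_vector_derivative (- 1) * cis \<theta>m) (at (- t))"
    by (rule has_vector_derivative_transform_within_open[OF _ open_lessThan]) (use ray_m[of "- _"] in force)
  then show "vector_derivative \<gamma> (at (- t)) = - cis \<theta>m" by (simp add: vector_derivative_at)
qed

lemma curve_integrable_on:
  assumes F: "F holomorphic_on S" "open S" "range \<gamma> \<subseteq> S"
  shows "(\<lambda>t. F (\<gamma> t) * vector_derivative \<gamma> (at t)) integrable_on {a..b}"
proof (cases "a < b")
  case True
  have "F contour_integrable_on seg \<gamma> a b"
    using F(3) by (intro contour_integrable_holomorphic_simple[OF F(1,2) valid_path_seg[OF PC1]]) (auto simp: path_image_seg[OF True])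
  then show ?thesis unfolding contour_integrable_on_def has_contour_integral_seg[OF PC1 True] by blast
next
  case False
  then have "{a..b} = {} \<or> {a..b} = {b}" by auto
  then show ?thesis using integrable_on_refl[of _ b] by auto
qed

lemma curve_integral_exists:
  assumes F: "F holomorphic_on S" "open S" "range \<gamma> \<subseteq> S"
    and dp: "decays F \<theta>p \<kappa>1" "\<kappa>1 > 0" and dm: "decays F \<theta>m \<kappa>2" "\<kappa>2 > 0"
  shows "\<exists>I. ((\<lambda>t. F (\<gamma> t) * vector_derivative \<gamma> (at t)) has_integral I) UNIV \<and>
     (\<forall>e>0. \<exists>B. \<forall>t1\<ge>B. \<forall>t2\<ge>B. cmod (integral {- t2..t1} (\<lambda>t. F (\<gamma> t) * vector_derivative \<gamma> (at t)) - I) < e)"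
proof -
  obtain T1 where T1: "\<forall>t\<ge>T1. cmod (F (cp + of_real t * cis \<theta>p)) \<le> exp (\<kappa>1 * cmod cp) * exp (- \<kappa>1 * t)"
    using ray_decay[OF dp, of cp] unfolding eventually_at_top_linorder ..
  obtain T2 where T2: "\<forall>t\<ge>T2. cmod (F (cm + of_real t * cis \<theta>m)) \<le> exp (\<kappa>2 * cmod cm) * exp (- \<kappa>2 * t)"
    using ray_decay[OF dm, of cm] unfolding eventually_at_top_linorder ..
  define \<kappa> where "\<kappa> = min \<kappa>1 \<kappa>2"
  define C where "C = max (exp (\<kappa>1 * cmod cp)) (exp (\<kappa>2 * cmod cm))"
  define T' where "T' = max (T + 1) (max T1 T2)"
  have T': "T' > T" "T' \<ge> T1" "T' \<ge> T2" "T' > 0" using T by (auto simp: T'_def)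
  show ?thesis
  proof (rule has_integral_UNIV_exp_tails[of _ \<kappa> T' C])
    fix a b :: real
    show "(\<lambda>t. F (\<gamma> t) * vector_derivative \<gamma> (at t)) integrable_on {a..b}"
      by (rule curve_integrable_on[OF F])
  next
    show "\<kappa> > 0" using dp dm by (simp add: \<kappa>_def)
    fix t :: real assume t: "\<bar>t\<bar> \<ge> T'"
    have e: "x * exp (- k * \<bar>t\<bar>) \<le> C * exp (- \<kappa> * \<bar>t\<bar>)" if "\<kappa> \<le> k" "0 \<le> x" "x \<le> C" for k x
      using that mult_right_mono[OF that(1), of "\<bar>t\<bar>"] by (intro mult_mono) auto
    show "cmod (F (\<gamma> t) * vector_derivative \<gamma> (at t)) \<le> C * exp (- \<kappa> * \<bar>t\<bar>)"
    proof (cases "t > 0")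
      case True
      then have t': "t > T" "t \<ge> T1" "\<bar>t\<bar> = t" using t T' by auto
      have "cmod (F (\<gamma> t) * vector_derivative \<gamma> (at t)) = cmod (F (cp + of_real t * cis \<theta>p))"
        using t' by (simp add: vector_derivative_rays norm_mult ray_p)
      also have "\<dots> \<le> exp (\<kappa>1 * cmod cp) * exp (- \<kappa>1 * \<bar>t\<bar>)" using T1 t'(2) unfolding t'(3) by blast
      also have "\<dots> \<le> C * exp (- \<kappa> * \<bar>t\<bar>)" by (rule e) (auto simp: \<kappa>_def C_def)
      finally show ?thesis .
    next
      case False
      define u where "u = - t"
      have u: "t = - u" "u > T" "u \<ge> T2" "\<bar>t\<bar> = u" using t T' False by (auto simp: u_def)
      have "cmod (F (\<gamma> t) * vector_derivative \<gamma> (at t)) = cmod (F (cm + of_real u * cis \<theta>m))"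
        using u(2) unfolding u(1) by (simp add: vector_derivative_rays norm_mult ray_m)
      also have "\<dots> \<le> exp (\<kappa>2 * cmod cm) * exp (- \<kappa>2 * \<bar>t\<bar>)" using T2 u(3) unfolding u(4) by blast
      also have "\<dots> \<le> C * exp (- \<kappa> * \<bar>t\<bar>)" by (rule e) (auto simp: \<kappa>_def C_def)
      finally show ?thesis .
    qed
  qed
qed

end

section \<open>Comparison of two contours\<close>

lemma integral_endpoint_diff:
  fixes A :: "real \<Rightarrow> complex"
  assumes "continuous_on UNIV A" "a1 \<le> c" "a2 \<le> c" "\<And>t. t \<in> closed_segment a1 a2 \<Longrightarrow> cmod (A t) \<le> B"
  shows "cmod (integral {a1..c} A - integral {a2..c} A) \<le> B * \<bar>a1 - a2\<bar>"
proof -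
  have *: "cmod (integral {a..c} A - integral {b..c} A) \<le> B * \<bar>a - b\<bar>" if "a \<le> b" "b \<le> c" "\<And>t. t \<in> {a..b} \<Longrightarrow> cmod (A t) \<le> B" for a b
  proof -
    have int: "A integrable_on {u..v}" for u v by (intro integrable_continuous_real continuous_on_subset[OF assms(1)]) auto
    have "integral {a..b} A + integral {b..c} A = integral {a..c} A"
      using that by (intro Henstock_Kurzweil_Integration.integral_combine int) auto
    then have "integral {a..c} A - integral {b..c} A = integral {a..b} A" by (simp add: algebra_simps)
    also have "cmod \<dots> \<le> B * (b - a)"
      using that by (intro integral_bound continuous_on_subset[OF assms(1)]) auto
    finally show ?thesis using that(1) by simp
  qed
  show ?thesis
  proof (cases "a1 \<le> a2")
    case True then show ?thesis using assms by (intro *) (auto simp: closed_segment_eq_real_ivl)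
  next
    case False
    then have "cmod (integral {a2..c} A - integral {a1..c} A) \<le> B * \<bar>a2 - a1\<bar>"
      using assms by (intro *) (auto simp: closed_segment_eq_real_ivl)
    then show ?thesis by (simp add: norm_minus_commute abs_minus_commute)
  qed
qed

lemma integral_endpoint_diff':
  fixes A :: "real \<Rightarrow> complex"
  assumes "continuous_on UNIV A" "c \<le> a1" "c \<le> a2" "\<And>t. t \<in> closed_segment a1 a2 \<Longrightarrow> cmod (A t) \<le> B"
  shows "cmod (integral {c..a1} A - integral {c..a2} A) \<le> B * \<bar>a1 - a2\<bar>"
proof -
  define A' where "A' = (\<lambda>t. A (- t))"
  have r: "integral {c..a} A = integral {- a..- c} A'" for a
    unfolding A'_def by (rule Henstock_Kurzweil_Integration.integral_reflect_real[symmetric])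
  have c: "continuous_on UNIV A'" unfolding A'_def by (intro continuous_on_compose2[OF assms(1)] continuous_intros) auto
  have "cmod (integral {- a1..- c} A' - integral {- a2..- c} A') \<le> B * \<bar>- a1 - - a2\<bar>"
    using assms by (intro integral_endpoint_diff c) (auto simp: A'_def closed_segment_eq_real_ivl split: if_splits)
  then show ?thesis unfolding r by (simp add: abs_minus_commute)
qed

text \<open>Left poles are finitely many in each right half-plane and right poles in each left
  half-plane. A pole that changes sides is subject to one of the two bounds, whatever its real
  part.\<close>

lemma pole_sets_exchange:
  assumes "pole_sets P1 M1 H1" "pole_sets P2 M2 H2" "P1 \<union> M1 = P2 \<union> M2"
  shows "finite (M1 - M2)"
proof -
  have "M1 - M2 \<subseteq> {s\<in>P2. Re s \<le> 0} \<union> {s\<in>M1. 0 \<le> Re s}" using assms(3) by auto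
  then show ?thesis
    by (rule finite_subset) (intro finite_UnI pole_sets.finite_left[OF assms(2)] pole_sets.finite_right[OF assms(1)])
qed

text \<open>Both sums run over infinite families truncated by S; once S contains every element in
  which the families differ, the truncation cancels.\<close>

lemma sum_diff_cut:
  fixes f :: "'a \<Rightarrow> complex"
  assumes "finite (A \<inter> S)" "finite (B \<inter> S)" "A - B \<subseteq> S" "B - A \<subseteq> S"
  shows "sum f (A \<inter> S) - sum f (B \<inter> S) = sum f (A - B) - sum f (B - A)"
proof -
  have "sum f (A \<inter> S) = sum f (A \<inter> S \<inter> B) + sum f (A \<inter> S - B)" using assms by (intro sum.Int_Diff)
  moreover have "sum f (B \<inter> S) = sum f (B \<inter> S \<inter> A) + sum f (B \<inter> S - A)" using assms by (intro sum.Int_Diff)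
  moreover have "A \<inter> S - B = A - B" "B \<inter> S - A = B - A" "A \<inter> S \<inter> B = B \<inter> S \<inter> A" using assms by auto
  ultimately show ?thesis by simp
qed

text \<open>Both arcs are split at the angle pi. The integrals agree on the common part, and their
  difference only involves directions between the ends of the two arcs, where F is exponentially
  small. No estimate near the left poles is required.\<close>

lemma arc_integral_diff:
  assumes dp: "decays_on F (closed_segment \<theta>1 \<theta>2)" and dm: "decays_on F (closed_segment \<phi>1 \<phi>2)"
  obtains \<eta> \<kappa> R where "\<eta> > 0" "\<kappa> > 0"
    "\<And>\<rho> \<alpha>1 \<alpha>2 \<beta>1 \<beta>2. \<rho> \<ge> R \<Longrightarrow> \<rho> \<ge> 0 \<Longrightarrow> continuous_on UNIV (\<lambda>t. F (of_real \<rho> * cis t)) \<Longrightarrow>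
       \<alpha>1 \<in> {0..pi} \<Longrightarrow> \<alpha>2 \<in> {0..pi} \<Longrightarrow> \<beta>1 \<in> {- pi..0} \<Longrightarrow> \<beta>2 \<in> {- pi..0} \<Longrightarrow>
       \<bar>\<alpha>1 - \<theta>1\<bar> < \<eta> \<Longrightarrow> \<bar>\<alpha>2 - \<theta>2\<bar> < \<eta> \<Longrightarrow> \<bar>\<beta>1 - \<phi>1\<bar> < \<eta> \<Longrightarrow> \<bar>\<beta>2 - \<phi>2\<bar> < \<eta> \<Longrightarrow>
       cmod (integral {\<alpha>1..\<beta>1 + 2 * pi} (\<lambda>t. F (of_real \<rho> * cis t) * of_real \<rho> * \<i> * cis t)
         - integral {\<alpha>2..\<beta>2 + 2 * pi} (\<lambda>t. F (of_real \<rho> * cis t) * of_real \<rho> * \<i> * cis t)) \<le> 2 * pi * \<rho> * exp (- \<kappa> * \<rho>)"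
proof -
  obtain \<kappa>1 \<eta>1 R1 where 1: "\<kappa>1 > 0" "\<eta>1 > 0"
    "\<And>r \<theta> \<psi>. r \<ge> R1 \<Longrightarrow> \<psi> \<in> closed_segment \<theta>1 \<theta>2 \<Longrightarrow> \<bar>\<theta> - \<psi>\<bar> \<le> \<eta>1 \<Longrightarrow> cmod (F (of_real r * cis \<theta>)) \<le> exp (- \<kappa>1 * r)"
    using dp unfolding decays_on_def by blast
  obtain \<kappa>2 \<eta>2 R2 where 2: "\<kappa>2 > 0" "\<eta>2 > 0"
    "\<And>r \<theta> \<psi>. r \<ge> R2 \<Longrightarrow> \<psi> \<in> closed_segment \<phi>1 \<phi>2 \<Longrightarrow> \<bar>\<theta> - \<psi>\<bar> \<le> \<eta>2 \<Longrightarrow> cmod (F (of_real r * cis \<theta>)) \<le> exp (- \<kappa>2 * r)"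
    using dm unfolding decays_on_def by blast
  define \<kappa> where "\<kappa> = min \<kappa>1 \<kappa>2"
  define \<eta> where "\<eta> = min \<eta>1 \<eta>2"
  have near: "\<exists>\<psi>\<in>closed_segment u v. \<bar>t - \<psi>\<bar> \<le> \<eta>" if "t \<in> closed_segment a b" "\<bar>a - u\<bar> < \<eta>" "\<bar>b - v\<bar> < \<eta>" for a b u v t :: real
  proof -
    from that(1) obtain x where x: "0 \<le> x" "x \<le> 1" "t = (1 - x) *\<^sub>R a + x *\<^sub>R b" unfolding closed_segment_def by blast
    have "\<bar>t - ((1 - x) *\<^sub>R u + x *\<^sub>R v)\<bar> = \<bar>(1 - x) * (a - u) + x * (b - v)\<bar>" unfolding x(3) by (simp add: algebra_simps)
    also have "\<dots> \<le> \<bar>(1 - x) * (a - u)\<bar> + \<bar>x * (b - v)\<bar>" by (rule abs_triangle_ineq)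
    also have "\<dots> = (1 - x) * \<bar>a - u\<bar> + x * \<bar>b - v\<bar>" using x by (simp add: abs_mult)
    also have "\<dots> \<le> (1 - x) * \<eta> + x * \<eta>" using that x by (intro add_mono mult_left_mono) auto
    also have "\<dots> = \<eta>" by (simp add: algebra_simps)
    finally show ?thesis using x by (intro bexI[of _ "(1 - x) *\<^sub>R u + x *\<^sub>R v"]) (auto simp: closed_segment_def)
  qed
  show ?thesis
  proof (rule that[of \<eta> \<kappa> "max R1 R2"])
    show "\<eta> > 0" "\<kappa> > 0" using 1 2 by (simp_all add: \<eta>_def \<kappa>_def)
    fix \<rho> \<alpha>1 \<alpha>2 \<beta>1 \<beta>2
    assume \<rho>: "\<rho> \<ge> max R1 R2" "\<rho> \<ge> 0" and cont: "continuous_on UNIV (\<lambda>t. F (of_real \<rho> * cis t))"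
      and \<alpha>: "\<alpha>1 \<in> {0..pi}" "\<alpha>2 \<in> {0..pi}" and \<beta>: "\<beta>1 \<in> {- pi..0}" "\<beta>2 \<in> {- pi..0}"
      and c\<alpha>: "\<bar>\<alpha>1 - \<theta>1\<bar> < \<eta>" "\<bar>\<alpha>2 - \<theta>2\<bar> < \<eta>" and c\<beta>: "\<bar>\<beta>1 - \<phi>1\<bar> < \<eta>" "\<bar>\<beta>2 - \<phi>2\<bar> < \<eta>"
    define A where "A = (\<lambda>t. F (of_real \<rho> * cis t) * of_real \<rho> * \<i> * cis t)"
    have cA: "continuous_on UNIV A" unfolding A_def by (intro continuous_intros cont)
    define B where "B = \<rho> * exp (- \<kappa> * \<rho>)"
    have B0: "B \<ge> 0" using \<rho> by (simp add: B_def)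
    have normA: "cmod (A t) \<le> B" if "cmod (F (of_real \<rho> * cis t)) \<le> exp (- k * \<rho>)" "\<kappa> \<le> k" for t k
    proof -
      have "cmod (A t) = \<rho> * cmod (F (of_real \<rho> * cis t))" using \<rho> by (simp add: A_def norm_mult)
      also have "\<dots> \<le> \<rho> * exp (- k * \<rho>)" by (rule mult_left_mono[OF that(1) \<rho>(2)])
      also have "\<dots> \<le> B" unfolding B_def using \<rho> that(2) by (intro mult_left_mono) (auto simp: mult_right_mono)
      finally show ?thesis .
    qed
    have up: "cmod (A t) \<le> B" if t: "t \<in> closed_segment \<alpha>1 \<alpha>2" for t
    proof -
      obtain \<psi> where "\<psi> \<in> closed_segment \<theta>1 \<theta>2" "\<bar>t - \<psi>\<bar> \<le> \<eta>" using near[OF t c\<alpha>] ..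
      then have "cmod (F (of_real \<rho> * cis t)) \<le> exp (- \<kappa>1 * \<rho>)" using \<rho> by (intro 1(3)) (auto simp: \<eta>_def)
      then show ?thesis by (rule normA) (simp add: \<kappa>_def)
    qed
    have dn: "cmod (A t) \<le> B" if t: "t \<in> closed_segment (\<beta>1 + 2 * pi) (\<beta>2 + 2 * pi)" for t
    proof -
      have "t - 2 * pi \<in> closed_segment \<beta>1 \<beta>2" using t by (auto simp: closed_segment_eq_real_ivl split: if_splits)
      then obtain \<psi> where "\<psi> \<in> closed_segment \<phi>1 \<phi>2" "\<bar>(t - 2 * pi) - \<psi>\<bar> \<le> \<eta>" using near[OF _ c\<beta>] by blast
      then have "cmod (F (of_real \<rho> * cis (t - 2 * pi))) \<le> exp (- \<kappa>2 * \<rho>)" using \<rho> by (intro 2(3)) (auto simp: \<eta>_def)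
      moreover have "cis (t - 2 * pi) = cis t" by (simp add: complex_eq_iff cos_diff sin_diff)
      ultimately have "cmod (F (of_real \<rho> * cis t)) \<le> exp (- \<kappa>2 * \<rho>)" by (simp only:)
      then show ?thesis by (rule normA) (simp add: \<kappa>_def)
    qed
    have int: "A integrable_on {u..v}" for u v by (intro integrable_continuous_real continuous_on_subset[OF cA]) auto
    have split: "integral {u..v + 2 * pi} A = integral {u..pi} A + integral {pi..v + 2 * pi} A" if "u \<in> {0..pi}" "v \<in> {- pi..0}" for u v
      using that by (intro Henstock_Kurzweil_Integration.integral_combine[symmetric] int) auto
    have "integral {\<alpha>1..\<beta>1 + 2 * pi} A - integral {\<alpha>2..\<beta>2 + 2 * pi} A
        = (integral {\<alpha>1..pi} A - integral {\<alpha>2..pi} A) + (integral {pi..\<beta>1 + 2 * pi} A - integral {pi..\<beta>2 + 2 * pi} A)"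
      unfolding split[OF \<alpha>(1) \<beta>(1)] split[OF \<alpha>(2) \<beta>(2)] by simp
    also have "cmod \<dots> \<le> cmod (integral {\<alpha>1..pi} A - integral {\<alpha>2..pi} A) + cmod (integral {pi..\<beta>1 + 2 * pi} A - integral {pi..\<beta>2 + 2 * pi} A)"
      by (rule norm_triangle_ineq)
    also have "\<dots> \<le> B * \<bar>\<alpha>1 - \<alpha>2\<bar> + B * \<bar>(\<beta>1 + 2 * pi) - (\<beta>2 + 2 * pi)\<bar>"
      using \<alpha> \<beta> by (intro add_mono integral_endpoint_diff integral_endpoint_diff' cA up dn) auto
    also have "\<dots> \<le> B * pi + B * pi" using \<alpha> \<beta> B0 by (intro add_mono mult_left_mono) auto
    finally show "cmod (integral {\<alpha>1..\<beta>1 + 2 * pi} (\<lambda>t. F (of_real \<rho> * cis t) * of_real \<rho> * \<i> * cis t)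
         - integral {\<alpha>2..\<beta>2 + 2 * pi} (\<lambda>t. F (of_real \<rho> * cis t) * of_real \<rho> * \<i> * cis t)) \<le> 2 * pi * \<rho> * exp (- \<kappa> * \<rho>)"
      unfolding A_def[symmetric] by (simp add: B_def mult_ac)
  qed
qed

text \<open>An interval is uncountable, so arbitrarily far out there are radii that are not the
  modulus of a pole.\<close>

lemma eventually_at_top_avoiding:
  fixes E :: "real set"
  assumes "countable E" "eventually Q at_top"
  obtains x where "x \<notin> E" "Q x"
proof -
  obtain X where X: "\<And>x. x \<ge> X \<Longrightarrow> Q x" using assms(2) unfolding eventually_at_top_linorder by blast
  have "uncountable {X..X + 1}" by (rule uncountable_closed_interval[THEN iffD2]) simp
  then have "\<not> {X..X + 1} \<subseteq> E" using assms(1) countable_subset by blast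
  then obtain x where "x \<in> {X..X + 1}" "x \<notin> E" by blast
  then show ?thesis using X[of x] that[of x] by simp
qed

text \<open>The infinite sum of residues for a single contour need not converge and is never formed.
  For a common circle the residue formulas of both curves are subtracted; the tails and the
  difference of the arcs vanish as the radius grows, and the residues at the exchanged poles
  remain.\<close>

theorem separating_curves_diff:
  assumes S1: "separating_curve \<gamma>1 \<theta>1 \<phi>1 c1 d1 T1 P1 M1 H1 R1 L1"
    and S2: "separating_curve \<gamma>2 \<theta>2 \<phi>2 c2 d2 T2 P2 M2 H2 R2 L2"
    and PM: "P1 \<union> M1 = P2 \<union> M2" and F: "F holomorphic_on - (P1 \<union> M1)"
    and dp: "\<And>\<psi>. \<psi> \<in> closed_segment \<theta>1 \<theta>2 \<Longrightarrow> \<exists>\<kappa>>0. decays F \<psi> \<kappa>"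
    and dm: "\<And>\<psi>. \<psi> \<in> closed_segment \<phi>1 \<phi>2 \<Longrightarrow> \<exists>\<kappa>>0. decays F \<psi> \<kappa>"
  shows "\<exists>I1 I2. ((\<lambda>t. F (\<gamma>1 t) * vector_derivative \<gamma>1 (at t)) has_integral I1) UNIV \<and>
     ((\<lambda>t. F (\<gamma>2 t) * vector_derivative \<gamma>2 (at t)) has_integral I2) UNIV \<and>
     I1 - I2 = 2 * of_real pi * \<i> * (sum (residue F) (M1 - M2) - sum (residue F) (M2 - M1))"
proof -
  interpret A: separating_curve \<gamma>1 \<theta>1 \<phi>1 c1 d1 T1 P1 M1 H1 R1 L1 by (rule S1)
  interpret B: separating_curve \<gamma>2 \<theta>2 \<phi>2 c2 d2 T2 P2 M2 H2 R2 L2 by (rule S2)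
  have F2: "F holomorphic_on - (P2 \<union> M2)" using F unfolding PM .
  have op: "open (- (P1 \<union> M1))" using A.closed_poles by (simp add: closed_def)
  obtain k1 where k1: "k1 > 0" "decays F \<theta>1 k1" using dp[OF ends_in_segment(1)] by blast
  obtain k2 where k2: "k2 > 0" "decays F \<theta>2 k2" using dp[OF ends_in_segment(2)] by blast
  obtain k3 where k3: "k3 > 0" "decays F \<phi>1 k3" using dm[OF ends_in_segment(1)] by blast
  obtain k4 where k4: "k4 > 0" "decays F \<phi>2 k4" using dm[OF ends_in_segment(2)] by blast
  define h1 where "h1 = (\<lambda>t. F (\<gamma>1 t) * vector_derivative \<gamma>1 (at t))"
  define h2 where "h2 = (\<lambda>t. F (\<gamma>2 t) * vector_derivative \<gamma>2 (at t))"
  have r1: "range \<gamma>1 \<subseteq> - (P1 \<union> M1)" using A.poles_avoid by blast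
  have r2: "range \<gamma>2 \<subseteq> - (P1 \<union> M1)" using B.poles_avoid PM by blast
  obtain I1 where I1: "(h1 has_integral I1) UNIV" "\<And>e. e > 0 \<Longrightarrow> \<exists>B. \<forall>t1\<ge>B. \<forall>t2\<ge>B. cmod (integral {- t2..t1} h1 - I1) < e"
    using A.curve_integral_exists[OF F op r1 k1(2,1) k3(2,1)] unfolding h1_def by blast
  obtain I2 where I2: "(h2 has_integral I2) UNIV" "\<And>e. e > 0 \<Longrightarrow> \<exists>B. \<forall>t1\<ge>B. \<forall>t2\<ge>B. cmod (integral {- t2..t1} h2 - I2) < e"
    using B.curve_integral_exists[OF F op r2 k2(2,1) k4(2,1)] unfolding h2_def by blast
  have dec: "decays_on F (closed_segment \<theta>1 \<theta>2)" "decays_on F (closed_segment \<phi>1 \<phi>2)"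
    by (rule decays_on_compact[OF compact_segment dp], assumption, rule decays_on_compact[OF compact_segment dm], assumption)
  obtain \<eta>0 \<kappa> Ra where \<eta>0: "\<eta>0 > 0" and \<kappa>: "\<kappa> > 0" and arc:
    "\<And>\<rho> \<alpha>1 \<alpha>2 \<beta>1 \<beta>2. \<rho> \<ge> Ra \<Longrightarrow> \<rho> \<ge> 0 \<Longrightarrow> continuous_on UNIV (\<lambda>t. F (of_real \<rho> * cis t)) \<Longrightarrow>
       \<alpha>1 \<in> {0..pi} \<Longrightarrow> \<alpha>2 \<in> {0..pi} \<Longrightarrow> \<beta>1 \<in> {- pi..0} \<Longrightarrow> \<beta>2 \<in> {- pi..0} \<Longrightarrow>
       \<bar>\<alpha>1 - \<theta>1\<bar> < \<eta>0 \<Longrightarrow> \<bar>\<alpha>2 - \<theta>2\<bar> < \<eta>0 \<Longrightarrow> \<bar>\<beta>1 - \<phi>1\<bar> < \<eta>0 \<Longrightarrow> \<bar>\<beta>2 - \<phi>2\<bar> < \<eta>0 \<Longrightarrow>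
       cmod (integral {\<alpha>1..\<beta>1 + 2 * pi} (\<lambda>t. F (of_real \<rho> * cis t) * of_real \<rho> * \<i> * cis t)
         - integral {\<alpha>2..\<beta>2 + 2 * pi} (\<lambda>t. F (of_real \<rho> * cis t) * of_real \<rho> * \<i> * cis t)) \<le> 2 * pi * \<rho> * exp (- \<kappa> * \<rho>)"
    by (rule arc_integral_diff[OF dec]) (rule that)
  obtain \<eta>1 g1 where g1: "A.arc_gap \<eta>1 g1" "\<eta>1 \<le> \<eta>0" using A.arc_gap_exists[OF \<eta>0] .
  obtain \<eta>2 g2 where g2: "B.arc_gap \<eta>2 g2" "\<eta>2 \<le> \<eta>0" using B.arc_gap_exists[OF \<eta>0] .
  have \<eta>: "\<eta>1 > 0" "\<eta>2 > 0" using g1 g2 unfolding A.arc_gap_def B.arc_gap_def by blast+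
  define D where "D = 2 * of_real pi * \<i> * (sum (residue F) (M1 - M2) - sum (residue F) (M2 - M1))"
  \<comment> \<open>One circle that avoids all poles cuts both curves. Two tails and the difference
    of the arcs each contribute at most e / 3.\<close>
  have le: "cmod (I1 - I2 - D) \<le> 0 + e" if e: "e > 0" for e
  proof -
    obtain b1 where b1: "\<And>t1 t2. t1 \<ge> b1 \<Longrightarrow> t2 \<ge> b1 \<Longrightarrow> cmod (integral {- t2..t1} h1 - I1) < e / 3" using I1(2)[of "e / 3"] e by auto
    obtain b2 where b2: "\<And>t1 t2. t1 \<ge> b2 \<Longrightarrow> t2 \<ge> b2 \<Longrightarrow> cmod (integral {- t2..t1} h2 - I2) < e / 3" using I2(2)[of "e / 3"] e by auto
    obtain r1 where r1: "\<forall>\<rho>\<ge>r1. \<exists>t1 t2 \<alpha> \<beta>. A.cut \<eta>1 \<rho> t1 t2 \<alpha> \<beta>" using A.cut_exists[OF \<eta>(1)] by blast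
    obtain r2 where r2: "\<forall>\<rho>\<ge>r2. \<exists>t1 t2 \<alpha> \<beta>. B.cut \<eta>2 \<rho> t1 t2 \<alpha> \<beta>" using B.cut_exists[OF \<eta>(2)] by blast
    obtain r3 where r3: "\<And>\<rho> t1 t2 \<alpha> \<beta>. \<rho> \<ge> r3 \<Longrightarrow> \<rho> \<notin> cmod ` (P1 \<union> M1) \<Longrightarrow> A.cut \<eta>1 \<rho> t1 t2 \<alpha> \<beta> \<Longrightarrow> 
       integral {- t2..t1} h1 + integral {\<alpha>..\<beta> + 2 * pi} (\<lambda>t. F (of_real \<rho> * cis t) * of_real \<rho> * \<i> * cis t)
        = 2 * of_real pi * \<i> * (\<Sum>p | p \<in> M1 \<and> cmod p \<le> \<rho>. residue F p)"
      using A.contour_residues[OF F g1(1)] unfolding h1_def by blast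
    obtain r4 where r4: "\<And>\<rho> t1 t2 \<alpha> \<beta>. \<rho> \<ge> r4 \<Longrightarrow> \<rho> \<notin> cmod ` (P2 \<union> M2) \<Longrightarrow> B.cut \<eta>2 \<rho> t1 t2 \<alpha> \<beta> \<Longrightarrow> 
       integral {- t2..t1} h2 + integral {\<alpha>..\<beta> + 2 * pi} (\<lambda>t. F (of_real \<rho> * cis t) * of_real \<rho> * \<i> * cis t)
        = 2 * of_real pi * \<i> * (\<Sum>p | p \<in> M2 \<and> cmod p \<le> \<rho>. residue F p)"
      using B.contour_residues[OF F2 g2(1)] unfolding h2_def by blast
    have fin: "finite (cmod ` ((M1 - M2) \<union> (M2 - M1)))"
      using pole_sets_exchange[OF A.pole_sets_axioms B.pole_sets_axioms PM]
        pole_sets_exchange[OF B.pole_sets_axioms A.pole_sets_axioms PM[symmetric]] by simp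
    define r5 where "r5 = Max (insert 0 (cmod ` ((M1 - M2) \<union> (M2 - M1))))"
    have r5: "cmod s \<le> r5" if "s \<in> (M1 - M2) \<union> (M2 - M1)" for s unfolding r5_def using fin that by (intro Max_ge) auto
    have "((\<lambda>\<rho>. 2 * pi * \<rho> * exp (- \<kappa> * \<rho>)) \<longlongrightarrow> 0) at_top" using \<kappa> by real_asymp
    then have sm: "\<forall>\<^sub>F \<rho> in at_top. 2 * pi * \<rho> * exp (- \<kappa> * \<rho>) < e / 3" by (rule order_tendstoD(2)) (use e in simp)
    have ev: "\<forall>\<^sub>F \<rho> in at_top. \<rho> \<ge> b1 + T1 \<and> \<rho> \<ge> b2 + T2 \<and> \<rho> \<ge> r1 \<and> \<rho> \<ge> r2 \<and> \<rho> \<ge> r3 \<and> \<rho> \<ge> r4 \<and> \<rho> \<ge> r5 \<and> \<rho> \<ge> Ra \<and> \<rho> > 0 \<and> 2 * pi * \<rho> * exp (- \<kappa> * \<rho>) < e / 3"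
      by (intro eventually_conj eventually_ge_at_top eventually_gt_at_top sm)
    have cnt: "countable (cmod ` (P1 \<union> M1))" using A.countable_poles by (rule countable_image)
    obtain \<rho> where \<rho>a: "\<rho> \<notin> cmod ` (P1 \<union> M1)" and \<rho>b: "\<rho> \<ge> b1 + T1 \<and> \<rho> \<ge> b2 + T2 \<and> \<rho> \<ge> r1 \<and> \<rho> \<ge> r2 \<and> \<rho> \<ge> r3 \<and> \<rho> \<ge> r4 \<and> \<rho> \<ge> r5 \<and> \<rho> \<ge> Ra \<and> \<rho> > 0 \<and> 2 * pi * \<rho> * exp (- \<kappa> * \<rho>) < e / 3"
      by (rule eventually_at_top_avoiding[OF cnt ev])
    have \<rho>: "\<rho> \<notin> cmod ` (P1 \<union> M1)" "\<rho> \<ge> b1 + T1" "\<rho> \<ge> b2 + T2" "\<rho> \<ge> r1" "\<rho> \<ge> r2" "\<rho> \<ge> r3" "\<rho> \<ge> r4" "\<rho> \<ge> r5" "\<rho> \<ge> Ra" "\<rho> > 0"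
       "2 * pi * \<rho> * exp (- \<kappa> * \<rho>) < e / 3" by (rule \<rho>a) (use \<rho>b in blast)+
    obtain t1 t2 \<alpha> \<beta> where c1: "A.cut \<eta>1 \<rho> t1 t2 \<alpha> \<beta>" using r1 \<rho> by blast
    obtain u1 u2 \<alpha>' \<beta>' where c2: "B.cut \<eta>2 \<rho> u1 u2 \<alpha>' \<beta>'" using r2 \<rho> by blast
    note f1 = A.cut_facts[OF g1(1) c1 \<rho>(10)] and f2 = B.cut_facts[OF g2(1) c2 \<rho>(10)]
    define A1 where "A1 = integral {\<alpha>..\<beta> + 2 * pi} (\<lambda>t. F (of_real \<rho> * cis t) * of_real \<rho> * \<i> * cis t)"
    define A2 where "A2 = integral {\<alpha>'..\<beta>' + 2 * pi} (\<lambda>t. F (of_real \<rho> * cis t) * of_real \<rho> * \<i> * cis t)"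
    have "of_real \<rho> * cis t \<in> - (P1 \<union> M1)" for t
    proof
      assume "of_real \<rho> * cis t \<in> P1 \<union> M1"
      then have "cmod (of_real \<rho> * cis t) \<in> cmod ` (P1 \<union> M1)" by (rule imageI)
      then show False using \<rho>(1,10) by (simp add: norm_mult)
    qed
    then have cont: "continuous_on UNIV (\<lambda>t. F (of_real \<rho> * cis t))"
      by (intro continuous_on_compose2[OF holomorphic_on_imp_continuous_on[OF F]] continuous_intros) auto
    have rng: "x \<in> {0..pi}" if "\<bar>x - \<theta>\<bar> < \<eta>" "\<eta> < \<theta>" "\<theta> + \<eta> < pi" for x \<theta> \<eta>
      using that unfolding atLeastAtMost_iff abs_less_iff by linarith
    have rng': "x \<in> {- pi..0}" if "\<bar>x - \<theta>\<bar> < \<eta>" "\<eta> < - \<theta>" "- \<theta> + \<eta> < pi" for x \<theta> \<eta>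
      using that unfolding atLeastAtMost_iff abs_less_iff by linarith
    have ga: "\<eta>1 < \<theta>1" "\<theta>1 + \<eta>1 < pi" "\<eta>1 < - \<phi>1" "- \<phi>1 + \<eta>1 < pi" using g1(1) unfolding A.arc_gap_def by blast+
    have gb: "\<eta>2 < \<theta>2" "\<theta>2 + \<eta>2 < pi" "\<eta>2 < - \<phi>2" "- \<phi>2 + \<eta>2 < pi" using g2(1) unfolding B.arc_gap_def by blast+
    have "cmod (A1 - A2) \<le> 2 * pi * \<rho> * exp (- \<kappa> * \<rho>)"
      unfolding A1_def A2_def
      by (rule arc[OF \<rho>(9) less_imp_le[OF \<rho>(10)] cont rng[OF f1(4) ga(1,2)] rng[OF f2(4) gb(1,2)] rng'[OF f1(5) ga(3,4)] rng'[OF f2(5) gb(3,4)]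
         less_le_trans[OF f1(4) g1(2)] less_le_trans[OF f2(4) g2(2)] less_le_trans[OF f1(5) g1(2)] less_le_trans[OF f2(5) g2(2)]])
    then have a: "cmod (A1 - A2) < e / 3" using \<rho>(11) by linarith
    have t1: "t1 \<ge> b1" "t2 \<ge> b1" using c1 \<rho>(2) unfolding A.cut_def by linarith+
    have u1: "u1 \<ge> b2" "u2 \<ge> b2" using c2 \<rho>(3) unfolding B.cut_def by linarith+
    have e1: "integral {- t2..t1} h1 + A1 = 2 * of_real pi * \<i> * (\<Sum>p | p \<in> M1 \<and> cmod p \<le> \<rho>. residue F p)"
      unfolding A1_def by (rule r3[OF \<rho>(6,1) c1])
    have e2: "integral {- u2..u1} h2 + A2 = 2 * of_real pi * \<i> * (\<Sum>p | p \<in> M2 \<and> cmod p \<le> \<rho>. residue F p)"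
      unfolding A2_def by (rule r4[OF \<rho>(7) \<rho>(1)[unfolded PM] c2])
    let ?S = "{p. cmod p \<le> \<rho>}"
    \<comment> \<open>\<rho> >= r5 places every exchanged pole inside the circle.\<close>
    have "sum (residue F) (M1 \<inter> ?S) - sum (residue F) (M2 \<inter> ?S) = sum (residue F) (M1 - M2) - sum (residue F) (M2 - M1)"
    proof (rule sum_diff_cut)
      show "finite (M1 \<inter> ?S)" by (rule finite_subset[OF _ A.finite_ball[of \<rho>]]) auto
      show "finite (M2 \<inter> ?S)" by (rule finite_subset[OF _ B.finite_ball[of \<rho>]]) auto
    qed (use order_trans[OF r5 \<rho>(8)] in blast)+
    then have D: "D = (integral {- t2..t1} h1 + A1) - (integral {- u2..u1} h2 + A2)"
      unfolding e1 e2 D_def by (simp only: right_diff_distrib[symmetric] Int_def mem_Collect_eq)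
    have "I1 - I2 - D = - (integral {- t2..t1} h1 - I1) + (integral {- u2..u1} h2 - I2) + - (A1 - A2)"
      unfolding D by simp
    also have "cmod \<dots> \<le> cmod (integral {- t2..t1} h1 - I1) + cmod (integral {- u2..u1} h2 - I2) + cmod (A1 - A2)"
      using norm_triangle_ineq[of "- (integral {- t2..t1} h1 - I1) + (integral {- u2..u1} h2 - I2)" "- (A1 - A2)"]
        norm_triangle_ineq[of "- (integral {- t2..t1} h1 - I1)" "integral {- u2..u1} h2 - I2"] unfolding norm_minus_cancel by (rule order_trans[OF _ add_right_mono])
    also have "\<dots> \<le> e / 3 + e / 3 + e / 3" by (intro add_mono less_imp_le a b1 b2 t1 u1)
    finally show ?thesis by simp
  qed
  have "cmod (I1 - I2 - D) \<le> 0" by (rule field_le_epsilon[OF le])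
  then have "I1 - I2 = D" by simp
  then show ?thesis using I1(1) I2(1) unfolding h1_def h2_def D_def by (intro exI[of _ I1] exI[of _ I2] conjI)
qed

section \<open>Existence of a contour\<close>

lemma piecewise_C1_glue:
  fixes f g :: "real \<Rightarrow> complex"
  assumes f: "f piecewise_C1_differentiable_on UNIV" and g: "g piecewise_C1_differentiable_on UNIV" and fg: "f c = g c"
  shows "(\<lambda>t. if t \<le> c then f t else g t) piecewise_C1_differentiable_on UNIV"
proof -
  let ?h = "\<lambda>t. if t \<le> c then f t else g t"
  obtain S1 D1 where 1: "finite S1" "\<And>x. x \<notin> S1 \<Longrightarrow> (f has_vector_derivative D1 x) (at x)" "continuous_on (- S1) D1"
    using f unfolding piecewise_C1_differentiable_on_def C1_differentiable_on_def Compl_eq_Diff_UNIV[symmetric] by auto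
  obtain S2 D2 where 2: "finite S2" "\<And>x. x \<notin> S2 \<Longrightarrow> (g has_vector_derivative D2 x) (at x)" "continuous_on (- S2) D2"
    using g unfolding piecewise_C1_differentiable_on_def C1_differentiable_on_def Compl_eq_Diff_UNIV[symmetric] by auto
  have "continuous_on UNIV f" "continuous_on UNIV g" using f g unfolding piecewise_C1_differentiable_on_def by blast+
  then have "continuous_on UNIV ?h" by (intro continuous_on_cases_1) (auto intro: continuous_on_subset simp: fg)
  moreover define S where "S = insert c (S1 \<union> S2)"
  have "finite S" using 1 2 by (simp add: S_def)
  moreover define D where "D = (\<lambda>t. if t \<le> c then D1 t else D2 t)"
  have "(?h has_vector_derivative D x) (at x)" if "x \<notin> S" for x
  proof (cases "x < c")
    case True
    have "(f has_vector_derivative D1 x) (at x)" using that by (intro 1) (simp add: S_def)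
    then have "(?h has_vector_derivative D1 x) (at x)"
      by (rule has_vector_derivative_transform_within_open[of _ _ _ "{..<c}"]) (use True in auto)
    then show ?thesis using True by (simp add: D_def)
  next
    case False
    have "(g has_vector_derivative D2 x) (at x)" using that by (intro 2) (simp add: S_def)
    then have "(?h has_vector_derivative D2 x) (at x)"
      by (rule has_vector_derivative_transform_within_open[of _ _ _ "{c<..}"]) (use False that in \<open>auto simp: S_def\<close>)
    then show ?thesis using False that by (simp add: D_def S_def)
  qed
  moreover have "continuous_on (- S) D"
  proof -
    have e: "- S = ({..<c} - S) \<union> ({c<..} - S)" by (auto simp: S_def)
    have "continuous_on ({..<c} - S) D"
      by (rule continuous_on_eq[OF continuous_on_subset[OF 1(3)]]) (auto simp: S_def D_def)
    moreover have "continuous_on ({c<..} - S) D"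
      by (rule continuous_on_eq[OF continuous_on_subset[OF 2(3)]]) (auto simp: S_def D_def)
    ultimately show ?thesis unfolding e
      by (intro continuous_on_open_Un open_Diff open_lessThan open_greaterThan finite_imp_closed \<open>finite S\<close>)
  qed
  ultimately show ?thesis
    unfolding piecewise_C1_differentiable_on_def C1_differentiable_on_def Compl_eq_Diff_UNIV[symmetric] by blast
qed

text \<open>Newton's step: a multiple of the polynomial that vanishes at the old nodes corrects the
  value at the new one.\<close>

lemma poly_interpolation:
  fixes f :: "'a::field \<Rightarrow> 'a"
  assumes "finite S"
  shows "\<exists>p. \<forall>x\<in>S. poly p x = f x"
  using assms
proof (induction S)
  case (insert y S)
  then obtain p where p: "\<forall>x\<in>S. poly p x = f x" by blast
  define r where "r = (\<Prod>x\<in>S. [:- x, 1:])"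
  have r: "poly r z = (\<Prod>x\<in>S. z - x)" for z by (simp add: r_def poly_prod)
  have "poly r y \<noteq> 0" unfolding r using insert by auto
  moreover have "poly r z = 0" if "z \<in> S" for z unfolding r using that insert by auto
  ultimately show ?case using p
    by (intro exI[of _ "p + smult ((f y - poly p y) / poly r y) r"]) auto
qed auto

text \<open>The parameter at which a curve has height y when it climbs with speed vp for t >= 0 and
  vm for t <= 0.\<close>

definition level :: "real \<Rightarrow> real \<Rightarrow> real \<Rightarrow> real" where
  "level vp vm y = (if y \<ge> 0 then y / vp else y / vm)"

definition right_side :: "(real \<Rightarrow> complex) \<Rightarrow> real \<Rightarrow> real \<Rightarrow> real \<Rightarrow> complex set" where
  "right_side \<gamma> k vp vm = {s. Re (\<gamma> (level vp vm (Im s - k * Re s))) < Re s}"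

definition left_side :: "(real \<Rightarrow> complex) \<Rightarrow> real \<Rightarrow> real \<Rightarrow> real \<Rightarrow> complex set" where
  "left_side \<gamma> k vp vm = {s. Re s < Re (\<gamma> (level vp vm (Im s - k * Re s)))}"

text \<open>In the sheared coordinates \<open>Re s\<close>, \<open>Im s - k * Re s\<close> the curve is a graph over the second one.\<close>
lemma graph_separates:
  assumes cont: "continuous_on UNIV \<gamma>" and v: "vp > 0" "vm > 0"
    and eq: "\<And>t. Im (\<gamma> t) - k * Re (\<gamma> t) = (if t \<ge> 0 then t * vp else t * vm)"
  shows "inj \<gamma>" "right_side \<gamma> k vp vm \<noteq> left_side \<gamma> k vp vm"
    "components (- range \<gamma>) = {right_side \<gamma> k vp vm, left_side \<gamma> k vp vm}"
    "right_side \<gamma> k vp vm \<union> left_side \<gamma> k vp vm = - range \<gamma>"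
proof -
  define w where "w = (\<lambda>y. Re (\<gamma> (level vp vm y)))"
  have lev: "level vp vm (Im (\<gamma> t) - k * Re (\<gamma> t)) = t" for t
    unfolding eq level_def using v by (auto simp: zero_le_mult_iff mult_less_0_iff)
  show "inj \<gamma>" by (rule injI) (metis lev)
  have lev': "Im (\<gamma> (level vp vm y)) - k * Re (\<gamma> (level vp vm y)) = y" for y
    unfolding eq level_def using v by (auto simp: divide_less_0_iff zero_le_divide_iff)
  have le: "level vp vm = (\<lambda>y. if y \<le> 0 then y / vm else y / vp)" by (auto simp: level_def fun_eq_iff)
  have "continuous_on UNIV (level vp vm)"
    unfolding le using v by (intro continuous_on_cases_1) (auto intro!: continuous_intros)
  then have wc: "continuous_on UNIV w" unfolding w_def
    by (intro continuous_intros continuous_on_compose2[OF cont]) auto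
  have w: "continuous_on A (\<lambda>s. w (f s))" if "continuous_on A f" for A :: "'x::topological_space set" and f
    by (rule continuous_on_compose2[OF wc that]) auto
  have R: "right_side \<gamma> k vp vm = {s. w (Im s - k * Re s) < Re s}" by (simp add: right_side_def w_def)
  have L: "left_side \<gamma> k vp vm = {s. Re s < w (Im s - k * Re s)}" by (simp add: left_side_def w_def)
  define G where "G = (\<lambda>z. Complex (w (snd z) + fst z) (snd z + k * (w (snd z) + fst z)))"
  have Gc: "continuous_on A G" for A unfolding G_def by (intro continuous_intros w)
  have G: "s = G (Re s - w (Im s - k * Re s), Im s - k * Re s)" for s by (simp add: G_def complex_eq_iff)
  have RG: "right_side \<gamma> k vp vm = G ` ({0<..} \<times> UNIV)"
  proof (intro equalityI subsetI)
    fix s assume "s \<in> right_side \<gamma> k vp vm"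
    then show "s \<in> G ` ({0<..} \<times> UNIV)" by (intro image_eqI[where f = G, OF G[of s]]) (simp add: R)
  qed (auto simp: R G_def)
  have LG: "left_side \<gamma> k vp vm = G ` ({..<0} \<times> UNIV)"
  proof (intro equalityI subsetI)
    fix s assume "s \<in> left_side \<gamma> k vp vm"
    then show "s \<in> G ` ({..<0} \<times> UNIV)" by (intro image_eqI[where f = G, OF G[of s]]) (simp add: L)
  qed (auto simp: L G_def)
  have conn: "connected (right_side \<gamma> k vp vm)" "connected (left_side \<gamma> k vp vm)"
    unfolding RG LG by (intro connected_continuous_image Gc convex_connected convex_Times convex_real_interval convex_UNIV)+
  have op: "open (right_side \<gamma> k vp vm)" "open (left_side \<gamma> k vp vm)"
    unfolding R L by (intro open_Collect_less continuous_intros w)+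
  have ne: "right_side \<gamma> k vp vm \<noteq> {}" "left_side \<gamma> k vp vm \<noteq> {}" unfolding RG LG by (auto intro: gt_ex lt_ex)
  have dj: "right_side \<gamma> k vp vm \<inter> left_side \<gamma> k vp vm = {}" unfolding R L by auto
  show nq: "right_side \<gamma> k vp vm \<noteq> left_side \<gamma> k vp vm" using ne dj by blast
  have "range \<gamma> = {s. Re s = w (Im s - k * Re s)}"
  proof (intro equalityI subsetI)
    fix s assume "s \<in> range \<gamma>"
    then obtain t where "s = \<gamma> t" by blast
    then show "s \<in> {s. Re s = w (Im s - k * Re s)}" by (simp add: w_def lev)
  next
    fix s assume s: "s \<in> {s. Re s = w (Im s - k * Re s)}"
    then have r: "Re (\<gamma> (level vp vm (Im s - k * Re s))) = Re s" by (simp add: w_def)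
    have "Im (\<gamma> (level vp vm (Im s - k * Re s))) = Im s" using lev'[of "Im s - k * Re s"] unfolding r by simp
    then have "\<gamma> (level vp vm (Im s - k * Re s)) = s" using r by (simp add: complex_eq_iff)
    then show "s \<in> range \<gamma>" by (metis rangeI)
  qed
  then show un: "right_side \<gamma> k vp vm \<union> left_side \<gamma> k vp vm = - range \<gamma>" unfolding R L by (auto simp: less_le)
  show "components (- range \<gamma>) = {right_side \<gamma> k vp vm, left_side \<gamma> k vp vm}"
    using un op conn ne dj nq by (intro components_open_unique) (auto simp: pairwise_insert disjnt_def)
qed

lemma linear_piece:
  fixes c d :: complex
  shows "(\<lambda>t. c + of_real t * d) piecewise_C1_differentiable_on UNIV"
proof (rule C1_differentiable_imp_piecewise)
  have "((\<lambda>t. c + of_real t * d) has_vector_derivative 1 * d) (at t)" for t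
    by (auto intro!: derivative_eq_intros)
  then show "(\<lambda>t. c + of_real t * d) C1_differentiable_on UNIV"
    unfolding C1_differentiable_on_def by (intro exI[of _ "\<lambda>_. 1 * d"]) auto
qed

lemma poly_piece:
  fixes d e :: complex
  shows "(\<lambda>t. of_real (poly q t) * d + of_real t * e) piecewise_C1_differentiable_on UNIV"
proof (rule C1_differentiable_imp_piecewise)
  have "((\<lambda>t. of_real (poly q t) * d + of_real t * e) has_vector_derivative of_real (poly (pderiv q) t) * d + of_real 1 * e) (at t)" for t
    by (intro has_vector_derivative_add has_vector_derivative_mult_left has_vector_derivative_of_real)
       (auto simp: has_real_derivative_iff_has_vector_derivative[symmetric] poly_DERIV)
  then show "(\<lambda>t. of_real (poly q t) * d + of_real t * e) C1_differentiable_on UNIV"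
    unfolding C1_differentiable_on_def
    by (intro exI[of _ "\<lambda>t. of_real (poly (pderiv q) t) * d + of_real 1 * e"] conjI ballI continuous_intros) auto
qed

context pole_sets
begin

text \<open>Only countably many slopes occur between two poles. For any other k the sheared heights
  Im s - k * Re s of a right pole and a left pole differ; equal real parts would force the two poles
  to coincide.\<close>

lemma generic_slope:
  assumes "k0 > 0"
  obtains k where "0 < k" "k < k0" "\<And>p s. p \<in> P \<Longrightarrow> s \<in> M \<Longrightarrow> Im p - k * Re p \<noteq> Im s - k * Re s"
proof -
  define E where "E = (\<lambda>(p, s). (Im p - Im s) / (Re p - Re s)) ` ((P \<union> M) \<times> (P \<union> M))"
  have "countable E" unfolding E_def by (intro countable_image countable_SIGMA countable_poles)
  moreover have "uncountable {0<..<k0}" using assms by (simp add: uncountable_open_interval)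
  ultimately have "\<not> {0<..<k0} \<subseteq> E" using countable_subset by blast
  then obtain k where "k \<in> {0<..<k0}" "k \<notin> E" by blast
  then have k: "0 < k" "k < k0" "k \<notin> E" by simp_all
  have "Im p - k * Re p \<noteq> Im s - k * Re s" if "p \<in> P" "s \<in> M" for p s
  proof
    assume e: "Im p - k * Re p = Im s - k * Re s"
    have "Re p \<noteq> Re s"
    proof
      assume "Re p = Re s"
      then have "p = s" using e by (simp add: complex_eq_iff)
      then show False using that disjoint by blast
    qed
    moreover have "k * (Re p - Re s) = Im p - Im s" using e unfolding right_diff_distrib by linarith
    ultimately have "k = (Im p - Im s) / (Re p - Re s)" by (simp only: nonzero_eq_divide_eq right_minus_eq not_False_eq_True)
    moreover have "(p, s) \<in> (P \<union> M) \<times> (P \<union> M)" using that by simp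
    ultimately have "k \<in> E" unfolding E_def by (intro image_eqI[of _ _ "(p, s)"]) (simp_all only: prod.case)
    then show False using k by blast
  qed
  with k(1,2) show ?thesis by (rule that)
qed

text \<open>In the sheared height Im s - k * Re s, with k > 0, right poles run off downwards and
  left poles upwards. So only finitely many poles lie on the wrong side of any fixed level, and a
  curve that is a graph over the height has only to pass left of the right poles and right of the
  left poles. In the middle it follows an interpolating polynomial, outside it follows the two rays,
  which are beyond the strip of poles.\<close>

lemma contour_exists:
  assumes \<theta>p: "0 < \<theta>p" "\<theta>p < pi" and \<theta>m: "- pi < \<theta>m" "\<theta>m < 0"
  shows "\<exists>\<gamma>. MB_contour P M \<theta>p \<theta>m \<gamma>"
proof -
  have sp: "sin \<theta>p > 0" using \<theta>p by (simp add: sin_gt_zero)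
  have sm: "sin \<theta>m < 0" using sin_gt_zero[of "- \<theta>m"] \<theta>m by simp
  \<comment> \<open>The bound on k keeps both speeds vp and vm positive, so the rays remain graphs
    over the sheared height.\<close>
  obtain k where k: "0 < k" "k < min (sin \<theta>p) (- sin \<theta>m)" "\<And>p s. p \<in> P \<Longrightarrow> s \<in> M \<Longrightarrow> Im p - k * Re p \<noteq> Im s - k * Re s"
    using generic_slope[of "min (sin \<theta>p) (- sin \<theta>m)"] sp sm by auto
  define vp where "vp = sin \<theta>p - k * cos \<theta>p"
  define vm where "vm = - sin \<theta>m + k * cos \<theta>m"
  have kc: "\<bar>k * cos x\<bar> \<le> k" for x using k(1) mult_left_mono[OF abs_cos_le_one[of x], of k] by (simp add: abs_mult)
  have v: "vp > 0" "vm > 0" using k(2) kc[of \<theta>p] kc[of \<theta>m] unfolding vp_def vm_def min_less_iff_conj abs_le_iff by linarith+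
  have H0: "\<bar>Im s\<bar> \<le> \<bar>H\<bar>" if "s \<in> P \<union> M" for s using strip[OF that] by linarith
  define lv where "lv = (\<lambda>s. level vp vm (Im s - k * Re s))"
  have lv_pos: "lv s * vp = Im s - k * Re s" if "lv s \<ge> 0" for s
    using that v by (auto simp: lv_def level_def zero_le_divide_iff split: if_splits)
  have lv_neg: "lv s * vm = Im s - k * Re s" if "lv s \<le> 0" for s
    using that v by (auto simp: lv_def level_def divide_le_0_iff split: if_splits)
  have lv_inj: "lv p \<noteq> lv s" if "p \<in> P" "s \<in> M" for p s
    using k(3)[OF that] lv_pos[of p] lv_pos[of s] lv_neg[of p] lv_neg[of s] by (cases "lv p \<ge> 0") auto
  have finP: "finite {s\<in>P. lv s \<ge> - x}" if "x \<ge> 0" for x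
  proof (rule finite_subset[OF _ finite_left[of "(\<bar>H\<bar> + x * vm) / k"]], safe)
    fix s assume s: "s \<in> P" "lv s \<ge> - x"
    have "Im s - k * Re s \<ge> - x * vm"
    proof (cases "lv s \<ge> 0")
      case True
      then have "Im s - k * Re s \<ge> 0" using lv_pos[OF True] v by (metis mult_nonneg_nonneg less_imp_le)
      moreover have "- x * vm \<le> 0" using that v by simp
      ultimately show ?thesis by linarith
    next
      case False
      then show ?thesis using lv_neg[of s] mult_right_mono[OF s(2), of vm] v by simp
    qed
    moreover have "Im s \<le> \<bar>H\<bar>" using H0[of s] s by simp
    ultimately have "Re s * k \<le> \<bar>H\<bar> + x * vm" by (simp add: algebra_simps)
    then show "Re s \<le> (\<bar>H\<bar> + x * vm) / k" using k(1) by (simp add: pos_le_divide_eq)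
  qed
  have finM: "finite {s\<in>M. lv s \<le> x}" if "x \<ge> 0" for x
  proof (rule finite_subset[OF _ finite_right[of "- ((\<bar>H\<bar> + x * vp) / k)"]], safe)
    fix s assume s: "s \<in> M" "lv s \<le> x"
    have "Im s - k * Re s \<le> x * vp"
    proof (cases "lv s \<le> 0")
      case True
      then have "Im s - k * Re s \<le> 0" using lv_neg[OF True] v by (metis mult_nonpos_nonneg less_imp_le)
      moreover have "0 \<le> x * vp" using that v by simp
      ultimately show ?thesis by linarith
    next
      case False
      then show ?thesis using lv_pos[of s] mult_right_mono[OF s(2), of vp] v by simp
    qed
    moreover have "- \<bar>H\<bar> \<le> Im s" using H0[of s] s by (simp add: abs_le_iff)
    ultimately have "- (\<bar>H\<bar> + x * vp) \<le> Re s * k" by (simp add: algebra_simps)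
    then show "- ((\<bar>H\<bar> + x * vp) / k) \<le> Re s" using k(1) by (simp add: pos_divide_le_eq minus_divide_left[symmetric] field_simps)
  qed
  \<comment> \<open>No right pole lies above level B and no left pole below level - B.\<close>
  define B where "B = Max (insert 0 (lv ` {s\<in>P. lv s \<ge> - 0} \<union> (\<lambda>s. - lv s) ` {s\<in>M. lv s \<le> 0}))"
  have Bf: "finite (insert 0 (lv ` {s\<in>P. lv s \<ge> - 0} \<union> (\<lambda>s. - lv s) ` {s\<in>M. lv s \<le> 0}))" 
    using finP[of 0] finM[of 0] by simp
  have B: "lv s \<le> B" if "s \<in> P" for s
  proof (cases "lv s \<ge> 0")
    case True then show ?thesis unfolding B_def using that by (intro Max_ge Bf) auto
  next
    case False
    moreover have "0 \<le> B" unfolding B_def by (intro Max_ge Bf) auto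
    ultimately show ?thesis by linarith
  qed
  have B': "- B \<le> lv s" if "s \<in> M" for s
  proof (cases "lv s \<le> 0")
    case True
    then have "- lv s \<le> B" unfolding B_def using that by (intro Max_ge Bf) auto
    then show ?thesis by linarith
  next
    case False
    moreover have "0 \<le> B" unfolding B_def by (intro Max_ge Bf) auto
    ultimately show ?thesis by linarith
  qed
  \<comment> \<open>Beyond level B all poles of the wrong kind are past; the other two bounds make
    the rays start outside the strip |Im s| <= |H|.\<close>
  define T where "T = max (B + 1) (max 1 (max (\<bar>H\<bar> / sin \<theta>p + 1) (\<bar>H\<bar> / (- sin \<theta>m) + 1)))"
  have T: "T > B" "T > 0" "T > \<bar>H\<bar> / sin \<theta>p" "T > \<bar>H\<bar> / (- sin \<theta>m)" unfolding T_def less_max_iff_disj by simp_all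
  have TH: "\<bar>H\<bar> < T * sin \<theta>p" "\<bar>H\<bar> < T * (- sin \<theta>m)"
    using T(3,4) sp sm by (simp_all only: pos_divide_less_eq neg_0_less_iff_less)
  define PT where "PT = {s\<in>P. - T \<le> lv s}"
  define MT where "MT = {s\<in>M. lv s \<le> T}"
  have fin: "finite PT" "finite MT" unfolding PT_def MT_def using finP[of T] finM[of T] T by simp_all
  \<comment> \<open>Prescribed abscissas: matching the rays at the ends, left of all right poles on
    their levels, and right of all left poles on the remaining levels. Levels of the two kinds never
    coincide by the choice of k. The inserted 0 covers a level without left poles.\<close>
  define f where "f = (\<lambda>t. if t = T then T * cos \<theta>p else if t = - T then T * cos \<theta>m
      else if t \<in> lv ` PT then Min (Re ` {s\<in>PT. lv s = t}) - 1 else Max (insert 0 (Re ` {s\<in>MT. lv s = t})) + 1)"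
  obtain q where q: "\<And>t. t \<in> {T, - T} \<union> lv ` PT \<union> lv ` MT \<Longrightarrow> poly q t = f t"
    using poly_interpolation[of "{T, - T} \<union> lv ` PT \<union> lv ` MT" f] fin by auto
  have qT: "poly q T = T * cos \<theta>p" "poly q (- T) = T * cos \<theta>m" using q T by (auto simp: f_def)
  \<comment> \<open>A step along 1 + \<i> k leaves the sheared height unchanged, so in the middle q
    moves the abscissa freely while the second summand controls the height.\<close>
  define \<gamma> where "\<gamma> = (\<lambda>t. if t \<le> - T then 0 + of_real t * (- cis \<theta>m) else
     if t \<le> 0 then of_real (poly q t) * (1 + \<i> * of_real k) + of_real t * (\<i> * of_real vm)
     else if t \<le> T then of_real (poly q t) * (1 + \<i> * of_real k) + of_real t * (\<i> * of_real vp)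
     else 0 + of_real t * cis \<theta>p)"
  have pc: "\<gamma> piecewise_C1_differentiable_on UNIV" unfolding \<gamma>_def
  proof (intro piecewise_C1_glue linear_piece poly_piece)
    show "of_real (poly q T) * (1 + \<i> * of_real k) + of_real T * (\<i> * of_real vp) = 0 + of_real T * cis \<theta>p"
      unfolding qT vp_def by (simp add: complex_eq_iff algebra_simps)
    show "0 + of_real (- T) * (- cis \<theta>m) = (if - T \<le> 0 then of_real (poly q (- T)) * (1 + \<i> * of_real k) + of_real (- T) * (\<i> * of_real vm)
     else if - T \<le> T then of_real (poly q (- T)) * (1 + \<i> * of_real k) + of_real (- T) * (\<i> * of_real vp)
     else 0 + of_real (- T) * cis \<theta>p)"
      unfolding qT vm_def using T by (simp add: complex_eq_iff algebra_simps)
  qed (use T in simp)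
  then have cont: "continuous_on UNIV \<gamma>" unfolding piecewise_C1_differentiable_on_def by blast
  have graph: "Im (\<gamma> t) - k * Re (\<gamma> t) = (if t \<ge> 0 then t * vp else t * vm)" for t
    using T(2) by (auto simp: \<gamma>_def vp_def vm_def algebra_simps)
  note sep = graph_separates[OF cont v graph]
  have ray: "\<gamma> t = 0 + of_real t * cis \<theta>p \<and> \<gamma> (- t) = 0 + of_real t * cis \<theta>m" if "t \<ge> T + 1" for t
    using that T(2) by (auto simp: \<gamma>_def)
  have mid: "Re (\<gamma> t) = poly q t" if "- T < t" "t \<le> T" for t using that by (auto simp: \<gamma>_def)
  have P_right: "P \<subseteq> right_side \<gamma> k vp vm"
  proof
    fix s assume s: "s \<in> P"
    have Ims: "\<bar>Im s\<bar> \<le> \<bar>H\<bar>" using H0 s by blast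
    have "Re (\<gamma> (lv s)) < Re s"
    proof (cases "- T < lv s")
      case True
      have sT: "s \<in> PT" "lv s \<noteq> T" using True s B[OF s] T by (auto simp: PT_def)
      have "Min (Re ` {u\<in>PT. lv u = lv s}) \<le> Re s" using sT fin by (intro Min_le) auto
      moreover have "Re (\<gamma> (lv s)) = f (lv s)" using mid[of "lv s"] q[of "lv s"] True sT B[OF s] T by auto
      moreover have "f (lv s) = Min (Re ` {u\<in>PT. lv u = lv s}) - 1" using sT True by (auto simp: f_def)
      ultimately show ?thesis by linarith
    next
      case False
      define u where "u = - lv s"
      have u: "u \<ge> T" "lv s = - u" using False by (auto simp: u_def)
      have "\<gamma> (lv s) = of_real u * cis \<theta>m" unfolding u(2) using u(1) T by (auto simp: \<gamma>_def)
      then have g: "Re (\<gamma> (lv s)) = u * cos \<theta>m" by simp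
      have "- u * vm = Im s - k * Re s" using lv_neg[of s] u T by simp
      then have "k * (Re s - u * cos \<theta>m) = Im s + u * (- sin \<theta>m)" unfolding vm_def by (simp add: algebra_simps)
      moreover have "T * (- sin \<theta>m) \<le> u * (- sin \<theta>m)" using u sm by (intro mult_right_mono) auto
      then have "Im s + u * (- sin \<theta>m) > 0" using TH(2) Ims by linarith
      ultimately have "0 < k * (Re s - u * cos \<theta>m)" by linarith
      then have "0 < Re s - u * cos \<theta>m" using k(1) by (simp add: zero_less_mult_iff)
      then show ?thesis unfolding g by linarith
    qed
    then show "s \<in> right_side \<gamma> k vp vm" by (simp add: right_side_def lv_def)
  qed
  have M_left: "M \<subseteq> left_side \<gamma> k vp vm"
  proof
    fix s assume s: "s \<in> M"
    have Ims: "\<bar>Im s\<bar> \<le> \<bar>H\<bar>" using H0 s by blast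
    have "Re s < Re (\<gamma> (lv s))"
    proof (cases "lv s < T")
      case True
      have sT: "s \<in> MT" "lv s \<noteq> - T" "- T < lv s" using True s B'[OF s] T by (auto simp: MT_def)
      have n: "lv s \<notin> lv ` PT" using lv_inj[OF _ s] by (force simp: PT_def)
      have "Re s \<le> Max (insert 0 (Re ` {u\<in>MT. lv u = lv s}))" using sT fin by (intro Max_ge) auto
      moreover have "Re (\<gamma> (lv s)) = f (lv s)" using mid[of "lv s"] q[of "lv s"] True sT by auto
      moreover have "f (lv s) = Max (insert 0 (Re ` {u\<in>MT. lv u = lv s})) + 1" using sT True n by (auto simp: f_def)
      ultimately show ?thesis by linarith
    next
      case False
      then have u: "lv s \<ge> T" by simp
      have "\<gamma> (lv s) = of_real (lv s) * cis \<theta>p"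
      proof (cases "lv s = T")
        case True
        have "T * vp = T * sin \<theta>p - T * (k * cos \<theta>p)" unfolding vp_def by (rule right_diff_distrib)
        then show ?thesis using T(2) True qT by (simp add: \<gamma>_def complex_eq_iff mult_ac)
      next
        case False
        then show ?thesis using u T(2) by (simp add: \<gamma>_def)
      qed
      then have g: "Re (\<gamma> (lv s)) = lv s * cos \<theta>p" by simp
      have "lv s * vp = Im s - k * Re s" using lv_pos[of s] u T by simp
      then have "k * (lv s * cos \<theta>p - Re s) = lv s * sin \<theta>p - Im s" unfolding vp_def by (simp add: algebra_simps)
      moreover have "T * sin \<theta>p \<le> lv s * sin \<theta>p" using u sp by (intro mult_right_mono) auto
      then have "lv s * sin \<theta>p - Im s > 0" using TH(1) Ims by linarith
      ultimately have "0 < k * (lv s * cos \<theta>p - Re s)" by linarith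
      then have "0 < lv s * cos \<theta>p - Re s" using k(1) by (simp add: zero_less_mult_iff)
      then show ?thesis unfolding g by linarith
    qed
    then show "s \<in> left_side \<gamma> k vp vm" by (simp add: left_side_def lv_def)
  qed
  have "\<forall>\<^sub>F x::real in at_top. of_real x \<in> right_side \<gamma> k vp vm"
    using eventually_ge_at_top[of "max 1 (T * vm / k)"]
  proof eventually_elim
    case (elim x)
    define u where "u = k * x / vm"
    have x: "x > 0" "T * vm \<le> k * x" using elim k(1) by (auto simp: pos_divide_le_eq mult.commute)
    have u: "u \<ge> T" "u * vm = k * x" unfolding u_def using x v by (auto simp: pos_le_divide_eq)
    have "- (k * x) < 0" using k(1) x by simp
    then have "level vp vm (Im (complex_of_real x) - k * Re (complex_of_real x)) = - u" by (simp add: level_def u_def)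
    moreover have "\<gamma> (- u) = of_real u * cis \<theta>m" using u(1) T by (auto simp: \<gamma>_def)
    moreover have "k * (x - u * cos \<theta>m) = u * (- sin \<theta>m)" using u(2) unfolding vm_def by (simp add: algebra_simps)
    then have "0 < k * (x - u * cos \<theta>m)" using u(1) T(2) sm by (simp add: mult_pos_neg)
    then have "u * cos \<theta>m < x" using k(1) by (simp add: zero_less_mult_iff)
    ultimately show ?case by (simp add: right_side_def)
  qed
  with sep(2,3) P_right M_left have a: "\<exists>R L. R \<noteq> L \<and> components (- range \<gamma>) = {R, L} \<and> P \<subseteq> R \<and> (\<forall>\<^sub>F x::real in at_top. of_real x \<in> R) \<and> M \<subseteq> L"
    by (intro exI[of _ "right_side \<gamma> k vp vm"] exI[of _ "left_side \<gamma> k vp vm"] conjI)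
  have b: "\<exists>cp cm T. \<forall>t\<ge>T. \<gamma> t = cp + of_real t * cis \<theta>p \<and> \<gamma> (- t) = cm + of_real t * cis \<theta>m"
    by (rule exI[of _ 0], rule exI[of _ 0], rule exI[of _ "T + 1"]) (use ray in blast)
  have "\<theta>p \<in> {0<..<pi}" "\<theta>m \<in> {- pi<..<0}" using \<theta>p \<theta>m by simp_all
  then have "MB_contour P M \<theta>p \<theta>m \<gamma>" unfolding MB_contour_def using pc sep(1) b a by (intro conjI)
  then show ?thesis by (intro exI[of _ \<gamma>])
qed

end

lemma MB_contour_separating:
  assumes "MB_contour P M \<theta>p \<theta>m \<gamma>" and ps: "pole_sets P M H"
  shows "\<exists>cp cm T R L. separating_curve \<gamma> \<theta>p \<theta>m cp cm T P M H R L"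
proof -
  from assms(1) have r: "\<exists>cp cm T. \<forall>t\<ge>T. \<gamma> t = cp + of_real t * cis \<theta>p \<and> \<gamma> (- t) = cm + of_real t * cis \<theta>m"
    unfolding MB_contour_def by (elim conjE)
  from assms(1) have s: "\<exists>R L. R \<noteq> L \<and> components (- range \<gamma>) = {R, L} \<and> P \<subseteq> R \<and> (\<forall>\<^sub>F x::real in at_top. of_real x \<in> R) \<and> M \<subseteq> L"
    unfolding MB_contour_def by (elim conjE)
  from r obtain cp cm T where r': "\<forall>t\<ge>T. \<gamma> t = cp + of_real t * cis \<theta>p \<and> \<gamma> (- t) = cm + of_real t * cis \<theta>m"
    by (elim exE)
  have ray: "\<gamma> t = cp + of_real t * cis \<theta>p" "\<gamma> (- t) = cm + of_real t * cis \<theta>m" if "t \<ge> T" for t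
    using r'[rule_format, OF that] by simp_all
  from s obtain R L where RL: "R \<noteq> L" "components (- range \<gamma>) = {R, L}" "P \<subseteq> R" "M \<subseteq> L" "\<forall>\<^sub>F x::real in at_top. of_real x \<in> R"
    by (elim exE conjE)
  define T' where "T' = max (max 1 T) (max (cmod cp) (cmod cm))"
  have T': "T' > 0" "T' \<ge> cmod cp" "T' \<ge> cmod cm" "T' \<ge> T" by (auto simp: T'_def)
  from assms(1) have "\<gamma> piecewise_C1_differentiable_on UNIV \<and> \<theta>p \<in> {0<..<pi} \<and> \<theta>m \<in> {- pi<..<0}"
    unfolding MB_contour_def by (elim conjE, intro conjI)
  then have a: "\<gamma> piecewise_C1_differentiable_on UNIV" "\<theta>p \<in> {0<..<pi}" "\<theta>m \<in> {- pi<..<0}"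
    by simp_all
  have "ray_curve \<gamma> \<theta>p \<theta>m cp cm T'"
    by (rule ray_curve.intro[OF a(1) T'(1,2,3) ray(1)[OF order_trans[OF T'(4)]] ray(2)[OF order_trans[OF T'(4)]]]) (use a in simp_all)
  moreover have "separating_curve_axioms \<gamma> P M R L" using RL by (intro separating_curve_axioms.intro)
  ultimately have "separating_curve \<gamma> \<theta>p \<theta>m cp cm T' P M H R L" using ps by (intro separating_curve.intro)
  then show ?thesis by (intro exI)
qed

section \<open>The wedge as a separating curve\<close>

definition wedge :: "real \<Rightarrow> real \<Rightarrow> real \<Rightarrow> real \<Rightarrow> complex" where
  "wedge c \<phi>p \<phi>m = (\<lambda>t. if t \<le> 0 then of_real c + of_real t * (- cis \<phi>m) else of_real c + of_real t * cis \<phi>p)"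

text \<open>The abscissa of the wedge at height \<open>y\<close>.\<close>
definition wedge_re :: "real \<Rightarrow> real \<Rightarrow> real \<Rightarrow> real \<Rightarrow> real" where
  "wedge_re c \<phi>p \<phi>m y = (if y \<ge> 0 then c + y * (cos \<phi>p / sin \<phi>p) else c + y * (cos \<phi>m / sin \<phi>m))"

text \<open>The imaginary part is strictly monotone along the wedge, which is therefore a graph
  without any shear. It sorts the poles into those on its right and on its left, regardless of the
  families they come from. Only finitely many change sides, as its abscissa is bounded above by c
  and also bounded below over the strip of poles.\<close>

lemma wedge_separating:
  assumes \<phi>p: "pi / 2 \<le> \<phi>p" "\<phi>p < pi" and \<phi>m: "- pi < \<phi>m" "\<phi>m \<le> - pi / 2" and ps: "pole_sets P M H"
    and off: "\<And>s. s \<in> P \<union> M \<Longrightarrow> Re s \<noteq> wedge_re c \<phi>p \<phi>m (Im s)"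
  shows "\<exists>T R L. separating_curve (wedge c \<phi>p \<phi>m) \<phi>p \<phi>m (of_real c) (of_real c) T
      {s \<in> P \<union> M. wedge_re c \<phi>p \<phi>m (Im s) < Re s} {s \<in> P \<union> M. Re s < wedge_re c \<phi>p \<phi>m (Im s)} H R L"
    and "\<And>y. wedge_re c \<phi>p \<phi>m y \<le> c"
proof -
  interpret pole_sets P M H by (rule ps)
  have sp: "sin \<phi>p > 0" and cp: "cos \<phi>p \<le> 0" using \<phi>p pi_gt_zero cos_ge_zero[of "pi - \<phi>p"] by (auto intro!: sin_gt_zero)
  have sm: "sin \<phi>m < 0" and cm: "cos \<phi>m \<le> 0"
    using sin_gt_zero[of "- \<phi>m"] \<phi>m pi_gt_zero cos_ge_zero[of "pi + \<phi>m"] by (auto simp: cos_add)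
  show le: "wedge_re c \<phi>p \<phi>m y \<le> c" for y
  proof (cases "y \<ge> 0")
    case True
    moreover have "cos \<phi>p / sin \<phi>p \<le> 0" using sp cp by (rule divide_nonpos_pos[rotated])
    ultimately have "y * (cos \<phi>p / sin \<phi>p) \<le> 0" by (rule mult_nonneg_nonpos)
    then show ?thesis using True unfolding wedge_re_def by simp
  next
    case False
    then have "y \<le> 0" by simp
    moreover have "0 \<le> cos \<phi>m / sin \<phi>m" using cm sm by (rule divide_nonpos_neg)
    ultimately have "y * (cos \<phi>m / sin \<phi>m) \<le> 0" by (rule mult_nonpos_nonneg)
    then show ?thesis using False unfolding wedge_re_def by simp
  qed
  define V where "V = wedge c \<phi>p \<phi>m"
  have pc: "V piecewise_C1_differentiable_on UNIV" unfolding V_def wedge_def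
    by (intro piecewise_C1_glue linear_piece) simp
  have cont: "continuous_on UNIV V" using pc unfolding piecewise_C1_differentiable_on_def by blast
  define vp where "vp = sin \<phi>p"
  define vm where "vm = - sin \<phi>m"
  have v: "vp > 0" "vm > 0" using sp sm by (auto simp: vp_def vm_def)
  have graph: "Im (V t) - 0 * Re (V t) = (if t \<ge> 0 then t * vp else t * vm)" for t
    by (auto simp: V_def wedge_def vp_def vm_def)
  note sep = graph_separates[OF cont v graph]
  have re: "Re (V (level vp vm (Im s - 0 * Re s))) = wedge_re c \<phi>p \<phi>m (Im s)" for s
  proof (cases "Im s > 0")
    case True
    then have "level vp vm (Im s - 0 * Re s) = Im s / sin \<phi>p" "\<not> Im s / sin \<phi>p \<le> 0"
      using sp by (simp_all add: level_def vp_def not_le)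
    then show ?thesis using True by (simp add: V_def wedge_def wedge_re_def)
  next
    case False
    then have "level vp vm (Im s - 0 * Re s) = - (Im s / sin \<phi>m)" "- (Im s / sin \<phi>m) \<le> 0"
      using sm by (auto simp: level_def vm_def zero_le_divide_iff)
    then show ?thesis using False by (auto simp: V_def wedge_def wedge_re_def)
  qed
  have rs: "s \<in> right_side V 0 vp vm \<longleftrightarrow> wedge_re c \<phi>p \<phi>m (Im s) < Re s" for s
    unfolding right_side_def mem_Collect_eq re ..
  have ls: "s \<in> left_side V 0 vp vm \<longleftrightarrow> Re s < wedge_re c \<phi>p \<phi>m (Im s)" for s
    unfolding left_side_def mem_Collect_eq re ..
  define T where "T = \<bar>c\<bar> + 1"
  have "ray_curve V \<phi>p \<phi>m (of_real c) (of_real c) T"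
  proof (rule ray_curve.intro[OF pc])
    show "0 < \<phi>p" "\<phi>m < 0" using \<phi>p \<phi>m pi_gt_zero by linarith+
  qed (use \<phi>p \<phi>m in \<open>auto simp: T_def V_def wedge_def\<close>)
  moreover have "pole_sets {s \<in> P \<union> M. wedge_re c \<phi>p \<phi>m (Im s) < Re s} {s \<in> P \<union> M. Re s < wedge_re c \<phi>p \<phi>m (Im s)} H"
  proof
    \<comment> \<open>A lower bound for the abscissa of the wedge over all heights at which poles
      occur.\<close>
    define m where "m = c + (- \<bar>H\<bar>) * \<bar>cos \<phi>p / sin \<phi>p\<bar> + (- \<bar>H\<bar>) * \<bar>cos \<phi>m / sin \<phi>m\<bar>"
    have aux: "c + - A + - B \<le> (if d then c + X else c + Y)" if "- A \<le> 0" "- B \<le> 0" "- A \<le> X" "- B \<le> Y" for A B X Y :: real and d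
      using that by simp
    have m: "m \<le> wedge_re c \<phi>p \<phi>m (Im s)" if "s \<in> P \<union> M" for s
    proof -
      have a: "\<bar>Im s\<bar> \<le> \<bar>H\<bar>" using strip[OF that] by linarith
      have b: "- (\<bar>H\<bar> * \<bar>z\<bar>) \<le> Im s * z" for z
        using mult_right_mono[OF a, of "\<bar>z\<bar>"] abs_ge_minus_self[of "Im s * z"] unfolding abs_mult by simp
      have "- (\<bar>H\<bar> * \<bar>cos \<phi>p / sin \<phi>p\<bar>) \<le> 0" "- (\<bar>H\<bar> * \<bar>cos \<phi>m / sin \<phi>m\<bar>) \<le> 0" by simp_all
      then show ?thesis using b[of "cos \<phi>p / sin \<phi>p"] b[of "cos \<phi>m / sin \<phi>m"] unfolding m_def wedge_re_def mult_minus_left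
        by (rule aux)
    qed
    show "finite {s \<in> {s \<in> P \<union> M. wedge_re c \<phi>p \<phi>m (Im s) < Re s}. Re s \<le> x}" for x
    proof (rule finite_subset)
      show "{s \<in> {s \<in> P \<union> M. wedge_re c \<phi>p \<phi>m (Im s) < Re s}. Re s \<le> x} \<subseteq> {s\<in>P. Re s \<le> x} \<union> {s\<in>M. m \<le> Re s}"
        using order_trans[OF m less_imp_le] by blast
    qed (intro finite_UnI finite_left finite_right)
    show "finite {s \<in> {s \<in> P \<union> M. Re s < wedge_re c \<phi>p \<phi>m (Im s)}. x \<le> Re s}" for x
    proof (rule finite_subset)
      show "{s \<in> {s \<in> P \<union> M. Re s < wedge_re c \<phi>p \<phi>m (Im s)}. x \<le> Re s} \<subseteq> {s\<in>P. Re s \<le> c} \<union> {s\<in>M. x \<le> Re s}"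
        using order_trans[OF less_imp_le le] by blast
    qed (intro finite_UnI finite_left finite_right)
  qed (use strip in auto)
  moreover have ev: "\<forall>\<^sub>F x::real in at_top. of_real x \<in> right_side V 0 vp vm"
    using eventually_gt_at_top[of c] by eventually_elim (simp add: rs wedge_re_def)
  have "separating_curve_axioms V {s \<in> P \<union> M. wedge_re c \<phi>p \<phi>m (Im s) < Re s} {s \<in> P \<union> M. Re s < wedge_re c \<phi>p \<phi>m (Im s)}
     (right_side V 0 vp vm) (left_side V 0 vp vm)"
    by (rule separating_curve_axioms.intro[OF sep(2,3) _ _ ev]) (auto simp: rs ls)
  ultimately have "separating_curve V \<phi>p \<phi>m (of_real c) (of_real c) T
      {s \<in> P \<union> M. wedge_re c \<phi>p \<phi>m (Im s) < Re s} {s \<in> P \<union> M. Re s < wedge_re c \<phi>p \<phi>m (Im s)} H (right_side V 0 vp vm) (left_side V 0 vp vm)"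
    by (intro separating_curve.intro)
  then show "\<exists>T R L. separating_curve (wedge c \<phi>p \<phi>m) \<phi>p \<phi>m (of_real c) (of_real c) T
      {s \<in> P \<union> M. wedge_re c \<phi>p \<phi>m (Im s) < Re s} {s \<in> P \<union> M. Re s < wedge_re c \<phi>p \<phi>m (Im s)} H R L"
    unfolding V_def by (intro exI)
qed

section \<open>Poles and singularities of the integrand\<close>

lemma finite_lattice_cone:
  assumes "\<tau> > 0"
  shows "finite {(l, k). real l * \<tau> + real k \<le> x}"
proof (rule finite_subset)
  show "{(l, k). real l * \<tau> + real k \<le> x} \<subseteq> {..nat \<lceil>x / \<tau>\<rceil>} \<times> {..nat \<lceil>x\<rceil>}"
  proof
    fix y assume "y \<in> {(l, k). real l * \<tau> + real k \<le> x}"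
    then obtain l k where y: "y = (l, k)" and le: "real l * \<tau> + real k \<le> x" by auto
    have "0 \<le> real l * \<tau>" using assms by simp
    then have "real l * \<tau> \<le> x" "real k \<le> x" using le by linarith+
    then have "real l \<le> x / \<tau>" using assms by (simp add: pos_le_divide_eq)
    then have "l \<le> nat \<lceil>x / \<tau>\<rceil>" "k \<le> nat \<lceil>x\<rceil>" using \<open>real k \<le> x\<close> by linarith+
    then show "y \<in> {..nat \<lceil>x / \<tau>\<rceil>} \<times> {..nat \<lceil>x\<rceil>}" unfolding y by simp
  qed
qed simp

lemma MB_pole_sets:
  assumes \<tau>: "\<tau> > 0" and disj: "MB_Lambda_plus n p a \<tau> \<inter> MB_Lambda_minus m q b \<tau> = {}"
  shows "pole_sets (MB_Lambda_plus n p a \<tau>) (MB_Lambda_minus m q b \<tau>) ((\<Sum>j\<in>{n+1..p}. \<bar>Im (a j)\<bar>) + (\<Sum>j\<in>{m+1..q}. \<bar>Im (b j)\<bar>))"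
proof
  let ?A = "\<Sum>j\<in>{n+1..p}. \<bar>Im (a j)\<bar>" and ?B = "\<Sum>j\<in>{m+1..q}. \<bar>Im (b j)\<bar>"
  have A0: "?A \<ge> 0" "?B \<ge> 0" by (simp_all add: sum_nonneg)
  fix s assume "s \<in> MB_Lambda_plus n p a \<tau> \<union> MB_Lambda_minus m q b \<tau>"
  then consider j where "j \<in> {n+1..p}" "Im s = Im (a j)" | j where "j \<in> {m+1..q}" "Im s = Im (b j)"
    unfolding MB_Lambda_plus_def MB_Lambda_minus_def by auto
  then show "\<bar>Im s\<bar> \<le> ?A + ?B"
  proof cases
    case 1
    then have "\<bar>Im s\<bar> \<le> ?A" using member_le_sum[of j "{n+1..p}" "\<lambda>j. \<bar>Im (a j)\<bar>"] by simp
    then show ?thesis using A0 by linarith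
  next
    case 2
    then have "\<bar>Im s\<bar> \<le> ?B" using member_le_sum[of j "{m+1..q}" "\<lambda>j. \<bar>Im (b j)\<bar>"] by simp
    then show ?thesis using A0 by linarith
  qed
next
  fix x
  show "finite {s \<in> MB_Lambda_plus n p a \<tau>. Re s \<le> x}"
  proof (rule finite_subset)
    show "{s \<in> MB_Lambda_plus n p a \<tau>. Re s \<le> x} \<subseteq>
       (\<Union>j\<in>{n+1..p}. (\<lambda>(l, k). a j + of_nat l * of_real \<tau> + of_nat k) ` {(l, k). real l * \<tau> + real k \<le> x - Re (a j)})"
    proof
      fix s assume "s \<in> {s \<in> MB_Lambda_plus n p a \<tau>. Re s \<le> x}"
      then obtain j l k where s: "s = a j + of_nat l * of_real \<tau> + of_nat k" "j \<in> {n+1..p}" "Re s \<le> x"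
        unfolding MB_Lambda_plus_def by auto
      then have "(l, k) \<in> {(l, k). real l * \<tau> + real k \<le> x - Re (a j)}" by simp
      then have "s \<in> (\<lambda>(l, k). a j + of_nat l * of_real \<tau> + of_nat k) ` {(l, k). real l * \<tau> + real k \<le> x - Re (a j)}"
        by (rule rev_image_eqI) (simp add: s)
      with s(2) show "s \<in> (\<Union>j\<in>{n+1..p}. (\<lambda>(l, k). a j + of_nat l * of_real \<tau> + of_nat k) ` {(l, k). real l * \<tau> + real k \<le> x - Re (a j)})"
        by (rule UN_I)
    qed
  qed (intro finite_UN_I finite_imageI finite_lattice_cone[OF \<tau>] finite_atLeastAtMost)
  show "finite {s \<in> MB_Lambda_minus m q b \<tau>. x \<le> Re s}"
  proof (rule finite_subset)
    show "{s \<in> MB_Lambda_minus m q b \<tau>. x \<le> Re s} \<subseteq>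
       (\<Union>j\<in>{m+1..q}. (\<lambda>(l, k). b j - of_nat l * of_real \<tau> - of_nat k) ` {(l, k). real l * \<tau> + real k \<le> Re (b j) - x})"
    proof
      fix s assume "s \<in> {s \<in> MB_Lambda_minus m q b \<tau>. x \<le> Re s}"
      then obtain j l k where s: "s = b j - of_nat l * of_real \<tau> - of_nat k" "j \<in> {m+1..q}" "x \<le> Re s"
        unfolding MB_Lambda_minus_def by auto
      then have "(l, k) \<in> {(l, k). real l * \<tau> + real k \<le> Re (b j) - x}" by simp
      then have "s \<in> (\<lambda>(l, k). b j - of_nat l * of_real \<tau> - of_nat k) ` {(l, k). real l * \<tau> + real k \<le> Re (b j) - x}"
        by (rule rev_image_eqI) (simp add: s)
      with s(2) show "s \<in> (\<Union>j\<in>{m+1..q}. (\<lambda>(l, k). b j - of_nat l * of_real \<tau> - of_nat k) ` {(l, k). real l * \<tau> + real k \<le> Re (b j) - x})"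
        by (rule UN_I)
    qed
  qed (intro finite_UN_I finite_imageI finite_lattice_cone[OF \<tau>] finite_atLeastAtMost)
qed (use disj in simp)

lemma prod_barnes_G_holomorphic:
  assumes "\<tau> > 0"
  shows "(\<lambda>s. \<Prod>j\<in>J. barnes_G \<tau> (c j - s)) holomorphic_on S" "(\<lambda>s. \<Prod>j\<in>J. barnes_G \<tau> (c j + s)) holomorphic_on S"
proof -
  have "(barnes_G \<tau> \<circ> (\<lambda>s. c j - s)) holomorphic_on S" "(barnes_G \<tau> \<circ> (\<lambda>s. c j + s)) holomorphic_on S" for j
    by (intro holomorphic_on_compose barnes_G_holomorphic assms holomorphic_intros)+
  then show "(\<lambda>s. \<Prod>j\<in>J. barnes_G \<tau> (c j - s)) holomorphic_on S" "(\<lambda>s. \<Prod>j\<in>J. barnes_G \<tau> (c j + s)) holomorphic_on S"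
    unfolding o_def by (intro holomorphic_on_prod; simp)+
qed

definition MB_num :: "nat \<Rightarrow> nat \<Rightarrow> (nat \<Rightarrow> complex) \<Rightarrow> (nat \<Rightarrow> complex) \<Rightarrow> real \<Rightarrow> complex \<Rightarrow> complex" where
  "MB_num m n a b \<tau> s = (\<Prod>j=1..m. barnes_G \<tau> (b j - s)) * (\<Prod>j=1..n. barnes_G \<tau> (1 + of_real \<tau> - a j + s))"

definition MB_den :: "nat \<Rightarrow> nat \<Rightarrow> nat \<Rightarrow> nat \<Rightarrow> (nat \<Rightarrow> complex) \<Rightarrow> (nat \<Rightarrow> complex) \<Rightarrow> real \<Rightarrow> complex \<Rightarrow> complex" where
  "MB_den m n p q a b \<tau> s = (\<Prod>j=m+1..q. barnes_G \<tau> (1 + of_real \<tau> - b j + s)) * (\<Prod>j=n+1..p. barnes_G \<tau> (a j - s))"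

lemma MB_integrand_eq: "MB_integrand m n p q a b \<tau> = (\<lambda>s. MB_num m n a b \<tau> s / MB_den m n p q a b \<tau> s)"
  by (simp add: fun_eq_iff MB_integrand_def MB_num_def MB_den_def)

lemma MB_num_den_holomorphic:
  assumes "\<tau> > 0"
  shows "MB_num m n a b \<tau> holomorphic_on S" "MB_den m n p q a b \<tau> holomorphic_on S"
  unfolding MB_num_def[abs_def] MB_den_def[abs_def]
  by (intro holomorphic_on_mult prod_barnes_G_holomorphic assms)+

lemma MB_den_eq_0:
  assumes "\<tau> > 0" "MB_den m n p q a b \<tau> s = 0"
  shows "s \<in> MB_Lambda_plus n p a \<tau> \<union> MB_Lambda_minus m q b \<tau>"
proof -
  from assms consider j where "j \<in> {m+1..q}" "barnes_G \<tau> (1 + of_real \<tau> - b j + s) = 0" | j where "j \<in> {n+1..p}" "barnes_G \<tau> (a j - s) = 0"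
    unfolding MB_den_def by auto
  then show ?thesis
  proof cases
    case 1
    then obtain k l where "1 + of_real \<tau> - b j + s = - (of_nat l * of_real \<tau>) - of_nat k"
      unfolding barnes_G_eq_0_iff[OF assms(1)] by blast
    \<comment> \<open>The shift by 1 + \<tau> in the factor turns indices from 0 on into indices
      from 1 on, as in the definition of the left poles.\<close>
    then have "s = b j - of_nat (Suc l) * of_real \<tau> - of_nat (Suc k)" by (simp add: algebra_simps)
    then have "s \<in> MB_Lambda_minus m q b \<tau>" unfolding MB_Lambda_minus_def using 1(1)
      by (intro CollectI exI[of _ j] exI[of _ "Suc l"] exI[of _ "Suc k"]) simp
    then show ?thesis ..
  next
    case 2
    then obtain k l where "a j - s = - (of_nat l * of_real \<tau>) - of_nat k"
      unfolding barnes_G_eq_0_iff[OF assms(1)] by blast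
    then have "s = a j + of_nat l * of_real \<tau> + of_nat k" by (simp add: algebra_simps)
    then have "s \<in> MB_Lambda_plus n p a \<tau>" unfolding MB_Lambda_plus_def using 2(1)
      by (intro CollectI exI[of _ j] exI[of _ l] exI[of _ k]) simp
    then show ?thesis ..
  qed
qed

lemma MB_integrand_holomorphic:
  assumes "\<tau> > 0"
  shows "MB_integrand m n p q a b \<tau> holomorphic_on - (MB_Lambda_plus n p a \<tau> \<union> MB_Lambda_minus m q b \<tau>)"
  unfolding MB_integrand_eq
  by (intro holomorphic_on_divide MB_num_den_holomorphic assms) (use MB_den_eq_0[OF assms] in blast)

lemma MB_kernel_holomorphic:
  assumes "\<tau> > 0"
  shows "MB_kernel m n p q a b \<tau> \<alpha> holomorphic_on - (MB_Lambda_plus n p a \<tau> \<union> MB_Lambda_minus m q b \<tau>)"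
  unfolding MB_kernel_def[abs_def]
  by (intro holomorphic_intros MB_integrand_holomorphic assms)

text \<open>Countability gives a cheap proof that the integrand does not vanish identically near any
  point.\<close>

lemma countable_MB_zeros:
  assumes "\<tau> > 0"
  shows "countable {s. MB_num m n a b \<tau> s = 0}" "countable {s. MB_den m n p q a b \<tau> s = 0}"
proof -
  have z: "countable {s. barnes_G \<tau> s = 0}"
    by (rule countable_subset[of _ "range (\<lambda>(l, k). - (of_nat l * of_real \<tau>) - of_nat k :: complex)"])
       (auto simp: barnes_G_eq_0_iff[OF assms])
  have c: "countable {s. barnes_G \<tau> (u - s) = 0}" "countable {s. barnes_G \<tau> (u + s) = 0}" for u
    by (rule countable_subset[OF _ countable_image[OF z, of "\<lambda>s. u - s"]], force)
       (rule countable_subset[OF _ countable_image[OF z, of "\<lambda>s. s - u"]], force)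
  have "{s. MB_num m n a b \<tau> s = 0} \<subseteq> (\<Union>j\<in>{1..m}. {s. barnes_G \<tau> (b j - s) = 0}) \<union> (\<Union>j\<in>{1..n}. {s. barnes_G \<tau> (1 + of_real \<tau> - a j + s) = 0})"
    unfolding MB_num_def by auto
  then show "countable {s. MB_num m n a b \<tau> s = 0}" by (rule countable_subset) (intro countable_Un countable_UN c countable_finite finite_atLeastAtMost)
  have "{s. MB_den m n p q a b \<tau> s = 0} \<subseteq> (\<Union>j\<in>{m+1..q}. {s. barnes_G \<tau> (1 + of_real \<tau> - b j + s) = 0}) \<union> (\<Union>j\<in>{n+1..p}. {s. barnes_G \<tau> (a j - s) = 0})"
    unfolding MB_den_def by auto
  then show "countable {s. MB_den m n p q a b \<tau> s = 0}" by (rule countable_subset) (intro countable_Un countable_UN c countable_finite finite_atLeastAtMost)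
qed

text \<open>The integrand is a quotient of entire functions. If it vanished on a punctured disc,
  numerator or denominator would vanish at each of its points, the quotient by zero being zero; but
  an uncountable disc is not covered by countably many zeros.\<close>

lemma MB_integrand_singularity:
  assumes \<tau>: "\<tau> > 0" and disj: "MB_Lambda_plus n p a \<tau> \<inter> MB_Lambda_minus m q b \<tau> = {}"
  shows "isolated_singularity_at (MB_integrand m n p q a b \<tau>) z" "not_essential (MB_integrand m n p q a b \<tau>) z"
    "\<exists>\<^sub>F s in at z. MB_integrand m n p q a b \<tau> s \<noteq> 0"
proof -
  interpret pole_sets "MB_Lambda_plus n p a \<tau>" "MB_Lambda_minus m q b \<tau>" "(\<Sum>j\<in>{n+1..p}. \<bar>Im (a j)\<bar>) + (\<Sum>j\<in>{m+1..q}. \<bar>Im (b j)\<bar>)"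
    by (rule MB_pole_sets[OF assms])
  let ?S = "MB_Lambda_plus n p a \<tau> \<union> MB_Lambda_minus m q b \<tau>"
  have op: "open (ball z 1 - ({s\<in>?S. cmod s \<le> cmod z + 1} - {z}))"
    by (intro open_Diff open_ball finite_imp_closed finite_Diff finite_ball)
  have hol: "MB_integrand m n p q a b \<tau> holomorphic_on (ball z 1 - ({s\<in>?S. cmod s \<le> cmod z + 1} - {z})) - {z}"
  proof (rule holomorphic_on_subset[OF MB_integrand_holomorphic[OF \<tau>]])
    have "cmod s \<le> cmod z + 1" if "s \<in> ball z 1" for s
      using that norm_triangle_ineq2[of s z] by (simp add: dist_norm norm_minus_commute)
    then show "(ball z 1 - ({s\<in>?S. cmod s \<le> cmod z + 1} - {z})) - {z} \<subseteq> - ?S" by blast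
  qed
  show "isolated_singularity_at (MB_integrand m n p q a b \<tau>) z"
    by (rule isolated_singularity_at_holomorphic[OF hol op]) simp
  have an: "MB_num m n a b \<tau> analytic_on {z}" "MB_den m n p q a b \<tau> analytic_on {z}"
    unfolding analytic_at by (rule exI[of _ UNIV]; intro conjI open_UNIV UNIV_I MB_num_den_holomorphic \<tau>)+
  then show "not_essential (MB_integrand m n p q a b \<tau>) z"
    unfolding MB_integrand_eq by (intro not_essential_divide not_essential_analytic isolated_singularity_at_analytic)
  show "\<exists>\<^sub>F s in at z. MB_integrand m n p q a b \<tau> s \<noteq> 0"
  proof (rule ccontr)
    assume "\<not> (\<exists>\<^sub>F s in at z. MB_integrand m n p q a b \<tau> s \<noteq> 0)"
    then have "\<forall>\<^sub>F s in at z. MB_integrand m n p q a b \<tau> s = 0" by (simp add: frequently_def)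
    then obtain d where d: "d > 0" "\<And>s. s \<noteq> z \<Longrightarrow> dist s z < d \<Longrightarrow> MB_integrand m n p q a b \<tau> s = 0"
      unfolding eventually_at by blast
    have "ball z d \<subseteq> insert z ({s. MB_num m n a b \<tau> s = 0} \<union> {s. MB_den m n p q a b \<tau> s = 0})"
    proof
      fix s assume "s \<in> ball z d"
      then show "s \<in> insert z ({s. MB_num m n a b \<tau> s = 0} \<union> {s. MB_den m n p q a b \<tau> s = 0})"
        using d(2)[of s] unfolding MB_integrand_eq by (cases "s = z") (auto simp: dist_commute)
    qed
    then have "countable (ball z d)" by (rule countable_subset) (intro countable_insert countable_Un countable_MB_zeros \<tau>)
    then show False using uncountable_ball[OF d(1)] by blast
  qed
qed

section \<open>Residues of the integrand as functions of w\<close>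

lemma higher_deriv_exp_mult: "(deriv ^^ i) (\<lambda>s. exp (- s * w)) = (\<lambda>s. (- w) ^ i * exp (- s * w :: complex))"
proof (induction i)
  case (Suc i)
  have "deriv (\<lambda>s. (- w) ^ i * exp (- s * w)) s = (- w) ^ Suc i * exp (- s * w)" for s
    by (rule DERIV_imp_deriv) (auto intro!: derivative_eq_intros)
  then show ?case by (simp only: funpow.simps o_def Suc)
qed simp

text \<open>Expanding the higher derivative of a product in the residue formula shows that the residue is
  \<open>exp (- p * w)\<close> times a polynomial in \<open>w\<close> whose degree is smaller than the multiplicity of the pole.\<close>
lemma residue_mult_exp:
  assumes iso: "isolated_singularity_at f p" and ness: "not_essential f p" and fr: "\<exists>\<^sub>F s in at p. f s \<noteq> 0"
    and h: "h holomorphic_on UNIV"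
  shows "\<exists>A. \<forall>w. residue (\<lambda>s. f s * h s * exp (- s * w)) p = exp (- p * w) * (\<Sum>i<pole_mult f p. A i * w ^ i)"
proof -
  obtain r where r: "r > 0" "zor_poly f p holomorphic_on cball p r"
    "\<And>s. s \<in> cball p r - {p} \<Longrightarrow> f s = zor_poly f p s * (s - p) powi zorder f p"
    using zorder_exist[OF iso ness fr] by blast
  define g where "g = (\<lambda>s. zor_poly f p s * h s)"
  have g: "g holomorphic_on ball p r" unfolding g_def
    by (intro holomorphic_on_mult holomorphic_on_subset[OF r(2)] holomorphic_on_subset[OF h]) auto
  have gw: "(\<lambda>s. g s * exp (- s * w)) holomorphic_on ball p r" for w by (intro holomorphic_intros g)
  define k where "k = pole_mult f p"
  show ?thesis
  \<comment> \<open>A point of nonnegative order has multiplicity 0 and residue 0, in agreement with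
    the empty sum.\<close>
  proof (cases "zorder f p \<ge> 0")
    case True
    have "residue (\<lambda>s. f s * h s * exp (- s * w)) p = 0" for w
    proof -
      have "residue (\<lambda>s. f s * h s * exp (- s * w)) p = residue (\<lambda>s. (g s * exp (- s * w)) * (s - p) ^ nat (zorder f p)) p"
      proof (rule residue_cong)
        show "\<forall>\<^sub>F s in at p. f s * h s * exp (- s * w) = g s * exp (- s * w) * (s - p) ^ nat (zorder f p)"
          unfolding eventually_at
        proof (rule exI[of _ r], rule conjI[OF r(1)], intro ballI impI)
          fix s assume "s \<noteq> p \<and> dist s p < r"
          then have "f s = zor_poly f p s * (s - p) powi zorder f p" by (intro r(3)) (auto simp: dist_commute)
          also have "(s - p) powi zorder f p = (s - p) ^ nat (zorder f p)" using True by (simp add: power_int_def)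
          finally show "f s * h s * exp (- s * w) = g s * exp (- s * w) * (s - p) ^ nat (zorder f p)" by (simp add: g_def mult_ac)
        qed
      qed simp
      also have "\<dots> = 0" by (rule residue_holo[of "ball p r"]) (use r(1) in \<open>auto intro!: holomorphic_intros g\<close>)
      finally show ?thesis .
    qed
    moreover have "pole_mult f p = 0" using True by (simp add: pole_mult_def)
    ultimately show ?thesis by simp
  next
    case False
    then obtain k' where k': "k = Suc k'" unfolding k_def pole_mult_def by (metis not_le nat_eq_iff2 gr0_implies_Suc neg_0_less_iff_less zero_less_nat_eq)
    \<comment> \<open>Leibniz coefficients: each derivative that falls on exp (- s * w) contributes
      a factor - w, the others fall on the regular part g.\<close>
    define A where "A = (\<lambda>i. of_nat (k' choose i) * (- 1) ^ i * (deriv ^^ (k' - i)) g p / fact k')"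
    have "residue (\<lambda>s. f s * h s * exp (- s * w)) p = exp (- p * w) * (\<Sum>i<k. A i * w ^ i)" for w
    proof -
      have "residue (\<lambda>s. f s * h s * exp (- s * w)) p = residue (\<lambda>s. (g s * exp (- s * w)) / (s - p) ^ Suc k') p"
      proof (rule residue_cong)
        show "\<forall>\<^sub>F s in at p. f s * h s * exp (- s * w) = g s * exp (- s * w) / (s - p) ^ Suc k'"
          unfolding eventually_at
        proof (rule exI[of _ r], rule conjI[OF r(1)], intro ballI impI)
          fix s assume "s \<noteq> p \<and> dist s p < r"
          then have "f s = zor_poly f p s * (s - p) powi zorder f p" by (intro r(3)) (auto simp: dist_commute)
          also have "zorder f p = - int (Suc k')" using False k'[symmetric] unfolding k_def pole_mult_def by simp
          also have "(s - p) powi (- int (Suc k')) = inverse ((s - p) ^ Suc k')" unfolding power_int_minus power_int_of_nat ..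
          finally show "f s * h s * exp (- s * w) = g s * exp (- s * w) / (s - p) ^ Suc k'" by (simp add: g_def field_simps)
        qed
      qed simp
      also have "\<dots> = (deriv ^^ k') (\<lambda>s. g s * exp (- s * w)) p / fact k'"
        using residue_holomorphic_over_power[OF _ _ gw[of w], of p k'] r(1) by simp
      also have "(deriv ^^ k') (\<lambda>s. g s * exp (- s * w)) p = (deriv ^^ k') (\<lambda>s. exp (- s * w) * g s) p" by (simp only: mult.commute)
      also have "\<dots> = (\<Sum>i=0..k'. of_nat (k' choose i) * (deriv ^^ i) (\<lambda>s. exp (- s * w)) p * (deriv ^^ (k' - i)) g p)"
        by (rule higher_deriv_mult[OF _ g open_ball]) (use r(1) in \<open>auto intro!: holomorphic_intros\<close>)
      also have "\<dots> / fact k' = (\<Sum>i=0..k'. exp (- p * w) * (A i * w ^ i))"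
        unfolding higher_deriv_exp_mult sum_divide_distrib A_def
        by (intro sum.cong refl) (subst power_minus, simp)
      also have "\<dots> = exp (- p * w) * (\<Sum>i<k. A i * w ^ i)" 
        unfolding k' sum_distrib_left lessThan_Suc_atMost atMost_atLeast0 ..
      finally show ?thesis .
    qed
    then show ?thesis unfolding k_def by blast
  qed
qed

section \<open>The integral over the wedge\<close>

lemma norm_exp_ray: "cmod (exp (- (of_real c + of_real r * cis \<theta>) * w)) = exp (- c * Re w + r * (- cos \<theta> * Re w + sin \<theta> * Im w))"
  by (simp add: algebra_simps)

text \<open>In the direction \<theta> the factor exp (- s * w) grows at the rate x \<theta>, which
  is continuous in \<theta>. Half of the gap between \<kappa> and x \<phi> covers the variation of x
  within a small sector, and the other half remains as the rate.\<close>

lemma decay_rate_imp_decays: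
  assumes "decay_rate K \<phi> w"
  shows "\<exists>\<kappa>>0. decays (\<lambda>s. K s * exp (- s * w)) \<phi> \<kappa>"
proof -
  define x where "x = (\<lambda>\<theta>. - cos \<theta> * Re w + sin \<theta> * Im w)"
  obtain \<kappa> where \<kappa>: "\<kappa> > x \<phi>" "decays K \<phi> \<kappa>" using assms unfolding decay_rate_def x_def by blast
  obtain \<eta> R where d: "\<eta> > 0" "\<And>r \<theta>. r \<ge> R \<Longrightarrow> \<bar>\<theta> - \<phi>\<bar> \<le> \<eta> \<Longrightarrow> cmod (K (of_real r * cis \<theta>)) \<le> exp (- \<kappa> * r)"
    using \<kappa>(2) unfolding decays_def by blast
  define e where "e = (\<kappa> - x \<phi>) / 2"
  have e: "e > 0" using \<kappa>(1) by (simp add: e_def)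
  have "isCont x \<phi>" unfolding x_def by (intro continuous_intros)
  then obtain \<eta>' where \<eta>': "\<eta>' > 0" "\<And>\<theta>. \<bar>\<theta> - \<phi>\<bar> < \<eta>' \<Longrightarrow> \<bar>x \<theta> - x \<phi>\<bar> < e"
    using e unfolding continuous_at_eps_delta dist_real_def by metis
  have "decays (\<lambda>s. K s * exp (- s * w)) \<phi> e"
    unfolding decays_def
  proof (rule exI[of _ "min \<eta> (\<eta>' / 2)"], intro conjI, use d(1) \<eta>'(1) in simp, rule exI[of _ "max R 0"], intro allI impI)
    fix r \<theta> assume r: "r \<ge> max R 0" and \<theta>: "\<bar>\<theta> - \<phi>\<bar> \<le> min \<eta> (\<eta>' / 2)"
    have 1: "cmod (K (of_real r * cis \<theta>)) \<le> exp (- \<kappa> * r)" using r \<theta> by (intro d(2)) auto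
    have "\<bar>\<theta> - \<phi>\<bar> < \<eta>'" using \<theta> \<eta>'(1) by simp
    from \<eta>'(2)[OF this] have "x \<theta> - x \<phi> < e" by (simp only: abs_less_iff)
    moreover have "\<kappa> - e = x \<phi> + e" by (simp add: e_def field_simps)
    ultimately have "x \<theta> \<le> \<kappa> - e" by linarith
    then have "r * x \<theta> \<le> r * (\<kappa> - e)" using r by (intro mult_left_mono) auto
    have 2: "cmod (exp (- (of_real r * cis \<theta>) * w)) \<le> exp (r * (\<kappa> - e))"
      using norm_exp_ray[of 0 r \<theta> w] \<open>r * x \<theta> \<le> _\<close> by (simp add: x_def)
    have "cmod (K (of_real r * cis \<theta>) * exp (- (of_real r * cis \<theta>) * w)) \<le> exp (- \<kappa> * r) * exp (r * (\<kappa> - e))"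
      unfolding norm_mult by (intro mult_mono 1 2) auto
    also have "\<dots> = exp (- e * r)" unfolding exp_add[symmetric] by (simp add: algebra_simps)
    finally show "cmod (K (of_real r * cis \<theta>) * exp (- (of_real r * cis \<theta>) * w)) \<le> exp (- e * r)" .
  qed
  then show ?thesis using e by blast
qed

text \<open>D is the set of those w for which the kernel times exp (- s * w) decays along both sides
  of the wedge. By \<open>off\<close> no pole lies on the wedge.\<close>

locale wedge_kernel =
  fixes K :: "complex \<Rightarrow> complex" and P M :: "complex set" and H c \<phi>p \<phi>m :: real and D :: "complex set"
  assumes \<phi>p: "pi / 2 \<le> \<phi>p" "\<phi>p < pi" and \<phi>m: "- pi < \<phi>m" "\<phi>m \<le> - pi / 2"
    and ps: "pole_sets P M H" and K_holo: "K holomorphic_on - (P \<union> M)"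
    and off: "\<And>s. s \<in> P \<union> M \<Longrightarrow> Re s \<noteq> wedge_re c \<phi>p \<phi>m (Im s)"
    and rate_p: "\<And>w. w \<in> D \<Longrightarrow> decay_rate K \<phi>p w" and rate_m: "\<And>w. w \<in> D \<Longrightarrow> decay_rate K \<phi>m w"
begin

abbreviation V :: "real \<Rightarrow> complex" where "V \<equiv> wedge c \<phi>p \<phi>m"

definition F :: "complex \<Rightarrow> complex \<Rightarrow> complex" where "F w s = K s * exp (- s * w)"

text \<open>Derivative of the wedge; at the corner t = 0 the value is a convention.\<close>

definition dV :: "real \<Rightarrow> complex" where "dV t = (if t \<le> 0 then - cis \<phi>m else cis \<phi>p)"

definition IV :: "complex \<Rightarrow> complex" where "IV w = integral UNIV (\<lambda>t. F w (V t) * dV t)"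

definition right_poles :: "complex set" where "right_poles = {s \<in> P \<union> M. wedge_re c \<phi>p \<phi>m (Im s) < Re s}"
definition left_poles :: "complex set" where "left_poles = {s \<in> P \<union> M. Re s < wedge_re c \<phi>p \<phi>m (Im s)}"

lemma poles_Un: "right_poles \<union> left_poles = P \<union> M"
  using off unfolding right_poles_def left_poles_def by fastforce

lemma F_holo: "F w holomorphic_on - (P \<union> M)"
  unfolding F_def[abs_def] by (intro holomorphic_intros K_holo)

lemma norm_dV: "cmod (dV t) = 1"
  by (simp add: dV_def)

lemma wedge_curve: "\<exists>T R L. separating_curve V \<phi>p \<phi>m (of_real c) (of_real c) T right_poles left_poles H R L"
  unfolding right_poles_def left_poles_def by (rule wedge_separating(1)[OF \<phi>p \<phi>m ps off])

lemma open_compl: "open (- (P \<union> M))"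
  using pole_sets.closed_poles[OF ps] by (simp add: closed_def)

lemma wedge_range: "range V \<subseteq> - (P \<union> M)"
proof -
  obtain T R L where "separating_curve V \<phi>p \<phi>m (of_real c) (of_real c) T right_poles left_poles H R L" using wedge_curve by blast
  from separating_curve.poles_avoid[OF this] show ?thesis unfolding poles_Un by blast
qed

lemma vector_derivative_wedge: "t \<noteq> 0 \<Longrightarrow> vector_derivative V (at t) = dV t"
proof -
  assume t: "t \<noteq> 0"
  have d: "((\<lambda>t. of_real c + of_real t * e) has_vector_derivative 1 * e) (at t)" for e :: complex
    by (auto intro!: derivative_eq_intros)
  show ?thesis
  proof (cases "t < 0")
    case True
    have "(V has_vector_derivative 1 * (- cis \<phi>m)) (at t)"
      by (rule has_vector_derivative_transform_within_open[of _ _ _ "{..<0}", OF d]) (use True in \<open>auto simp: wedge_def\<close>)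
    then show ?thesis using True by (simp add: dV_def vector_derivative_at)
  next
    case False
    have "(V has_vector_derivative 1 * (cis \<phi>p)) (at t)"
      by (rule has_vector_derivative_transform_within_open[of _ _ _ "{0<..}", OF d]) (use False t in \<open>auto simp: wedge_def\<close>)
    then show ?thesis using False t by (simp add: dV_def vector_derivative_at)
  qed
qed

lemma integrable: "(\<lambda>t. F w (V t) * dV t) integrable_on {a..b}"
proof -
  obtain T R L where "separating_curve V \<phi>p \<phi>m (of_real c) (of_real c) T right_poles left_poles H R L" using wedge_curve by blast
  then have "ray_curve V \<phi>p \<phi>m (of_real c) (of_real c) T" by (rule separating_curve.axioms(1))
  from ray_curve.curve_integrable_on[OF this F_holo open_compl wedge_range]
  show ?thesis by (rule integrable_spike_finite[of "{0}", rotated 2]) (auto simp: vector_derivative_wedge)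
qed

lemma continuous_FV: "continuous_on A (\<lambda>t. F w (V t))"
proof -
  have "V piecewise_C1_differentiable_on UNIV" unfolding wedge_def by (intro piecewise_C1_glue linear_piece) simp
  then have "continuous_on UNIV V" unfolding piecewise_C1_differentiable_on_def by (rule conjunct1)
  then have "continuous_on A V" by (rule continuous_on_subset) simp
  then show ?thesis
    by (rule continuous_on_compose2[OF holomorphic_on_imp_continuous_on[OF F_holo]]) (use wedge_range in blast)
qed

text \<open>Decay holds on both rays from some parameter on; on the compact rest continuity gives a
  bound, and a larger constant C covers all t at once.\<close>

lemma F_bound:
  assumes "w \<in> D"
  shows "\<exists>C \<kappa>. \<kappa> > 0 \<and> (\<forall>t. cmod (F w (V t)) \<le> C * exp (- \<kappa> * \<bar>t\<bar>))"
proof -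
  obtain \<kappa>1 where 1: "\<kappa>1 > 0" "decays (F w) \<phi>p \<kappa>1" using decay_rate_imp_decays[OF rate_p[OF assms]] unfolding F_def[abs_def] by blast
  obtain \<kappa>2 where 2: "\<kappa>2 > 0" "decays (F w) \<phi>m \<kappa>2" using decay_rate_imp_decays[OF rate_m[OF assms]] unfolding F_def[abs_def] by blast
  define C1 where "C1 = exp (\<kappa>1 * cmod (of_real c))"
  define C2 where "C2 = exp (\<kappa>2 * cmod (of_real c))"
  obtain T1 where T1: "\<And>t. t \<ge> T1 \<Longrightarrow> cmod (F w (of_real c + of_real t * cis \<phi>p)) \<le> C1 * exp (- \<kappa>1 * t)"
    using ray_decay[OF 1(2,1), of "of_real c"] unfolding eventually_at_top_linorder C1_def by blast
  obtain T2 where T2: "\<And>t. t \<ge> T2 \<Longrightarrow> cmod (F w (of_real c + of_real t * cis \<phi>m)) \<le> C2 * exp (- \<kappa>2 * t)"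
    using ray_decay[OF 2(2,1), of "of_real c"] unfolding eventually_at_top_linorder C2_def by blast
  define T where "T = max 1 (max T1 T2)"
  have "compact ((\<lambda>t. F w (V t)) ` {- T..T})" by (intro compact_continuous_image continuous_FV) simp
  then have "bounded ((\<lambda>t. F w (V t)) ` {- T..T})" by (rule compact_imp_bounded)
  then obtain B where B': "\<forall>x\<in>(\<lambda>t. F w (V t)) ` {- T..T}. cmod x \<le> B" unfolding bounded_iff ..
  have B: "cmod (F w (V t)) \<le> B" if "t \<in> {- T..T}" for t using B' imageI[OF that] by (rule bspec)
  define \<kappa> where "\<kappa> = min \<kappa>1 \<kappa>2"
  have \<kappa>: "\<kappa> > 0" "\<kappa> \<le> \<kappa>1" "\<kappa> \<le> \<kappa>2" using 1 2 by (auto simp: \<kappa>_def)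
  define C where "C = max (max C1 C2) (\<bar>B\<bar> * exp (\<kappa> * T))"
  have mono: "x * exp (- k * u) \<le> C * exp (- \<kappa> * u)" if "\<kappa> \<le> k" "0 \<le> x" "x \<le> C" "0 \<le> u" for k x u
    using that mult_right_mono[OF that(1), of u] by (intro mult_mono) auto
  have "cmod (F w (V t)) \<le> C * exp (- \<kappa> * \<bar>t\<bar>)" for t
  proof -
    consider "t \<in> {- T..T}" | "t > T" | "t < - T" by force
    then show ?thesis
    proof cases
      case 1
      have "cmod (F w (V t)) \<le> \<bar>B\<bar> * 1" using B[OF 1] by linarith
      also have "\<dots> \<le> \<bar>B\<bar> * (exp (\<kappa> * T) * exp (- \<kappa> * \<bar>t\<bar>))"
        using 1 \<kappa> unfolding exp_add[symmetric] by (intro mult_left_mono) (auto simp: abs_le_iff)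
      also have "\<dots> \<le> C * exp (- \<kappa> * \<bar>t\<bar>)" unfolding mult.assoc[symmetric] by (intro mult_right_mono) (auto simp: C_def)
      finally show ?thesis .
    next
      case 2
      then have t: "t \<ge> T1" "t > 0" by (auto simp: T_def)
      have "cmod (F w (V t)) \<le> C1 * exp (- \<kappa>1 * t)" using T1[OF t(1)] t(2) by (simp add: wedge_def)
      also have "\<dots> \<le> C * exp (- \<kappa> * t)" by (rule mono) (use t \<kappa> in \<open>auto simp: C_def C1_def\<close>)
      finally show ?thesis using t by simp
    next
      case 3
      then have t: "- t \<ge> T2" "t < 0" by (auto simp: T_def)
      have "cmod (F w (V t)) \<le> C2 * exp (- \<kappa>2 * (- t))" using T2[OF t(1)] t(2) by (simp add: wedge_def)
      also have "\<dots> \<le> C * exp (- \<kappa> * (- t))" by (rule mono) (use t \<kappa> in \<open>auto simp: C_def C2_def\<close>)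
      finally show ?thesis using t by simp
    qed
  qed
  then show ?thesis using \<kappa>(1) by blast
qed

text \<open>As the bound holds for all t, the estimate of the tails is valid from a = 0 on, where
  the truncated integral vanishes; this bounds the full integral.\<close>

lemma IV_rate:
  assumes \<kappa>: "\<kappa> > 0" and bd: "\<And>t. cmod (F w (V t)) \<le> C * exp (- \<kappa> * \<bar>t\<bar>)"
  shows "((\<lambda>t. F w (V t) * dV t) has_integral IV w) UNIV"
    "\<And>a. a \<ge> 0 \<Longrightarrow> cmod (IV w - integral {- a..a} (\<lambda>t. F w (V t) * dV t)) \<le> 2 * (\<bar>C\<bar> / \<kappa>) * exp (- \<kappa> * a)"
    "cmod (IV w) \<le> 2 * (\<bar>C\<bar> / \<kappa>)"
proof -
  have "\<exists>I. ((\<lambda>t. F w (V t) * dV t) has_integral I) UNIV \<and> (\<forall>a\<ge>max 0 0. cmod (I - integral {- a..a} (\<lambda>t. F w (V t) * dV t)) \<le> 2 * (\<bar>C\<bar> / \<kappa>) * exp (- \<kappa> * a)) \<and>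
     (\<forall>e>0. \<exists>B. \<forall>t1\<ge>B. \<forall>t2\<ge>B. cmod (integral {- t2..t1} (\<lambda>t. F w (V t) * dV t) - I) < e)"
    using bd by (intro has_integral_UNIV_exp_rate integrable \<kappa>) (simp add: norm_mult norm_dV)
  then obtain I where I: "((\<lambda>t. F w (V t) * dV t) has_integral I) UNIV"
    "\<And>a. a \<ge> 0 \<Longrightarrow> cmod (I - integral {- a..a} (\<lambda>t. F w (V t) * dV t)) \<le> 2 * (\<bar>C\<bar> / \<kappa>) * exp (- \<kappa> * a)" by auto
  have "I = IV w" unfolding IV_def using I(1) by (rule integral_unique[symmetric])
  then show "((\<lambda>t. F w (V t) * dV t) has_integral IV w) UNIV"
    and r: "\<And>a. a \<ge> 0 \<Longrightarrow> cmod (IV w - integral {- a..a} (\<lambda>t. F w (V t) * dV t)) \<le> 2 * (\<bar>C\<bar> / \<kappa>) * exp (- \<kappa> * a)" using I by auto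
  show "cmod (IV w) \<le> 2 * (\<bar>C\<bar> / \<kappa>)" using r[of 0] by simp
qed

lemma finite_exchange: "finite (M - left_poles)" "finite (left_poles - M)"
proof -
  obtain T R L where "separating_curve V \<phi>p \<phi>m (of_real c) (of_real c) T right_poles left_poles H R L" using wedge_curve by blast
  then have "pole_sets right_poles left_poles H" by (rule separating_curve.axioms(2))
  then show "finite (M - left_poles)" "finite (left_poles - M)"
    using pole_sets_exchange[OF ps _ poles_Un[symmetric]] pole_sets_exchange[OF _ ps poles_Un] by blast+
qed

text \<open>All contours give the integral over the wedge, up to the residues at the poles in between.\<close>
lemma contour_eq_wedge:
  assumes con: "MB_contour P M \<theta>p \<theta>m \<gamma>"
    and rp: "\<And>\<psi>. \<psi> \<in> closed_segment \<phi>p \<theta>p \<Longrightarrow> decay_rate K \<psi> w"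
    and rm: "\<And>\<psi>. \<psi> \<in> closed_segment \<phi>m \<theta>m \<Longrightarrow> decay_rate K \<psi> w"
    and w: "w \<in> D"
  shows "((\<lambda>t. F w (\<gamma> t) * vector_derivative \<gamma> (at t)) has_integral
     (IV w + 2 * of_real pi * \<i> * (sum (residue (F w)) (M - left_poles) - sum (residue (F w)) (left_poles - M)))) UNIV"
proof -
  obtain T R L where S2: "separating_curve V \<phi>p \<phi>m (of_real c) (of_real c) T right_poles left_poles H R L" using wedge_curve by blast
  obtain cp cm T' R' L' where S1: "separating_curve \<gamma> \<theta>p \<theta>m cp cm T' P M H R' L'"
    using MB_contour_separating[OF con ps] by (elim exE)
  have dp: "\<exists>\<kappa>>0. decays (F w) \<psi> \<kappa>" if "\<psi> \<in> closed_segment \<theta>p \<phi>p" for \<psi>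
    unfolding F_def[abs_def] using that closed_segment_commute[of \<theta>p \<phi>p] by (intro decay_rate_imp_decays rp) simp
  have dm: "\<exists>\<kappa>>0. decays (F w) \<psi> \<kappa>" if "\<psi> \<in> closed_segment \<theta>m \<phi>m" for \<psi>
    unfolding F_def[abs_def] using that closed_segment_commute[of \<theta>m \<phi>m] by (intro decay_rate_imp_decays rm) simp
  have ex: "\<exists>I1 I2. ((\<lambda>t. F w (\<gamma> t) * vector_derivative \<gamma> (at t)) has_integral I1) UNIV \<and>
     ((\<lambda>t. F w (V t) * vector_derivative V (at t)) has_integral I2) UNIV \<and>
     I1 - I2 = 2 * of_real pi * \<i> * (sum (residue (F w)) (M - left_poles) - sum (residue (F w)) (left_poles - M))"
    by (rule separating_curves_diff[OF S1 S2 poles_Un[symmetric] F_holo dp dm])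
  then obtain I1 I2 where I: "((\<lambda>t. F w (\<gamma> t) * vector_derivative \<gamma> (at t)) has_integral I1) UNIV"
     "((\<lambda>t. F w (V t) * vector_derivative V (at t)) has_integral I2) UNIV"
     "I1 - I2 = 2 * of_real pi * \<i> * (sum (residue (F w)) (M - left_poles) - sum (residue (F w)) (left_poles - M))"
    by (elim exE conjE)
  have "((\<lambda>t. F w (V t) * dV t) has_integral I2) UNIV"
    by (rule has_integral_spike_finite[OF _ _ I(2), of "{0}"]) (auto simp: vector_derivative_wedge)
  then have "I2 = IV w" unfolding IV_def by (rule integral_unique[symmetric])
  then have "I1 = IV w + 2 * of_real pi * \<i> * (sum (residue (F w)) (M - left_poles) - sum (residue (F w)) (left_poles - M))"
    using I(3) by (simp only: diff_eq_eq add.commute)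
  then show ?thesis using I(1) by (simp only:)
qed

text \<open>The truncated integrals are entire in w, and near each point of D they converge
  uniformly.\<close>

lemma IV_holomorphic:
  assumes D: "open D"
  shows "IV holomorphic_on D"
proof (rule holomorphic_uniform_sequence[OF D, of "\<lambda>n w. integral {- real n..real n} (\<lambda>t. F w (V t) * dV t)"])
  fix n :: nat
  \<comment> \<open>The derivative of the wedge jumps at 0. On either side it is a constant e, and
    the Leibniz rule applies to a continuous integrand.\<close>
  have half: "(\<lambda>w. integral {u..v} (\<lambda>t. F w (V t) * e)) holomorphic_on UNIV" for u v e
  proof -
    have cV: "continuous_on A V" for A
      using continuous_on_subset[of UNIV V] piecewise_C1_glue[OF linear_piece[of "of_real c" "- cis \<phi>m"] linear_piece[of "of_real c" "cis \<phi>p"], of 0]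
      unfolding wedge_def piecewise_C1_differentiable_on_def by simp
    have cK: "continuous_on A (\<lambda>t. K (V t))" for A
      by (rule continuous_on_compose2[OF holomorphic_on_imp_continuous_on[OF K_holo] cV]) (use wedge_range in blast)
    have "(\<lambda>w. integral (cbox u v) (\<lambda>t. F w (V t) * e)) holomorphic_on UNIV"
    proof (rule leibniz_rule_holomorphic[where fx = "\<lambda>w t. K (V t) * (exp (- V t * w) * (- V t)) * e"])
      show "((\<lambda>w. F w (V t) * e) has_field_derivative K (V t) * (exp (- V t * w) * (- V t)) * e) (at w within UNIV)" for w t
        unfolding F_def by (auto intro!: derivative_eq_intros)
      show "(\<lambda>t. F w (V t) * e) integrable_on cbox u v" for w
        by (intro integrable_continuous continuous_intros continuous_FV)
      have s: "continuous_on (UNIV \<times> cbox u v) (\<lambda>x. V (snd x))" "continuous_on (UNIV \<times> cbox u v) (\<lambda>x. K (V (snd x)))"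
        by (rule continuous_on_compose2[OF cV[of UNIV]], (intro continuous_intros | simp)+)
           (rule continuous_on_compose2[OF cK[of UNIV]], (intro continuous_intros | simp)+)
      show "continuous_on (UNIV \<times> cbox u v) (\<lambda>(w, t). K (V t) * (exp (- V t * w) * (- V t)) * e)"
        unfolding case_prod_beta by (intro continuous_intros s)
    qed simp
    then show ?thesis by simp
  qed
  have "integral {- real n..real n} (\<lambda>t. F w (V t) * dV t) = integral {- real n..0} (\<lambda>t. F w (V t) * (- cis \<phi>m)) + integral {0..real n} (\<lambda>t. F w (V t) * cis \<phi>p)" for w
  proof -
    have "integral {- real n..real n} (\<lambda>t. F w (V t) * dV t) = integral {- real n..0} (\<lambda>t. F w (V t) * dV t) + integral {0..real n} (\<lambda>t. F w (V t) * dV t)"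
      by (intro Henstock_Kurzweil_Integration.integral_combine[symmetric] integrable) auto
    moreover have "integral {- real n..0} (\<lambda>t. F w (V t) * dV t) = integral {- real n..0} (\<lambda>t. F w (V t) * (- cis \<phi>m))"
      by (intro integral_cong) (simp add: dV_def)
    moreover have "integral {0..real n} (\<lambda>t. F w (V t) * dV t) = integral {0..real n} (\<lambda>t. F w (V t) * cis \<phi>p)"
      by (rule integral_spike[of "{0}"]) (auto simp: dV_def)
    ultimately show ?thesis by (simp only:)
  qed
  then show "(\<lambda>w. integral {- real n..real n} (\<lambda>t. F w (V t) * dV t)) holomorphic_on D"
    by (simp only:) (intro holomorphic_on_add holomorphic_on_subset[OF half] subset_UNIV)
next
  fix w0 assume w0: "w0 \<in> D"
  obtain C \<kappa> where C: "\<kappa> > 0" "\<And>t. cmod (F w0 (V t)) \<le> C * exp (- \<kappa> * \<bar>t\<bar>)" using F_bound[OF w0] by blast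
  obtain d0 where d0: "d0 > 0" "cball w0 d0 \<subseteq> D" using D w0 unfolding open_contains_cball by blast
  \<comment> \<open>Moving w by at most \<kappa> / 2 costs a factor exp (|V t| \<kappa> / 2); half
    of the rate \<kappa> is left.\<close>
  define d where "d = min d0 (\<kappa> / 2)"
  have d: "d > 0" "d \<le> \<kappa> / 2" "d \<le> d0" using C(1) d0(1) by (auto simp: d_def)
  define C' where "C' = \<bar>C\<bar> * exp (\<kappa> / 2 * \<bar>c\<bar>)"
  have bd: "cmod (F w (V t)) \<le> C' * exp (- (\<kappa> / 2) * \<bar>t\<bar>)" if "w \<in> cball w0 d" for w t
  proof -
    have "cmod (V t) \<le> \<bar>c\<bar> + \<bar>t\<bar>"
      unfolding wedge_def using norm_triangle_ineq[of "of_real c" "of_real t * (- cis \<phi>m)"] norm_triangle_ineq[of "of_real c" "of_real t * cis \<phi>p"]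
      by (auto simp: norm_mult)
    moreover have "cmod (w - w0) \<le> \<kappa> / 2" using that d by (simp add: dist_norm norm_minus_commute)
    ultimately have le: "cmod (V t) * cmod (w - w0) \<le> (\<bar>c\<bar> + \<bar>t\<bar>) * (\<kappa> / 2)" by (intro mult_mono) auto
    have "F w (V t) = F w0 (V t) * exp (- V t * (w - w0))" unfolding F_def by (simp add: exp_add[symmetric] algebra_simps)
    then have "cmod (F w (V t)) = cmod (F w0 (V t)) * cmod (exp (- V t * (w - w0)))" by (simp only: norm_mult)
    also have "\<dots> \<le> (\<bar>C\<bar> * exp (- \<kappa> * \<bar>t\<bar>)) * exp ((\<bar>c\<bar> + \<bar>t\<bar>) * (\<kappa> / 2))"
    proof (intro mult_mono)
      show "cmod (F w0 (V t)) \<le> \<bar>C\<bar> * exp (- \<kappa> * \<bar>t\<bar>)" by (rule order_trans[OF C(2)]) (intro mult_right_mono, auto)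
      have "cmod (exp (- V t * (w - w0))) \<le> exp (cmod (- V t * (w - w0)))" by (rule norm_exp)
      also have "\<dots> \<le> exp ((\<bar>c\<bar> + \<bar>t\<bar>) * (\<kappa> / 2))" using le by (simp add: norm_mult)
      finally show "cmod (exp (- V t * (w - w0))) \<le> exp ((\<bar>c\<bar> + \<bar>t\<bar>) * (\<kappa> / 2))" .
    qed auto
    also have "\<dots> = C' * exp (- (\<kappa> / 2) * \<bar>t\<bar>)" unfolding C'_def mult.assoc exp_add[symmetric]
      by (intro arg_cong[of _ _ "\<lambda>z. \<bar>C\<bar> * exp z"]) (simp add: field_simps)
    finally show ?thesis .
  qed
  show "\<exists>d>0. cball w0 d \<subseteq> D \<and> uniform_limit (cball w0 d) (\<lambda>n w. integral {- real n..real n} (\<lambda>t. F w (V t) * dV t)) IV sequentially"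
  proof (intro exI[of _ d] conjI)
    show "d > 0" by (rule d)
    show "cball w0 d \<subseteq> D" using d0(2) d(3) by (meson order_trans subset_cball)
    show "uniform_limit (cball w0 d) (\<lambda>n w. integral {- real n..real n} (\<lambda>t. F w (V t) * dV t)) IV sequentially"
    proof (rule uniform_limitI)
      fix e :: real assume e: "e > 0"
      have "(\<lambda>n. 2 * (\<bar>C'\<bar> / (\<kappa> / 2)) * exp (- (\<kappa> / 2) * real n)) \<longlonglongrightarrow> 0" using C(1) by real_asymp
      then have "\<forall>\<^sub>F n in sequentially. 2 * (\<bar>C'\<bar> / (\<kappa> / 2)) * exp (- (\<kappa> / 2) * real n) < e" by (rule order_tendstoD(2)) (rule e)
      then show "\<forall>\<^sub>F n in sequentially. \<forall>w\<in>cball w0 d. dist (integral {- real n..real n} (\<lambda>t. F w (V t) * dV t)) (IV w) < e"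
      proof eventually_elim
        case (elim n)
        show ?case
        proof
          fix w assume "w \<in> cball w0 d"
          from IV_rate(2)[of "\<kappa> / 2" w C', OF _ bd[OF this], of "real n"]
          show "dist (integral {- real n..real n} (\<lambda>t. F w (V t) * dV t)) (IV w) < e"
            using C(1) elim unfolding dist_norm norm_minus_commute[of _ "IV w"] by simp
        qed
      qed
    qed
  qed
qed

text \<open>The points w1 and w2 are the upper and lower corners of the region at Re w = - 1. On the
  upper side of the wedge the sine is nonnegative, so a larger Im w makes exp (- s * w) larger and
  w1 dominates; on the lower side w2 does. Since the cosines are nonpositive, a smaller Re w only
  helps, apart from the contribution exp (- c Re w) of the apex.\<close>

lemma IV_bound:
  assumes w12: "w1 \<in> D" "w2 \<in> D" "Re w1 = - 1" "Re w2 = - 1"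
  shows "\<exists>C. \<forall>w. Re w \<le> - 1 \<longrightarrow> Im w2 \<le> Im w \<longrightarrow> Im w \<le> Im w1 \<longrightarrow> cmod (IV w) \<le> C * exp (- c * Re w)"
proof -
  obtain C1 \<kappa>1 where 1: "\<kappa>1 > 0" "\<And>t. cmod (F w1 (V t)) \<le> C1 * exp (- \<kappa>1 * \<bar>t\<bar>)" using F_bound[OF w12(1)] by blast
  obtain C2 \<kappa>2 where 2: "\<kappa>2 > 0" "\<And>t. cmod (F w2 (V t)) \<le> C2 * exp (- \<kappa>2 * \<bar>t\<bar>)" using F_bound[OF w12(2)] by blast
  define \<kappa> where "\<kappa> = min \<kappa>1 \<kappa>2"
  define C where "C = max \<bar>C1\<bar> \<bar>C2\<bar>"
  have \<kappa>: "\<kappa> > 0" "\<kappa> \<le> \<kappa>1" "\<kappa> \<le> \<kappa>2" using 1 2 by (auto simp: \<kappa>_def)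
  have mono: "x * exp (- k * \<bar>t\<bar>) \<le> C * exp (- \<kappa> * \<bar>t\<bar>)" if "\<kappa> \<le> k" "\<bar>x\<bar> \<le> C" for k x t
  proof -
    have "x * exp (- k * \<bar>t\<bar>) \<le> \<bar>x\<bar> * exp (- k * \<bar>t\<bar>)" by (intro mult_right_mono) auto
    also have "\<dots> \<le> C * exp (- \<kappa> * \<bar>t\<bar>)" using that mult_right_mono[OF that(1), of "\<bar>t\<bar>"] by (intro mult_mono) auto
    finally show ?thesis .
  qed
  have sp: "sin \<phi>p \<ge> 0" and cp: "cos \<phi>p \<le> 0" using \<phi>p pi_gt_zero cos_ge_zero[of "pi - \<phi>p"] by (auto intro!: sin_ge_zero)
  have sm: "sin \<phi>m \<le> 0" and cm: "cos \<phi>m \<le> 0"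
    using sin_ge_zero[of "- \<phi>m"] \<phi>m pi_gt_zero cos_ge_zero[of "pi + \<phi>m"] by (auto simp: cos_add)
  have "cmod (IV w) \<le> 2 * (C * exp (- c) / \<kappa>) * exp (- c * Re w)" if w: "Re w \<le> - 1" "Im w2 \<le> Im w" "Im w \<le> Im w1" for w
  proof -
    \<comment> \<open>The factor exp (- c - c Re w) is the quotient of the apex contributions at w
      and at w', where Re w' = - 1.\<close>
    have ex: "cmod (exp (- (of_real c + of_real r * cis \<theta>) * w)) \<le> exp (- c - c * Re w) * cmod (exp (- (of_real c + of_real r * cis \<theta>) * w'))"
      if "r \<ge> 0" "cos \<theta> \<le> 0" "sin \<theta> * Im w \<le> sin \<theta> * Im w'" "Re w' = - 1" for r \<theta> w'
    proof -
      have "- cos \<theta> * Re w \<le> - cos \<theta> * Re w'" using that w by (intro mult_left_mono) auto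
      then have "r * (- cos \<theta> * Re w + sin \<theta> * Im w) \<le> r * (- cos \<theta> * Re w' + sin \<theta> * Im w')" using that by (intro mult_left_mono) auto
      then show ?thesis unfolding norm_exp_ray exp_add[symmetric] using that(4) by simp
    qed
    have bd: "cmod (F w (V t)) \<le> (C * exp (- c - c * Re w)) * exp (- \<kappa> * \<bar>t\<bar>)" for t
    proof (cases "t \<le> 0")
      case True
      have V: "V t = of_real c + of_real (- t) * cis \<phi>m" using True by (simp add: wedge_def)
      have "cmod (exp (- V t * w)) \<le> exp (- c - c * Re w) * cmod (exp (- V t * w2))"
        unfolding V using True cm w12 sm w by (intro ex) (auto intro: mult_left_mono_neg)
      then have "cmod (F w (V t)) \<le> cmod (K (V t)) * (exp (- c - c * Re w) * cmod (exp (- V t * w2)))"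
        unfolding F_def norm_mult by (rule mult_left_mono) simp
      also have "\<dots> = exp (- c - c * Re w) * cmod (F w2 (V t))" unfolding F_def norm_mult by (simp only: mult_ac)
      also have "\<dots> \<le> exp (- c - c * Re w) * (C * exp (- \<kappa> * \<bar>t\<bar>))"
        by (intro mult_left_mono order_trans[OF 2(2)] mono) (use \<kappa> in \<open>auto simp: C_def\<close>)
      finally show ?thesis by (simp only: mult_ac)
    next
      case False
      have V: "V t = of_real c + of_real t * cis \<phi>p" using False by (simp add: wedge_def)
      have "cmod (exp (- V t * w)) \<le> exp (- c - c * Re w) * cmod (exp (- V t * w1))"
        unfolding V using False cp w12 sp w by (intro ex) (auto intro: mult_left_mono)
      then have "cmod (F w (V t)) \<le> cmod (K (V t)) * (exp (- c - c * Re w) * cmod (exp (- V t * w1)))"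
        unfolding F_def norm_mult by (rule mult_left_mono) simp
      also have "\<dots> = exp (- c - c * Re w) * cmod (F w1 (V t))" unfolding F_def norm_mult by (simp only: mult_ac)
      also have "\<dots> \<le> exp (- c - c * Re w) * (C * exp (- \<kappa> * \<bar>t\<bar>))"
        by (intro mult_left_mono order_trans[OF 1(2)] mono) (use \<kappa> in \<open>auto simp: C_def\<close>)
      finally show ?thesis by (simp only: mult_ac)
    qed
    have C0: "C \<ge> 0" by (simp add: C_def)
    have "cmod (IV w) \<le> 2 * (\<bar>C * exp (- c - c * Re w)\<bar> / \<kappa>)" by (rule IV_rate(3)[OF \<kappa>(1) bd])
    also have "\<bar>C * exp (- c - c * Re w)\<bar> = C * exp (- c) * exp (- c * Re w)" using C0 by (simp add: exp_add[symmetric] abs_mult)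
    also have "2 * (C * exp (- c) * exp (- c * Re w) / \<kappa>) = 2 * (C * exp (- c) / \<kappa>) * exp (- c * Re w)" by simp
    finally show ?thesis .
  qed
  then show ?thesis by (intro exI[of _ "2 * (C * exp (- c) / \<kappa>)"] allI impI)
qed

end

section \<open>Choice of the apex and the asymptotic expansion\<close>

text \<open>Left poles with real part at least l - 1 are finite in number, so below l there is a gap
  free of their real parts. Moving c translates the wedge horizontally, hence each pole excludes
  just one value of c, and the gap is uncountable.\<close>

lemma generic_abscissa:
  assumes ps: "pole_sets P M H"
  obtains c where "c < l" "\<And>s. s \<in> M \<Longrightarrow> Re s < l \<Longrightarrow> Re s < c" "\<And>s. s \<in> P \<union> M \<Longrightarrow> Re s \<noteq> wedge_re c \<phi>p \<phi>m (Im s)"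
proof -
  \<comment> \<open>The element l - 1 keeps E nonempty and takes care of all left poles further to
    the left.\<close>
  define E where "E = insert (l - 1) (Re ` {s\<in>M. l - 1 \<le> Re s} \<inter> {..<l})"
  have E: "finite E" "E \<noteq> {}" unfolding E_def using pole_sets.finite_right[OF ps, of "l - 1"] by auto
  have "Max E < l" using E by (subst Max_less_iff) (auto simp: E_def)
  then have "uncountable {Max E<..<l}" by (simp add: uncountable_open_interval)
  moreover define Z where "Z = (\<lambda>s. Re s - wedge_re 0 \<phi>p \<phi>m (Im s)) ` (P \<union> M)"
  have "countable Z" unfolding Z_def by (intro countable_image pole_sets.countable_poles[OF ps])
  ultimately have "\<not> {Max E<..<l} \<subseteq> Z" using countable_subset by blast
  then obtain c where c: "c \<in> {Max E<..<l}" "c \<notin> Z" by blast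
  show ?thesis
  proof (rule that[of c])
    show "c < l" using c by simp
    show "Re s < c" if "s \<in> M" "Re s < l" for s
    proof (cases "l - 1 \<le> Re s")
      case True
      then have "Re s \<le> Max E" using that E by (intro Max_ge) (auto simp: E_def)
      then show ?thesis using c by simp
    next
      case False
      moreover have "l - 1 \<le> Max E" using E by (intro Max_ge) (auto simp: E_def)
      ultimately show ?thesis using c by simp
    qed
    show "Re s \<noteq> wedge_re c \<phi>p \<phi>m (Im s)" if "s \<in> P \<union> M" for s
    proof
      assume "Re s = wedge_re c \<phi>p \<phi>m (Im s)"
      then have "c = Re s - wedge_re 0 \<phi>p \<phi>m (Im s)" by (simp add: wedge_re_def)
      then have "c \<in> Z" unfolding Z_def using that by (rule image_eqI)
      then show False using c(2) by blast
    qed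
  qed
qed

text \<open>The gap c - Re s > 0 provides an additional exponential decay as Re w tends to minus
  infinity, which absorbs every power of |w|. The imaginary part stays bounded and only affects the
  constant.\<close>

lemma norm_exp_mult_power_bound:
  assumes "Re s < c" "B \<ge> 0"
  shows "\<exists>C. \<forall>w. Re w \<le> - 1 \<longrightarrow> \<bar>Im w\<bar> \<le> B \<longrightarrow> cmod (exp (- s * w) * w ^ i) \<le> C * exp (- c * Re w)"
proof -
  define d where "d = c - Re s"
  have d: "d > 0" using assms by (simp add: d_def)
  \<comment> \<open>With i + 1 in place of i the number k is positive for i = 0 too, and i / k stays
    below d.\<close>
  define k where "k = real (Suc i) / d"
  have k: "k > 0" using d by (simp add: k_def)
  have pw: "y ^ i \<le> k ^ i * exp (d * y)" if "y \<ge> 0" for y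
  proof -
    have "y / k \<le> exp (y / k)" using exp_ge_add_one_self[of "y / k"] by linarith
    then have "y \<le> k * exp (y / k)" using k by (simp add: field_simps)
    then have "y ^ i \<le> (k * exp (y / k)) ^ i" using that by (rule power_mono)
    also have "\<dots> = k ^ i * exp (real i * (y / k))" by (simp only: power_mult_distrib exp_of_nat_mult)
    also have "real i * (y / k) = d * y * (real i / real (Suc i))" unfolding k_def by simp
    also have "k ^ i * exp (d * y * (real i / real (Suc i))) \<le> k ^ i * exp (d * y)"
      using that d k mult_left_mono[of "real i / real (Suc i)" 1 "d * y"] by (intro mult_left_mono) auto
    finally show ?thesis .
  qed
  have "cmod (exp (- s * w) * w ^ i) \<le> (k ^ i * exp (\<bar>Im s\<bar> * B + d * B)) * exp (- c * Re w)" if w: "Re w \<le> - 1" "\<bar>Im w\<bar> \<le> B" for w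
  proof -
    have "Im s * Im w \<le> \<bar>Im s\<bar> * B" using abs_ge_self[of "Im s * Im w"] mult_left_mono[OF w(2), of "\<bar>Im s\<bar>"] by (simp add: abs_mult)
    then have 1: "cmod (exp (- s * w)) \<le> exp (- Re s * Re w + \<bar>Im s\<bar> * B)" by simp
    have "cmod w \<le> - Re w + B" using cmod_le[of w] w by linarith
    then have "d * cmod w \<le> d * (- Re w + B)" using d by (intro mult_left_mono) auto
    then have "k ^ i * exp (d * cmod w) \<le> k ^ i * exp (d * (- Re w + B))" using k by (intro mult_left_mono) auto
    then have 2: "cmod (w ^ i) \<le> k ^ i * exp (d * (- Re w + B))"
      unfolding norm_power by (rule order_trans[OF pw[OF norm_ge_zero]])
    have "cmod (exp (- s * w) * w ^ i) \<le> exp (- Re s * Re w + \<bar>Im s\<bar> * B) * (k ^ i * exp (d * (- Re w + B)))"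
      unfolding norm_mult by (intro mult_mono 1 2) auto
    also have "\<dots> = k ^ i * exp ((- Re s * Re w + \<bar>Im s\<bar> * B) + d * (- Re w + B))" by (simp only: exp_add mult_ac)
    also have "(- Re s * Re w + \<bar>Im s\<bar> * B) + d * (- Re w + B) = (\<bar>Im s\<bar> * B + d * B) + - c * Re w"
      unfolding d_def by (simp add: algebra_simps)
    finally show ?thesis by (simp only: exp_add mult_ac)
  qed
  then show ?thesis by (intro exI[of _ "k ^ i * exp (\<bar>Im s\<bar> * B + d * B)"] allI impI)
qed

lemma sum_bound_exists:
  fixes f :: "'a \<Rightarrow> 'b \<Rightarrow> complex" and g :: "'b \<Rightarrow> real"
  assumes "\<And>x. x \<in> Q \<Longrightarrow> \<exists>C. \<forall>w\<in>W. cmod (f x w) \<le> C * g w"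
  shows "\<exists>C. \<forall>w\<in>W. cmod (\<Sum>x\<in>Q. f x w) \<le> C * g w"
proof -
  have "\<forall>x\<in>Q. \<exists>C. \<forall>w\<in>W. cmod (f x w) \<le> C * g w" using assms by simp
  from bchoice[OF this] obtain C where C: "\<forall>x\<in>Q. \<forall>w\<in>W. cmod (f x w) \<le> C x * g w" by (elim exE)
  have "cmod (\<Sum>x\<in>Q. f x w) \<le> (\<Sum>x\<in>Q. C x) * g w" if "w \<in> W" for w
    unfolding sum_distrib_right using C that by (intro sum_norm_le) simp
  then show ?thesis by (intro exI[of _ "\<Sum>x\<in>Q. C x"] ballI)
qed

lemma MB_Lambda_minus_Re_le:
  assumes "\<tau> > 0" "s \<in> MB_Lambda_minus m q b \<tau>"
  shows "Re s \<le> MB_lambda_sharp m q b \<tau>"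
proof -
  obtain j l k where s: "s = b j - of_nat l * of_real \<tau> - of_nat k" "j \<in> {m+1..q}" "l \<ge> 1" "k \<ge> 1"
    using assms(2) unfolding MB_Lambda_minus_def by blast
  have "Re (b j) \<le> Max ((\<lambda>j. Re (b j)) ` {m+1..q})" using s(2) by (intro Max_ge) auto
  moreover have "1 * \<tau> \<le> real l * \<tau>" using s assms(1) by (intro mult_right_mono) auto
  moreover have "Re s = Re (b j) - real l * \<tau> - real k" "real k \<ge> 1" using s(1,4) by simp_all
  ultimately show ?thesis unfolding MB_lambda_sharp_def by linarith
qed

lemma MB_domain_geometry:
  assumes "\<tau> > 0" and "\<not> MB_in_case Case_VII m n p q a b \<alpha>"
  shows "MB_domain m n p q a b \<tau> \<alpha> = {w. Im w \<in> MB_args m n p q a b \<tau> \<alpha>}"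
    "open (MB_domain m n p q a b \<tau> \<alpha>)" "connected (MB_domain m n p q a b \<tau> \<alpha>)"
    "of_real x \<in> MB_domain m n p q a b \<tau> \<alpha>"
proof -
  show d: "MB_domain m n p q a b \<tau> \<alpha> = {w. Im w \<in> MB_args m n p q a b \<tau> \<alpha>}"
    using assms(2) unfolding MB_domain_def by (simp only: if_False)
  define B where "B = - (pi * Re (MB_nu p q a b) / (2 * \<tau>))"
  have dom: "MB_domain m n p q a b \<tau> \<alpha> = UNIV \<or> MB_domain m n p q a b \<tau> \<alpha> = {w. Im w < B} \<inter> {w. Im w > - B} \<and> B > 0"
  proof (cases "MB_in_case Case_VI m n p q a b \<alpha>")
    case True
    then have "Re (MB_nu p q a b) < 0" unfolding MB_in_case.simps by (elim conjE)
    then have "B > 0" using assms(1) by (simp add: B_def mult_pos_neg divide_neg_pos)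
    moreover have "MB_args m n p q a b \<tau> \<alpha> = {\<phi>. \<bar>\<phi>\<bar> < B}"
      unfolding MB_args_def B_def using assms(2) True by (simp only: if_False if_True)
    moreover have "{w. Im w \<in> {\<phi>. \<bar>\<phi>\<bar> < B}} = {w. Im w < B} \<inter> {w. Im w > - B}" by (rule set_eqI) (simp, linarith)
    ultimately show ?thesis unfolding d by (simp only: simp_thms)
  next
    case False
    then have "MB_args m n p q a b \<tau> \<alpha> = UNIV" unfolding MB_args_def using assms(2) by (simp only: if_False)
    then show ?thesis unfolding d by simp
  qed
  have X: "open X \<and> connected X \<and> of_real x \<in> X" if "X = UNIV \<or> X = {w. Im w < B} \<inter> {w. Im w > - B} \<and> B > 0" for X :: "complex set"
    using that
  proof (elim disjE conjE)
    assume "X = {w. Im w < B} \<inter> {w. Im w > - B}" "B > 0"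
    then show ?thesis
      by (simp add: open_Int open_halfspace_Im_lt open_halfspace_Im_gt convex_connected convex_Int convex_halfspace_Im_lt convex_halfspace_Im_gt)
  qed (simp add: connected_UNIV)
  from X[OF dom] show "open (MB_domain m n p q a b \<tau> \<alpha>)" "connected (MB_domain m n p q a b \<tau> \<alpha>)" "of_real x \<in> MB_domain m n p q a b \<tau> \<alpha>"
    by simp_all
qed

text \<open>The error is an additive term, uniform for arguments in the compact set S; \<delta> and
  the coefficients serve all S. The implied constant comes from the extreme arguments in S, at which
  the wedge integral is dominated. For a pole that cancels against a zero of the numerator the inner
  sum is empty.\<close>

theorem theorem4:
  fixes m n p q :: nat and a b :: "nat \<Rightarrow> complex" and \<tau> :: real and \<alpha> :: complex
  assumes "\<tau> > 0" and "m < q" and "n \<le> p"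
    and "MB_admissible m n p q a b \<tau> \<alpha>"
    and "\<exists>z>0. \<forall>\<^sub>F \<epsilon> in at_right 0. \<exists>\<theta>p \<theta>m.
           MB_table m n p q a b \<alpha> z \<epsilon> \<theta>p \<theta>m \<and> \<theta>p \<ge> pi / 2 \<and> \<theta>m \<le> - pi / 2"
  shows "\<exists>\<delta>>0. \<exists>A :: complex \<Rightarrow> nat \<Rightarrow> complex.
    \<forall>S. compact S \<and> S \<subseteq> MB_args m n p q a b \<tau> \<alpha> \<longrightarrow>
      (\<lambda>w. MB_K m n p q a b \<tau> \<alpha> w
            - (\<Sum>s\<in>MB_Lambda_sharp m q b \<tau>.
                 exp (- s * w) * (\<Sum>i<pole_mult (MB_integrand m n p q a b \<tau>) s. A s i * w ^ i)))
        \<in> O[to_zero_in_sector S](\<lambda>w.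
              of_real (exp (Re w) powr (- MB_lambda_sharp m q b \<tau> + \<delta>)))"
proof -
  note \<tau> = assms(1)
  define P where "P = MB_Lambda_plus n p a \<tau>"
  define M where "M = MB_Lambda_minus m q b \<tau>"
  define K where "K = MB_kernel m n p q a b \<tau> \<alpha>"
  define D where "D = MB_domain m n p q a b \<tau> \<alpha>"
  define f where "f = MB_integrand m n p q a b \<tau>"
  define l where "l = MB_lambda_sharp m q b \<tau>"
  define N where "N = MB_Lambda_sharp m q b \<tau>"
  define H where "H = (\<Sum>j\<in>{n+1..p}. \<bar>Im (a j)\<bar>) + (\<Sum>j\<in>{m+1..q}. \<bar>Im (b j)\<bar>)"
  note adm = assms(4)[unfolded MB_admissible_def]
  note disj = conjunct1[OF adm] and ex = conjunct2[OF adm]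
  have ps: "pole_sets P M H" unfolding P_def M_def H_def by (rule MB_pole_sets[OF \<tau> disj])
  have "\<exists>\<phi>p \<phi>m. (pi / 2 \<le> \<phi>p \<and> \<phi>p < pi \<and> - pi < \<phi>m \<and> \<phi>m \<le> - pi / 2) \<and>
     (\<forall>w\<in>D. decay_rate K \<phi>p w) \<and> (\<forall>w\<in>D. decay_rate K \<phi>m w) \<and>
     (\<forall>x. complex_of_real x \<in> D \<longrightarrow> (\<forall>\<^sub>F \<epsilon> in at_right 0. (\<exists>\<theta>p \<theta>m. MB_table m n p q a b \<alpha> (exp x) \<epsilon> \<theta>p \<theta>m) \<and>
         (\<forall>\<theta>p \<theta>m. MB_table m n p q a b \<alpha> (exp x) \<epsilon> \<theta>p \<theta>m \<longrightarrow>
           \<theta>p \<in> {0<..<pi} \<and> \<theta>m \<in> {-pi<..<0} \<and>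
           (\<forall>\<psi>\<in>closed_segment \<phi>p \<theta>p. decay_rate K \<psi> (of_real x)) \<and>
           (\<forall>\<psi>\<in>closed_segment \<phi>m \<theta>m. decay_rate K \<psi> (of_real x)))))"
  proof (rule MB_kernel_decay_upper_lower[OF assms(1-3) ex assms(5)], goal_cases)
    case (1 \<phi>p \<phi>m)
    show ?case unfolding D_def K_def
      by (rule exI[of _ \<phi>p], rule exI[of _ \<phi>m], intro conjI ballI allI impI 1(1-4); (rule 1(5) | rule 1(6) | rule 1(7)), assumption)
  qed
  then obtain \<phi>p \<phi>m where \<phi>': "pi / 2 \<le> \<phi>p \<and> \<phi>p < pi \<and> - pi < \<phi>m \<and> \<phi>m \<le> - pi / 2"
    and rp: "\<forall>w\<in>D. decay_rate K \<phi>p w" and rm: "\<forall>w\<in>D. decay_rate K \<phi>m w"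
    and tab': "\<forall>x. complex_of_real x \<in> D \<longrightarrow> (\<forall>\<^sub>F \<epsilon> in at_right 0. (\<exists>\<theta>p \<theta>m. MB_table m n p q a b \<alpha> (exp x) \<epsilon> \<theta>p \<theta>m) \<and>
         (\<forall>\<theta>p \<theta>m. MB_table m n p q a b \<alpha> (exp x) \<epsilon> \<theta>p \<theta>m \<longrightarrow>
           \<theta>p \<in> {0<..<pi} \<and> \<theta>m \<in> {-pi<..<0} \<and>
           (\<forall>\<psi>\<in>closed_segment \<phi>p \<theta>p. decay_rate K \<psi> (of_real x)) \<and>
           (\<forall>\<psi>\<in>closed_segment \<phi>m \<theta>m. decay_rate K \<psi> (of_real x))))"
    by (elim exE conjE) (rule that, intro conjI, assumption+)
  have \<phi>: "pi / 2 \<le> \<phi>p" "\<phi>p < pi" "- pi < \<phi>m" "\<phi>m \<le> - pi / 2" using \<phi>' by simp_all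
  note tab = tab'[rule_format]
  obtain c where c: "c < l \<and> (\<forall>s\<in>M. Re s < l \<longrightarrow> Re s < c)" and off': "\<forall>s\<in>P \<union> M. Re s \<noteq> wedge_re c \<phi>p \<phi>m (Im s)"
    using generic_abscissa[OF ps, of l \<phi>p \<phi>m] by metis
  note off = off'[rule_format]
  have cM: "Re s < c" if "s \<in> M" "Re s < l" for s using c that by simp
  have cl: "c < l" using c ..
  have Kh: "K holomorphic_on - (P \<union> M)" unfolding K_def P_def M_def by (rule MB_kernel_holomorphic[OF \<tau>])
  have wle: "\<And>y. wedge_re c \<phi>p \<phi>m y \<le> c" by (rule wedge_separating(2)[OF \<phi> ps off])
  interpret W: wedge_kernel K P M H c \<phi>p \<phi>m D
    by (rule wedge_kernel.intro[OF \<phi> ps Kh off bspec[OF rp] bspec[OF rm]])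
  have "\<exists>A. \<forall>w. residue (W.F w) s = exp (- s * w) * (\<Sum>i<pole_mult f s. A i * w ^ i)" for s
  proof -
    have "(\<lambda>s. exp (of_real pi * \<alpha> / of_real \<tau> * s\<^sup>2)) holomorphic_on UNIV" by (intro holomorphic_intros)
    from residue_mult_exp[OF MB_integrand_singularity[OF \<tau> disj, folded f_def] this, of s]
    have "\<exists>A. \<forall>w. residue (\<lambda>s. f s * exp (of_real pi * \<alpha> / of_real \<tau> * s\<^sup>2) * exp (- s * w)) s = exp (- s * w) * (\<Sum>i<pole_mult f s. A i * w ^ i)" .
    moreover have "W.F w = (\<lambda>s. f s * exp (of_real pi * \<alpha> / of_real \<tau> * s\<^sup>2) * exp (- s * w))" for w
      by (rule ext) (simp only: W.F_def, simp add: K_def MB_kernel_def f_def)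
    ultimately show ?thesis by (simp only:)
  qed
  then have "\<forall>s. \<exists>A. \<forall>w. residue (W.F w) s = exp (- s * w) * (\<Sum>i<pole_mult f s. A i * w ^ i)" by (rule allI)
  from choice[OF this] obtain A where A': "\<forall>s w. residue (W.F w) s = exp (- s * w) * (\<Sum>i<pole_mult f s. A s i * w ^ i)"
    by (elim exE)
  note A = A'[rule_format]
  \<comment> \<open>The poles between a contour and the wedge: Q1 are left poles to the right of the
    wedge, Q2 the remaining family to the left of it. They enter with opposite signs.\<close>
  define Q1 where "Q1 = M - W.left_poles"
  define Q2 where "Q2 = W.left_poles - M"
  have Q: "finite Q1" "finite Q2" unfolding Q1_def Q2_def by (rule W.finite_exchange)+
  \<comment> \<open>The candidate for K: a single formula that is meaningful on all of D, for real
    and complex w alike.\<close>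
  define Kf where "Kf = (\<lambda>w. W.IV w / (2 * of_real pi * \<i>) + (\<Sum>s\<in>Q1. residue (W.F w) s) - (\<Sum>s\<in>Q2. residue (W.F w) s))"
  have Kf2: "2 * of_real pi * \<i> * Kf w = W.IV w + 2 * of_real pi * \<i> * (sum (residue (W.F w)) Q1 - sum (residue (W.F w)) Q2)" for w
    unfolding Kf_def by (simp add: algebra_simps)

  \<comment> \<open>All admissible contours give the value \<open>Kf\<close> by comparison with the
    wedge. For uniqueness of the value, the table must offer angles for small \<epsilon> and a
    contour with these angles must exist.\<close>
  have pos: "MB_K_pos m n p q a b \<tau> \<alpha> (exp x) = Kf (of_real x)" if x: "of_real x \<in> D" for x
  proof -
    have eqF: "MB_integrand m n p q a b \<tau> s * exp (of_real pi * \<alpha> / of_real \<tau> * s\<^sup>2) * of_real (exp x) powr (- s) = W.F (of_real x) s" for s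
    proof -
      have "complex_of_real (exp x) powr (- s) = exp (- s * of_real x)"
        unfolding powr_def using Ln_of_real[of "exp x"] by simp
      moreover have "K s = MB_integrand m n p q a b \<tau> s * exp (of_real pi * \<alpha> / of_real \<tau> * s\<^sup>2)"
        by (simp only: K_def MB_kernel_def)
      moreover have "W.F (of_real x) s = K s * exp (- s * of_real x)" by (rule W.F_def)
      ultimately show ?thesis by (simp only:)
    qed
    define good where "good = (\<lambda>\<epsilon> y. \<forall>\<theta>p \<theta>m \<gamma>. MB_table m n p q a b \<alpha> (exp x) \<epsilon> \<theta>p \<theta>m \<and> MB_contour P M \<theta>p \<theta>m \<gamma> \<longrightarrow>
        ((\<lambda>t. W.F (of_real x) (\<gamma> t) * vector_derivative \<gamma> (at t)) has_integral (2 * of_real pi * \<i> * y)) UNIV)"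
    have key: "\<forall>\<^sub>F \<epsilon> in at_right 0. good \<epsilon> (Kf (of_real x))"
      using tab[OF x]
    proof eventually_elim
      case (elim \<epsilon>)
      show ?case unfolding good_def
      proof (intro allI impI, elim conjE)
        fix \<theta>p \<theta>m \<gamma> assume t: "MB_table m n p q a b \<alpha> (exp x) \<epsilon> \<theta>p \<theta>m" and g: "MB_contour P M \<theta>p \<theta>m \<gamma>"
        from elim t have s: "\<forall>\<psi>\<in>closed_segment \<phi>p \<theta>p. decay_rate K \<psi> (of_real x)" "\<forall>\<psi>\<in>closed_segment \<phi>m \<theta>m. decay_rate K \<psi> (of_real x)"
          by simp_all
        show "((\<lambda>t. W.F (of_real x) (\<gamma> t) * vector_derivative \<gamma> (at t)) has_integral (2 * of_real pi * \<i> * Kf (of_real x))) UNIV"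
          unfolding Kf2 Q1_def Q2_def by (rule W.contour_eq_wedge[OF g s[THEN bspec] x])
      qed
    qed
    have ang: "\<forall>\<^sub>F \<epsilon> in at_right 0. \<exists>\<theta>p \<theta>m. MB_table m n p q a b \<alpha> (exp x) \<epsilon> \<theta>p \<theta>m \<and> \<theta>p \<in> {0<..<pi} \<and> \<theta>m \<in> {-pi<..<0}"
      using tab[OF x]
    proof eventually_elim
      case (elim \<epsilon>)
      then obtain \<theta>p \<theta>m where t: "MB_table m n p q a b \<alpha> (exp x) \<epsilon> \<theta>p \<theta>m" by (elim conjE exE)
      from elim[THEN conjunct2, rule_format, OF t] t show ?case
        by (elim conjE) (rule exI[of _ \<theta>p], rule exI[of _ \<theta>m], intro conjI)
    qed
    show ?thesis unfolding MB_K_pos_def eqF P_def[symmetric] M_def[symmetric]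
    proof (rule the_equality, rule key[unfolded good_def])
      fix y assume "\<forall>\<^sub>F \<epsilon> in at_right 0. \<forall>\<theta>p \<theta>m \<gamma>. MB_table m n p q a b \<alpha> (exp x) \<epsilon> \<theta>p \<theta>m \<and> MB_contour P M \<theta>p \<theta>m \<gamma> \<longrightarrow>
        ((\<lambda>t. W.F (of_real x) (\<gamma> t) * vector_derivative \<gamma> (at t)) has_integral (2 * of_real pi * \<i> * y)) UNIV"
      then have y: "\<forall>\<^sub>F \<epsilon> in at_right 0. good \<epsilon> y" unfolding good_def .
      from eventually_happens'[OF trivial_limit_at_right_real eventually_conj[OF ang eventually_conj[OF key y]]]
      obtain \<epsilon> \<theta>p \<theta>m where e: "MB_table m n p q a b \<alpha> (exp x) \<epsilon> \<theta>p \<theta>m" "\<theta>p \<in> {0<..<pi}" "\<theta>m \<in> {-pi<..<0}"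
        "good \<epsilon> (Kf (of_real x))" "good \<epsilon> y" by (elim exE conjE)
      have "0 < \<theta>p" "\<theta>p < pi" "- pi < \<theta>m" "\<theta>m < 0" using e(2,3) by simp_all
      from pole_sets.contour_exists[OF ps this] obtain \<gamma> where \<gamma>: "MB_contour P M \<theta>p \<theta>m \<gamma>" by (elim exE)
      have "2 * of_real pi * \<i> * y = 2 * of_real pi * \<i> * Kf (of_real x)"
        by (rule has_integral_unique[OF e(5)[unfolded good_def, rule_format, OF conjI[OF e(1) \<gamma>]] e(4)[unfolded good_def, rule_format, OF conjI[OF e(1) \<gamma>]]])
      then show "y = Kf (of_real x)" by simp
    qed
  qed

  \<comment> \<open>In case (vii) w is real and nothing has to be continued. Otherwise any
    holomorphic function with the prescribed values on the real line agrees with \<open>Kf\<close>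
    by the identity theorem, whichever one the choice operator picks.\<close>
  have K_eq: "MB_K m n p q a b \<tau> \<alpha> w = Kf w" if w: "w \<in> D" for w
  proof (cases "MB_in_case Case_VII m n p q a b \<alpha>")
    case True
    have "w \<in> {w. Im w = 0 \<and> Re w < 0}" using w True unfolding D_def MB_domain_def by (simp only: if_True)
    then have e: "w = of_real (Re w)" by (simp add: complex_eq_iff)
    have "MB_K m n p q a b \<tau> \<alpha> w = MB_K_pos m n p q a b \<tau> \<alpha> (exp (Re w))" unfolding MB_K_def using True by (simp only: if_True)
    also have "\<dots> = Kf (of_real (Re w))" using w e by (intro pos) (simp only: e[symmetric])
    finally show ?thesis using e by (simp only: e[symmetric])
  next
    case False
    note geo = MB_domain_geometry[OF \<tau> False, folded D_def]
    define Z where "Z = (\<lambda>g. g holomorphic_on D \<and> (\<forall>x::real. g (of_real x) = MB_K_pos m n p q a b \<tau> \<alpha> (exp x)))"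
    have Kf_hol: "Kf holomorphic_on D" unfolding Kf_def A
      by (intro holomorphic_intros W.IV_holomorphic geo(2)) simp
    have "Z Kf" unfolding Z_def using Kf_hol pos[OF geo(4)] by simp
    then have "Z (SOME g. Z g)" by (rule someI[of Z])
    moreover have "MB_K m n p q a b \<tau> \<alpha> = (SOME g. Z g)" unfolding MB_K_def Z_def geo(1) using False by (simp only: if_False)
    ultimately have Zk: "Z (MB_K m n p q a b \<tau> \<alpha>)" by (simp only:)
    have hol: "(\<lambda>w. MB_K m n p q a b \<tau> \<alpha> w - Kf w) holomorphic_on D"
      using Zk Kf_hol unfolding Z_def by (intro holomorphic_on_diff) simp_all
    have lim: "(0::complex) islimpt range of_real"
      unfolding islimpt_approachable
    proof (intro allI impI)
      fix e :: real assume "e > 0"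
      then show "\<exists>x'\<in>range complex_of_real. x' \<noteq> 0 \<and> dist x' 0 < e" by (intro bexI[OF _ rangeI[of complex_of_real "e / 2"]]) (simp add: norm_divide)
    qed
    have "MB_K m n p q a b \<tau> \<alpha> w - Kf w = 0"
    proof (rule analytic_continuation[OF hol geo(2,3) _ _ lim _ w])
      show "range complex_of_real \<subseteq> D" using geo(4) by auto
      show "(0::complex) \<in> D" using geo(4)[of 0] by simp
      show "MB_K m n p q a b \<tau> \<alpha> z - Kf z = 0" if "z \<in> range complex_of_real" for z
        using that Zk pos[OF geo(4)] unfolding Z_def by auto
    qed
    then show ?thesis by simp
  qed

  \<comment> \<open>The leading poles have real part l > c, and the wedge never goes beyond
    c.\<close>
  have N_sub: "N \<subseteq> Q1"
  proof
    fix s assume "s \<in> N"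
    then have s: "s \<in> M" "Re s = l" unfolding N_def MB_Lambda_sharp_def M_def l_def by simp_all
    then show "s \<in> Q1" using wle[of "Im s"] cl unfolding Q1_def W.left_poles_def by auto
  qed
  \<comment> \<open>Left poles that do not lead have real part below l, hence below c by the choice
    of the gap.\<close>
  have Re1: "Re s < c" if "s \<in> Q1 - N" for s
  proof -
    have s: "s \<in> M" "s \<notin> N" using that unfolding Q1_def by blast+
    then have "Re s \<le> l" unfolding M_def l_def by (intro MB_Lambda_minus_Re_le \<tau>)
    moreover have "Re s \<noteq> l" using s unfolding N_def MB_Lambda_sharp_def M_def l_def by simp
    ultimately show ?thesis using cM[OF s(1)] by simp
  qed
  have Re2: "Re s < c" if "s \<in> Q2" for s
    using that wle[of "Im s"] unfolding Q2_def W.left_poles_def by auto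
  \<comment> \<open>Besides the leading residues there remain the wedge integral and finitely many
    residues at poles with real part below c; each is O(|z| powr - c).\<close>
  have split: "Kf w - (\<Sum>s\<in>N. residue (W.F w) s) = W.IV w / (2 * of_real pi * \<i>) + (\<Sum>s\<in>Q1 - N. residue (W.F w) s) - (\<Sum>s\<in>Q2. residue (W.F w) s)" for w
    unfolding Kf_def using sum.subset_diff[OF N_sub Q(1), of "residue (W.F w)"] by simp

  have main: "\<exists>C. \<forall>w\<in>{w. Re w \<le> - 1 \<and> Im w \<in> S}. cmod (MB_K m n p q a b \<tau> \<alpha> w - (\<Sum>s\<in>N. residue (W.F w) s)) \<le> C * exp (- c * Re w)"
    if S: "compact S" "S \<subseteq> MB_args m n p q a b \<tau> \<alpha>" for S
  proof (cases "S = {}")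
    case False
    let ?W = "{w. Re w \<le> - 1 \<and> Im w \<in> S}"
    have inD: "w \<in> D" if "Re w \<le> - 1" "Im w \<in> S" for w
    proof (cases "MB_in_case Case_VII m n p q a b \<alpha>")
      case True
      then have "MB_args m n p q a b \<tau> \<alpha> = {0}" unfolding MB_args_def by (simp only: if_True)
      then have "Im w = 0" using that S by auto
      then have "w \<in> {w. Im w = 0 \<and> Re w < 0}" using that(1) by simp
      then show ?thesis unfolding D_def MB_domain_def using True by (simp only: if_True)
    next
      case False
      have "Im w \<in> MB_args m n p q a b \<tau> \<alpha>" using S(2) that(2) by (rule subsetD)
      then show ?thesis unfolding D_def MB_domain_def using False by (simp only: if_False mem_Collect_eq)
    qed
    obtain t1 where t1: "t1 \<in> S" "\<And>t. t \<in> S \<Longrightarrow> t \<le> t1" using compact_attains_sup[OF S(1) False] by blast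
    obtain t2 where t2: "t2 \<in> S" "\<And>t. t \<in> S \<Longrightarrow> t2 \<le> t" using compact_attains_inf[OF S(1) False] by blast
    have "Complex (- 1) t1 \<in> D" "Complex (- 1) t2 \<in> D" using t1(1) t2(1) by (simp_all add: inD)
    from W.IV_bound[OF this, unfolded complex.sel, OF refl refl]
    obtain C0 where C0': "\<forall>w. Re w \<le> - 1 \<longrightarrow> t2 \<le> Im w \<longrightarrow> Im w \<le> t1 \<longrightarrow> cmod (W.IV w) \<le> C0 * exp (- c * Re w)" by (elim exE)
    note C0 = C0'[rule_format]
    define B where "B = max \<bar>t1\<bar> \<bar>t2\<bar>"
    have B: "\<bar>Im w\<bar> \<le> B" if "w \<in> ?W" for w
      using t1(2)[of "Im w"] t2(2)[of "Im w"] that unfolding B_def by auto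
    have res: "\<exists>C. \<forall>w\<in>?W. cmod (residue (W.F w) s) \<le> C * exp (- c * Re w)" if sc: "Re s < c" for s
    proof -
      have "\<exists>C. \<forall>w\<in>?W. cmod (\<Sum>i<pole_mult f s. A s i * (exp (- s * w) * w ^ i)) \<le> C * exp (- c * Re w)"
      proof (rule sum_bound_exists)
        fix i
        have B0: "B \<ge> 0" unfolding B_def by (rule order_trans[OF abs_ge_zero max.cobounded1])
        from norm_exp_mult_power_bound[OF sc B0, of i]
        obtain C where C': "\<forall>w. Re w \<le> - 1 \<longrightarrow> \<bar>Im w\<bar> \<le> B \<longrightarrow> cmod (exp (- s * w) * w ^ i) \<le> C * exp (- c * Re w)" by (elim exE)
        note C = C'[rule_format]
        have "cmod (A s i * (exp (- s * w) * w ^ i)) \<le> (cmod (A s i) * C) * exp (- c * Re w)" if "w \<in> ?W" for w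
          unfolding norm_mult[of "A s i"] mult.assoc using that B[OF that] by (intro mult_left_mono C) auto
        then show "\<exists>C. \<forall>w\<in>?W. cmod (A s i * (exp (- s * w) * w ^ i)) \<le> C * exp (- c * Re w)"
          by (intro exI[of _ "cmod (A s i) * C"] ballI)
      qed
      moreover have "(\<Sum>i<pole_mult f s. A s i * (exp (- s * w) * w ^ i)) = residue (W.F w) s" for w
        unfolding A sum_distrib_left by (intro sum.cong refl) (simp only: mult_ac)
      ultimately show ?thesis by (simp only:)
    qed
    have "\<exists>C. \<forall>w\<in>?W. cmod (\<Sum>s\<in>Q1 - N. residue (W.F w) s) \<le> C * exp (- c * Re w)" by (intro sum_bound_exists res Re1)
    then obtain C1 where C1': "\<forall>w\<in>?W. cmod (\<Sum>s\<in>Q1 - N. residue (W.F w) s) \<le> C1 * exp (- c * Re w)" by (elim exE)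
    have "\<exists>C. \<forall>w\<in>?W. cmod (\<Sum>s\<in>Q2. residue (W.F w) s) \<le> C * exp (- c * Re w)" by (intro sum_bound_exists res Re2)
    then obtain C2 where C2': "\<forall>w\<in>?W. cmod (\<Sum>s\<in>Q2. residue (W.F w) s) \<le> C2 * exp (- c * Re w)" by (elim exE)
    note C1 = bspec[OF C1'] and C2 = bspec[OF C2']
    have "cmod (MB_K m n p q a b \<tau> \<alpha> w - (\<Sum>s\<in>N. residue (W.F w) s)) \<le> (C0 / (2 * pi) + C1 + C2) * exp (- c * Re w)" if w: "w \<in> ?W" for w
    proof -
      have D: "w \<in> D" using w by (intro inD) auto
      have "cmod (W.IV w) \<le> C0 * exp (- c * Re w)" using w t1(2) t2(2) by (intro C0) auto
      then have 0: "cmod (W.IV w / (2 * of_real pi * \<i>)) \<le> C0 / (2 * pi) * exp (- c * Re w)"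
        by (simp add: norm_divide norm_mult divide_right_mono)
      have "cmod (MB_K m n p q a b \<tau> \<alpha> w - (\<Sum>s\<in>N. residue (W.F w) s))
          \<le> cmod (W.IV w / (2 * of_real pi * \<i>)) + cmod (\<Sum>s\<in>Q1 - N. residue (W.F w) s) + cmod (\<Sum>s\<in>Q2. residue (W.F w) s)"
        unfolding K_eq[OF D] split by (rule order_trans[OF norm_triangle_ineq4 add_right_mono[OF norm_triangle_ineq]])
      also have "\<dots> \<le> C0 / (2 * pi) * exp (- c * Re w) + C1 * exp (- c * Re w) + C2 * exp (- c * Re w)"
        by (intro add_mono 0 C1 C2 w)
      finally show ?thesis by (simp only: distrib_right)
    qed
    then show ?thesis by (intro exI[of _ "C0 / (2 * pi) + C1 + C2"] ballI)
  qed simp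

  show ?thesis
  \<comment> \<open>With \<delta> = l - c the exponent - l + \<delta> of the claim equals -
    c.\<close>
  proof (rule exI[of _ "l - c"], rule conjI, use cl in simp, rule exI[of _ A], intro allI impI, elim conjE)
    fix S assume S: "compact S" "S \<subseteq> MB_args m n p q a b \<tau> \<alpha>"
    from main[OF S] obtain C where C': "\<forall>w\<in>{w. Re w \<le> - 1 \<and> Im w \<in> S}. cmod (MB_K m n p q a b \<tau> \<alpha> w - (\<Sum>s\<in>N. residue (W.F w) s)) \<le> C * exp (- c * Re w)"
      by (elim exE)
    have C: "cmod (MB_K m n p q a b \<tau> \<alpha> w - (\<Sum>s\<in>N. residue (W.F w) s)) \<le> C * exp (- c * Re w)" if "Re w \<le> - 1" "Im w \<in> S" for w
      by (rule bspec[OF C']) (use that in simp)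
    have "\<forall>\<^sub>F w in filtercomap Re at_bot. Re w \<le> - 1"
      by (rule eventually_filtercomapI[OF eventually_le_at_bot])
    then have "\<forall>\<^sub>F w in to_zero_in_sector S. Re w \<le> - 1 \<and> Im w \<in> S"
      unfolding to_zero_in_sector_def eventually_inf_principal by eventually_elim simp
    then have "\<forall>\<^sub>F w in to_zero_in_sector S. cmod (MB_K m n p q a b \<tau> \<alpha> w - (\<Sum>s\<in>N. residue (W.F w) s))
        \<le> C * cmod (of_real (exp (Re w) powr (- l + (l - c))))"
    proof eventually_elim
      case (elim w)
      have "cmod (of_real (exp (Re w) powr (- l + (l - c)))) = exp (- c * Re w)" by (simp add: powr_def)
      then show ?case using C[OF conjunct1[OF elim] conjunct2[OF elim]] by (simp only:)
    qed
    then have "(\<lambda>w. MB_K m n p q a b \<tau> \<alpha> w - (\<Sum>s\<in>N. residue (W.F w) s)) \<in> O[to_zero_in_sector S](\<lambda>w. of_real (exp (Re w) powr (- l + (l - c))))"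
      by (rule bigoI)
    then show "(\<lambda>w. MB_K m n p q a b \<tau> \<alpha> w
            - (\<Sum>s\<in>MB_Lambda_sharp m q b \<tau>. exp (- s * w) * (\<Sum>i<pole_mult (MB_integrand m n p q a b \<tau>) s. A s i * w ^ i)))
        \<in> O[to_zero_in_sector S](\<lambda>w. of_real (exp (Re w) powr (- MB_lambda_sharp m q b \<tau> + (l - c))))"
      unfolding A f_def N_def l_def .
  qed
qed

end
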